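(* For any classes $\Phi$ and $\Psi$ of weights, the classes $\Phi^-$ and $\Psi^+$ are saturated; that is, $(\Psi^{+})^{*} = \Psi^+$ and $(\Phi^{-})^{*} = \Phi^-$. Moreover $\Psi^+ = (\Psi^{*})^{+}$ and $\Phi^- = (\Phi^{*})^{-}$.
   Context: Throughout, $\mathcal{V}$ is a symmetric monoidal closed category whose underlying ordinary category is locally small, complete and cocomplete. "Category", "functor", "natural transformation" mean $\mathcal{V}$-category, $\mathcal{V}$-functor, $\mathcal{V}$-natural transformation. A category is small if its set of isomorphism classes of objects is small; $[\mathcal{X},\mathcal{Y}]$ denotes the functor $\mathcal{V}$-category. A weight is a functor $\phi:\mathcal{K}^{op}\to\mathcal{V}$ with $\mathcal{K}$ small. The $\phi$-weighted limit $\{\phi,T\}$ of $T:\mathcal{K}^{op}\to\mathcal{A}$ is defined by $\mathcal{A}(a,\{\phi,T\})\cong[\mathcal{K}^{op},\mathcal{V}](\phi,\mathcal{A}(a,T-))$, and the $\phi$-weighted colimit $\phi*S$ of $S:\mathcal{K}\to\mathcal{A}$ by $\mathcal{A}(\phi*S,a)\cong[\mathcal{K}^{op},\mathcal{V}](\phi,\mathcal{A}(S-,a))$, naturally in $a$. For a class $\Phi$ of weights, $\mathcal{A}$ is $\Phi$-complete if it admits $\{\phi,T\}$ for all $\phi\in\Phi$ and all $T$; a functor between $\Phi$-complete categories is $\Phi$-continuous if it preserves all these limits. The saturation $\Phi^*$ of a class $\Phi$ of weights is the class of those weights $\psi$ such that every $\Phi$-complete category is $\psi$-complete and every $\Phi$-continuous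 functor is $\psi$-continuous. $\Phi$ is saturated if $\Phi=\Phi^*$. For weights $\psi:\mathcal{K}^{op}\to\mathcal{V}$ and $\phi:\mathcal{L}^{op}\to\mathcal{V}$, one says that $\phi$-colimits commute with $\psi$-limits in $\mathcal{V}$ if $\phi*-:[\mathcal{L},\mathcal{V}]\to\mathcal{V}$ preserves $\psi$-limits; equivalently, $\{\psi,-\}:[\mathcal{K}^{op},\mathcal{V}]\to\mathcal{V}$ preserves $\phi$-colimits. $\Psi^+$ (the $\Psi$-flat weights) is the class of all weights $\phi$ such that $\phi$-colimits commute in $\mathcal{V}$ with $\psi$-limits for all $\psi\in\Psi$. $\Phi^-$ (the $\Phi$-atomic weights) is the class of all weights $\psi$ such that $\phi$-colimits commute in $\mathcal{V}$ with $\psi$-limits for all $\phi\in\Phi$. *)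

theory Defs
  imports "HOL-Library.FuncSet"
begin

unbundle cardinal_syntax

section \<open>Size\<close>

text \<open>
  The universe of small sets is represented by a type \<open>'u\<close>: a set, of elements of any type, is
  small if its cardinality is strictly below that of \<open>'u\<close>. The closure conditions below say that
  the cardinality of \<open>'u\<close> is that of a Grothendieck universe. Uncountability is not demanded.
\<close>

definition small :: "'u itself \<Rightarrow> 'b set \<Rightarrow> bool" where
  "small _ X \<longleftrightarrow> |X| <o |UNIV :: 'u set|"

definition universe :: "'u itself \<Rightarrow> bool" where
  "universe U \<longleftrightarrow> infinite (UNIV :: 'u set) \<and>
     (\<forall>X :: 'u set. small U X \<longrightarrow> small U (Pow X)) \<and>
     (\<forall>(X :: 'u set) (Y :: 'u \<Rightarrow> 'u set).
        small U X \<and> (\<forall>x\<in>X. small U (Y x)) \<longrightarrow> small U (\<Union>x\<in>X. Y x))"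


section \<open>Ordinary categories and their limits\<close>

record ('o, 'm) cat =
  Obj :: "'o set"
  Arr :: "'m set"
  Dom :: "'m \<Rightarrow> 'o"
  Cod :: "'m \<Rightarrow> 'o"
  Id :: "'o \<Rightarrow> 'm"  (\<open>\<one>\<index>\<close>)
  Cmp :: "'m \<Rightarrow> 'm \<Rightarrow> 'm"  (infixr \<open>\<cdot>\<index>\<close> 65)

definition Hom :: "('o, 'm, 'x) cat_scheme \<Rightarrow> 'o \<Rightarrow> 'o \<Rightarrow> 'm set" where
  "Hom C a b = {f \<in> Arr C. Dom C f = a \<and> Cod C f = b}"

locale category =
  fixes C :: "('o, 'm, 'x) cat_scheme" (structure)
  assumes Dom_Obj: "f \<in> Arr C \<Longrightarrow> Dom C f \<in> Obj C"
    and Cod_Obj: "f \<in> Arr C \<Longrightarrow> Cod C f \<in> Obj C"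
    and Id_Hom: "a \<in> Obj C \<Longrightarrow> \<one> a \<in> Hom C a a"
    and Cmp_Hom: "f \<in> Hom C a b \<Longrightarrow> g \<in> Hom C b c \<Longrightarrow> g \<cdot> f \<in> Hom C a c"
    and Id_left: "f \<in> Hom C a b \<Longrightarrow> \<one> b \<cdot> f = f"
    and Id_right: "f \<in> Hom C a b \<Longrightarrow> f \<cdot> \<one> a = f"
    and Cmp_assoc: "f \<in> Hom C a b \<Longrightarrow> g \<in> Hom C b c \<Longrightarrow> h \<in> Hom C c d \<Longrightarrow>
                      (h \<cdot> g) \<cdot> f = h \<cdot> (g \<cdot> f)"

definition is_iso :: "('o, 'm, 'x) cat_scheme \<Rightarrow> 'o \<Rightarrow> 'o \<Rightarrow> 'm \<Rightarrow> bool" where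
  "is_iso C a b f \<longleftrightarrow> f \<in> Hom C a b \<and>
     (\<exists>g \<in> Hom C b a. Cmp C g f = Id C a \<and> Cmp C f g = Id C b)"

definition op_cat :: "('o, 'm, 'x) cat_scheme \<Rightarrow> ('o, 'm) cat" where
  "op_cat C = \<lparr>Obj = Obj C, Arr = Arr C, Dom = Cod C, Cod = Dom C,
                Id = Id C, Cmp = (\<lambda>g f. Cmp C f g)\<rparr>"

definition is_functor ::
  "('j, 'n, 'y) cat_scheme \<Rightarrow> ('o, 'm, 'x) cat_scheme \<Rightarrow> ('j \<Rightarrow> 'o) \<Rightarrow> ('n \<Rightarrow> 'm) \<Rightarrow> bool" where
  "is_functor J C F\<^sub>o F\<^sub>a \<longleftrightarrow>
     (\<forall>i\<in>Obj J. F\<^sub>o i \<in> Obj C) \<and>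
     (\<forall>f\<in>Arr J. F\<^sub>a f \<in> Hom C (F\<^sub>o (Dom J f)) (F\<^sub>o (Cod J f))) \<and>
     (\<forall>i\<in>Obj J. F\<^sub>a (Id J i) = Id C (F\<^sub>o i)) \<and>
     (\<forall>f\<in>Arr J. \<forall>g\<in>Arr J. Cod J f = Dom J g \<longrightarrow> F\<^sub>a (Cmp J g f) = Cmp C (F\<^sub>a g) (F\<^sub>a f))"

definition is_cone ::
  "('j, 'n, 'y) cat_scheme \<Rightarrow> ('o, 'm, 'x) cat_scheme \<Rightarrow> ('j \<Rightarrow> 'o) \<Rightarrow> ('n \<Rightarrow> 'm) \<Rightarrow>
     'o \<Rightarrow> ('j \<Rightarrow> 'm) \<Rightarrow> bool" where
  "is_cone J C F\<^sub>o F\<^sub>a l p \<longleftrightarrow> l \<in> Obj C \<and> (\<forall>i\<in>Obj J. p i \<in> Hom C l (F\<^sub>o i)) \<and>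
     (\<forall>f\<in>Arr J. Cmp C (F\<^sub>a f) (p (Dom J f)) = p (Cod J f))"

definition is_limit ::
  "('j, 'n, 'y) cat_scheme \<Rightarrow> ('o, 'm, 'x) cat_scheme \<Rightarrow> ('j \<Rightarrow> 'o) \<Rightarrow> ('n \<Rightarrow> 'm) \<Rightarrow>
     'o \<Rightarrow> ('j \<Rightarrow> 'm) \<Rightarrow> bool" where
  "is_limit J C F\<^sub>o F\<^sub>a l p \<longleftrightarrow> is_cone J C F\<^sub>o F\<^sub>a l p \<and>
     (\<forall>z q. is_cone J C F\<^sub>o F\<^sub>a z q \<longrightarrow> (\<exists>!h. h \<in> Hom C z l \<and> (\<forall>i\<in>Obj J. Cmp C (p i) h = q i)))"

text \<open>Every small category is isomorphic to one whose objects and arrows are elements of \<open>'u\<close>.\<close>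

definition complete :: "'u itself \<Rightarrow> ('o, 'm, 'x) cat_scheme \<Rightarrow> bool" where
  "complete U C \<longleftrightarrow>
     (\<forall>(J :: ('u, 'u) cat) F\<^sub>o F\<^sub>a. category J \<and> small U (Obj J) \<and> small U (Arr J) \<and> is_functor J C F\<^sub>o F\<^sub>a \<longrightarrow>
        (\<exists>l p. is_limit J C F\<^sub>o F\<^sub>a l p))"

definition cocomplete :: "'u itself \<Rightarrow> ('o, 'm, 'x) cat_scheme \<Rightarrow> bool" where
  "cocomplete U C \<longleftrightarrow> complete U (op_cat C)"

definition locally_small :: "'u itself \<Rightarrow> ('o, 'm, 'x) cat_scheme \<Rightarrow> bool" where
  "locally_small U C \<longleftrightarrow> (\<forall>a\<in>Obj C. \<forall>b\<in>Obj C. small U (Hom C a b))"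


section \<open>The base of enrichment\<close>

text \<open>
  Here \<open>a \<otimes> b\<close> is the tensor product of objects and \<open>f \<boxtimes> g\<close> that of arrows; \<open>[a, b]\<close> is the
  internal hom and \<open>ev a b : [a, b] \<otimes> a \<rightarrow> b\<close> its evaluation.
\<close>

record ('v, 'm) smcc = "('v, 'm) cat" +
  tens_obj :: "'v \<Rightarrow> 'v \<Rightarrow> 'v"  (infixr \<open>\<otimes>\<index>\<close> 75)
  tens_arr :: "'m \<Rightarrow> 'm \<Rightarrow> 'm"  (infixr \<open>\<boxtimes>\<index>\<close> 75)
  unit :: 'v  (\<open>\<I>\<index>\<close>)
  assoc :: "'v \<Rightarrow> 'v \<Rightarrow> 'v \<Rightarrow> 'm"  (\<open>\<alpha>\<index>\<close>)
  lunit :: "'v \<Rightarrow> 'm"  (\<open>\<lambda>\<lambda>\<index>\<close>)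
  runit :: "'v \<Rightarrow> 'm"  (\<open>\<rho>\<index>\<close>)
  symm :: "'v \<Rightarrow> 'v \<Rightarrow> 'm"  (\<open>\<sigma>\<index>\<close>)
  ihom :: "'v \<Rightarrow> 'v \<Rightarrow> 'v"  (\<open>\<lbrakk>_, _\<rbrakk>\<index>\<close>)
  ev :: "'v \<Rightarrow> 'v \<Rightarrow> 'm"

locale symmetric_monoidal_closed = category V
  for V :: "('v, 'm) smcc" (structure) +
  assumes tens_Obj: "a \<in> Obj V \<Longrightarrow> b \<in> Obj V \<Longrightarrow> a \<otimes> b \<in> Obj V"
    and tens_Hom: "f \<in> Hom V a b \<Longrightarrow> g \<in> Hom V c d \<Longrightarrow> f \<boxtimes> g \<in> Hom V (a \<otimes> c) (b \<otimes> d)"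
    and tens_Id: "a \<in> Obj V \<Longrightarrow> b \<in> Obj V \<Longrightarrow> \<one> a \<boxtimes> \<one> b = \<one> (a \<otimes> b)"
    and tens_Cmp: "f \<in> Hom V a b \<Longrightarrow> f' \<in> Hom V b c \<Longrightarrow> g \<in> Hom V a' b' \<Longrightarrow> g' \<in> Hom V b' c' \<Longrightarrow>
                     (f' \<cdot> f) \<boxtimes> (g' \<cdot> g) = (f' \<boxtimes> g') \<cdot> (f \<boxtimes> g)"
    and unit_Obj: "\<I> \<in> Obj V"
    and assoc_iso: "a \<in> Obj V \<Longrightarrow> b \<in> Obj V \<Longrightarrow> c \<in> Obj V \<Longrightarrow>
                      is_iso V ((a \<otimes> b) \<otimes> c) (a \<otimes> (b \<otimes> c)) (\<alpha> a b c)"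
    and assoc_nat: "f \<in> Hom V a a' \<Longrightarrow> g \<in> Hom V b b' \<Longrightarrow> h \<in> Hom V c c' \<Longrightarrow>
                      \<alpha> a' b' c' \<cdot> ((f \<boxtimes> g) \<boxtimes> h) = (f \<boxtimes> (g \<boxtimes> h)) \<cdot> \<alpha> a b c"
    and lunit_iso: "a \<in> Obj V \<Longrightarrow> is_iso V (\<I> \<otimes> a) a (\<lambda>\<lambda> a)"
    and lunit_nat: "f \<in> Hom V a b \<Longrightarrow> \<lambda>\<lambda> b \<cdot> (\<one> \<I> \<boxtimes> f) = f \<cdot> \<lambda>\<lambda> a"
    and runit_iso: "a \<in> Obj V \<Longrightarrow> is_iso V (a \<otimes> \<I>) a (\<rho> a)"
    and runit_nat: "f \<in> Hom V a b \<Longrightarrow> \<rho> b \<cdot> (f \<boxtimes> \<one> \<I>) = f \<cdot> \<rho> a"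
    and pentagon: "a \<in> Obj V \<Longrightarrow> b \<in> Obj V \<Longrightarrow> c \<in> Obj V \<Longrightarrow> d \<in> Obj V \<Longrightarrow>
                     \<alpha> a b (c \<otimes> d) \<cdot> \<alpha> (a \<otimes> b) c d
                       = (\<one> a \<boxtimes> \<alpha> b c d) \<cdot> \<alpha> a (b \<otimes> c) d \<cdot> (\<alpha> a b c \<boxtimes> \<one> d)"
    and triangle: "a \<in> Obj V \<Longrightarrow> b \<in> Obj V \<Longrightarrow> (\<one> a \<boxtimes> \<lambda>\<lambda> b) \<cdot> \<alpha> a \<I> b = \<rho> a \<boxtimes> \<one> b"
    and symm_Hom: "a \<in> Obj V \<Longrightarrow> b \<in> Obj V \<Longrightarrow> \<sigma> a b \<in> Hom V (a \<otimes> b) (b \<otimes> a)"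
    and symm_nat: "f \<in> Hom V a a' \<Longrightarrow> g \<in> Hom V b b' \<Longrightarrow> \<sigma> a' b' \<cdot> (f \<boxtimes> g) = (g \<boxtimes> f) \<cdot> \<sigma> a b"
    and symm_inv: "a \<in> Obj V \<Longrightarrow> b \<in> Obj V \<Longrightarrow> \<sigma> b a \<cdot> \<sigma> a b = \<one> (a \<otimes> b)"
    and hexagon: "a \<in> Obj V \<Longrightarrow> b \<in> Obj V \<Longrightarrow> c \<in> Obj V \<Longrightarrow>
                    \<alpha> b c a \<cdot> \<sigma> a (b \<otimes> c) \<cdot> \<alpha> a b c
                      = (\<one> b \<boxtimes> \<sigma> a c) \<cdot> \<alpha> b a c \<cdot> (\<sigma> a b \<boxtimes> \<one> c)"
    and ihom_Obj: "a \<in> Obj V \<Longrightarrow> b \<in> Obj V \<Longrightarrow> \<lbrakk>a, b\<rbrakk> \<in> Obj V"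
    and ev_Hom: "a \<in> Obj V \<Longrightarrow> b \<in> Obj V \<Longrightarrow> ev V a b \<in> Hom V (\<lbrakk>a, b\<rbrakk> \<otimes> a) b"
    and ev_univ: "a \<in> Obj V \<Longrightarrow> b \<in> Obj V \<Longrightarrow> c \<in> Obj V \<Longrightarrow> f \<in> Hom V (a \<otimes> b) c \<Longrightarrow>
                    \<exists>!g. g \<in> Hom V a \<lbrakk>b, c\<rbrakk> \<and> ev V b c \<cdot> (g \<boxtimes> \<one> b) = f"

definition enrichment_base :: "'u itself \<Rightarrow> ('v, 'm) smcc \<Rightarrow> bool" where
  "enrichment_base U V \<longleftrightarrow>
     symmetric_monoidal_closed V \<and> locally_small U V \<and> complete U V \<and> cocomplete U V"


section \<open>Enriched categories and functors\<close>

text \<open>\<open>VComp A a b c\<close> is the composition \<open>A(b, c) \<otimes> A(a, b) \<rightarrow> A(a, c)\<close>.\<close>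

record ('a, 'v, 'm) vcat =
  VObj :: "'a set"
  VHom :: "'a \<Rightarrow> 'a \<Rightarrow> 'v"
  VComp :: "'a \<Rightarrow> 'a \<Rightarrow> 'a \<Rightarrow> 'm"
  VId :: "'a \<Rightarrow> 'm"

record ('a, 'b, 'm) vfun =
  FO :: "'a \<Rightarrow> 'b"
  FA :: "'a \<Rightarrow> 'a \<Rightarrow> 'm"

type_synonym ('k, 'v, 'm) weight = "('k, 'v, 'm) vcat \<times> ('k, 'v, 'm) vfun"

context
  fixes V :: "('v, 'm) smcc" (structure)
begin

definition vcategory :: "('a, 'v, 'm) vcat \<Rightarrow> bool" where
  "vcategory A \<longleftrightarrow>
     (\<forall>a\<in>VObj A. \<forall>b\<in>VObj A. VHom A a b \<in> Obj V) \<and>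
     (\<forall>a\<in>VObj A. \<forall>b\<in>VObj A. \<forall>c\<in>VObj A.
        VComp A a b c \<in> Hom V (VHom A b c \<otimes> VHom A a b) (VHom A a c)) \<and>
     (\<forall>a\<in>VObj A. VId A a \<in> Hom V \<I> (VHom A a a)) \<and>
     (\<forall>a\<in>VObj A. \<forall>b\<in>VObj A. \<forall>c\<in>VObj A. \<forall>d\<in>VObj A.
        VComp A a b d \<cdot> (VComp A b c d \<boxtimes> \<one> (VHom A a b))
          = VComp A a c d \<cdot> (\<one> (VHom A c d) \<boxtimes> VComp A a b c)
              \<cdot> \<alpha> (VHom A c d) (VHom A b c) (VHom A a b)) \<and>
     (\<forall>a\<in>VObj A. \<forall>b\<in>VObj A.
        VComp A a b b \<cdot> (VId A b \<boxtimes> \<one> (VHom A a b)) = \<lambda>\<lambda> (VHom A a b) \<and>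
        VComp A a a b \<cdot> (\<one> (VHom A a b) \<boxtimes> VId A a) = \<rho> (VHom A a b))"

definition vop :: "('a, 'v, 'm) vcat \<Rightarrow> ('a, 'v, 'm) vcat" where
  "vop A = \<lparr>VObj = VObj A, VHom = (\<lambda>a b. VHom A b a),
     VComp = (\<lambda>a b c. VComp A c b a \<cdot> \<sigma> (VHom A c b) (VHom A b a)), VId = VId A\<rparr>"

text \<open>
  Functors take the value \<open>undefined\<close> off their domain, so that equality of functors, and hence the
  object set of a functor category, is as usual.
\<close>

definition vfunctors :: "('a, 'v, 'm) vcat \<Rightarrow> ('b, 'v, 'm) vcat \<Rightarrow> ('a, 'b, 'm) vfun set" where
  "vfunctors X Y = {F.
     FO F \<in> VObj X \<rightarrow>\<^sub>E VObj Y \<and>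
     (\<forall>x y. x \<notin> VObj X \<or> y \<notin> VObj X \<longrightarrow> FA F x y = undefined) \<and>
     (\<forall>x\<in>VObj X. \<forall>y\<in>VObj X. FA F x y \<in> Hom V (VHom X x y) (VHom Y (FO F x) (FO F y))) \<and>
     (\<forall>x\<in>VObj X. \<forall>y\<in>VObj X. \<forall>z\<in>VObj X.
        FA F x z \<cdot> VComp X x y z
          = VComp Y (FO F x) (FO F y) (FO F z) \<cdot> (FA F y z \<boxtimes> FA F x y)) \<and>
     (\<forall>x\<in>VObj X. FA F x x \<cdot> VId X x = VId Y (FO F x))}"

definition mk_vfun :: "('a, 'v, 'm) vcat \<Rightarrow> ('a \<Rightarrow> 'b) \<Rightarrow> ('a \<Rightarrow> 'a \<Rightarrow> 'm) \<Rightarrow> ('a, 'b, 'm) vfun" where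
  "mk_vfun X fo fa = \<lparr>FO = restrict fo (VObj X),
     FA = (\<lambda>x y. if x \<in> VObj X \<and> y \<in> VObj X then fa x y else undefined)\<rparr>"

definition vcompose ::
  "('a, 'v, 'm) vcat \<Rightarrow> ('b, 'c, 'm) vfun \<Rightarrow> ('a, 'b, 'm) vfun \<Rightarrow> ('a, 'c, 'm) vfun" where
  "vcompose X G F = mk_vfun X (\<lambda>x. FO G (FO F x)) (\<lambda>x y. FA G (FO F x) (FO F y) \<cdot> FA F x y)"

text \<open>The functor \<open>vop X \<rightarrow> vop Y\<close> determined by a functor \<open>X \<rightarrow> Y\<close>.\<close>

definition vop_fun :: "('a, 'b, 'm) vfun \<Rightarrow> ('a, 'b, 'm) vfun" where
  "vop_fun F = \<lparr>FO = FO F, FA = (\<lambda>x y. FA F y x)\<rparr>"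

definition curry_arr :: "'v \<Rightarrow> 'v \<Rightarrow> 'v \<Rightarrow> 'm \<Rightarrow> 'm" where
  "curry_arr a b c f = (THE g. g \<in> Hom V a \<lbrakk>b, c\<rbrakk> \<and> ev V b c \<cdot> (g \<boxtimes> \<one> b) = f)"

definition self_enriched :: "('v, 'v, 'm) vcat" (\<open>\<V>\<close>) where
  "self_enriched = \<lparr>VObj = Obj V, VHom = (\<lambda>a b. \<lbrakk>a, b\<rbrakk>),
     VComp = (\<lambda>a b c. curry_arr (\<lbrakk>b, c\<rbrakk> \<otimes> \<lbrakk>a, b\<rbrakk>) a c
                         (ev V b c \<cdot> (\<one> \<lbrakk>b, c\<rbrakk> \<boxtimes> ev V a b) \<cdot> \<alpha> \<lbrakk>b, c\<rbrakk> \<lbrakk>a, b\<rbrakk> a)),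
     VId = (\<lambda>a. curry_arr \<I> a a (\<lambda>\<lambda> a))\<rparr>"

text \<open>The bijection between arrows \<open>a \<rightarrow> b\<close> and arrows \<open>\<I> \<rightarrow> [a, b]\<close>.\<close>

definition name :: "'v \<Rightarrow> 'v \<Rightarrow> 'm \<Rightarrow> 'm" where
  "name a b f = curry_arr \<I> a b (f \<cdot> \<lambda>\<lambda> a)"

definition unname :: "'v \<Rightarrow> 'v \<Rightarrow> 'm \<Rightarrow> 'm" where
  "unname a b u = (THE f. f \<in> Hom V a b \<and> name a b f = u)"

text \<open>The covariant representable \<open>A(a, -)\<close>; the contravariant \<open>A(-, a)\<close> is \<open>hom_functor (vop A) a\<close>.\<close>

definition hom_functor :: "('a, 'v, 'm) vcat \<Rightarrow> 'a \<Rightarrow> ('a, 'v, 'm) vfun" where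
  "hom_functor A a = mk_vfun A (VHom A a)
     (\<lambda>x y. curry_arr (VHom A x y) (VHom A a x) (VHom A a y) (VComp A a x y))"

text \<open>
  Isomorphism in the underlying ordinary category, whose arrows \<open>a \<rightarrow> b\<close> are the arrows
  \<open>\<I> \<rightarrow> A(a, b)\<close> of \<open>V\<close>, with \<open>g\<close> after \<open>f\<close> given by \<open>VComp A a b c \<cdot> (g \<boxtimes> f)\<close> up to \<open>\<I> \<cong> \<I> \<otimes> \<I>\<close>.
\<close>

definition viso_rel :: "('a, 'v, 'm) vcat \<Rightarrow> ('a \<times> 'a) set" where
  "viso_rel A = {(a, b). a \<in> VObj A \<and> b \<in> VObj A \<and>
     (\<exists>f \<in> Hom V \<I> (VHom A a b). \<exists>g \<in> Hom V \<I> (VHom A b a).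
        VComp A a b a \<cdot> (g \<boxtimes> f) = VId A a \<cdot> \<lambda>\<lambda> \<I> \<and>
        VComp A b a b \<cdot> (f \<boxtimes> g) = VId A b \<cdot> \<lambda>\<lambda> \<I>)}"

definition vsmall :: "'u itself \<Rightarrow> ('a, 'v, 'm) vcat \<Rightarrow> bool" where
  "vsmall U A \<longleftrightarrow> small U (VObj A // viso_rel A)"


section \<open>Natural transformations and functor categories\<close>

text \<open>
  The extraordinary naturality of a family \<open>q x : z \<rightarrow> Y(F x, G x)\<close> in \<open>x\<close>. For \<open>z = \<I>\<close> it is the
  naturality of a transformation \<open>F \<rightarrow> G\<close>; a universal such family is the end of \<open>Y(F -, G -)\<close>.
\<close>

definition natural_family ::
  "('a, 'v, 'm) vcat \<Rightarrow> ('b, 'v, 'm) vcat \<Rightarrow> ('a, 'b, 'm) vfun \<Rightarrow> ('a, 'b, 'm) vfun \<Rightarrow>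
     'v \<Rightarrow> ('a \<Rightarrow> 'm) \<Rightarrow> bool" where
  "natural_family X Y F G z q \<longleftrightarrow> z \<in> Obj V \<and>
     (\<forall>x\<in>VObj X. q x \<in> Hom V z (VHom Y (FO F x) (FO G x))) \<and>
     (\<forall>x\<in>VObj X. \<forall>y\<in>VObj X.
        VComp Y (FO F x) (FO F y) (FO G y) \<cdot> (q y \<boxtimes> FA F x y)
          = VComp Y (FO F x) (FO G x) (FO G y) \<cdot> (FA G x y \<boxtimes> q x) \<cdot> \<sigma> z (VHom X x y))"

definition vnat_trans ::
  "('a, 'v, 'm) vcat \<Rightarrow> ('b, 'v, 'm) vcat \<Rightarrow> ('a, 'b, 'm) vfun \<Rightarrow> ('a, 'b, 'm) vfun \<Rightarrow>
     ('a \<Rightarrow> 'm) \<Rightarrow> bool" where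
  "vnat_trans X Y F G \<eta> \<longleftrightarrow> natural_family X Y F G \<I> \<eta>"

definition is_hom_end ::
  "('a, 'v, 'm) vcat \<Rightarrow> ('b, 'v, 'm) vcat \<Rightarrow> ('a, 'b, 'm) vfun \<Rightarrow> ('a, 'b, 'm) vfun \<Rightarrow>
     'v \<Rightarrow> ('a \<Rightarrow> 'm) \<Rightarrow> bool" where
  "is_hom_end X Y F G e p \<longleftrightarrow> natural_family X Y F G e p \<and>
     (\<forall>z q. natural_family X Y F G z q \<longrightarrow>
        (\<exists>!h. h \<in> Hom V z e \<and> (\<forall>x\<in>VObj X. p x \<cdot> h = q x)))"

definition hom_end ::
  "('a, 'v, 'm) vcat \<Rightarrow> ('b, 'v, 'm) vcat \<Rightarrow> ('a, 'b, 'm) vfun \<Rightarrow> ('a, 'b, 'm) vfun \<Rightarrow>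
     'v \<times> ('a \<Rightarrow> 'm)" where
  "hom_end X Y F G = (SOME (e, p). is_hom_end X Y F G e p)"

definition nat_obj ::
  "('a, 'v, 'm) vcat \<Rightarrow> ('b, 'v, 'm) vcat \<Rightarrow> ('a, 'b, 'm) vfun \<Rightarrow> ('a, 'b, 'm) vfun \<Rightarrow> 'v" where
  "nat_obj X Y F G = fst (hom_end X Y F G)"

definition nat_proj ::
  "('a, 'v, 'm) vcat \<Rightarrow> ('b, 'v, 'm) vcat \<Rightarrow> ('a, 'b, 'm) vfun \<Rightarrow> ('a, 'b, 'm) vfun \<Rightarrow> 'a \<Rightarrow> 'm" where
  "nat_proj X Y F G = snd (hom_end X Y F G)"

definition functor_cat ::
  "('a, 'v, 'm) vcat \<Rightarrow> ('b, 'v, 'm) vcat \<Rightarrow> (('a, 'b, 'm) vfun, 'v, 'm) vcat" where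
  "functor_cat X Y = \<lparr>VObj = vfunctors X Y, VHom = nat_obj X Y,
     VComp = (\<lambda>F G H. THE h. h \<in> Hom V (nat_obj X Y G H \<otimes> nat_obj X Y F G) (nat_obj X Y F H) \<and>
        (\<forall>x\<in>VObj X. nat_proj X Y F H x \<cdot> h
           = VComp Y (FO F x) (FO G x) (FO H x) \<cdot> (nat_proj X Y G H x \<boxtimes> nat_proj X Y F G x))),
     VId = (\<lambda>F. THE h. h \<in> Hom V \<I> (nat_obj X Y F F) \<and>
        (\<forall>x\<in>VObj X. nat_proj X Y F F x \<cdot> h = VId Y (FO F x)))\<rparr>"


section \<open>Weighted limits and colimits\<close>

definition weights :: "'u itself \<Rightarrow> ('k, 'v, 'm) weight set" where
  "weights U = {(K, \<phi>). vcategory K \<and> vsmall U K \<and> \<phi> \<in> vfunctors (vop K) \<V>}"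

text \<open>The functor \<open>vop A \<rightarrow> [X, V]\<close> sending \<open>a\<close> to \<open>A(a, T -)\<close>, for \<open>T : X \<rightarrow> A\<close>.\<close>

definition hom_along ::
  "('x, 'v, 'm) vcat \<Rightarrow> ('a, 'v, 'm) vcat \<Rightarrow> ('x, 'a, 'm) vfun \<Rightarrow> ('a, ('x, 'v, 'm) vfun, 'm) vfun"
where
  "hom_along X A T =
     (let N = (\<lambda>a. vcompose X (hom_functor A a) T) in
      mk_vfun (vop A) N
        (\<lambda>a b. THE h. h \<in> Hom V (VHom A b a) (nat_obj X \<V> (N a) (N b)) \<and>
           (\<forall>x\<in>VObj X. nat_proj X \<V> (N a) (N b) x \<cdot> h = FA (hom_functor (vop A) (FO T x)) a b)))"

text \<open>The functor \<open>vop A \<rightarrow> V\<close> sending \<open>a\<close> to \<open>[K\<^sup>o\<^sup>p, V](\<phi>, A(a, T -))\<close>.\<close>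

definition cylinders ::
  "('k, 'v, 'm) weight \<Rightarrow> ('a, 'v, 'm) vcat \<Rightarrow> ('k, 'a, 'm) vfun \<Rightarrow> ('a, 'v, 'm) vfun" where
  "cylinders w A T = (case w of (K, \<phi>) \<Rightarrow>
     vcompose (vop A) (hom_functor (functor_cat (vop K) \<V>) \<phi>) (hom_along (vop K) A T))"

definition is_wlimit ::
  "('k, 'v, 'm) weight \<Rightarrow> ('a, 'v, 'm) vcat \<Rightarrow> ('k, 'a, 'm) vfun \<Rightarrow> 'a \<Rightarrow> ('a \<Rightarrow> 'm) \<Rightarrow> bool" where
  "is_wlimit w A T L \<theta> \<longleftrightarrow> L \<in> VObj A \<and>
     (\<forall>a\<in>VObj A. is_iso V (VHom A a L) (FO (cylinders w A T) a) (\<theta> a)) \<and>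
     vnat_trans (vop A) \<V> (hom_functor (vop A) L) (cylinders w A T)
       (\<lambda>a. name (VHom A a L) (FO (cylinders w A T) a) (\<theta> a))"

text \<open>
  The counit \<open>\<phi> k \<rightarrow> A(L, T k)\<close> of a weighted limit: the image under \<open>\<theta> L\<close> of the identity of \<open>L\<close>,
  which is an element of \<open>[K\<^sup>o\<^sup>p, V](\<phi>, A(L, T -))\<close>.
\<close>

definition counit ::
  "('k, 'v, 'm) weight \<Rightarrow> ('a, 'v, 'm) vcat \<Rightarrow> ('k, 'a, 'm) vfun \<Rightarrow> 'a \<Rightarrow> ('a \<Rightarrow> 'm) \<Rightarrow> 'k \<Rightarrow> 'm" where
  "counit w A T L \<theta> k = (case w of (K, \<phi>) \<Rightarrow>
     unname (FO \<phi> k) (VHom A L (FO T k))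
       (nat_proj (vop K) \<V> \<phi> (vcompose (vop K) (hom_functor A L) T) k \<cdot> \<theta> L \<cdot> VId A L))"

text \<open>
  A colimit of \<open>S : K \<rightarrow> A\<close> is a limit of the opposite functor into \<open>vop A\<close>:
  \<open>A(C, a) \<cong> [K\<^sup>o\<^sup>p, V](\<phi>, A(S -, a))\<close>.
\<close>

definition is_wcolimit ::
  "('k, 'v, 'm) weight \<Rightarrow> ('a, 'v, 'm) vcat \<Rightarrow> ('k, 'a, 'm) vfun \<Rightarrow> 'a \<Rightarrow> ('a \<Rightarrow> 'm) \<Rightarrow> bool" where
  "is_wcolimit w A S C \<theta> \<longleftrightarrow> is_wlimit w (vop A) (vop_fun S) C \<theta>"

definition wcolim_unit ::
  "('k, 'v, 'm) weight \<Rightarrow> ('a, 'v, 'm) vcat \<Rightarrow> ('k, 'a, 'm) vfun \<Rightarrow> 'a \<Rightarrow> ('a \<Rightarrow> 'm) \<Rightarrow> 'k \<Rightarrow> 'm" where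
  "wcolim_unit w A S C \<theta> = counit w (vop A) (vop_fun S) C \<theta>"

definition wcomplete :: "('k, 'v, 'm) weight set \<Rightarrow> ('a, 'v, 'm) vcat \<Rightarrow> bool" where
  "wcomplete \<Phi> A \<longleftrightarrow>
     (\<forall>w\<in>\<Phi>. \<forall>T\<in>vfunctors (vop (fst w)) A. \<exists>L \<theta>. is_wlimit w A T L \<theta>)"

text \<open>Preservation means that the image of the limit, with the image of its counit, is a limit.\<close>

definition preserves ::
  "('k, 'v, 'm) weight \<Rightarrow> ('a, 'v, 'm) vcat \<Rightarrow> ('b, 'v, 'm) vcat \<Rightarrow> ('a, 'b, 'm) vfun \<Rightarrow> bool" where
  "preserves w A B F \<longleftrightarrow>
     (\<forall>T\<in>vfunctors (vop (fst w)) A. \<forall>L \<theta>. is_wlimit w A T L \<theta> \<longrightarrow>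
        (\<exists>\<theta>'. is_wlimit w B (vcompose (vop (fst w)) F T) (FO F L) \<theta>' \<and>
           (\<forall>k\<in>VObj (fst w). counit w B (vcompose (vop (fst w)) F T) (FO F L) \<theta>' k
              = FA F L (FO T k) \<cdot> counit w A T L \<theta> k)))"

definition wcontinuous ::
  "('k, 'v, 'm) weight set \<Rightarrow> ('a, 'v, 'm) vcat \<Rightarrow> ('b, 'v, 'm) vcat \<Rightarrow> ('a, 'b, 'm) vfun \<Rightarrow> bool" where
  "wcontinuous \<Phi> A B F \<longleftrightarrow> (\<forall>w\<in>\<Phi>. preserves w A B F)"


section \<open>Saturation, flatness and atomicity\<close>

text \<open>
  The categories tested are those with objects in \<open>'a\<close>, of whatever size; \<open>'a\<close> is to be taken large
  enough for the functor categories \<open>[K, V]\<close> with \<open>K\<close> the domain of a weight.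
\<close>

definition saturation ::
  "'u itself \<Rightarrow> 'a itself \<Rightarrow> ('k, 'v, 'm) weight set \<Rightarrow> ('k, 'v, 'm) weight set" where
  "saturation U _ \<Phi> = {w \<in> weights U.
     (\<forall>A :: ('a, 'v, 'm) vcat. vcategory A \<and> wcomplete \<Phi> A \<longrightarrow> wcomplete {w} A) \<and>
     (\<forall>(A :: ('a, 'v, 'm) vcat) (B :: ('a, 'v, 'm) vcat). \<forall>F\<in>vfunctors A B.
        vcategory A \<and> vcategory B \<and> wcomplete \<Phi> A \<and> wcomplete \<Phi> B \<and> wcontinuous \<Phi> A B F \<longrightarrow>
        wcontinuous {w} A B F)}"

text \<open>
  \<open>G\<close> is the functor \<open>\<phi> * - : [L, V] \<rightarrow> V\<close>: it takes a colimit at each \<open>S\<close>, and its action on homs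
  is the one for which the units \<open>\<phi> l \<rightarrow> [S l, G S]\<close> are natural in \<open>S\<close>. The equation asserts the
  equality of two arrows \<open>[L, V](S, S') \<otimes> \<phi> l \<rightarrow> [S l, G S']\<close>.
\<close>

definition is_wcolim_functor ::
  "('k, 'v, 'm) weight \<Rightarrow> (('k, 'v, 'm) vfun, 'v, 'm) vfun \<Rightarrow> bool" where
  "is_wcolim_functor w G \<longleftrightarrow> (case w of (L, \<phi>) \<Rightarrow>
     G \<in> vfunctors (functor_cat L \<V>) \<V> \<and>
     (\<exists>\<theta>. (\<forall>S\<in>vfunctors L \<V>. is_wcolimit w \<V> S (FO G S) (\<theta> S)) \<and>
        (\<forall>S\<in>vfunctors L \<V>. \<forall>S'\<in>vfunctors L \<V>. \<forall>l\<in>VObj L.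
           VComp \<V> (FO S l) (FO G S) (FO G S')
               \<cdot> (FA G S S' \<boxtimes> wcolim_unit w \<V> S (FO G S) (\<theta> S) l)
             = VComp \<V> (FO S l) (FO S' l) (FO G S')
               \<cdot> \<sigma> \<lbrakk>FO S l, FO S' l\<rbrakk> \<lbrakk>FO S' l, FO G S'\<rbrakk>
               \<cdot> (nat_proj L \<V> S S' l \<boxtimes> wcolim_unit w \<V> S' (FO G S') (\<theta> S') l))))"

definition wcolim_functor :: "('k, 'v, 'm) weight \<Rightarrow> (('k, 'v, 'm) vfun, 'v, 'm) vfun" where
  "wcolim_functor w = (SOME G. is_wcolim_functor w G)"

text \<open>\<open>commutes w w'\<close>: in \<open>V\<close>, \<open>w\<close>-weighted colimits commute with \<open>w'\<close>-weighted limits.\<close>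

definition commutes :: "('k, 'v, 'm) weight \<Rightarrow> ('k, 'v, 'm) weight \<Rightarrow> bool" where
  "commutes w w' \<longleftrightarrow> preserves w' (functor_cat (fst w) \<V>) \<V> (wcolim_functor w)"

definition flat :: "'u itself \<Rightarrow> ('k, 'v, 'm) weight set \<Rightarrow> ('k, 'v, 'm) weight set" where
  "flat U \<Psi> = {w \<in> weights U. \<forall>w'\<in>\<Psi>. commutes w w'}"

definition atomic :: "'u itself \<Rightarrow> ('k, 'v, 'm) weight set \<Rightarrow> ('k, 'v, 'm) weight set" where
  "atomic U \<Phi> = {w' \<in> weights U. \<forall>w\<in>\<Phi>. commutes w w'}"

definition saturated :: "'u itself \<Rightarrow> 'a itself \<Rightarrow> ('k, 'v, 'm) weight set \<Rightarrow> bool" where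
  "saturated U T \<Phi> \<longleftrightarrow> saturation U T \<Phi> = \<Phi>"

end

end

theory Submission
  imports Defs
begin

text \<open>
  Interchanging a limit and a colimit is symmetric: for weights \<open>\<phi>\<close> on \<open>L\<close> and \<open>\<psi>\<close> on \<open>K\<close>, the functor
  \<open>\<phi> * - : [L, V] \<rightarrow> V\<close> preserves \<open>\<psi>\<close>-limits if and only if \<open>{\<psi>, -} : [K\<^sup>o\<^sup>p, V] \<rightarrow> V\<close> preserves
  \<open>\<phi>\<close>-colimits, since both statements say that one canonical arrow is invertible. So for fixed \<open>\<phi>\<close> the
  \<open>\<psi>\<close> commuting with it are the weights whose limits are preserved by a single functor between
  complete categories, and if this class contains \<open>\<Psi>\<close> then it contains \<open>\<Psi>\<^sup>*\<close>; applied to the opposite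
  of \<open>{\<psi>, -}\<close>, the same argument gives closure under saturation in \<open>\<phi>\<close> for fixed \<open>\<psi>\<close>. All four
  claims follow formally.
\<close>

text \<open>The formal argument is short; the work is in making the canonical arrow available.
  \<open>V\<close> is not strict, so equations between arrows are checked on elements, where
  coherence isomorphisms disappear. Representability of \<open>cylinders\<close> is replaced by a
  universal property of cones with arbitrary domain \<open>z\<close> (\<open>is_lim\<close>), in
  which no functor category occurs. Colimits are limits in opposite categories, and the locale
  \<open>functor_category\<close> covers both \<open>[L, V]\<close> and the opposite of
  \<open>[X, V]\<close>, so that pointwise limits and limit functors are constructed once. The
  domain of a weight is small only up to isomorphism of objects; ends and colimits are therefore
  built on a small set of representatives and then extended to all objects. Finally, saturation
  quantifies over categories with objects in one type \<open>'a\<close>, whereas the functors to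
  which it is applied live on functor categories and on \<open>V\<close>; relabelling along
  injections bridges the difference.\<close>

context category
begin

section \<open>Arrows and isomorphisms in an ordinary category\<close>

lemma Hom_iff: "f \<in> Hom C a b \<longleftrightarrow> f \<in> Arr C \<and> Dom C f = a \<and> Cod C f = b"
  by (auto simp: Hom_def)

lemma Dom_Obj' [simp]: "f \<in> Arr C \<Longrightarrow> Dom C f \<in> Obj C"
  by (rule Dom_Obj)

lemma Cod_Obj' [simp]: "f \<in> Arr C \<Longrightarrow> Cod C f \<in> Obj C"
  by (rule Cod_Obj)

lemma Id_simps [simp]:
  assumes "a \<in> Obj C"
  shows "\<one> a \<in> Arr C" "Dom C (\<one> a) = a" "Cod C (\<one> a) = a"
  using Id_Hom[OF assms] by (auto simp: Hom_iff)

lemma Cmp_simps [simp]: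
  assumes "f \<in> Arr C" "g \<in> Arr C" "Dom C g = Cod C f"
  shows "g \<cdot> f \<in> Arr C" "Dom C (g \<cdot> f) = Dom C f" "Cod C (g \<cdot> f) = Cod C g"
  using Cmp_Hom[of f "Dom C f" "Cod C f" g "Cod C g"] assms by (auto simp: Hom_iff)

lemma Id_l [simp]: "f \<in> Arr C \<Longrightarrow> Cod C f = a \<Longrightarrow> \<one> a \<cdot> f = f"
  using Id_left by (auto simp: Hom_iff)

lemma Id_r [simp]: "f \<in> Arr C \<Longrightarrow> Dom C f = a \<Longrightarrow> f \<cdot> \<one> a = f"
  using Id_right by (auto simp: Hom_iff)

lemma assoc_r [simp]:
  "f \<in> Arr C \<Longrightarrow> g \<in> Arr C \<Longrightarrow> h \<in> Arr C \<Longrightarrow> Dom C h = Cod C g \<Longrightarrow> Dom C g = Cod C f \<Longrightarrow>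
   (h \<cdot> g) \<cdot> f = h \<cdot> g \<cdot> f"
  using Cmp_assoc[of f "Dom C f" "Cod C f" g "Cod C g" h "Cod C h"] by (auto simp: Hom_iff)

text \<open>Simplification brackets composites to the right, so the left side of an equation for
  \<open>g \<cdot> f\<close> is no longer a subterm once something precedes \<open>f\<close>. This
  supplies the equation with an arbitrary tail.\<close>

lemma tail:
  assumes "g \<cdot> f = k" "f \<in> Arr C" "g \<in> Arr C" "Dom C g = Cod C f" "x \<in> Arr C" "Cod C x = Dom C f"
  shows "g \<cdot> f \<cdot> x = k \<cdot> x"
  using assoc_r[of x f g] assms by simp

text \<open>\<open>is_iso\<close> takes source and target as arguments. Reading them off the arrow
  turns typing into equations for \<open>Dom\<close> and \<open>Cod\<close>, which simplification
  discharges.\<close>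

definition iso :: "'m \<Rightarrow> bool" where
  "iso f \<longleftrightarrow> f \<in> Arr C \<and> (\<exists>g \<in> Arr C. Dom C g = Cod C f \<and> Cod C g = Dom C f \<and>
     g \<cdot> f = \<one> (Dom C f) \<and> f \<cdot> g = \<one> (Cod C f))"

definition invr :: "'m \<Rightarrow> 'm" where
  "invr f = (SOME g. g \<in> Arr C \<and> Dom C g = Cod C f \<and> Cod C g = Dom C f \<and>
     g \<cdot> f = \<one> (Dom C f) \<and> f \<cdot> g = \<one> (Cod C f))"

lemma is_iso_iff: "is_iso C a b f \<longleftrightarrow> iso f \<and> Dom C f = a \<and> Cod C f = b"
  unfolding is_iso_def iso_def by (auto simp: Hom_iff)

lemma iso_Arr [simp]: "iso f \<Longrightarrow> f \<in> Arr C"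
  by (simp add: iso_def)

lemma invr_simps [simp]:
  assumes "iso f"
  shows "invr f \<in> Arr C" "Dom C (invr f) = Cod C f" "Cod C (invr f) = Dom C f"
    "invr f \<cdot> f = \<one> (Dom C f)" "f \<cdot> invr f = \<one> (Cod C f)"
proof -
  from assms have "\<exists>g. g \<in> Arr C \<and> Dom C g = Cod C f \<and> Cod C g = Dom C f \<and>
     g \<cdot> f = \<one> (Dom C f) \<and> f \<cdot> g = \<one> (Cod C f)" unfolding iso_def by blast
  from someI_ex[OF this, folded invr_def]
  show "invr f \<in> Arr C" "Dom C (invr f) = Cod C f" "Cod C (invr f) = Dom C f"
    "invr f \<cdot> f = \<one> (Dom C f)" "f \<cdot> invr f = \<one> (Cod C f)" by auto
qed

lemma invr_tail [simp]:
  assumes "iso f" "x \<in> Arr C"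
  shows "Cod C x = Dom C f \<Longrightarrow> invr f \<cdot> f \<cdot> x = x" "Cod C x = Cod C f \<Longrightarrow> f \<cdot> invr f \<cdot> x = x"
proof -
  show "invr f \<cdot> f \<cdot> x = x" if "Cod C x = Dom C f"
    using assms that assoc_r[of x f "invr f"] by simp
  show "f \<cdot> invr f \<cdot> x = x" if "Cod C x = Cod C f"
    using assms that assoc_r[of x "invr f" f] by simp
qed

lemma isoI:
  "f \<in> Arr C \<Longrightarrow> g \<in> Arr C \<Longrightarrow> Dom C g = Cod C f \<Longrightarrow> Cod C g = Dom C f \<Longrightarrow>
   g \<cdot> f = \<one> (Dom C f) \<Longrightarrow> f \<cdot> g = \<one> (Cod C f) \<Longrightarrow> iso f"
  unfolding iso_def by blast

lemma iso_invr [simp]: "iso f \<Longrightarrow> iso (invr f)"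
  by (rule isoI[of _ f]) simp_all

lemma iso_Id [simp]: "a \<in> Obj C \<Longrightarrow> iso (\<one> a)"
  by (rule isoI[of _ "\<one> a"]) simp_all

lemma iso_Cmp [simp]:
  assumes "iso f" "iso g" "Dom C g = Cod C f"
  shows "iso (g \<cdot> f)"
  by (rule isoI[of _ "invr f \<cdot> invr g"]) (use assms in simp_all)

lemma iso_cancel_l:
  assumes "iso g" "f \<in> Arr C" "f' \<in> Arr C" "Cod C f = Dom C g" "Cod C f' = Dom C g" "g \<cdot> f = g \<cdot> f'"
  shows "f = f'"
proof -
  have "f = invr g \<cdot> g \<cdot> f" using assms(1-5) by simp
  also have "\<dots> = invr g \<cdot> g \<cdot> f'" by (simp only: assms(6))
  also have "\<dots> = f'" using assms(1-5) by simp
  finally show ?thesis .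
qed

lemma iso_cancel_r:
  assumes "iso g" "f \<in> Arr C" "f' \<in> Arr C" "Dom C f = Cod C g" "Dom C f' = Cod C g" "f \<cdot> g = f' \<cdot> g"
  shows "f = f'"
proof -
  have "f = (f \<cdot> g) \<cdot> invr g" using assms(1-5) by simp
  also have "\<dots> = (f' \<cdot> g) \<cdot> invr g" by (simp only: assms(6))
  also have "\<dots> = f'" using assms(1-5) by simp
  finally show ?thesis .
qed

lemma invr_unique:
  assumes "iso f" "g \<in> Arr C" "Dom C g = Cod C f" "Cod C g = Dom C f" "f \<cdot> g = \<one> (Cod C f)"
  shows "invr f = g"
  by (rule iso_cancel_l[of f]) (use assms in simp_all)

end

section \<open>Elements of a symmetric monoidal category\<close>

context symmetric_monoidal_closed
begin

section \<open>Coherence of the units and the symmetry\<close>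

lemma obj_simps [simp]: "a \<in> Obj V \<Longrightarrow> b \<in> Obj V \<Longrightarrow> a \<otimes> b \<in> Obj V" "\<I> \<in> Obj V"
  "a \<in> Obj V \<Longrightarrow> b \<in> Obj V \<Longrightarrow> \<lbrakk>a, b\<rbrakk> \<in> Obj V"
  by (simp_all add: tens_Obj unit_Obj ihom_Obj)

lemma tens_simps [simp]:
  assumes "f \<in> Arr V" "g \<in> Arr V"
  shows "f \<boxtimes> g \<in> Arr V" "Dom V (f \<boxtimes> g) = Dom V f \<otimes> Dom V g" "Cod V (f \<boxtimes> g) = Cod V f \<otimes> Cod V g"
  using tens_Hom[of f "Dom V f" "Cod V f" g "Dom V g" "Cod V g"] assms by (auto simp: Hom_iff)

lemma tens_cmp:
  "f \<in> Arr V \<Longrightarrow> f' \<in> Arr V \<Longrightarrow> g \<in> Arr V \<Longrightarrow> g' \<in> Arr V \<Longrightarrow> Dom V f' = Cod V f \<Longrightarrow> Dom V g' = Cod V g \<Longrightarrow>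
   (f' \<boxtimes> g') \<cdot> (f \<boxtimes> g) = (f' \<cdot> f) \<boxtimes> (g' \<cdot> g)"
  using tens_Cmp[of f "Dom V f" "Cod V f" f' "Cod V f'" g "Dom V g" "Cod V g" g' "Cod V g'"]
  by (auto simp: Hom_iff)

lemma tens_cmp_tail:
  "f \<in> Arr V \<Longrightarrow> f' \<in> Arr V \<Longrightarrow> g \<in> Arr V \<Longrightarrow> g' \<in> Arr V \<Longrightarrow> Dom V f' = Cod V f \<Longrightarrow> Dom V g' = Cod V g \<Longrightarrow>
   x \<in> Arr V \<Longrightarrow> Cod V x = Dom V f \<otimes> Dom V g \<Longrightarrow>
   (f' \<boxtimes> g') \<cdot> (f \<boxtimes> g) \<cdot> x = ((f' \<cdot> f) \<boxtimes> (g' \<cdot> g)) \<cdot> x"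
  by (rule tail[OF tens_cmp]) simp_all

lemma tens_id [simp]: "a \<in> Obj V \<Longrightarrow> b \<in> Obj V \<Longrightarrow> \<one> a \<boxtimes> \<one> b = \<one> (a \<otimes> b)"
  by (rule tens_Id)

lemma assoc_simps [simp]:
  assumes "a \<in> Obj V" "b \<in> Obj V" "c \<in> Obj V"
  shows "\<alpha> a b c \<in> Arr V" "Dom V (\<alpha> a b c) = (a \<otimes> b) \<otimes> c" "Cod V (\<alpha> a b c) = a \<otimes> (b \<otimes> c)" "iso (\<alpha> a b c)"
  using assoc_iso[OF assms] by (auto simp: is_iso_iff)

lemma lunit_simps [simp]:
  assumes "a \<in> Obj V"
  shows "\<lambda>\<lambda> a \<in> Arr V" "Dom V (\<lambda>\<lambda> a) = \<I> \<otimes> a" "Cod V (\<lambda>\<lambda> a) = a" "iso (\<lambda>\<lambda> a)"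
  using lunit_iso[OF assms] by (auto simp: is_iso_iff)

lemma runit_simps [simp]:
  assumes "a \<in> Obj V"
  shows "\<rho> a \<in> Arr V" "Dom V (\<rho> a) = a \<otimes> \<I>" "Cod V (\<rho> a) = a" "iso (\<rho> a)"
  using runit_iso[OF assms] by (auto simp: is_iso_iff)

lemma symm_simps [simp]:
  assumes "a \<in> Obj V" "b \<in> Obj V"
  shows "\<sigma> a b \<in> Arr V" "Dom V (\<sigma> a b) = a \<otimes> b" "Cod V (\<sigma> a b) = b \<otimes> a" "iso (\<sigma> a b)"
    "\<sigma> b a \<cdot> \<sigma> a b = \<one> (a \<otimes> b)"
proof -
  show *: "\<sigma> a b \<in> Arr V" "Dom V (\<sigma> a b) = a \<otimes> b" "Cod V (\<sigma> a b) = b \<otimes> a"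
     "\<sigma> b a \<cdot> \<sigma> a b = \<one> (a \<otimes> b)"
    using symm_Hom[OF assms] symm_inv[OF assms] by (auto simp: Hom_iff)
  show "iso (\<sigma> a b)"
    by (rule isoI[of _ "\<sigma> b a"]) (use assms symm_Hom[OF assms] symm_Hom[OF assms(2,1)] symm_inv[OF assms]
        symm_inv[OF assms(2,1)] in \<open>simp_all add: Hom_iff\<close>)
qed

lemma invr_symm [simp]: "a \<in> Obj V \<Longrightarrow> b \<in> Obj V \<Longrightarrow> invr (\<sigma> a b) = \<sigma> b a"
  by (rule invr_unique) simp_all

lemma ev_simps [simp]:
  assumes "a \<in> Obj V" "b \<in> Obj V"
  shows "ev V a b \<in> Arr V" "Dom V (ev V a b) = \<lbrakk>a, b\<rbrakk> \<otimes> a" "Cod V (ev V a b) = b"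
  using ev_Hom[OF assms] by (auto simp: Hom_iff)

lemma iso_tens [simp]: "iso f \<Longrightarrow> iso g \<Longrightarrow> iso (f \<boxtimes> g)"
  by (rule isoI[of _ "invr f \<boxtimes> invr g"]) (simp_all add: tens_cmp)

lemma invr_tens: "iso f \<Longrightarrow> iso g \<Longrightarrow> invr (f \<boxtimes> g) = invr f \<boxtimes> invr g"
  by (rule invr_unique) (simp_all add: tens_cmp)

lemma invr_Id [simp]: "a \<in> Obj V \<Longrightarrow> invr (\<one> a) = \<one> a"
  by (rule invr_unique) simp_all

lemma invr_Cmp: "iso f \<Longrightarrow> iso g \<Longrightarrow> Dom V g = Cod V f \<Longrightarrow> invr (g \<cdot> f) = invr f \<cdot> invr g"
  by (rule invr_unique) simp_all

lemma assoc_nat':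
  "f \<in> Arr V \<Longrightarrow> g \<in> Arr V \<Longrightarrow> h \<in> Arr V \<Longrightarrow>
   \<alpha> (Cod V f) (Cod V g) (Cod V h) \<cdot> ((f \<boxtimes> g) \<boxtimes> h) = (f \<boxtimes> (g \<boxtimes> h)) \<cdot> \<alpha> (Dom V f) (Dom V g) (Dom V h)"
  by (rule assoc_nat) (auto simp: Hom_iff)

lemma assoc_inv_nat:
  assumes [simp]: "f \<in> Arr V" "g \<in> Arr V" "h \<in> Arr V"
  shows "invr (\<alpha> (Cod V f) (Cod V g) (Cod V h)) \<cdot> (f \<boxtimes> (g \<boxtimes> h))
     = ((f \<boxtimes> g) \<boxtimes> h) \<cdot> invr (\<alpha> (Dom V f) (Dom V g) (Dom V h))"
proof (rule iso_cancel_l[of "\<alpha> (Cod V f) (Cod V g) (Cod V h)"])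
  show "\<alpha> (Cod V f) (Cod V g) (Cod V h) \<cdot> invr (\<alpha> (Cod V f) (Cod V g) (Cod V h)) \<cdot> (f \<boxtimes> (g \<boxtimes> h))
    = \<alpha> (Cod V f) (Cod V g) (Cod V h) \<cdot> ((f \<boxtimes> g) \<boxtimes> h) \<cdot> invr (\<alpha> (Dom V f) (Dom V g) (Dom V h))"
    using tail[OF assoc_nat'[of f g h], of "invr (\<alpha> (Dom V f) (Dom V g) (Dom V h))"] by simp
qed simp_all

lemma symm_nat':
  "f \<in> Arr V \<Longrightarrow> g \<in> Arr V \<Longrightarrow> \<sigma> (Cod V f) (Cod V g) \<cdot> (f \<boxtimes> g) = (g \<boxtimes> f) \<cdot> \<sigma> (Dom V f) (Dom V g)"
  by (rule symm_nat) (auto simp: Hom_iff)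

lemma lunit_nat': "f \<in> Arr V \<Longrightarrow> \<lambda>\<lambda> (Cod V f) \<cdot> (\<one> \<I> \<boxtimes> f) = f \<cdot> \<lambda>\<lambda> (Dom V f)"
  by (rule lunit_nat) (auto simp: Hom_iff)

lemma runit_nat': "f \<in> Arr V \<Longrightarrow> \<rho> (Cod V f) \<cdot> (f \<boxtimes> \<one> \<I>) = f \<cdot> \<rho> (Dom V f)"
  by (rule runit_nat) (auto simp: Hom_iff)

text \<open>Naturality of the left unitor makes tensoring with \<open>\<I>\<close> isomorphic to the
  identity functor.\<close>

lemma unit_tens_faithful:
  assumes "f \<in> Arr V" "g \<in> Arr V" "Dom V f = Dom V g" "Cod V f = Cod V g" "\<one> \<I> \<boxtimes> f = \<one> \<I> \<boxtimes> g"
  shows "f = g"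
proof (rule iso_cancel_r[of "\<lambda>\<lambda> (Dom V g)"])
  show "f \<cdot> \<lambda>\<lambda> (Dom V g) = g \<cdot> \<lambda>\<lambda> (Dom V g)"
    using lunit_nat'[OF assms(1)] lunit_nat'[OF assms(2)] unfolding assms(3-5) by (rule trans[OF sym])
qed (use assms(1-4) in simp_all)

lemma tens_unit_faithful:
  assumes "f \<in> Arr V" "g \<in> Arr V" "Dom V f = Dom V g" "Cod V f = Cod V g" "f \<boxtimes> \<one> \<I> = g \<boxtimes> \<one> \<I>"
  shows "f = g"
proof (rule iso_cancel_r[of "\<rho> (Dom V g)"])
  show "f \<cdot> \<rho> (Dom V g) = g \<cdot> \<rho> (Dom V g)"
    using runit_nat'[OF assms(1)] runit_nat'[OF assms(2)] unfolding assms(3-5) by (rule trans[OF sym])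
qed (use assms(1-4) in simp_all)

text \<open>In the triangle axiom the unit stands in the middle. Tensoring with \<open>\<I>\<close>
  on the left, which is faithful, brings it there; composed with the invertible \<open>?c\<close>,
  the two sides agree by pentagon, triangle and naturality.\<close>

lemma lunit_tens:
  assumes [simp]: "a \<in> Obj V" "b \<in> Obj V"
  shows "\<lambda>\<lambda> (a \<otimes> b) \<cdot> \<alpha> \<I> a b = \<lambda>\<lambda> a \<boxtimes> \<one> b"
proof (rule unit_tens_faithful)
  let ?c = "\<alpha> \<I> (\<I> \<otimes> a) b \<cdot> (\<alpha> \<I> \<I> a \<boxtimes> \<one> b)"
  have "(\<one> \<I> \<boxtimes> (\<lambda>\<lambda> (a \<otimes> b) \<cdot> \<alpha> \<I> a b)) \<cdot> ?c = (\<one> \<I> \<boxtimes> \<lambda>\<lambda> (a \<otimes> b)) \<cdot> (\<one> \<I> \<boxtimes> \<alpha> \<I> a b) \<cdot> ?c"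
    by (simp add: tens_cmp_tail)
  also have "\<dots> = (\<one> \<I> \<boxtimes> \<lambda>\<lambda> (a \<otimes> b)) \<cdot> \<alpha> \<I> \<I> (a \<otimes> b) \<cdot> \<alpha> (\<I> \<otimes> \<I>) a b"
    by (simp add: pentagon)
  also have "\<dots> = (\<rho> \<I> \<boxtimes> \<one> (a \<otimes> b)) \<cdot> \<alpha> (\<I> \<otimes> \<I>) a b"
    using tail[OF triangle[of \<I> "a \<otimes> b"], of "\<alpha> (\<I> \<otimes> \<I>) a b"] by simp
  also have "\<dots> = \<alpha> \<I> a b \<cdot> ((\<rho> \<I> \<boxtimes> \<one> a) \<boxtimes> \<one> b)"
    using assoc_nat'[of "\<rho> \<I>" "\<one> a" "\<one> b"] by simp
  also have "\<dots> = \<alpha> \<I> a b \<cdot> (((\<one> \<I> \<boxtimes> \<lambda>\<lambda> a) \<cdot> \<alpha> \<I> \<I> a) \<boxtimes> \<one> b)"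
    by (simp add: triangle)
  also have "\<dots> = \<alpha> \<I> a b \<cdot> ((\<one> \<I> \<boxtimes> \<lambda>\<lambda> a) \<boxtimes> \<one> b) \<cdot> (\<alpha> \<I> \<I> a \<boxtimes> \<one> b)"
    by (simp add: tens_cmp)
  also have "\<dots> = (\<one> \<I> \<boxtimes> (\<lambda>\<lambda> a \<boxtimes> \<one> b)) \<cdot> ?c"
    using tail[OF assoc_nat'[of "\<one> \<I>" "\<lambda>\<lambda> a" "\<one> b"], of "\<alpha> \<I> \<I> a \<boxtimes> \<one> b"] by simp
  finally show "\<one> \<I> \<boxtimes> (\<lambda>\<lambda> (a \<otimes> b) \<cdot> \<alpha> \<I> a b) = \<one> \<I> \<boxtimes> (\<lambda>\<lambda> a \<boxtimes> \<one> b)"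
    by (rule iso_cancel_r[rotated -1]) simp_all
qed simp_all

text \<open>After tensoring with \<open>\<I>\<close>, the left side is given by
  \<open>lunit_tens\<close> and the right side by the triangle. These differ in
  \<open>\<lambda>\<lambda> (\<I> \<otimes> \<I>)\<close> against
  \<open>\<one> \<I> \<boxtimes> \<lambda>\<lambda> \<I>\<close>, which agree by naturality of the
  unitor at itself.\<close>

lemma lunit_unit: "\<lambda>\<lambda> \<I> = \<rho> \<I>"
proof (rule tens_unit_faithful)
  have "\<lambda>\<lambda> \<I> \<cdot> \<lambda>\<lambda> (\<I> \<otimes> \<I>) = \<lambda>\<lambda> \<I> \<cdot> (\<one> \<I> \<boxtimes> \<lambda>\<lambda> \<I>)"
    using lunit_nat'[of "\<lambda>\<lambda> \<I>"] by simp
  then have "\<lambda>\<lambda> (\<I> \<otimes> \<I>) = \<one> \<I> \<boxtimes> \<lambda>\<lambda> \<I>"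
    by (rule iso_cancel_l[rotated -1]) simp_all
  with lunit_tens[of \<I> \<I>] triangle[of \<I> \<I>] show "\<lambda>\<lambda> \<I> \<boxtimes> \<one> \<I> = \<rho> \<I> \<boxtimes> \<one> \<I>" by simp
qed simp_all

text \<open>The hexagon for \<open>a\<close>, \<open>\<I>\<close>, \<open>\<I>\<close> gives the
  claim tensored with \<open>\<I>\<close> and composed with \<open>\<sigma> a \<I>\<close>; the
  first operation is faithful and the second is cancelled.\<close>

lemma lunit_symm:
  assumes [simp]: "a \<in> Obj V"
  shows "\<lambda>\<lambda> a \<cdot> \<sigma> a \<I> = \<rho> a"
proof (rule tens_unit_faithful)
  have "\<sigma> a \<I> \<cdot> (\<rho> a \<boxtimes> \<one> \<I>) = \<sigma> a \<I> \<cdot> (\<one> a \<boxtimes> \<lambda>\<lambda> \<I>) \<cdot> \<alpha> a \<I> \<I>"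
    by (simp add: triangle)
  also have "\<dots> = (\<lambda>\<lambda> \<I> \<boxtimes> \<one> a) \<cdot> \<sigma> a (\<I> \<otimes> \<I>) \<cdot> \<alpha> a \<I> \<I>"
    using tail[OF symm_nat'[of "\<one> a" "\<lambda>\<lambda> \<I>"], of "\<alpha> a \<I> \<I>"] by simp
  also have "\<dots> = \<lambda>\<lambda> (\<I> \<otimes> a) \<cdot> \<alpha> \<I> \<I> a \<cdot> \<sigma> a (\<I> \<otimes> \<I>) \<cdot> \<alpha> a \<I> \<I>"
    using tail[OF lunit_tens[of \<I> a], of "\<sigma> a (\<I> \<otimes> \<I>) \<cdot> \<alpha> a \<I> \<I>"] by simp
  also have "\<dots> = \<lambda>\<lambda> (\<I> \<otimes> a) \<cdot> (\<one> \<I> \<boxtimes> \<sigma> a \<I>) \<cdot> \<alpha> \<I> a \<I> \<cdot> (\<sigma> a \<I> \<boxtimes> \<one> \<I>)"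
    by (simp add: hexagon)
  also have "\<dots> = \<sigma> a \<I> \<cdot> \<lambda>\<lambda> (a \<otimes> \<I>) \<cdot> \<alpha> \<I> a \<I> \<cdot> (\<sigma> a \<I> \<boxtimes> \<one> \<I>)"
    using tail[OF lunit_nat'[of "\<sigma> a \<I>"], of "\<alpha> \<I> a \<I> \<cdot> (\<sigma> a \<I> \<boxtimes> \<one> \<I>)"] by simp
  also have "\<dots> = \<sigma> a \<I> \<cdot> (\<lambda>\<lambda> a \<boxtimes> \<one> \<I>) \<cdot> (\<sigma> a \<I> \<boxtimes> \<one> \<I>)"
    using tail[OF lunit_tens[of a \<I>], of "\<sigma> a \<I> \<boxtimes> \<one> \<I>"] by simp
  also have "\<dots> = \<sigma> a \<I> \<cdot> ((\<lambda>\<lambda> a \<cdot> \<sigma> a \<I>) \<boxtimes> \<one> \<I>)"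
    by (simp add: tens_cmp)
  finally have "\<sigma> a \<I> \<cdot> ((\<lambda>\<lambda> a \<cdot> \<sigma> a \<I>) \<boxtimes> \<one> \<I>) = \<sigma> a \<I> \<cdot> (\<rho> a \<boxtimes> \<one> \<I>)" by simp
  then show "(\<lambda>\<lambda> a \<cdot> \<sigma> a \<I>) \<boxtimes> \<one> \<I> = \<rho> a \<boxtimes> \<one> \<I>"
    by (rule iso_cancel_l[rotated -1]) simp_all
qed simp_all

text \<open>Both sides become \<open>\<lambda>\<lambda> \<I>\<close> after composition with it,
  since \<open>\<lambda>\<lambda> \<I>\<close> and \<open>\<rho> \<I>\<close> coincide.\<close>

lemma symm_unit: "\<sigma> \<I> \<I> = \<one> (\<I> \<otimes> \<I>)"
  by (rule iso_cancel_l[of "\<lambda>\<lambda> \<I>"]) (use lunit_symm[of \<I>] in \<open>simp_all add: lunit_unit\<close>)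

text \<open>Carries \<open>x\<close> past \<open>a\<close> in a product bracketed to the right. This
  is the elementary move from which the permutations of variables are composed.\<close>

definition swap :: "'v \<Rightarrow> 'v \<Rightarrow> 'v \<Rightarrow> 'm" where
  "swap x a b = \<alpha> a x b \<cdot> (\<sigma> x a \<boxtimes> \<one> b) \<cdot> invr (\<alpha> x a b)"

lemma swap_simps [simp]:
  assumes "x \<in> Obj V" "a \<in> Obj V" "b \<in> Obj V"
  shows "swap x a b \<in> Arr V" "Dom V (swap x a b) = x \<otimes> (a \<otimes> b)" "Cod V (swap x a b) = a \<otimes> (x \<otimes> b)"
    "iso (swap x a b)"
  using assms by (simp_all add: swap_def)

text \<open>The pentagon solved for the situation in which a new variable joins the first of three
  factors.\<close>

lemma pentagon_inv:
  assumes [simp]: "x \<in> Obj V" "a \<in> Obj V" "b \<in> Obj V" "c \<in> Obj V"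
  shows "invr (\<alpha> x a (b \<otimes> c)) \<cdot> (\<one> x \<boxtimes> \<alpha> a b c)
    = \<alpha> (x \<otimes> a) b c \<cdot> (invr (\<alpha> x a b) \<boxtimes> \<one> c) \<cdot> invr (\<alpha> x (a \<otimes> b) c)" (is "?l = ?r")
proof (rule iso_cancel_l[of "\<alpha> x a (b \<otimes> c)"])
  have "\<alpha> x a (b \<otimes> c) \<cdot> \<alpha> (x \<otimes> a) b c \<cdot> (invr (\<alpha> x a b) \<boxtimes> \<one> c) \<cdot> invr (\<alpha> x (a \<otimes> b) c)
    = (\<one> x \<boxtimes> \<alpha> a b c) \<cdot> \<alpha> x (a \<otimes> b) c \<cdot> (\<alpha> x a b \<boxtimes> \<one> c) \<cdot> (invr (\<alpha> x a b) \<boxtimes> \<one> c) \<cdot> invr (\<alpha> x (a \<otimes> b) c)"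
    using tail[OF pentagon[of x a b c], of "(invr (\<alpha> x a b) \<boxtimes> \<one> c) \<cdot> invr (\<alpha> x (a \<otimes> b) c)"] by simp
  also have "\<dots> = \<one> x \<boxtimes> \<alpha> a b c"
    by (simp add: tens_cmp_tail)
  finally show "\<alpha> x a (b \<otimes> c) \<cdot> ?l = \<alpha> x a (b \<otimes> c) \<cdot> ?r" by simp
qed simp_all

lemma swap_nat:
  assumes [simp]: "x \<in> Obj V" "f \<in> Arr V" "g \<in> Arr V"
  shows "swap x (Cod V f) (Cod V g) \<cdot> (\<one> x \<boxtimes> (f \<boxtimes> g)) = (f \<boxtimes> (\<one> x \<boxtimes> g)) \<cdot> swap x (Dom V f) (Dom V g)"
proof -
  have "swap x (Cod V f) (Cod V g) \<cdot> (\<one> x \<boxtimes> (f \<boxtimes> g))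
    = \<alpha> (Cod V f) x (Cod V g) \<cdot> (\<sigma> x (Cod V f) \<boxtimes> \<one> (Cod V g)) \<cdot> ((\<one> x \<boxtimes> f) \<boxtimes> g) \<cdot> invr (\<alpha> x (Dom V f) (Dom V g))"
    using assoc_inv_nat[of "\<one> x" f g] by (simp add: swap_def)
  also have "\<dots> = \<alpha> (Cod V f) x (Cod V g) \<cdot> ((f \<boxtimes> \<one> x) \<boxtimes> g) \<cdot> (\<sigma> x (Dom V f) \<boxtimes> \<one> (Dom V g))
      \<cdot> invr (\<alpha> x (Dom V f) (Dom V g))"
    using symm_nat'[of "\<one> x" f] by (simp add: tens_cmp_tail)
  also have "\<dots> = (f \<boxtimes> (\<one> x \<boxtimes> g)) \<cdot> swap x (Dom V f) (Dom V g)"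
    using tail[OF assoc_nat'[of f "\<one> x" g], of "(\<sigma> x (Dom V f) \<boxtimes> \<one> (Dom V g)) \<cdot> invr (\<alpha> x (Dom V f) (Dom V g))"]
    by (simp add: swap_def)
  finally show ?thesis .
qed

text \<open>Two pentagons, one with \<open>x\<close> before and one with \<open>x\<close> behind
  \<open>a\<close>, joined by naturality. It is the case in which a new variable joins the second of
  three factors.\<close>

lemma swap_assoc_mid:
  assumes [simp]: "x \<in> Obj V" "a \<in> Obj V" "b \<in> Obj V" "c \<in> Obj V"
  shows "(\<one> a \<boxtimes> invr (\<alpha> x b c)) \<cdot> swap x a (b \<otimes> c) \<cdot> (\<one> x \<boxtimes> \<alpha> a b c)
    = \<alpha> a (x \<otimes> b) c \<cdot> (swap x a b \<boxtimes> \<one> c) \<cdot> invr (\<alpha> x (a \<otimes> b) c)"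
proof -
  let ?u = "(invr (\<alpha> x a b) \<boxtimes> \<one> c) \<cdot> invr (\<alpha> x (a \<otimes> b) c)"
  let ?v = "((\<sigma> x a \<boxtimes> \<one> b) \<boxtimes> \<one> c) \<cdot> ?u"
  have "swap x a (b \<otimes> c) \<cdot> (\<one> x \<boxtimes> \<alpha> a b c)
    = \<alpha> a x (b \<otimes> c) \<cdot> (\<sigma> x a \<boxtimes> \<one> (b \<otimes> c)) \<cdot> \<alpha> (x \<otimes> a) b c \<cdot> ?u"
    by (simp add: swap_def pentagon_inv)
  also have "\<dots> = \<alpha> a x (b \<otimes> c) \<cdot> \<alpha> (a \<otimes> x) b c \<cdot> ?v"
    using tail[OF assoc_nat'[of "\<sigma> x a" "\<one> b" "\<one> c"], of ?u] by simp
  also have "\<dots> = (\<one> a \<boxtimes> \<alpha> x b c) \<cdot> \<alpha> a (x \<otimes> b) c \<cdot> (\<alpha> a x b \<boxtimes> \<one> c) \<cdot> ?v"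
    using tail[OF pentagon[of a x b c], of ?v] by simp
  finally have "(\<one> a \<boxtimes> invr (\<alpha> x b c)) \<cdot> swap x a (b \<otimes> c) \<cdot> (\<one> x \<boxtimes> \<alpha> a b c)
     = (\<one> a \<boxtimes> invr (\<alpha> x b c)) \<cdot> (\<one> a \<boxtimes> \<alpha> x b c) \<cdot> \<alpha> a (x \<otimes> b) c \<cdot> (\<alpha> a x b \<boxtimes> \<one> c) \<cdot> ?v" by simp
  also have "\<dots> = \<alpha> a (x \<otimes> b) c \<cdot> (\<alpha> a x b \<boxtimes> \<one> c) \<cdot> ?v"
    by (simp add: tens_cmp_tail)
  also have "(\<alpha> a x b \<boxtimes> \<one> c) \<cdot> ?v = (swap x a b \<boxtimes> \<one> c) \<cdot> invr (\<alpha> x (a \<otimes> b) c)"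
    by (simp add: tens_cmp_tail swap_def)
  finally show ?thesis .
qed

text \<open>The hexagon splits the passage of \<open>x\<close> across \<open>a \<otimes> b\<close>
  into passages across \<open>a\<close> and across \<open>b\<close>. It is the case in which a new
  variable joins the last of three factors.\<close>

lemma swap_assoc_right:
  assumes [simp]: "x \<in> Obj V" "a \<in> Obj V" "b \<in> Obj V" "c \<in> Obj V"
  shows "(\<one> a \<boxtimes> swap x b c) \<cdot> swap x a (b \<otimes> c) \<cdot> (\<one> x \<boxtimes> \<alpha> a b c)
    = \<alpha> a b (x \<otimes> c) \<cdot> swap x (a \<otimes> b) c"
proof -
  let ?i = "invr (\<alpha> x (a \<otimes> b) c)"
  have hex: "\<alpha> a b x \<cdot> \<sigma> x (a \<otimes> b) = (\<one> a \<boxtimes> \<sigma> x b) \<cdot> \<alpha> a x b \<cdot> (\<sigma> x a \<boxtimes> \<one> b) \<cdot> invr (\<alpha> x a b)"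
    by (rule iso_cancel_r[of "\<alpha> x a b"]) (use hexagon[of x a b] in simp_all)
  have "\<alpha> a b (x \<otimes> c) \<cdot> swap x (a \<otimes> b) c
    = (\<one> a \<boxtimes> \<alpha> b x c) \<cdot> \<alpha> a (b \<otimes> x) c \<cdot> (\<alpha> a b x \<boxtimes> \<one> c) \<cdot> (\<sigma> x (a \<otimes> b) \<boxtimes> \<one> c) \<cdot> ?i"
    using tail[OF pentagon[of a b x c], of "(\<sigma> x (a \<otimes> b) \<boxtimes> \<one> c) \<cdot> ?i"] by (simp add: swap_def)
  also have "\<dots> = (\<one> a \<boxtimes> \<alpha> b x c) \<cdot> \<alpha> a (b \<otimes> x) c \<cdot> ((\<one> a \<boxtimes> \<sigma> x b) \<boxtimes> \<one> c) \<cdot> (swap x a b \<boxtimes> \<one> c) \<cdot> ?i"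
    by (simp add: tens_cmp_tail hex swap_def)
  also have "\<dots> = (\<one> a \<boxtimes> \<alpha> b x c) \<cdot> (\<one> a \<boxtimes> (\<sigma> x b \<boxtimes> \<one> c)) \<cdot> \<alpha> a (x \<otimes> b) c \<cdot> (swap x a b \<boxtimes> \<one> c) \<cdot> ?i"
    using tail[OF assoc_nat'[of "\<one> a" "\<sigma> x b" "\<one> c"], of "(swap x a b \<boxtimes> \<one> c) \<cdot> ?i"] by simp
  also have "\<dots> = (\<one> a \<boxtimes> \<alpha> b x c) \<cdot> (\<one> a \<boxtimes> (\<sigma> x b \<boxtimes> \<one> c)) \<cdot> (\<one> a \<boxtimes> invr (\<alpha> x b c)) \<cdot> swap x a (b \<otimes> c)
      \<cdot> (\<one> x \<boxtimes> \<alpha> a b c)"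
    by (simp add: swap_assoc_mid)
  also have "\<dots> = (\<one> a \<boxtimes> swap x b c) \<cdot> swap x a (b \<otimes> c) \<cdot> (\<one> x \<boxtimes> \<alpha> a b c)"
    by (simp add: tens_cmp_tail swap_def)
  finally show ?thesis by simp
qed

text \<open>The hexagon with both sides inverted; this is the induction step of
  \<open>spl_symm\<close>.\<close>

lemma symm_assoc_left:
  assumes [simp]: "a \<in> Obj V" "b \<in> Obj V" "x \<in> Obj V"
  shows "\<sigma> (x \<otimes> a) b \<cdot> invr (\<alpha> x a b) = swap x b a \<cdot> (\<one> x \<boxtimes> \<sigma> a b)"
proof -
  have "invr (\<alpha> x a b \<cdot> \<sigma> b (x \<otimes> a) \<cdot> \<alpha> b x a)
      = invr ((\<one> x \<boxtimes> \<sigma> b a) \<cdot> \<alpha> x b a \<cdot> (\<sigma> b x \<boxtimes> \<one> a))"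
    by (simp add: hexagon)
  then have "invr (\<alpha> b x a) \<cdot> \<sigma> (x \<otimes> a) b \<cdot> invr (\<alpha> x a b)
      = (\<sigma> x b \<boxtimes> \<one> a) \<cdot> invr (\<alpha> x b a) \<cdot> (\<one> x \<boxtimes> \<sigma> a b)"
    by (simp add: invr_Cmp invr_tens)
  then have "\<alpha> b x a \<cdot> invr (\<alpha> b x a) \<cdot> \<sigma> (x \<otimes> a) b \<cdot> invr (\<alpha> x a b)
      = \<alpha> b x a \<cdot> (\<sigma> x b \<boxtimes> \<one> a) \<cdot> invr (\<alpha> x b a) \<cdot> (\<one> x \<boxtimes> \<sigma> a b)" by simp
  then show ?thesis by (simp add: swap_def)
qed

text \<open>
  Coherence is dealt with by elements. A list \<open>\<Gamma>\<close> declares typed variables, and an element of \<open>a\<close> over a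
  set \<open>S\<close> of variables is an arrow to \<open>a\<close> from the tensor product \<open>tob S \<Gamma>\<close> of their types, in the order
  of \<open>\<Gamma>\<close>; \<open>spl S T \<Gamma>\<close> is the permutation that moves the variables of \<open>S\<close> to the left of those of \<open>T\<close>.
  On elements the associativity, unit and symmetry isomorphisms act by mere rebracketing and
  permutation, so that simplification proves equations between arrows.
\<close>

primrec tob :: "nat set \<Rightarrow> (nat \<times> 'v) list \<Rightarrow> 'v" where
  "tob S [] = \<I>"
| "tob S (p # \<Gamma>) = (if fst p \<in> S then snd p \<otimes> tob S \<Gamma> else tob S \<Gamma>)"

primrec spl :: "nat set \<Rightarrow> nat set \<Rightarrow> (nat \<times> 'v) list \<Rightarrow> 'm" where
  "spl S T [] = invr (\<lambda>\<lambda> \<I>)"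
| "spl S T (p # \<Gamma>) =
     (if fst p \<in> S then invr (\<alpha> (snd p) (tob S \<Gamma>) (tob T \<Gamma>)) \<cdot> (\<one> (snd p) \<boxtimes> spl S T \<Gamma>)
      else if fst p \<in> T then swap (snd p) (tob S \<Gamma>) (tob T \<Gamma>) \<cdot> (\<one> (snd p) \<boxtimes> spl S T \<Gamma>)
      else spl S T \<Gamma>)"

definition env :: "(nat \<times> 'v) list \<Rightarrow> bool" where
  "env \<Gamma> \<longleftrightarrow> snd ` set \<Gamma> \<subseteq> Obj V"

lemma env_simps [simp]: "env []" "env (p # \<Gamma>) \<longleftrightarrow> snd p \<in> Obj V \<and> env \<Gamma>"
  by (auto simp: env_def)

lemma tob_Obj [simp]: "env \<Gamma> \<Longrightarrow> tob S \<Gamma> \<in> Obj V"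
  by (induction \<Gamma>) auto

lemma tob_empty [simp]: "tob {} \<Gamma> = \<I>"
  by (induction \<Gamma>) auto

lemma spl_simps [simp]:
  assumes "env \<Gamma>" "S \<inter> T = {}"
  shows "spl S T \<Gamma> \<in> Arr V" "Dom V (spl S T \<Gamma>) = tob (S \<union> T) \<Gamma>" "Cod V (spl S T \<Gamma>) = tob S \<Gamma> \<otimes> tob T \<Gamma>"
    "iso (spl S T \<Gamma>)"
  using assms by (induction \<Gamma>) (auto simp: disjoint_iff)

text \<open>Induction on the list, by the side to which the first variable goes. Through this lemma
  the symmetry will act on elements as a mere exchange of factors.\<close>

lemma spl_symm:
  assumes "env \<Gamma>" and disj: "S \<inter> T = {}"
  shows "\<sigma> (tob S \<Gamma>) (tob T \<Gamma>) \<cdot> spl S T \<Gamma> = spl T S \<Gamma>"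
  using assms(1)
proof (induction \<Gamma>)
  case Nil
  show ?case by (simp add: symm_unit)
next
  case (Cons p \<Gamma>)
  have disj': "T \<inter> S = {}" using disj by blast
  obtain i x where p [simp]: "p = (i, x)" by (cases p)
  from Cons have [simp]: "x \<in> Obj V" "env \<Gamma>" and IH: "\<sigma> (tob S \<Gamma>) (tob T \<Gamma>) \<cdot> spl S T \<Gamma> = spl T S \<Gamma>" by auto
  consider "i \<in> S" "i \<notin> T" | "i \<notin> S" "i \<in> T" | "i \<notin> S" "i \<notin> T" using disj by blast
  then show ?case
  proof cases
    case 1
    have "\<sigma> (x \<otimes> tob S \<Gamma>) (tob T \<Gamma>) \<cdot> invr (\<alpha> x (tob S \<Gamma>) (tob T \<Gamma>)) \<cdot> (\<one> x \<boxtimes> spl S T \<Gamma>)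
      = swap x (tob T \<Gamma>) (tob S \<Gamma>) \<cdot> (\<one> x \<boxtimes> \<sigma> (tob S \<Gamma>) (tob T \<Gamma>)) \<cdot> (\<one> x \<boxtimes> spl S T \<Gamma>)"
      using tail[OF symm_assoc_left, of "tob S \<Gamma>" "tob T \<Gamma>" x "\<one> x \<boxtimes> spl S T \<Gamma>"] disj by simp
    then show ?thesis using 1 disj disj' by (simp add: tens_cmp IH)
  next
    case 2
    \<comment> \<open>The induction hypothesis concerns \<open>S\<close> and \<open>T\<close> in
      this order only. Inserting a symmetry and its inverse reduces the case to the previous one
      with the two sets exchanged.\<close>
    have "swap x (tob S \<Gamma>) (tob T \<Gamma>) \<cdot> (\<one> x \<boxtimes> spl S T \<Gamma>)
      = swap x (tob S \<Gamma>) (tob T \<Gamma>) \<cdot> (\<one> x \<boxtimes> \<sigma> (tob T \<Gamma>) (tob S \<Gamma>)) \<cdot> (\<one> x \<boxtimes> \<sigma> (tob S \<Gamma>) (tob T \<Gamma>))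
          \<cdot> (\<one> x \<boxtimes> spl S T \<Gamma>)"
      using disj by (simp add: tens_cmp_tail)
    also have "\<dots> = \<sigma> (x \<otimes> tob T \<Gamma>) (tob S \<Gamma>) \<cdot> invr (\<alpha> x (tob T \<Gamma>) (tob S \<Gamma>)) \<cdot> (\<one> x \<boxtimes> spl T S \<Gamma>)"
      using tail[OF symm_assoc_left, of "tob T \<Gamma>" "tob S \<Gamma>" x "\<one> x \<boxtimes> spl T S \<Gamma>"] disj disj'
      by (simp add: tens_cmp IH)
    finally have *: "swap x (tob S \<Gamma>) (tob T \<Gamma>) \<cdot> (\<one> x \<boxtimes> spl S T \<Gamma>) = \<dots>" .
    show ?thesis using 2 disj disj'
      invr_tail(1)[of "\<sigma> (x \<otimes> tob T \<Gamma>) (tob S \<Gamma>)" "invr (\<alpha> x (tob T \<Gamma>) (tob S \<Gamma>)) \<cdot> (\<one> x \<boxtimes> spl T S \<Gamma>)"]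
      by (simp add: *)
  next
    case 3
    then show ?thesis by (simp add: IH)
  qed
qed

text \<open>With nothing on the left, each variable is carried past \<open>\<I>\<close>;
  \<open>lunit_tens\<close>, \<open>lunit_symm\<close> and the triangle show that this has no
  effect.\<close>

lemma spl_lunit: "env \<Gamma> \<Longrightarrow> \<lambda>\<lambda> (tob T \<Gamma>) \<cdot> spl {} T \<Gamma> = \<one> (tob T \<Gamma>)"
proof (induction \<Gamma>)
  case Nil
  show ?case by simp
next
  case (Cons p \<Gamma>)
  obtain i x where p [simp]: "p = (i, x)" by (cases p)
  from Cons have [simp]: "x \<in> Obj V" "env \<Gamma>" and IH: "\<lambda>\<lambda> (tob T \<Gamma>) \<cdot> spl {} T \<Gamma> = \<one> (tob T \<Gamma>)" by auto
  let ?s = "\<one> x \<boxtimes> spl {} T \<Gamma>" and ?B = "tob T \<Gamma>"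
  have "\<lambda>\<lambda> (x \<otimes> ?B) \<cdot> swap x \<I> ?B \<cdot> ?s = (\<lambda>\<lambda> x \<boxtimes> \<one> ?B) \<cdot> (\<sigma> x \<I> \<boxtimes> \<one> ?B) \<cdot> invr (\<alpha> x \<I> ?B) \<cdot> ?s"
    using tail[OF lunit_tens[of x ?B], of "(\<sigma> x \<I> \<boxtimes> \<one> ?B) \<cdot> invr (\<alpha> x \<I> ?B) \<cdot> ?s"] by (simp add: swap_def)
  also have "\<dots> = (\<rho> x \<boxtimes> \<one> ?B) \<cdot> invr (\<alpha> x \<I> ?B) \<cdot> ?s"
    by (simp add: tens_cmp_tail lunit_symm)
  also have "\<dots> = (\<one> x \<boxtimes> \<lambda>\<lambda> ?B) \<cdot> ?s"
    using triangle[of x ?B, symmetric] by simp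
  also have "\<dots> = \<one> (x \<otimes> ?B)" by (simp add: tens_cmp IH)
  finally show ?case using IH by simp
qed

text \<open>Splitting into three parts does not depend on which cut is made first. The cases say
  which part receives the first variable, and use \<open>pentagon_inv\<close>,
  \<open>swap_assoc_mid\<close> and \<open>swap_assoc_right\<close> respectively.\<close>

lemma spl_assoc:
  assumes "env \<Gamma>" and disj: "R \<inter> S = {}" "R \<inter> T = {}" "S \<inter> T = {}"
  shows "(\<one> (tob R \<Gamma>) \<boxtimes> spl S T \<Gamma>) \<cdot> spl R (S \<union> T) \<Gamma>
    = \<alpha> (tob R \<Gamma>) (tob S \<Gamma>) (tob T \<Gamma>) \<cdot> (spl R S \<Gamma> \<boxtimes> \<one> (tob T \<Gamma>)) \<cdot> spl (R \<union> S) T \<Gamma>"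
  using assms(1)
proof (induction \<Gamma>)
  case Nil
  have "\<alpha> \<I> \<I> \<I> \<cdot> (invr (\<lambda>\<lambda> \<I>) \<boxtimes> \<one> \<I>) = \<one> \<I> \<boxtimes> invr (\<lambda>\<lambda> \<I>)"
  proof (rule iso_cancel_l[of "\<one> \<I> \<boxtimes> \<lambda>\<lambda> \<I>"])
    show "(\<one> \<I> \<boxtimes> \<lambda>\<lambda> \<I>) \<cdot> \<alpha> \<I> \<I> \<I> \<cdot> (invr (\<lambda>\<lambda> \<I>) \<boxtimes> \<one> \<I>) = (\<one> \<I> \<boxtimes> \<lambda>\<lambda> \<I>) \<cdot> (\<one> \<I> \<boxtimes> invr (\<lambda>\<lambda> \<I>))"
      using tail[OF triangle[of \<I> \<I>], of "invr (\<lambda>\<lambda> \<I>) \<boxtimes> \<one> \<I>"] by (simp add: tens_cmp lunit_unit)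
  qed simp_all
  from tail[OF this, of "invr (\<lambda>\<lambda> \<I>)"] show ?case by simp
next
  case (Cons p \<Gamma>)
  obtain i x where p [simp]: "p = (i, x)" by (cases p)
  define A B C E F where defs: "A = tob R \<Gamma>" "B = tob S \<Gamma>" "C = tob T \<Gamma>" "E = tob (S \<union> T) \<Gamma>" "F = tob (R \<union> S) \<Gamma>"
  define s s' t t' where defs': "s = spl S T \<Gamma>" "s' = spl R (S \<union> T) \<Gamma>" "t = spl R S \<Gamma>" "t' = spl (R \<union> S) T \<Gamma>"
  have disj': "R \<inter> (S \<union> T) = {}" "(R \<union> S) \<inter> T = {}" using disj by blast+
  have un: "R \<union> (S \<union> T) = R \<union> S \<union> T" by blast
  from Cons have [simp]: "x \<in> Obj V" "env \<Gamma>" and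
    IH: "(\<one> A \<boxtimes> s) \<cdot> s' = \<alpha> A B C \<cdot> (t \<boxtimes> \<one> C) \<cdot> t'" by (auto simp: defs defs')
  have [simp]: "A \<in> Obj V" "B \<in> Obj V" "C \<in> Obj V" "E \<in> Obj V" "F \<in> Obj V" by (simp_all add: defs)
  have [simp]: "s \<in> Arr V" "Dom V s = E" "Cod V s = B \<otimes> C" "s' \<in> Arr V" "Dom V s' = tob (R \<union> S \<union> T) \<Gamma>" "Cod V s'
      = A \<otimes> E"
    "t \<in> Arr V" "Dom V t = F" "Cod V t = A \<otimes> B" "t' \<in> Arr V" "Dom V t' = tob (R \<union> S \<union> T) \<Gamma>" "Cod V t' = F \<otimes> C"
    using disj disj' un by (simp_all add: defs defs')
  let ?u = "\<one> x \<boxtimes> ((t \<boxtimes> \<one> C) \<cdot> t')"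
  consider "i \<in> R" "i \<notin> S" "i \<notin> T" | "i \<notin> R" "i \<in> S" "i \<notin> T" | "i \<notin> R" "i \<notin> S" "i \<in> T" | "i \<notin> R" "i \<notin> S" "i \<notin> T"
    using disj by blast
  then show ?case
  proof cases
    case 1
    have "(\<one> (x \<otimes> A) \<boxtimes> s) \<cdot> invr (\<alpha> x A E) \<cdot> (\<one> x \<boxtimes> s') = invr (\<alpha> x A (B \<otimes> C)) \<cdot> (\<one> x \<boxtimes> (\<one> A \<boxtimes> s)) \<cdot> (\<one> x \<boxtimes> s')"
      using tail[OF assoc_inv_nat[of "\<one> x" "\<one> A" s], of "\<one> x \<boxtimes> s'"] by simp
    also have "\<dots> = invr (\<alpha> x A (B \<otimes> C)) \<cdot> (\<one> x \<boxtimes> \<alpha> A B C) \<cdot> ?u"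
      by (simp add: tens_cmp IH)
    also have "\<dots> = \<alpha> (x \<otimes> A) B C \<cdot> (invr (\<alpha> x A B) \<boxtimes> \<one> C) \<cdot> invr (\<alpha> x (A \<otimes> B) C) \<cdot> ?u"
      using tail[OF pentagon_inv[of x A B C], of ?u] by simp
    also have "invr (\<alpha> x (A \<otimes> B) C) \<cdot> ?u = ((\<one> x \<boxtimes> t) \<boxtimes> \<one> C) \<cdot> invr (\<alpha> x F C) \<cdot> (\<one> x \<boxtimes> t')"
      using tail[OF assoc_inv_nat[of "\<one> x" t "\<one> C"], of "\<one> x \<boxtimes> t'"] by (simp add: tens_cmp)
    finally have *: "(\<one> (x \<otimes> A) \<boxtimes> s) \<cdot> invr (\<alpha> x A E) \<cdot> (\<one> x \<boxtimes> s') =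
      \<alpha> (x \<otimes> A) B C \<cdot> ((invr (\<alpha> x A B) \<cdot> (\<one> x \<boxtimes> t)) \<boxtimes> \<one> C) \<cdot> invr (\<alpha> x F C) \<cdot> (\<one> x \<boxtimes> t')"
      by (simp add: tens_cmp_tail)
    show ?thesis using 1 * by (simp flip: defs defs')
  next
    case 2
    have "(\<one> A \<boxtimes> (invr (\<alpha> x B C) \<cdot> (\<one> x \<boxtimes> s))) \<cdot> swap x A E \<cdot> (\<one> x \<boxtimes> s')
      = (\<one> A \<boxtimes> invr (\<alpha> x B C)) \<cdot> (\<one> A \<boxtimes> (\<one> x \<boxtimes> s)) \<cdot> swap x A E \<cdot> (\<one> x \<boxtimes> s')"
      by (simp add: tens_cmp_tail)
    also have "\<dots> = (\<one> A \<boxtimes> invr (\<alpha> x B C)) \<cdot> swap x A (B \<otimes> C) \<cdot> (\<one> x \<boxtimes> (\<one> A \<boxtimes> s)) \<cdot> (\<one> x \<boxtimes> s')"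
      using tail[OF swap_nat[of x "\<one> A" s], of "\<one> x \<boxtimes> s'"] by simp
    also have "\<dots> = (\<one> A \<boxtimes> invr (\<alpha> x B C)) \<cdot> swap x A (B \<otimes> C) \<cdot> (\<one> x \<boxtimes> \<alpha> A B C) \<cdot> ?u"
      by (simp add: tens_cmp IH)
    also have "\<dots> = \<alpha> A (x \<otimes> B) C \<cdot> (swap x A B \<boxtimes> \<one> C) \<cdot> invr (\<alpha> x (A \<otimes> B) C) \<cdot> ?u"
      using arg_cong[OF swap_assoc_mid[of x A B C], of "\<lambda>f. f \<cdot> ?u"] by simp
    also have "invr (\<alpha> x (A \<otimes> B) C) \<cdot> ?u = ((\<one> x \<boxtimes> t) \<boxtimes> \<one> C) \<cdot> invr (\<alpha> x F C) \<cdot> (\<one> x \<boxtimes> t')"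
      using tail[OF assoc_inv_nat[of "\<one> x" t "\<one> C"], of "\<one> x \<boxtimes> t'"] by (simp add: tens_cmp)
    finally have *: "(\<one> A \<boxtimes> (invr (\<alpha> x B C) \<cdot> (\<one> x \<boxtimes> s))) \<cdot> swap x A E \<cdot> (\<one> x \<boxtimes> s')
      = \<alpha> A (x \<otimes> B) C \<cdot> ((swap x A B \<cdot> (\<one> x \<boxtimes> t)) \<boxtimes> \<one> C) \<cdot> invr (\<alpha> x F C) \<cdot> (\<one> x \<boxtimes> t')"
      by (simp add: tens_cmp_tail)
    show ?thesis using 2 * by (simp flip: defs defs')
  next
    case 3
    have "(\<one> A \<boxtimes> (swap x B C \<cdot> (\<one> x \<boxtimes> s))) \<cdot> swap x A E \<cdot> (\<one> x \<boxtimes> s')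
      = (\<one> A \<boxtimes> swap x B C) \<cdot> (\<one> A \<boxtimes> (\<one> x \<boxtimes> s)) \<cdot> swap x A E \<cdot> (\<one> x \<boxtimes> s')"
      by (simp add: tens_cmp_tail)
    also have "\<dots> = (\<one> A \<boxtimes> swap x B C) \<cdot> swap x A (B \<otimes> C) \<cdot> (\<one> x \<boxtimes> (\<one> A \<boxtimes> s)) \<cdot> (\<one> x \<boxtimes> s')"
      using tail[OF swap_nat[of x "\<one> A" s], of "\<one> x \<boxtimes> s'"] by simp
    also have "\<dots> = (\<one> A \<boxtimes> swap x B C) \<cdot> swap x A (B \<otimes> C) \<cdot> (\<one> x \<boxtimes> \<alpha> A B C) \<cdot> ?u"
      by (simp add: tens_cmp IH)
    also have "\<dots> = \<alpha> A B (x \<otimes> C) \<cdot> swap x (A \<otimes> B) C \<cdot> ?u"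
      using arg_cong[OF swap_assoc_right[of x A B C], of "\<lambda>f. f \<cdot> ?u"] by simp
    also have "swap x (A \<otimes> B) C \<cdot> ?u = (t \<boxtimes> \<one> (x \<otimes> C)) \<cdot> swap x F C \<cdot> (\<one> x \<boxtimes> t')"
      using tail[OF swap_nat[of x t "\<one> C"], of "\<one> x \<boxtimes> t'"] by (simp add: tens_cmp)
    finally have *: "(\<one> A \<boxtimes> (swap x B C \<cdot> (\<one> x \<boxtimes> s))) \<cdot> swap x A E \<cdot> (\<one> x \<boxtimes> s')
      = \<alpha> A B (x \<otimes> C) \<cdot> (t \<boxtimes> \<one> (x \<otimes> C)) \<cdot> swap x F C \<cdot> (\<one> x \<boxtimes> t')" .
    show ?thesis using 3 * by (simp flip: defs defs')
  next
    case 4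
    then show ?thesis using IH by (simp flip: defs defs')
  qed
qed

end

section \<open>Elements over a list of typed variables\<close>

type_synonym 'm elt = "nat set \<times> 'm"

locale environment = symmetric_monoidal_closed V
  for V :: "('v, 'm) smcc" (structure) +
  fixes \<Gamma> :: "(nat \<times> 'v) list"
  assumes env: "env \<Gamma>"
begin

declare env [simp]

definition el :: "'m elt \<Rightarrow> bool" where
  "el e \<longleftrightarrow> snd e \<in> Arr V \<and> Dom V (snd e) = tob (fst e) \<Gamma>"

definition ty :: "'m elt \<Rightarrow> 'v" where
  "ty e = Cod V (snd e)"

definition ctx :: "'m elt \<Rightarrow> nat set" where
  "ctx e = fst e"

definition emap :: "'m \<Rightarrow> 'm elt \<Rightarrow> 'm elt"  (infixr \<open>\<bullet>\<close> 80) where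
  "f \<bullet> e = (ctx e, f \<cdot> snd e)"

text \<open>The domain depends on the union of the two contexts and on \<open>\<Gamma>\<close>,
  hence not on the order of the factors. Thus \<open>s \<diamondop> t\<close> and
  \<open>t \<diamondop> s\<close> are arrows from the same object and can be compared after a
  symmetry. Disjointness of the contexts gives \<open>spl\<close> its type.\<close>

definition pr :: "'m elt \<Rightarrow> 'm elt \<Rightarrow> 'm elt"  (infixr \<open>\<diamondop>\<close> 85) where
  "s \<diamondop> t = (ctx s \<union> ctx t, (snd s \<boxtimes> snd t) \<cdot> spl (ctx s) (ctx t) \<Gamma>)"

definition star :: "'m elt"  (\<open>\<star>\<close>) where
  "\<star> = ({}, \<one> \<I>)"

lemma ctx_simps [simp]: "ctx (f \<bullet> e) = ctx e" "ctx (s \<diamondop> t) = ctx s \<union> ctx t" "ctx \<star> = {}"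
  by (simp_all add: ctx_def emap_def pr_def star_def)

lemma disj_simps [simp]:
  "(ctx s \<union> B) \<inter> A = {} \<longleftrightarrow> ctx s \<inter> A = {} \<and> B \<inter> A = {}"
  "A \<inter> (ctx s \<union> B) = {} \<longleftrightarrow> A \<inter> ctx s = {} \<and> A \<inter> B = {}"
  by auto

lemma ty_Obj [simp]: "el e \<Longrightarrow> ty e \<in> Obj V"
  by (simp add: el_def ty_def)

lemma emap_simps [simp]:
  assumes "el e" "f \<in> Arr V" "Dom V f = ty e"
  shows "el (f \<bullet> e)" "ty (f \<bullet> e) = Cod V f"
  using assms by (simp_all add: el_def ty_def ctx_def emap_def)

lemma pr_simps [simp]:
  assumes "el s" "el t" "ctx s \<inter> ctx t = {}"
  shows "el (s \<diamondop> t)" "ty (s \<diamondop> t) = ty s \<otimes> ty t"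
  using assms by (simp_all add: el_def ty_def ctx_def pr_def)

lemma star_simps [simp]: "el \<star>" "ty \<star> = \<I>"
  by (simp_all add: el_def ty_def ctx_def star_def)

lemma emap_Cmp [simp]:
  assumes "el e" "f \<in> Arr V" "Dom V f = ty e" "g \<in> Arr V" "Dom V g = Cod V f"
  shows "(g \<cdot> f) \<bullet> e = g \<bullet> f \<bullet> e"
  using assms by (simp add: el_def ty_def ctx_def emap_def)

lemma emap_Id [simp]: "el e \<Longrightarrow> ty e = a \<Longrightarrow> \<one> a \<bullet> e = e"
  by (cases e) (auto simp: el_def ty_def ctx_def emap_def)

lemma emap_tens [simp]:
  assumes "el s" "el t" "ctx s \<inter> ctx t = {}" "f \<in> Arr V" "Dom V f = ty s" "g \<in> Arr V" "Dom V g = ty t"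
  shows "(f \<boxtimes> g) \<bullet> (s \<diamondop> t) = (f \<bullet> s) \<diamondop> (g \<bullet> t)"
  using assms by (simp add: el_def ty_def ctx_def emap_def pr_def tens_cmp_tail)

text \<open>Naturality moves the associator from the two products to the splittings, where
  \<open>spl_assoc\<close> absorbs it.\<close>

lemma emap_assoc [simp]:
  assumes "el r" "el s" "el t" "ctx r \<inter> ctx s = {}" "ctx r \<inter> ctx t = {}" "ctx s \<inter> ctx t = {}"
    and "ty r = a" "ty s = b" "ty t = c"
  shows "\<alpha> a b c \<bullet> ((r \<diamondop> s) \<diamondop> t) = r \<diamondop> s \<diamondop> t"
proof -
  obtain R S T f g h where e: "r = (R, f)" "s = (S, g)" "t = (T, h)" by (metis surj_pair)
  have [simp]: "f \<in> Arr V" "g \<in> Arr V" "h \<in> Arr V" "Dom V f = tob R \<Gamma>" "Dom V g = tob S \<Gamma>" "Dom V h = tob T \<Gamma>"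
    "Cod V f = a" "Cod V g = b" "Cod V h = c" and
    disj: "R \<inter> S = {}" "R \<inter> T = {}" "S \<inter> T = {}" "(R \<union> S) \<inter> T = {}" "R \<inter> (S \<union> T) = {}"
    using assms by (auto simp: e el_def ty_def ctx_def)
  have [simp]: "a \<in> Obj V" "b \<in> Obj V" "c \<in> Obj V"
    using assms ty_Obj by blast+
  have un: "R \<union> (S \<union> T) = R \<union> S \<union> T" by blast
  have "\<alpha> a b c \<cdot> (((f \<boxtimes> g) \<cdot> spl R S \<Gamma>) \<boxtimes> h) \<cdot> spl (R \<union> S) T \<Gamma>
    = \<alpha> a b c \<cdot> ((f \<boxtimes> g) \<boxtimes> h) \<cdot> (spl R S \<Gamma> \<boxtimes> \<one> (tob T \<Gamma>)) \<cdot> spl (R \<union> S) T \<Gamma>"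
    using disj by (simp add: tens_cmp_tail)
  also have "\<dots> = (f \<boxtimes> g \<boxtimes> h) \<cdot> \<alpha> (tob R \<Gamma>) (tob S \<Gamma>) (tob T \<Gamma>) \<cdot> (spl R S \<Gamma> \<boxtimes> \<one> (tob T \<Gamma>)) \<cdot> spl (R \<union> S) T \<Gamma>"
    using tail[OF assoc_nat'[of f g h], of "(spl R S \<Gamma> \<boxtimes> \<one> (tob T \<Gamma>)) \<cdot> spl (R \<union> S) T \<Gamma>"] disj by simp
  also have "\<dots> = (f \<boxtimes> g \<boxtimes> h) \<cdot> (\<one> (tob R \<Gamma>) \<boxtimes> spl S T \<Gamma>) \<cdot> spl R (S \<union> T) \<Gamma>"
    using spl_assoc[OF env disj(1-3)] by simp
  also have "\<dots> = (f \<boxtimes> ((g \<boxtimes> h) \<cdot> spl S T \<Gamma>)) \<cdot> spl R (S \<union> T) \<Gamma>"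
    using disj un by (simp add: tens_cmp_tail)
  finally show ?thesis using un by (simp add: e emap_def pr_def ctx_def)
qed

lemma emap_symm [simp]:
  assumes "el s" "el t" "ctx s \<inter> ctx t = {}" "ty s = a" "ty t = b"
  shows "\<sigma> a b \<bullet> (s \<diamondop> t) = t \<diamondop> s"
proof -
  obtain S T f g where e: "s = (S, f)" "t = (T, g)" by (metis surj_pair)
  have [simp]: "f \<in> Arr V" "g \<in> Arr V" "Dom V f = tob S \<Gamma>" "Dom V g = tob T \<Gamma>"
    "Cod V f = a" "Cod V g = b" and disj: "S \<inter> T = {}"
    using assms by (auto simp: e el_def ty_def ctx_def)
  have [simp]: "a \<in> Obj V" "b \<in> Obj V"
    using assms ty_Obj by blast+
  have "\<sigma> a b \<cdot> (f \<boxtimes> g) \<cdot> spl S T \<Gamma> = (g \<boxtimes> f) \<cdot> \<sigma> (tob S \<Gamma>) (tob T \<Gamma>) \<cdot> spl S T \<Gamma>"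
    using tail[OF symm_nat'[of f g], of "spl S T \<Gamma>"] disj by simp
  also have "\<dots> = (g \<boxtimes> f) \<cdot> spl T S \<Gamma>"
    using disj by (simp add: spl_symm)
  finally show ?thesis by (simp add: e emap_def pr_def ctx_def Un_commute)
qed

lemma emap_lunit [simp]:
  assumes "el s" "ty s = a"
  shows "\<lambda>\<lambda> a \<bullet> (\<star> \<diamondop> s) = s"
proof -
  obtain S f where e: "s = (S, f)" by (metis surj_pair)
  have [simp]: "f \<in> Arr V" "Dom V f = tob S \<Gamma>" "Cod V f = a"
    using assms by (auto simp: e el_def ty_def ctx_def)
  have [simp]: "a \<in> Obj V"
    using assms ty_Obj by blast+
  have "\<lambda>\<lambda> a \<cdot> (\<one> \<I> \<boxtimes> f) \<cdot> spl {} S \<Gamma> = f \<cdot> \<lambda>\<lambda> (tob S \<Gamma>) \<cdot> spl {} S \<Gamma>"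
    using tail[OF lunit_nat'[of f], of "spl {} S \<Gamma>"] by simp
  then show ?thesis by (simp add: spl_lunit e emap_def pr_def ctx_def star_def)
qed

text \<open>By \<open>lunit_symm\<close> the right unitor is a left unitor after a symmetry, and
  both already act as required.\<close>

lemma emap_runit [simp]:
  assumes "el s" "ty s = a"
  shows "\<rho> a \<bullet> (s \<diamondop> \<star>) = s"
proof -
  have [simp]: "a \<in> Obj V"
    using assms ty_Obj by blast+
  show ?thesis using assms by (simp flip: lunit_symm)
qed

lemma emap_inv:
  assumes "f \<bullet> e = e'" "el e" "iso f" "Dom V f = ty e"
  shows "invr f \<bullet> e' = e"
  unfolding assms(1)[symmetric] using assms(2-4) emap_Cmp[of e f "invr f", symmetric] by simp

lemma emap_assoc_inv [simp]:
  assumes "el r" "el s" "el t" "ctx r \<inter> ctx s = {}" "ctx r \<inter> ctx t = {}" "ctx s \<inter> ctx t = {}"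
    and "ty r = a" "ty s = b" "ty t = c"
  shows "invr (\<alpha> a b c) \<bullet> (r \<diamondop> s \<diamondop> t) = (r \<diamondop> s) \<diamondop> t"
  by (rule emap_inv) (use assms in auto)

lemma emap_lunit_inv [simp]: "el s \<Longrightarrow> ty s = a \<Longrightarrow> invr (\<lambda>\<lambda> a) \<bullet> s = \<star> \<diamondop> s"
  by (rule emap_inv) auto

lemma emap_runit_inv [simp]: "el s \<Longrightarrow> ty s = a \<Longrightarrow> invr (\<rho> a) \<bullet> s = s \<diamondop> \<star>"
  by (rule emap_inv) auto

text \<open>Generic elements are invertible arrows, so equality of two arrows may be tested on one
  of them. Variables are generic, and products of generic elements with disjoint contexts are
  generic.\<close>

definition gen :: "'m elt \<Rightarrow> bool" where
  "gen e \<longleftrightarrow> el e \<and> iso (snd e)"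

lemma gen_el: "gen e \<Longrightarrow> el e"
  by (simp add: gen_def)

lemma gen_star [simp]: "gen \<star>"
  by (simp add: gen_def) (simp add: star_def)

lemma gen_pr [simp]: "gen s \<Longrightarrow> gen t \<Longrightarrow> ctx s \<inter> ctx t = {} \<Longrightarrow> gen (s \<diamondop> t)"
  by (simp add: gen_def) (simp add: pr_def el_def ctx_def)

lemma gen_ext:
  assumes "gen e" "f \<in> Arr V" "g \<in> Arr V" "Dom V f = ty e" "Dom V g = ty e" "f \<bullet> e = g \<bullet> e"
  shows "f = g"
  by (rule iso_cancel_r[of "snd e"]) (use assms in \<open>auto simp: gen_def emap_def ty_def\<close>)

text \<open>The product \<open>tob\<close> ends in \<open>\<I>\<close>, so a single variable of type
  \<open>a\<close> has domain \<open>a \<otimes> \<I>\<close>, and the right unitor is its generic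
  element.\<close>

lemma gen_var: "a \<in> Obj V \<Longrightarrow> tob {i} \<Gamma> = a \<otimes> \<I> \<Longrightarrow> \<exists>e. gen e \<and> ty e = a \<and> ctx e = {i}"
  by (rule exI[of _ "({i}, \<rho> a)"]) (auto simp: gen_def el_def ty_def ctx_def)

end

section \<open>Equality of arrows tested on variables\<close>

context symmetric_monoidal_closed
begin

abbreviation (input) "El \<equiv> environment.el V"
abbreviation (input) "Ty \<equiv> environment.ty V"
abbreviation (input) "Ctx \<equiv> environment.ctx"
abbreviation (input) "App \<equiv> environment.emap V"
abbreviation (input) "Pr \<equiv> environment.pr V"
abbreviation (input) "Star \<equiv> environment.star V"

text \<open>The proof chooses the environment with exactly this variable and its generic element.
  Users of the rule see an arbitrary environment and the three facts \<open>El\<close>,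
  \<open>Ty\<close>, \<open>Ctx\<close>, which is all that the rewrite rules for elements require.
  Concrete singletons as contexts let simplification prove disjointness.\<close>

lemma ext1:
  assumes [simp]: "f \<in> Arr V" "g \<in> Arr V" and d: "Dom V f = a" "Dom V g = a"
    and eq: "\<And>\<Gamma> s. environment V \<Gamma> \<Longrightarrow> El \<Gamma> s \<Longrightarrow> Ty s = a \<Longrightarrow> Ctx s = {0} \<Longrightarrow>
       App f s = App g s"
  shows "f = g"
proof -
  have [simp]: "a \<in> Obj V" using d(1) Dom_Obj'[of f] by simp
  interpret environment V "[(0, a)]" by unfold_locales simp
  obtain s where s: "gen s" "ty s = a" "ctx s = {0}" using gen_var[of a 0] by auto
  note [simp] = s s(1)[THEN gen_el]
  show ?thesis
  proof (rule gen_ext[of s])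
    show "emap f s = emap g s" by (rule eq[OF environment_axioms]) simp_all
  qed (simp_all add: d)
qed

lemma ext2:
  assumes [simp]: "f \<in> Arr V" "g \<in> Arr V" "a \<in> Obj V" "b \<in> Obj V"
    and d: "Dom V f = a \<otimes> b" "Dom V g = a \<otimes> b"
    and eq: "\<And>\<Gamma> s t. environment V \<Gamma> \<Longrightarrow> El \<Gamma> s \<Longrightarrow> El \<Gamma> t \<Longrightarrow>
       Ty s = a \<Longrightarrow> Ty t = b \<Longrightarrow> Ctx s = {0} \<Longrightarrow> Ctx t = {Suc 0} \<Longrightarrow>
       App f (Pr \<Gamma> s t) = App g (Pr \<Gamma> s t)"
  shows "f = g"
proof -
  interpret environment V "[(0, a), (Suc 0, b)]" by unfold_locales simp
  obtain s where s: "gen s" "ty s = a" "ctx s = {0}" using gen_var[of a 0] by auto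
  obtain t where t: "gen t" "ty t = b" "ctx t = {Suc 0}" using gen_var[of b "Suc 0"] by auto
  note [simp] = s t s(1)[THEN gen_el] t(1)[THEN gen_el]
  show ?thesis
  proof (rule gen_ext[of "pr s t"])
    show "emap f (pr s t) = emap g (pr s t)" by (rule eq[OF environment_axioms]) simp_all
  qed (simp_all add: d)
qed

lemma ext3:
  assumes [simp]: "f \<in> Arr V" "g \<in> Arr V" "a \<in> Obj V" "b \<in> Obj V" "c \<in> Obj V"
    and d: "Dom V f = (a \<otimes> b) \<otimes> c" "Dom V g = (a \<otimes> b) \<otimes> c"
    and eq: "\<And>\<Gamma> s t u. environment V \<Gamma> \<Longrightarrow> El \<Gamma> s \<Longrightarrow> El \<Gamma> t \<Longrightarrow> El \<Gamma> u \<Longrightarrow>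
       Ty s = a \<Longrightarrow> Ty t = b \<Longrightarrow> Ty u = c \<Longrightarrow>
       Ctx s = {0} \<Longrightarrow> Ctx t = {Suc 0} \<Longrightarrow> Ctx u = {2} \<Longrightarrow>
       App f (Pr \<Gamma> (Pr \<Gamma> s t) u) =
       App g (Pr \<Gamma> (Pr \<Gamma> s t) u)"
  shows "f = g"
proof -
  interpret environment V "[(0, a), (Suc 0, b), (2, c)]" by unfold_locales simp
  obtain s where s: "gen s" "ty s = a" "ctx s = {0}" using gen_var[of a 0] by auto
  obtain t where t: "gen t" "ty t = b" "ctx t = {Suc 0}" using gen_var[of b "Suc 0"] by auto
  obtain u where u: "gen u" "ty u = c" "ctx u = {2}" using gen_var[of c 2] by auto
  note [simp] = s t u s(1)[THEN gen_el] t(1)[THEN gen_el] u(1)[THEN gen_el]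
  show ?thesis
  proof (rule gen_ext[of "pr (pr s t) u"])
    show "emap f (pr (pr s t) u) = emap g (pr (pr s t) u)" by (rule eq[OF environment_axioms]) simp_all
  qed (simp_all add: d)
qed

lemma ext3':
  assumes [simp]: "f \<in> Arr V" "g \<in> Arr V" "a \<in> Obj V" "b \<in> Obj V" "c \<in> Obj V"
    and d: "Dom V f = a \<otimes> (b \<otimes> c)" "Dom V g = a \<otimes> (b \<otimes> c)"
    and eq: "\<And>\<Gamma> s t u. environment V \<Gamma> \<Longrightarrow> El \<Gamma> s \<Longrightarrow> El \<Gamma> t \<Longrightarrow> El \<Gamma> u \<Longrightarrow>
       Ty s = a \<Longrightarrow> Ty t = b \<Longrightarrow> Ty u = c \<Longrightarrow>
       Ctx s = {0} \<Longrightarrow> Ctx t = {Suc 0} \<Longrightarrow> Ctx u = {2} \<Longrightarrow>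
       App f (Pr \<Gamma> s (Pr \<Gamma> t u)) =
       App g (Pr \<Gamma> s (Pr \<Gamma> t u))"
  shows "f = g"
proof -
  interpret environment V "[(0, a), (Suc 0, b), (2, c)]" by unfold_locales simp
  obtain s where s: "gen s" "ty s = a" "ctx s = {0}" using gen_var[of a 0] by auto
  obtain t where t: "gen t" "ty t = b" "ctx t = {Suc 0}" using gen_var[of b "Suc 0"] by auto
  obtain u where u: "gen u" "ty u = c" "ctx u = {2}" using gen_var[of c 2] by auto
  note [simp] = s t u s(1)[THEN gen_el] t(1)[THEN gen_el] u(1)[THEN gen_el]
  show ?thesis
  proof (rule gen_ext[of "pr s (pr t u)"])
    show "emap f (pr s (pr t u)) = emap g (pr s (pr t u))" by (rule eq[OF environment_axioms]) simp_all
  qed (simp_all add: d)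
qed

lemma ext4:
  assumes [simp]: "f \<in> Arr V" "g \<in> Arr V" "a \<in> Obj V" "b \<in> Obj V" "c \<in> Obj V" "h \<in> Obj V"
    and d: "Dom V f = ((a \<otimes> b) \<otimes> c) \<otimes> h" "Dom V g = ((a \<otimes> b) \<otimes> c) \<otimes> h"
    and eq: "\<And>\<Gamma> s t u v. environment V \<Gamma> \<Longrightarrow>
       El \<Gamma> s \<Longrightarrow> El \<Gamma> t \<Longrightarrow> El \<Gamma> u \<Longrightarrow> El \<Gamma> v \<Longrightarrow>
       Ty s = a \<Longrightarrow> Ty t = b \<Longrightarrow> Ty u = c \<Longrightarrow> Ty v = h \<Longrightarrow>
       Ctx s = {0} \<Longrightarrow> Ctx t = {Suc 0} \<Longrightarrow> Ctx u = {2} \<Longrightarrow> Ctx v = {3} \<Longrightarrow>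
       App f (Pr \<Gamma> (Pr \<Gamma> (Pr \<Gamma> s t) u) v) =
       App g (Pr \<Gamma> (Pr \<Gamma> (Pr \<Gamma> s t) u) v)"
  shows "f = g"
proof -
  interpret environment V "[(0, a), (Suc 0, b), (2, c), (3, h)]" by unfold_locales simp
  obtain s where s: "gen s" "ty s = a" "ctx s = {0}" using gen_var[of a 0] by auto
  obtain t where t: "gen t" "ty t = b" "ctx t = {Suc 0}" using gen_var[of b "Suc 0"] by auto
  obtain u where u: "gen u" "ty u = c" "ctx u = {2}" using gen_var[of c 2] by auto
  obtain v where v: "gen v" "ty v = h" "ctx v = {3}" using gen_var[of h 3] by auto
  note [simp] = s t u v s(1)[THEN gen_el] t(1)[THEN gen_el] u(1)[THEN gen_el] v(1)[THEN gen_el]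
  show ?thesis
  proof (rule gen_ext[of "pr (pr (pr s t) u) v"])
    show "emap f (pr (pr (pr s t) u) v) = emap g (pr (pr (pr s t) u) v)" by (rule eq[OF environment_axioms]) simp_all
  qed (simp_all add: d)
qed

end

section \<open>Enriched categories\<close>

lemma self_enriched_simps [simp]:
  "VObj (self_enriched V) = Obj V" "VHom (self_enriched V) = ihom V"
  "VComp (self_enriched V) a b c = curry_arr V (tens_obj V (ihom V b c) (ihom V a b)) a c
     (Cmp V (ev V b c) (Cmp V (tens_arr V (Id V (ihom V b c)) (ev V a b)) (assoc V (ihom V b c) (ihom V a b) a)))"
  "VId (self_enriched V) a = curry_arr V (unit V) a a (lunit V a)"
  by (simp_all add: self_enriched_def)

lemma vop_simps [simp]:
  "VObj (vop V A) = VObj A" "VHom (vop V A) a b = VHom A b a"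
  "VComp (vop V A) a b c = Cmp V (VComp A c b a) (symm V (VHom A c b) (VHom A b a))"
  "VId (vop V A) = VId A"
  by (simp_all add: vop_def)

lemma vop_fun_simps [simp]: "FO (vop_fun F) = FO F" "FA (vop_fun F) x y = FA F y x"
  by (simp_all add: vop_fun_def)

lemma vop_fun_vop_fun [simp]: "vop_fun (vop_fun F) = F"
  by (simp add: vop_fun_def)

lemma mk_vfun_simps [simp]:
  "x \<in> VObj X \<Longrightarrow> FO (mk_vfun X fo fa) x = fo x"
  "x \<in> VObj X \<Longrightarrow> y \<in> VObj X \<Longrightarrow> FA (mk_vfun X fo fa) x y = fa x y"
  by (simp_all add: mk_vfun_def)

lemma vcompose_simps [simp]:
  "x \<in> VObj X \<Longrightarrow> FO (vcompose V X G F) x = FO G (FO F x)"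
  "x \<in> VObj X \<Longrightarrow> y \<in> VObj X \<Longrightarrow> FA (vcompose V X G F) x y = Cmp V (FA G (FO F x) (FO F y)) (FA F x y)"
  by (simp_all add: vcompose_def)

context symmetric_monoidal_closed
begin

abbreviation \<V> :: "('v, 'v, 'm) vcat" where "\<V> \<equiv> self_enriched V"
abbreviation vcat :: "('a, 'v, 'm) vcat \<Rightarrow> bool" where "vcat \<equiv> vcategory V"
abbreviation vfun :: "('a, 'v, 'm) vcat \<Rightarrow> ('b, 'v, 'm) vcat \<Rightarrow> ('a, 'b, 'm) vfun set" where
  "vfun \<equiv> vfunctors V"
abbreviation op :: "('a, 'v, 'm) vcat \<Rightarrow> ('a, 'v, 'm) vcat" where "op \<equiv> vop V"
abbreviation curry :: "'v \<Rightarrow> 'v \<Rightarrow> 'v \<Rightarrow> 'm \<Rightarrow> 'm" where "curry \<equiv> curry_arr V"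

lemma curry_spec:
  assumes [simp]: "f \<in> Arr V" "a \<in> Obj V" "b \<in> Obj V" and d: "Dom V f = a \<otimes> b" "Cod V f = c"
  shows "curry a b c f \<in> Hom V a \<lbrakk>b, c\<rbrakk>" "ev V b c \<cdot> (curry a b c f \<boxtimes> \<one> b) = f"
proof -
  have "c \<in> Obj V" using d(2) Cod_Obj'[of f] by simp
  then have "\<exists>!g. g \<in> Hom V a \<lbrakk>b, c\<rbrakk> \<and> ev V b c \<cdot> (g \<boxtimes> \<one> b) = f"
    by (intro ev_univ) (use d in \<open>auto simp: Hom_iff\<close>)
  from theI'[OF this] show "curry a b c f \<in> Hom V a \<lbrakk>b, c\<rbrakk>" "ev V b c \<cdot> (curry a b c f \<boxtimes> \<one> b) = f"
    unfolding curry_arr_def by auto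
qed

lemma curry_simps [simp]:
  assumes "f \<in> Arr V" "a \<in> Obj V" "b \<in> Obj V" "Dom V f = a \<otimes> b" "Cod V f = c"
  shows "curry a b c f \<in> Arr V" "Dom V (curry a b c f) = a" "Cod V (curry a b c f) = \<lbrakk>b, c\<rbrakk>"
  using curry_spec(1)[OF assms] by (auto simp: Hom_iff)

lemma uncurry_inj:
  assumes [simp]: "f \<in> Arr V" "g \<in> Arr V" "b \<in> Obj V" "c \<in> Obj V"
    and d: "Dom V f = a" "Dom V g = a" "Cod V f = \<lbrakk>b, c\<rbrakk>" "Cod V g = \<lbrakk>b, c\<rbrakk>"
    and eq: "ev V b c \<cdot> (f \<boxtimes> \<one> b) = ev V b c \<cdot> (g \<boxtimes> \<one> b)"
  shows "f = g"
proof -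
  have [simp]: "a \<in> Obj V" using d(1) Dom_Obj'[of f] by simp
  have "ev V b c \<cdot> (g \<boxtimes> \<one> b) \<in> Hom V (a \<otimes> b) c"
    using d by (simp add: Hom_iff)
  then have "\<exists>!h. h \<in> Hom V a \<lbrakk>b, c\<rbrakk> \<and> ev V b c \<cdot> (h \<boxtimes> \<one> b) = ev V b c \<cdot> (g \<boxtimes> \<one> b)"
    by (intro ev_univ) auto
  moreover have "f \<in> Hom V a \<lbrakk>b, c\<rbrakk>" "g \<in> Hom V a \<lbrakk>b, c\<rbrakk>"
    using d by (auto simp: Hom_iff)
  ultimately show ?thesis using eq by blast
qed

text \<open>Extensionality for arrows into an internal hom: by uniqueness of transposes they may be
  compared after evaluation at one more variable. The variants below differ in the shape of the
  domain.\<close>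

lemma ihom_ext1:
  assumes [simp]: "f \<in> Arr V" "g \<in> Arr V" "a \<in> Obj V" "b \<in> Obj V" "c \<in> Obj V"
    and d: "Dom V f = a" "Dom V g = a" "Cod V f = \<lbrakk>b, c\<rbrakk>" "Cod V g = \<lbrakk>b, c\<rbrakk>"
    and eq: "\<And>\<Gamma> s t. environment V \<Gamma> \<Longrightarrow> El \<Gamma> s \<Longrightarrow> El \<Gamma> t \<Longrightarrow>
       Ty s = a \<Longrightarrow> Ty t = b \<Longrightarrow> Ctx s = {0} \<Longrightarrow> Ctx t = {Suc 0} \<Longrightarrow>
       App (ev V b c) (Pr \<Gamma> (App f s) t) =
       App (ev V b c) (Pr \<Gamma> (App g s) t)"
  shows "f = g"
proof (rule uncurry_inj[OF assms(1,2,4,5) d], rule ext2[of _ _ a b])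
  fix \<Gamma> s t assume "environment V \<Gamma>" and p: "El \<Gamma> s" "El \<Gamma> t"
       "Ty s = a" "Ty t = b" "Ctx s = {0}" "Ctx t = {Suc 0}"
  then interpret environment V \<Gamma> by simp
  show "emap (ev V b c \<cdot> (f \<boxtimes> \<one> b)) (pr s t) = emap (ev V b c \<cdot> (g \<boxtimes> \<one> b)) (pr s t)"
    using eq[OF environment_axioms p] p d by simp
qed (use d in simp_all)

lemma ihom_ext2:
  assumes [simp]: "f \<in> Arr V" "g \<in> Arr V" "a \<in> Obj V" "a' \<in> Obj V" "b \<in> Obj V" "c \<in> Obj V"
    and d: "Dom V f = a \<otimes> a'" "Dom V g = a \<otimes> a'" "Cod V f = \<lbrakk>b, c\<rbrakk>" "Cod V g = \<lbrakk>b, c\<rbrakk>"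
    and eq: "\<And>\<Gamma> s s' t. environment V \<Gamma> \<Longrightarrow> El \<Gamma> s \<Longrightarrow> El \<Gamma> s' \<Longrightarrow> El \<Gamma> t \<Longrightarrow>
       Ty s = a \<Longrightarrow> Ty s' = a' \<Longrightarrow> Ty t = b \<Longrightarrow>
       Ctx s = {0} \<Longrightarrow> Ctx s' = {Suc 0} \<Longrightarrow> Ctx t = {2} \<Longrightarrow>
       App (ev V b c) (Pr \<Gamma> (App f (Pr \<Gamma> s s')) t) =
       App (ev V b c) (Pr \<Gamma> (App g (Pr \<Gamma> s s')) t)"
  shows "f = g"
proof (rule uncurry_inj[OF assms(1,2,5,6) d], rule ext3[of _ _ a a' b])
  fix \<Gamma> s s' t assume "environment V \<Gamma>" and p: "El \<Gamma> s" "El \<Gamma> s'" "El \<Gamma> t"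
       "Ty s = a" "Ty s' = a'" "Ty t = b"
       "Ctx s = {0}" "Ctx s' = {Suc 0}" "Ctx t = {2}"
  then interpret environment V \<Gamma> by simp
  show "emap (ev V b c \<cdot> (f \<boxtimes> \<one> b)) (pr (pr s s') t) = emap (ev V b c \<cdot> (g \<boxtimes> \<one> b)) (pr (pr s s') t)"
    using eq[OF environment_axioms p] p d by simp
qed (use d in simp_all)

lemma ihom_ext3:
  assumes [simp]: "f \<in> Arr V" "g \<in> Arr V" "a \<in> Obj V" "a' \<in> Obj V" "a'' \<in> Obj V" "b \<in> Obj V" "c \<in> Obj V"
    and d: "Dom V f = (a \<otimes> a') \<otimes> a''" "Dom V g = (a \<otimes> a') \<otimes> a''" "Cod V f = \<lbrakk>b, c\<rbrakk>" "Cod V g = \<lbrakk>b, c\<rbrakk>"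
    and eq: "\<And>\<Gamma> s s' s'' t. environment V \<Gamma> \<Longrightarrow>
       El \<Gamma> s \<Longrightarrow> El \<Gamma> s' \<Longrightarrow> El \<Gamma> s'' \<Longrightarrow> El \<Gamma> t \<Longrightarrow>
       Ty s = a \<Longrightarrow> Ty s' = a' \<Longrightarrow> Ty s'' = a'' \<Longrightarrow> Ty t = b \<Longrightarrow>
       Ctx s = {0} \<Longrightarrow> Ctx s' = {Suc 0} \<Longrightarrow> Ctx s'' = {2} \<Longrightarrow> Ctx t = {3} \<Longrightarrow>
       App (ev V b c) (Pr \<Gamma> (App f (Pr \<Gamma> (Pr \<Gamma> s s') s'')) t) =
       App (ev V b c) (Pr \<Gamma> (App g (Pr \<Gamma> (Pr \<Gamma> s s') s'')) t)"
  shows "f = g"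
proof (rule uncurry_inj[OF assms(1,2,6,7) d], rule ext4[of _ _ a a' a'' b])
  fix \<Gamma> s s' s'' t assume "environment V \<Gamma>" and p: "El \<Gamma> s" "El \<Gamma> s'" "El \<Gamma> s''" "El \<Gamma> t"
       "Ty s = a" "Ty s' = a'" "Ty s'' = a''" "Ty t = b"
       "Ctx s = {0}" "Ctx s' = {Suc 0}" "Ctx s'' = {2}" "Ctx t = {3}"
  then interpret environment V \<Gamma> by simp
  show "emap (ev V b c \<cdot> (f \<boxtimes> \<one> b)) (pr (pr (pr s s') s'') t) = emap (ev V b c \<cdot> (g \<boxtimes> \<one> b)) (pr (pr (pr s s') s'') t)"
    using eq[OF environment_axioms p] p d by simp
qed (use d in simp_all)

lemma unit_ext:
  assumes [simp]: "f \<in> Arr V" "g \<in> Arr V" and d: "Dom V f = \<I>" "Dom V g = \<I>"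
    and eq: "\<And>\<Gamma>. environment V \<Gamma> \<Longrightarrow> App f (Star) = App g (Star)"
  shows "f = g"
proof -
  interpret environment V "[]" by unfold_locales simp
  show ?thesis by (rule gen_ext[of star]) (use d eq[OF environment_axioms] in simp_all)
qed

text \<open>The transposed arrows start at \<open>\<I> \<otimes> b\<close>. Composing with the
  inverse unitor leaves one variable of type \<open>b\<close>, and the unit factor becomes
  \<open>\<star>\<close>, to which the unit rules apply.\<close>

lemma ihom_ext0:
  assumes [simp]: "f \<in> Arr V" "g \<in> Arr V" "b \<in> Obj V" "c \<in> Obj V"
    and d: "Dom V f = \<I>" "Dom V g = \<I>" "Cod V f = \<lbrakk>b, c\<rbrakk>" "Cod V g = \<lbrakk>b, c\<rbrakk>"
    and eq: "\<And>\<Gamma> t. environment V \<Gamma> \<Longrightarrow> El \<Gamma> t \<Longrightarrow> Ty t = b \<Longrightarrow> Ctx t = {0} \<Longrightarrow>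
       App (ev V b c) (Pr \<Gamma> (App f (Star)) t) =
       App (ev V b c) (Pr \<Gamma> (App g (Star)) t)"
  shows "f = g"
proof (rule uncurry_inj[OF assms(1-4) d])
  have "ev V b c \<cdot> (f \<boxtimes> \<one> b) \<cdot> invr (\<lambda>\<lambda> b) = ev V b c \<cdot> (g \<boxtimes> \<one> b) \<cdot> invr (\<lambda>\<lambda> b)"
  proof (rule ext1[of _ _ b])
    fix \<Gamma> t assume "environment V \<Gamma>" and p: "El \<Gamma> t" "Ty t = b" "Ctx t = {0}"
    then interpret environment V \<Gamma> by simp
    show "emap (ev V b c \<cdot> (f \<boxtimes> \<one> b) \<cdot> invr (\<lambda>\<lambda> b)) t = emap (ev V b c \<cdot> (g \<boxtimes> \<one> b) \<cdot> invr (\<lambda>\<lambda> b)) t"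
      using eq[OF environment_axioms p] p d by simp
  qed (use d in simp_all)
  then have "(ev V b c \<cdot> (f \<boxtimes> \<one> b)) \<cdot> invr (\<lambda>\<lambda> b) = (ev V b c \<cdot> (g \<boxtimes> \<one> b)) \<cdot> invr (\<lambda>\<lambda> b)"
    using d by simp
  then show "ev V b c \<cdot> (f \<boxtimes> \<one> b) = ev V b c \<cdot> (g \<boxtimes> \<one> b)"
    by (rule iso_cancel_r[rotated -1]) (use d in simp_all)
qed

lemma vcat_simps [simp]:
  assumes "vcat A"
  shows "a \<in> VObj A \<Longrightarrow> b \<in> VObj A \<Longrightarrow> VHom A a b \<in> Obj V"
    and "a \<in> VObj A \<Longrightarrow> b \<in> VObj A \<Longrightarrow> c \<in> VObj A \<Longrightarrow> VComp A a b c \<in> Arr V"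
    and "a \<in> VObj A \<Longrightarrow> b \<in> VObj A \<Longrightarrow> c \<in> VObj A \<Longrightarrow> Dom V (VComp A a b c) = VHom A b c \<otimes> VHom A a b"
    and "a \<in> VObj A \<Longrightarrow> b \<in> VObj A \<Longrightarrow> c \<in> VObj A \<Longrightarrow> Cod V (VComp A a b c) = VHom A a c"
    and "a \<in> VObj A \<Longrightarrow> VId A a \<in> Arr V"
    and "a \<in> VObj A \<Longrightarrow> Dom V (VId A a) = \<I>"
    and "a \<in> VObj A \<Longrightarrow> Cod V (VId A a) = VHom A a a"
  using assms by (auto simp: vcategory_def Hom_iff)

lemma vfun_simps [simp]:
  assumes "F \<in> vfun X Y"
  shows "x \<in> VObj X \<Longrightarrow> FO F x \<in> VObj Y"
    and "x \<in> VObj X \<Longrightarrow> y \<in> VObj X \<Longrightarrow> FA F x y \<in> Arr V"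
    and "x \<in> VObj X \<Longrightarrow> y \<in> VObj X \<Longrightarrow> Dom V (FA F x y) = VHom X x y"
    and "x \<in> VObj X \<Longrightarrow> y \<in> VObj X \<Longrightarrow> Cod V (FA F x y) = VHom Y (FO F x) (FO F y)"
    and "x \<in> VObj X \<Longrightarrow> FA F x x \<cdot> VId X x = VId Y (FO F x)"
  using assms by (auto simp: vfunctors_def Hom_iff)

lemma vfun_Cmp:
  assumes "F \<in> vfun X Y" "x \<in> VObj X" "y \<in> VObj X" "z \<in> VObj X"
  shows "FA F x z \<cdot> VComp X x y z = VComp Y (FO F x) (FO F y) (FO F z) \<cdot> (FA F y z \<boxtimes> FA F x y)"
  using assms unfolding vfunctors_def by blast

lemma vfun_undef:
  assumes "F \<in> vfun X Y"
  shows "x \<notin> VObj X \<Longrightarrow> FO F x = undefined" "x \<notin> VObj X \<or> y \<notin> VObj X \<Longrightarrow> FA F x y = undefined"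
proof -
  have *: "FO F \<in> VObj X \<rightarrow>\<^sub>E VObj Y" "\<forall>x y. x \<notin> VObj X \<or> y \<notin> VObj X \<longrightarrow> FA F x y = undefined"
    using assms unfolding vfunctors_def by blast+
  show "x \<notin> VObj X \<Longrightarrow> FO F x = undefined" using *(1) by (rule PiE_arb)
  show "x \<notin> VObj X \<or> y \<notin> VObj X \<Longrightarrow> FA F x y = undefined" using *(2) by blast
qed

lemma vfunI:
  assumes "\<And>x. x \<in> VObj X \<Longrightarrow> FO F x \<in> VObj Y" "\<And>x. x \<notin> VObj X \<Longrightarrow> FO F x = undefined"
    and "\<And>x y. x \<notin> VObj X \<or> y \<notin> VObj X \<Longrightarrow> FA F x y = undefined"
    and "\<And>x y. x \<in> VObj X \<Longrightarrow> y \<in> VObj X \<Longrightarrow> FA F x y \<in> Arr V \<and> Dom V (FA F x y) = VHom X x y \<and> Cod V (FA F x y)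
        = VHom Y (FO F x) (FO F y)"
    and "\<And>x y z. x \<in> VObj X \<Longrightarrow> y \<in> VObj X \<Longrightarrow> z \<in> VObj X \<Longrightarrow>
       FA F x z \<cdot> VComp X x y z = VComp Y (FO F x) (FO F y) (FO F z) \<cdot> (FA F y z \<boxtimes> FA F x y)"
    and "\<And>x. x \<in> VObj X \<Longrightarrow> FA F x x \<cdot> VId X x = VId Y (FO F x)"
  shows "F \<in> vfun X Y"
  unfolding vfunctors_def mem_Collect_eq
  by (intro conjI allI ballI impI PiE_I; (rule assms; assumption)?; (unfold Hom_iff)?; (rule assms; assumption)?)

lemma vfun_eqI:
  assumes "F \<in> vfun X Y" "G \<in> vfun X Y'" "\<And>x. x \<in> VObj X \<Longrightarrow> FO F x = FO G x"
    "\<And>x y. x \<in> VObj X \<Longrightarrow> y \<in> VObj X \<Longrightarrow> FA F x y = FA G x y"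
  shows "F = G"
proof -
  have "FO F x = FO G x" for x
    using assms(3) vfun_undef(1)[OF assms(1)] vfun_undef(1)[OF assms(2)] by (cases "x \<in> VObj X") auto
  moreover have "FA F x y = FA G x y" for x y
    using assms(4) vfun_undef(2)[OF assms(1)] vfun_undef(2)[OF assms(2)]
    by (cases "x \<in> VObj X \<and> y \<in> VObj X") auto
  ultimately show ?thesis by (cases F, cases G) (auto simp: fun_eq_iff)
qed

lemma mk_vfun_vfun:
  assumes "\<And>x. x \<in> VObj X \<Longrightarrow> fo x \<in> VObj Y"
    and "\<And>x y. x \<in> VObj X \<Longrightarrow> y \<in> VObj X \<Longrightarrow> fa x y \<in> Arr V \<and> Dom V (fa x y) = VHom X x y \<and> Cod V (fa x y)
        = VHom Y (fo x) (fo y)"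
    and "\<And>x y z. x \<in> VObj X \<Longrightarrow> y \<in> VObj X \<Longrightarrow> z \<in> VObj X \<Longrightarrow>
       fa x z \<cdot> VComp X x y z = VComp Y (fo x) (fo y) (fo z) \<cdot> (fa y z \<boxtimes> fa x y)"
    and "\<And>x. x \<in> VObj X \<Longrightarrow> fa x x \<cdot> VId X x = VId Y (fo x)"
  shows "mk_vfun X fo fa \<in> vfun X Y"
  by (rule vfunI) (use assms in \<open>simp_all add: assms(3,4)\<close>, auto simp: mk_vfun_def)

end

section \<open>Axioms of enriched categories and functors as rewrite rules\<close>

context environment
begin

text \<open>Oriented so as to bracket composites to the right. With the unit rules, the functor
  rules and \<open>ev_curry\<close>, simplification brings composites in any enriched category to a
  normal form.\<close>

lemma vassoc [simp]:
  assumes "vcat A" "a \<in> VObj A" "b \<in> VObj A" "c \<in> VObj A" "d \<in> VObj A"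
    and el: "el r" "el s" "el t" and ctx: "ctx r \<inter> ctx s = {}" "ctx r \<inter> ctx t = {}" "ctx s \<inter> ctx t = {}"
    and ty: "ty r = VHom A c d" "ty s = VHom A b c" "ty t = VHom A a b"
  shows "VComp A a b d \<bullet> ((VComp A b c d \<bullet> (r \<diamondop> s)) \<diamondop> t) = VComp A a c d \<bullet> (r \<diamondop> (VComp A a b c \<bullet> (s \<diamondop> t)))"
proof -
  have "(VComp A a b d \<cdot> (VComp A b c d \<boxtimes> \<one> (VHom A a b))) \<bullet> ((r \<diamondop> s) \<diamondop> t)
    = (VComp A a c d \<cdot> (\<one> (VHom A c d) \<boxtimes> VComp A a b c) \<cdot> \<alpha> (VHom A c d) (VHom A b c) (VHom A a b)) \<bullet> ((r \<diamondop> s) \<diamondop> t)"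
    using assms(1-5) by (simp add: vcategory_def)
  then show ?thesis using assms by simp
qed

lemma vid_left [simp]:
  assumes "vcat A" "a \<in> VObj A" "b \<in> VObj A" "el t" "ty t = VHom A a b"
  shows "VComp A a b b \<bullet> ((VId A b \<bullet> \<star>) \<diamondop> t) = t"
proof -
  have "(VComp A a b b \<cdot> (VId A b \<boxtimes> \<one> (VHom A a b))) \<bullet> (\<star> \<diamondop> t) = \<lambda>\<lambda> (VHom A a b) \<bullet> (\<star> \<diamondop> t)"
    using assms(1-3) by (simp add: vcategory_def)
  then show ?thesis using assms by simp
qed

lemma vid_right [simp]:
  assumes "vcat A" "a \<in> VObj A" "b \<in> VObj A" "el t" "ty t = VHom A a b"
  shows "VComp A a a b \<bullet> (t \<diamondop> (VId A a \<bullet> \<star>)) = t"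
proof -
  have "(VComp A a a b \<cdot> (\<one> (VHom A a b) \<boxtimes> VId A a)) \<bullet> (t \<diamondop> \<star>) = \<rho> (VHom A a b) \<bullet> (t \<diamondop> \<star>)"
    using assms(1-3) by (simp add: vcategory_def)
  then show ?thesis using assms by simp
qed

lemma vfun_el_Cmp [simp]:
  assumes "F \<in> vfun X Y" "vcat X" "vcat Y" "x \<in> VObj X" "y \<in> VObj X" "z \<in> VObj X"
    and "el s" "el t" "ctx s \<inter> ctx t = {}" "ty s = VHom X y z" "ty t = VHom X x y"
  shows "FA F x z \<bullet> VComp X x y z \<bullet> (s \<diamondop> t) = VComp Y (FO F x) (FO F y) (FO F z) \<bullet> ((FA F y z \<bullet> s) \<diamondop> (FA F x y \<bullet> t))"
  using arg_cong[OF vfun_Cmp[OF assms(1,4-6)], of "\<lambda>f. f \<bullet> (s \<diamondop> t)"] assms by simp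

lemma vfun_el_Id [simp]:
  assumes "F \<in> vfun X Y" "vcat X" "x \<in> VObj X"
  shows "FA F x x \<bullet> VId X x \<bullet> \<star> = VId Y (FO F x) \<bullet> \<star>"
  using arg_cong[OF vfun_simps(5)[OF assms(1,3)], of "\<lambda>f. f \<bullet> \<star>"] assms by (simp del: vfun_simps(5))

text \<open>The beta rule of the internal hom.\<close>

lemma ev_curry [simp]:
  assumes "f \<in> Arr V" "Dom V f = a \<otimes> b" "Cod V f = c" "el s" "el t" "ctx s \<inter> ctx t = {}" "ty s = a" "ty t = b"
  shows "ev V b c \<bullet> ((curry a b c f \<bullet> s) \<diamondop> t) = f \<bullet> (s \<diamondop> t)"
proof -
  have [simp]: "a \<in> Obj V" "b \<in> Obj V" using assms ty_Obj by blast+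
  have [simp]: "c \<in> Obj V" using Cod_Obj'[OF assms(1)] assms(3) by simp
  have "(ev V b c \<cdot> (curry a b c f \<boxtimes> \<one> b)) \<bullet> (s \<diamondop> t) = f \<bullet> (s \<diamondop> t)"
    using curry_spec(2)[of f a b c] assms by simp
  then show ?thesis using assms by simp
qed

end

section \<open>Self-enrichment, opposites, composites and representables\<close>

context symmetric_monoidal_closed
begin

lemma vcat_self [simp]: "vcat \<V>"
  unfolding vcategory_def
proof (intro conjI ballI)
  fix a b c d assume [simp]: "a \<in> VObj \<V>" "b \<in> VObj \<V>" "c \<in> VObj \<V>" "d \<in> VObj \<V>"
  have [simp]: "a \<in> Obj V" "b \<in> Obj V" "c \<in> Obj V" "d \<in> Obj V" 
    using \<open>a \<in> VObj \<V>\<close> \<open>b \<in> VObj \<V>\<close> \<open>c \<in> VObj \<V>\<close> \<open>d \<in> VObj \<V>\<close> by simp_all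
  show "VHom \<V> a b \<in> Obj V" "VComp \<V> a b c \<in> Hom V (VHom \<V> b c \<otimes> VHom \<V> a b) (VHom \<V> a c)"
    "VId \<V> a \<in> Hom V \<I> (VHom \<V> a a)"
    by (simp_all add: Hom_iff)
  show "VComp \<V> a b d \<cdot> (VComp \<V> b c d \<boxtimes> \<one> (VHom \<V> a b))
          = VComp \<V> a c d \<cdot> (\<one> (VHom \<V> c d) \<boxtimes> VComp \<V> a b c) \<cdot> \<alpha> (VHom \<V> c d) (VHom \<V> b c) (VHom \<V> a b)"
  proof (rule ihom_ext3[of _ _ "\<lbrakk>c, d\<rbrakk>" "\<lbrakk>b, c\<rbrakk>" "\<lbrakk>a, b\<rbrakk>" a d], goal_cases)
    case p: (12 \<Gamma> r s t u)
    interpret environment V \<Gamma> by (rule p)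
    from p(2-) show ?case by simp
  qed simp_all
  show "VComp \<V> a b b \<cdot> (VId \<V> b \<boxtimes> \<one> (VHom \<V> a b)) = \<lambda>\<lambda> (VHom \<V> a b)"
  proof (rule ihom_ext2[of _ _ "\<I>" "\<lbrakk>a, b\<rbrakk>" a b], goal_cases)
    case p: (11 \<Gamma> r s t)
    interpret environment V \<Gamma> by (rule p)
    \<comment> \<open>Here the unit factor is a generic element of \<open>\<I>\<close> and not
      \<open>\<star>\<close>, so the unit rules do not apply. \<open>lunit_tens\<close> moves the
      unitor from the value to the function.\<close>
    have [simp]: "emap (\<lambda>\<lambda> b) (pr r (emap (ev V a b) (pr s t))) = emap (ev V a b) (pr (emap (\<lambda>\<lambda> \<lbrakk>a, b\<rbrakk>) (pr r s)) t)"
    proof -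
      have "emap (\<lambda>\<lambda> b \<cdot> (\<one> \<I> \<boxtimes> ev V a b)) (pr r (pr s t))
          = emap (ev V a b \<cdot> (\<lambda>\<lambda> \<lbrakk>a, b\<rbrakk> \<boxtimes> \<one> a) \<cdot> invr (\<alpha> \<I> \<lbrakk>a, b\<rbrakk> a)) (pr r (pr s t))"
        using lunit_nat'[of "ev V a b"] lunit_tens[of "\<lbrakk>a, b\<rbrakk>" a, symmetric] by simp
      then show ?thesis using p(2-) by simp
    qed
    from p(2-) show ?case by simp
  qed simp_all
  show "VComp \<V> a a b \<cdot> (\<one> (VHom \<V> a b) \<boxtimes> VId \<V> a) = \<rho> (VHom \<V> a b)"
  proof (rule ihom_ext2[of _ _ "\<lbrakk>a, b\<rbrakk>" "\<I>" a b], goal_cases)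
    case p: (11 \<Gamma> r s t)
    interpret environment V \<Gamma> by (rule p)
    \<comment> \<open>The same for the right unit, where the triangle moves the unitor from the
      argument to the function.\<close>
    have [simp]: "emap (ev V a b) (pr r (emap (\<lambda>\<lambda> a) (pr s t))) = emap (ev V a b) (pr (emap (\<rho> \<lbrakk>a, b\<rbrakk>) (pr r s)) t)"
    proof -
      have "emap (ev V a b \<cdot> (\<one> \<lbrakk>a, b\<rbrakk> \<boxtimes> \<lambda>\<lambda> a) \<cdot> \<alpha> \<lbrakk>a, b\<rbrakk> \<I> a) (pr (pr r s) t)
          = emap (ev V a b \<cdot> (\<rho> \<lbrakk>a, b\<rbrakk> \<boxtimes> \<one> a)) (pr (pr r s) t)"
        using triangle[of "\<lbrakk>a, b\<rbrakk>" a] by simp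
      then show ?thesis using p(2-) by simp
    qed
    from p(2-) show ?case by simp
  qed simp_all
qed

lemma vcat_op [simp]:
  assumes [simp]: "vcat A"
  shows "vcat (op A)"
  unfolding vcategory_def
proof (intro conjI ballI)
  fix a b c d assume "a \<in> VObj (op A)" "b \<in> VObj (op A)" "c \<in> VObj (op A)" "d \<in> VObj (op A)"
  then have [simp]: "a \<in> VObj A" "b \<in> VObj A" "c \<in> VObj A" "d \<in> VObj A" by simp_all
  show "VHom (op A) a b \<in> Obj V" "VComp (op A) a b c \<in> Hom V (VHom (op A) b c \<otimes> VHom (op A) a b) (VHom (op A) a c)"
    "VId (op A) a \<in> Hom V \<I> (VHom (op A) a a)"
    by (simp_all add: Hom_iff)
  show "VComp (op A) a b d \<cdot> (VComp (op A) b c d \<boxtimes> \<one> (VHom (op A) a b))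
          = VComp (op A) a c d \<cdot> (\<one> (VHom (op A) c d) \<boxtimes> VComp (op A) a b c)
              \<cdot> \<alpha> (VHom (op A) c d) (VHom (op A) b c) (VHom (op A) a b)"
  proof (rule ext3[of _ _ "VHom A d c" "VHom A c b" "VHom A b a"], goal_cases)
    case p: (8 \<Gamma> r s t)
    interpret environment V \<Gamma> by (rule p)
    from p(2-) show ?case by simp
  qed simp_all
  show "VComp (op A) a b b \<cdot> (VId (op A) b \<boxtimes> \<one> (VHom (op A) a b)) = \<lambda>\<lambda> (VHom (op A) a b)"
  proof -
    \<comment> \<open>The symmetry in the opposite composition turns this into the other unit law of
      \<open>A\<close>; \<open>lunit_symm\<close> then matches the unitors.\<close>
    have "VComp (op A) a b b \<cdot> (VId (op A) b \<boxtimes> \<one> (VHom (op A) a b))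
        = VComp A b b a \<cdot> (\<one> (VHom A b a) \<boxtimes> VId A b) \<cdot> \<sigma> \<I> (VHom A b a)"
      using symm_nat'[of "VId A b" "\<one> (VHom A b a)"] by simp
    also have "\<dots> = (VComp A b b a \<cdot> (\<one> (VHom A b a) \<boxtimes> VId A b)) \<cdot> \<sigma> \<I> (VHom A b a)" by simp
    also have "VComp A b b a \<cdot> (\<one> (VHom A b a) \<boxtimes> VId A b) = \<rho> (VHom A b a)"
      using assms by (simp add: vcategory_def)
    also have "\<dots> = \<lambda>\<lambda> (VHom A b a) \<cdot> \<sigma> (VHom A b a) \<I>" by (simp add: lunit_symm)
    finally show ?thesis by simp
  qed
  show "VComp (op A) a a b \<cdot> (\<one> (VHom (op A) a b) \<boxtimes> VId (op A) a) = \<rho> (VHom (op A) a b)"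
  proof -
    have "VComp (op A) a a b \<cdot> (\<one> (VHom (op A) a b) \<boxtimes> VId (op A) a)
        = VComp A b a a \<cdot> (VId A a \<boxtimes> \<one> (VHom A b a)) \<cdot> \<sigma> (VHom A b a) \<I>"
      using symm_nat'[of "\<one> (VHom A b a)" "VId A a"] by simp
    also have "\<dots> = (VComp A b a a \<cdot> (VId A a \<boxtimes> \<one> (VHom A b a))) \<cdot> \<sigma> (VHom A b a) \<I>" by simp
    also have "VComp A b a a \<cdot> (VId A a \<boxtimes> \<one> (VHom A b a)) = \<lambda>\<lambda> (VHom A b a)"
      using assms by (simp add: vcategory_def)
    finally show ?thesis by (simp add: lunit_symm)
  qed
qed

lemma vop_fun_vfun [simp]:
  assumes "vcat X" "vcat Y" "F \<in> vfun X Y"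
  shows "vop_fun F \<in> vfun (op X) (op Y)"
proof -
  have "FA F z x \<cdot> VComp X z y x \<cdot> \<sigma> (VHom X z y) (VHom X y x)
    = VComp Y (FO F z) (FO F y) (FO F x) \<cdot> \<sigma> (VHom Y (FO F z) (FO F y)) (VHom Y (FO F y) (FO F x))
        \<cdot> (FA F z y \<boxtimes> FA F y x)"
    if [simp]: "x \<in> VObj X" "y \<in> VObj X" "z \<in> VObj X" for x y z
    using tail[OF vfun_Cmp[OF assms(3), of z y x], of "\<sigma> (VHom X z y) (VHom X y x)"]
      symm_nat'[of "FA F z y" "FA F y x"] assms by simp
  then show ?thesis
    by (intro vfunI) (use assms vfun_undef[OF assms(3)] in auto)
qed

text \<open>Off the objects of \<open>A\<close> the two inserted symmetries need not cancel, so a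
  double opposite is not literally \<open>A\<close>. What can be identified are the sets of
  functors, as \<open>vfun_op_op\<close> does.\<close>

lemma op_op: "vcat A \<Longrightarrow> a \<in> VObj A \<Longrightarrow> b \<in> VObj A \<Longrightarrow> c \<in> VObj A \<Longrightarrow> VComp (op (op A)) a b c = VComp A a b c"
  by simp

lemma vfun_op_op:
  assumes "vcat X" "vcat Y"
  shows "vfun (op (op X)) Y = vfun X Y" "vfun X (op (op Y)) = vfun X Y"
proof -
  have 1: "F \<in> vfun (op (op X)) Y \<longleftrightarrow> F \<in> vfun X Y" for F
    unfolding vfunctors_def mem_Collect_eq using op_op[OF assms(1)]
    by (intro conj_cong ball_cong) (simp_all del: vop_simps(3))
  have 2: "F \<in> vfun X (op (op Y)) \<longleftrightarrow> F \<in> vfun X Y" for F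
    unfolding vfunctors_def mem_Collect_eq using op_op[OF assms(2)]
    by (intro conj_cong ball_cong) (simp_all del: vop_simps(3) add: PiE_iff)
  show "vfun (op (op X)) Y = vfun X Y" "vfun X (op (op Y)) = vfun X Y"
    using 1 2 by blast+
qed

lemma vcompose_vfun [simp]:
  assumes "vcat X" "vcat Y" "vcat Z" "F \<in> vfun X Y" "G \<in> vfun Y Z"
  shows "vcompose V X G F \<in> vfun X Z"
  unfolding vcompose_def
proof (rule mk_vfun_vfun, goal_cases)
  case (3 x y z)
  then show ?case
    using assms tail[OF vfun_Cmp[OF assms(5), of "FO F x" "FO F y" "FO F z"], of "FA F y z \<boxtimes> FA F x y"]
    by (simp add: vfun_Cmp[OF assms(4)] tens_cmp)
qed (use assms in simp_all)

lemma hom_functor_simps [simp]: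
  "x \<in> VObj A \<Longrightarrow> FO (hom_functor V A a) x = VHom A a x"
  "x \<in> VObj A \<Longrightarrow> y \<in> VObj A \<Longrightarrow> FA (hom_functor V A a) x y = curry (VHom A x y) (VHom A a x) (VHom A a y) (VComp A a
      x y)"
  by (simp_all add: hom_functor_def)

text \<open>Under transposition the functor laws of a representable are associativity and the left
  unit law of \<open>A\<close>.\<close>

lemma hom_functor_vfun [simp]:
  assumes [simp]: "vcat A" "a \<in> VObj A"
  shows "hom_functor V A a \<in> vfun A \<V>"
  unfolding hom_functor_def
proof (rule mk_vfun_vfun, goal_cases)
  case [simp]: (3 x y z)
  show ?case 
  proof (rule ihom_ext2[of _ _ "VHom A y z" "VHom A x y" "VHom A a x" "VHom A a z"], goal_cases)
    case p: (11 \<Gamma> r s t)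
    interpret environment V \<Gamma> by (rule p)
    from p(2-) show ?case by simp
  qed simp_all
next
  case [simp]: (4 x)
  show ?case
  proof (rule ihom_ext0[of _ _ "VHom A a x" "VHom A a x"], goal_cases)
    case p: (9 \<Gamma> t)
    interpret environment V \<Gamma> by (rule p)
    from p(2-) show ?case by simp
  qed simp_all
qed simp_all

end

section \<open>Ends and colimits in the base\<close>

lemma small_finite:
  assumes "infinite (UNIV :: 'u set)" "finite S"
  shows "small (U :: 'u itself) S"
  using finite_ordLess_infinite[OF card_of_Well_order card_of_Well_order, of S "UNIV :: 'u set"] assms
  unfolding small_def Field_card_of by blast

lemma small_image: "small U S \<Longrightarrow> small U (f ` S)"
  unfolding small_def by (rule ordLeq_ordLess_trans[OF card_of_image])

lemma small_square:
  assumes "infinite (UNIV :: 'u set)" "small (U :: 'u itself) S"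
  shows "small U (S \<times> S)"
proof (cases "finite S")
  case True
  then show ?thesis using assms(1) by (simp add: small_finite)
next
  case False
  from card_of_Times_same_infinite[OF this] assms(2) show ?thesis
    unfolding small_def using ordIso_ordLess_trans by blast
qed

lemma ex1_unique: "\<exists>!x. P x \<Longrightarrow> P a \<Longrightarrow> P b \<Longrightarrow> a = b"
  by blast

context category
begin

lemma Hom_Obj: "f \<in> Hom C a b \<Longrightarrow> a \<in> Obj C" "f \<in> Hom C a b \<Longrightarrow> b \<in> Obj C"
  using Dom_Obj Cod_Obj by (auto simp: Hom_def)

lemma product_exists:
  fixes U :: "'u itself"
  assumes "complete U C" "small U I" and D: "\<And>i. i \<in> I \<Longrightarrow> D i \<in> Obj C"
  obtains P p where "P \<in> Obj C" "\<And>i. i \<in> I \<Longrightarrow> p i \<in> Hom C P (D i)"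
    "\<And>z q. z \<in> Obj C \<Longrightarrow> (\<And>i. i \<in> I \<Longrightarrow> q i \<in> Hom C z (D i)) \<Longrightarrow> \<exists>!h. h \<in> Hom C z P \<and> (\<forall>i\<in>I. p i \<cdot> h = q i)"
proof -
  \<comment> \<open>\<open>complete\<close> speaks only of shapes whose objects and arrows lie in
    \<open>'u\<close>. The index set is copied there and made a discrete category, each object
    serving as its own identity.\<close>
  obtain e :: "_ \<Rightarrow> 'u" where e: "inj_on e I"
    using assms(2) card_of_ordLeq[of I "UNIV :: 'u set"] ordLess_imp_ordLeq unfolding small_def by blast
  define J :: "('u, 'u) cat" where
    "J = \<lparr>Obj = e ` I, Arr = e ` I, Dom = \<lambda>x. x, Cod = \<lambda>x. x, Id = \<lambda>x. x, Cmp = \<lambda>g f. f\<rparr>"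
  define F\<^sub>o where "F\<^sub>o u = D (inv_into I e u)" for u
  have inv: "inv_into I e (e i) = i" if "i \<in> I" for i using e that by simp
  have "category J" by unfold_locales (auto simp: J_def Hom_def)
  moreover have "is_functor J C F\<^sub>o (\<lambda>u. \<one> (F\<^sub>o u))"
    unfolding is_functor_def F\<^sub>o_def J_def using D inv by (auto simp: Hom_iff)
  moreover have "small U (Obj J)" "small U (Arr J)"
    using small_image[OF assms(2), of e] by (simp_all add: J_def)
  ultimately obtain l p where lp: "is_limit J C F\<^sub>o (\<lambda>u. \<one> (F\<^sub>o u)) l p"
    using assms(1) unfolding complete_def by blast
  have cone: "is_cone J C F\<^sub>o (\<lambda>u. \<one> (F\<^sub>o u)) z q \<longleftrightarrow> z \<in> Obj C \<and> (\<forall>i\<in>I. q (e i) \<in> Hom C z (D i))" for z q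
    unfolding is_cone_def F\<^sub>o_def J_def using D inv by (auto simp: Hom_iff)
  show thesis
  proof (rule that[of l "\<lambda>i. p (e i)"])
    show "l \<in> Obj C" "\<And>i. i \<in> I \<Longrightarrow> p (e i) \<in> Hom C l (D i)"
      using lp cone unfolding is_limit_def by auto
    fix z q assume z: "z \<in> Obj C" "\<And>i. i \<in> I \<Longrightarrow> q i \<in> Hom C z (D i)"
    then have "is_cone J C F\<^sub>o (\<lambda>u. \<one> (F\<^sub>o u)) z (\<lambda>u. q (inv_into I e u))"
      unfolding cone using inv by auto
    moreover have "Obj J = e ` I" by (simp add: J_def)
    ultimately have "\<exists>!h. h \<in> Hom C z l \<and> (\<forall>u\<in>e ` I. p u \<cdot> h = q (inv_into I e u))"
      using lp unfolding is_limit_def by (metis (no_types, lifting))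
    moreover have "(\<forall>u\<in>e ` I. p u \<cdot> h = q (inv_into I e u)) \<longleftrightarrow> (\<forall>i\<in>I. p (e i) \<cdot> h = q i)" for h
      using inv by auto
    ultimately show "\<exists>!h. h \<in> Hom C z l \<and> (\<forall>i\<in>I. p (e i) \<cdot> h = q i)" by simp
  qed
qed

lemma equalizer_exists:
  fixes U :: "'u itself"
  assumes "complete U C" "infinite (UNIV :: 'u set)" and fg: "f \<in> Hom C a b" "g \<in> Hom C a b"
  obtains E m where "m \<in> Hom C E a" "f \<cdot> m = g \<cdot> m"
    "\<And>z h. h \<in> Hom C z a \<Longrightarrow> f \<cdot> h = g \<cdot> h \<Longrightarrow> \<exists>!k. k \<in> Hom C z E \<and> m \<cdot> k = h"
proof -
  \<comment> \<open>Four distinct elements make up the parallel pair: \<open>u 0\<close> and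
    \<open>u 1\<close> are the objects and their identities, \<open>u 2\<close> and
    \<open>u 3\<close> the two arrows.\<close>
  obtain u :: "nat \<Rightarrow> 'u" where u: "inj u"
    using assms(2) unfolding infinite_iff_countable_subset by blast
  have ne: "u i = u j \<longleftrightarrow> i = j" for i j using u by (auto dest: injD)
  define J :: "('u, 'u) cat" where
    "J = \<lparr>Obj = {u 0, u 1}, Arr = {u 0, u 1, u 2, u 3}, Dom = \<lambda>x. if x = u 1 then u 1 else u 0,
      Cod = \<lambda>x. if x = u 0 then u 0 else u 1, Id = \<lambda>x. x, Cmp = \<lambda>g f. if g = u 0 \<or> g = u 1 then f else g\<rparr>"
  define F\<^sub>o where "F\<^sub>o x = (if x = u 0 then a else b)" for x
  define F\<^sub>a where "F\<^sub>a x = (if x = u 0 then \<one> a else if x = u 1 then \<one> b else if x = u 2 then f else g)" for x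
  have ab [simp]: "a \<in> Obj C" "b \<in> Obj C" using fg Dom_Obj Cod_Obj by (auto simp: Hom_iff)
  have "category J" by unfold_locales (auto simp: J_def Hom_def ne)
  moreover have "is_functor J C F\<^sub>o F\<^sub>a"
    unfolding is_functor_def F\<^sub>o_def F\<^sub>a_def J_def using fg by (auto simp: Hom_iff ne)
  moreover have "small U (Obj J)" "small U (Arr J)"
    by (rule small_finite[OF assms(2)]; simp add: J_def)+
  ultimately obtain l p where lp: "is_limit J C F\<^sub>o F\<^sub>a l p"
    using assms(1) unfolding complete_def by blast
  have cone: "is_cone J C F\<^sub>o F\<^sub>a z q \<longleftrightarrow> q (u 0) \<in> Hom C z a \<and> f \<cdot> q (u 0) = g \<cdot> q (u 0) \<and> q (u 1)
      = f \<cdot> q (u 0)" for z q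
    unfolding is_cone_def F\<^sub>o_def F\<^sub>a_def J_def using fg Dom_Obj by (auto simp: Hom_iff ne)
  have p: "p (u 0) \<in> Hom C l a" "f \<cdot> p (u 0) = g \<cdot> p (u 0)" "p (u 1) = f \<cdot> p (u 0)"
    using lp cone unfolding is_limit_def by auto
  show thesis
  proof (rule that[OF p(1,2)])
    fix z h assume h: "h \<in> Hom C z a" "f \<cdot> h = g \<cdot> h"
    define q where "q x = (if x = u 0 then h else f \<cdot> h)" for x
    have "is_cone J C F\<^sub>o F\<^sub>a z q" unfolding cone q_def using h by (simp add: ne)
    moreover have "Obj J = {u 0, u 1}" by (simp add: J_def)
    ultimately have "\<exists>!k. k \<in> Hom C z l \<and> (\<forall>x\<in>{u 0, u 1}. p x \<cdot> k = q x)"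
      using lp unfolding is_limit_def by (metis (no_types, lifting))
    moreover have "k \<in> Hom C z l \<and> (\<forall>x\<in>{u 0, u 1}. p x \<cdot> k = q x) \<longleftrightarrow> k \<in> Hom C z l \<and> p (u 0) \<cdot> k = h" for k
      using Cmp_assoc[OF _ p(1) fg(1), of k z] p(3) by (auto simp: q_def ne)
    ultimately show "\<exists>!k. k \<in> Hom C z l \<and> p (u 0) \<cdot> k = h" by simp
  qed
qed

text \<open>The shape of the diagram that computes an end: one equation for each \<open>k\<close>.\<close>

lemma graph_limit_exists:
  fixes U :: "'u itself"
  assumes "complete U C" "infinite (UNIV :: 'u set)" "small U I" "small U K"
    and D: "\<And>i. i \<in> I \<Longrightarrow> D i \<in> Obj C"
    and s: "\<And>k. k \<in> K \<Longrightarrow> s k \<in> I" "\<And>k. k \<in> K \<Longrightarrow> t k \<in> I"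
    and f: "\<And>k. k \<in> K \<Longrightarrow> f k \<in> Hom C (D (s k)) (B k)" "\<And>k. k \<in> K \<Longrightarrow> g k \<in> Hom C (D (t k)) (B k)"
  obtains E p where "E \<in> Obj C" "\<And>i. i \<in> I \<Longrightarrow> p i \<in> Hom C E (D i)"
    "\<And>k. k \<in> K \<Longrightarrow> f k \<cdot> p (s k) = g k \<cdot> p (t k)"
    "\<And>z q. z \<in> Obj C \<Longrightarrow> (\<And>i. i \<in> I \<Longrightarrow> q i \<in> Hom C z (D i)) \<Longrightarrow>
       (\<And>k. k \<in> K \<Longrightarrow> f k \<cdot> q (s k) = g k \<cdot> q (t k)) \<Longrightarrow> \<exists>!h. h \<in> Hom C z E \<and> (\<forall>i\<in>I. p i \<cdot> h = q i)"
proof -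
  have B: "B k \<in> Obj C" if "k \<in> K" for k using Hom_Obj(2)[OF f(1)[OF that]] .
  obtain P p where P: "P \<in> Obj C" "\<And>i. i \<in> I \<Longrightarrow> p i \<in> Hom C P (D i)"
    and Pu: "\<And>z q. z \<in> Obj C \<Longrightarrow> (\<And>i. i \<in> I \<Longrightarrow> q i \<in> Hom C z (D i)) \<Longrightarrow> \<exists>!h. h \<in> Hom C z P \<and> (\<forall>i\<in>I. p i \<cdot> h = q i)"
    using product_exists[where D = D, OF assms(1,3) D] by blast
  obtain Q q where Q: "Q \<in> Obj C" "\<And>k. k \<in> K \<Longrightarrow> q k \<in> Hom C Q (B k)"
    and Qu: "\<And>z r. z \<in> Obj C \<Longrightarrow> (\<And>k. k \<in> K \<Longrightarrow> r k \<in> Hom C z (B k)) \<Longrightarrow> \<exists>!h. h \<in> Hom C z Q \<and> (\<forall>k\<in>K. q k \<cdot> h = r k)"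
    using product_exists[where D = B, OF assms(1,4) B] by blast
  have "\<exists>!h. h \<in> Hom C P Q \<and> (\<forall>k\<in>K. q k \<cdot> h = f k \<cdot> p (s k))"
    by (rule Qu[OF P(1)]) (rule Cmp_Hom[OF P(2)[OF s(1)] f(1)])
  then obtain F where F: "F \<in> Hom C P Q" "\<And>k. k \<in> K \<Longrightarrow> q k \<cdot> F = f k \<cdot> p (s k)" by blast
  have "\<exists>!h. h \<in> Hom C P Q \<and> (\<forall>k\<in>K. q k \<cdot> h = g k \<cdot> p (t k))"
    by (rule Qu[OF P(1)]) (rule Cmp_Hom[OF P(2)[OF s(2)] f(2)])
  then obtain G where G: "G \<in> Hom C P Q" "\<And>k. k \<in> K \<Longrightarrow> q k \<cdot> G = g k \<cdot> p (t k)" by blast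
  obtain E m where m: "m \<in> Hom C E P" "F \<cdot> m = G \<cdot> m"
    and Eu: "\<And>z h. h \<in> Hom C z P \<Longrightarrow> F \<cdot> h = G \<cdot> h \<Longrightarrow> \<exists>!k. k \<in> Hom C z E \<and> m \<cdot> k = h"
    by (rule equalizer_exists[OF assms(1,2) F(1) G(1)]) (rule that)
  have E: "E \<in> Obj C" using Hom_Obj(1)[OF m(1)] .
  \<comment> \<open>Projections of the product \<open>Q\<close> are jointly monic, so the equalizer
    of \<open>F\<close> and \<open>G\<close> imposes exactly the equations indexed by
    \<open>K\<close>.\<close>
  have FG: "F \<cdot> h = G \<cdot> h \<longleftrightarrow> (\<forall>k\<in>K. f k \<cdot> p (s k) \<cdot> h = g k \<cdot> p (t k) \<cdot> h)" if h: "h \<in> Hom C z P" for z h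
  proof -
    have Fh: "q k \<cdot> F \<cdot> h = f k \<cdot> p (s k) \<cdot> h" if k: "k \<in> K" for k
      using Cmp_assoc[OF h F(1) Q(2)[OF k]] Cmp_assoc[OF h P(2)[OF s(1)[OF k]] f(1)[OF k]] F(2)[OF k] by simp
    have Gh: "q k \<cdot> G \<cdot> h = g k \<cdot> p (t k) \<cdot> h" if k: "k \<in> K" for k
      using Cmp_assoc[OF h G(1) Q(2)[OF k]] Cmp_assoc[OF h P(2)[OF s(2)[OF k]] f(2)[OF k]] G(2)[OF k] by simp
    have "z \<in> Obj C" using Hom_Obj(1)[OF h] .
    then have "\<exists>!l. l \<in> Hom C z Q \<and> (\<forall>k\<in>K. q k \<cdot> l = g k \<cdot> p (t k) \<cdot> h)"
      by (rule Qu) (rule Cmp_Hom[OF Cmp_Hom[OF h P(2)[OF s(2)]] f(2)])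
    note u = ex1_unique[OF this, of "F \<cdot> h" "G \<cdot> h"]
    have H: "F \<cdot> h \<in> Hom C z Q" "G \<cdot> h \<in> Hom C z Q" using Cmp_Hom[OF h F(1)] Cmp_Hom[OF h G(1)] .
    show ?thesis
    proof
      assume eq: "F \<cdot> h = G \<cdot> h"
      show "\<forall>k\<in>K. f k \<cdot> p (s k) \<cdot> h = g k \<cdot> p (t k) \<cdot> h"
        using Fh Gh unfolding eq by simp
    next
      assume "\<forall>k\<in>K. f k \<cdot> p (s k) \<cdot> h = g k \<cdot> p (t k) \<cdot> h"
      with Fh Gh H show "F \<cdot> h = G \<cdot> h" by (intro u conjI ballI) simp_all
    qed
  qed
  show thesis
  proof (rule that[OF E])
    show pm: "p i \<cdot> m \<in> Hom C E (D i)" if "i \<in> I" for i using Cmp_Hom[OF m(1) P(2)[OF that]] .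
    show "f k \<cdot> p (s k) \<cdot> m = g k \<cdot> p (t k) \<cdot> m" if "k \<in> K" for k
      using FG[OF m(1)] m(2) that by blast
    fix z r assume z: "z \<in> Obj C" and r: "\<And>i. i \<in> I \<Longrightarrow> r i \<in> Hom C z (D i)"
      and eq: "\<And>k. k \<in> K \<Longrightarrow> f k \<cdot> r (s k) = g k \<cdot> r (t k)"
    obtain h where h: "h \<in> Hom C z P" "\<And>i. i \<in> I \<Longrightarrow> p i \<cdot> h = r i" using Pu[OF z r] by blast
    have "F \<cdot> h = G \<cdot> h" unfolding FG[OF h(1)] using h(2) eq s by simp
    then obtain k where k: "k \<in> Hom C z E" "m \<cdot> k = h" using Eu[OF h(1)] by blast
    have as: "(p i \<cdot> m) \<cdot> k' = p i \<cdot> m \<cdot> k'" if "i \<in> I" "k' \<in> Hom C z E" for i k'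
      using Cmp_assoc[OF that(2) m(1) P(2)[OF that(1)]] .
    show "\<exists>!h. h \<in> Hom C z E \<and> (\<forall>i\<in>I. (p i \<cdot> m) \<cdot> h = r i)"
    proof (rule ex1I[of _ k])
      show "k \<in> Hom C z E \<and> (\<forall>i\<in>I. (p i \<cdot> m) \<cdot> k = r i)" using k h(2) as by simp
      fix k' assume k': "k' \<in> Hom C z E \<and> (\<forall>i\<in>I. (p i \<cdot> m) \<cdot> k' = r i)"
      then have mk: "m \<cdot> k' \<in> Hom C z P" "m \<cdot> k \<in> Hom C z P" using Cmp_Hom m(1) k(1) by blast+
      have "m \<cdot> k' = m \<cdot> k"
        by (rule ex1_unique[OF Pu[OF z r]]) (use mk k' k(2) h as in auto)
      moreover have "\<exists>!l. l \<in> Hom C z E \<and> m \<cdot> l = m \<cdot> k"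
        using Eu[OF h(1) \<open>F \<cdot> h = G \<cdot> h\<close>] k(2) by simp
      ultimately show "k' = k" using k' k by blast
    qed
  qed
qed

lemma category_op: "category (op_cat C)"
proof
  fix f a b g c h d
  show "f \<in> Arr (op_cat C) \<Longrightarrow> Dom (op_cat C) f \<in> Obj (op_cat C)"
    "f \<in> Arr (op_cat C) \<Longrightarrow> Cod (op_cat C) f \<in> Obj (op_cat C)"
    "a \<in> Obj (op_cat C) \<Longrightarrow> Id (op_cat C) a \<in> Hom (op_cat C) a a"
    by (auto simp: op_cat_def Hom_def)
  show "Cmp (op_cat C) g f \<in> Hom (op_cat C) a c" if "f \<in> Hom (op_cat C) a b" "g \<in> Hom (op_cat C) b c"
    using that Cmp_Hom[of g c b f a] by (auto simp: op_cat_def Hom_def)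
  show "Cmp (op_cat C) (Id (op_cat C) b) f = f" "Cmp (op_cat C) f (Id (op_cat C) a) = f" if "f \<in> Hom (op_cat C) a b"
    using that by (auto simp: op_cat_def Hom_def)
  show "Cmp (op_cat C) (Cmp (op_cat C) h g) f = Cmp (op_cat C) h (Cmp (op_cat C) g f)"
    if "f \<in> Hom (op_cat C) a b" "g \<in> Hom (op_cat C) b c" "h \<in> Hom (op_cat C) c d"
    using that by (auto simp: op_cat_def Hom_def)
qed

end

lemma Hom_op_cat [simp]: "Hom (op_cat C) a b = Hom C b a" "Obj (op_cat C) = Obj C" "Cmp (op_cat C) g f = Cmp C f g"
  by (auto simp: op_cat_def Hom_def)

section \<open>Small sets of representatives\<close>

context symmetric_monoidal_closed
begin

text \<open>An essentially small category may have too many objects for a limit over all of them.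
  The data exhibit every object \<open>x\<close> as a retract of an object \<open>rep x\<close> of
  \<open>R\<close>: \<open>i x\<close> goes to the representative and \<open>j x\<close>
  returns.\<close>

definition representatives ::
  "('a, 'v, 'm) vcat \<Rightarrow> 'a set \<Rightarrow> ('a \<Rightarrow> 'a) \<Rightarrow> ('a \<Rightarrow> 'm) \<Rightarrow> ('a \<Rightarrow> 'm) \<Rightarrow> bool" where
  "representatives X R rep i j \<longleftrightarrow> R \<subseteq> VObj X \<and> (\<forall>x\<in>VObj X. rep x \<in> R \<and>
     (i x \<in> Arr V \<and> Dom V (i x) = \<I> \<and> Cod V (i x) = VHom X x (rep x)) \<and>
     (j x \<in> Arr V \<and> Dom V (j x) = \<I> \<and> Cod V (j x) = VHom X (rep x) x) \<and>
     VComp X x (rep x) x \<cdot> (j x \<boxtimes> i x) = VId X x \<cdot> \<lambda>\<lambda> \<I>)"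

lemma vsmall_representatives:
  assumes "vcat X" "vsmall V U X"
  obtains R rep i j where "small U R" "representatives X R rep i j"
proof -
  define c where "c x = viso_rel V X `` {x}" for x
  \<comment> \<open>\<open>rep x\<close> depends on \<open>x\<close> only through its class, so
    \<open>rep\<close> takes at most as many values as there are classes.\<close>
  define rep where "rep x = (SOME y. y \<in> c x)" for x
  have refl: "(x, x) \<in> viso_rel V X" if [simp]: "x \<in> VObj X" for x
  proof -
    have "VComp X x x x \<cdot> (VId X x \<boxtimes> VId X x) = VId X x \<cdot> \<lambda>\<lambda> \<I>"
    proof (rule ext2[of _ _ \<I> \<I>], goal_cases)
      case p: (7 \<Gamma> s t)
      interpret environment V \<Gamma> by (rule p)
      have "VComp X x x x \<cdot> (VId X x \<boxtimes> VId X x) = (VComp X x x x \<cdot> (VId X x \<boxtimes> \<one> (VHom X x x))) \<cdot> (\<one> \<I> \<boxtimes> VId X x)"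
        using assms by (simp add: tens_cmp)
      also have "\<dots> = \<lambda>\<lambda> (VHom X x x) \<cdot> (\<one> \<I> \<boxtimes> VId X x)" using assms by (simp add: vcategory_def)
      finally show ?case using lunit_nat'[of "VId X x"] assms by simp
    qed (use assms in simp_all)
    moreover have "VId X x \<in> Hom V \<I> (VHom X x x)" using assms by (simp add: Hom_iff)
    ultimately show ?thesis unfolding viso_rel_def using that by blast
  qed
  have c: "rep x \<in> c x" if "x \<in> VObj X" for x
    unfolding rep_def by (rule someI[of _ x]) (use refl[OF that] in \<open>auto simp: c_def\<close>)
  have "\<exists>i j. rep x \<in> VObj X \<and> (i \<in> Arr V \<and> Dom V i = \<I> \<and> Cod V i = VHom X x (rep x)) \<and>
     (j \<in> Arr V \<and> Dom V j = \<I> \<and> Cod V j = VHom X (rep x) x) \<and>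
     VComp X x (rep x) x \<cdot> (j \<boxtimes> i) = VId X x \<cdot> \<lambda>\<lambda> \<I>" if "x \<in> VObj X" for x
  proof -
    have "(x, rep x) \<in> viso_rel V X" using c[OF that] by (simp add: c_def)
    then show ?thesis unfolding viso_rel_def Bex_def Hom_iff by blast
  qed
  then obtain i j where ij: "\<And>x. x \<in> VObj X \<Longrightarrow> rep x \<in> VObj X \<and> (i x \<in> Arr V \<and> Dom V (i x) = \<I> \<and> Cod V (i x)
      = VHom X x (rep x)) \<and>
     (j x \<in> Arr V \<and> Dom V (j x) = \<I> \<and> Cod V (j x) = VHom X (rep x) x) \<and>
     VComp X x (rep x) x \<cdot> (j x \<boxtimes> i x) = VId X x \<cdot> \<lambda>\<lambda> \<I>"
    by metis
  have "rep ` VObj X = (\<lambda>C. SOME y. y \<in> C) ` (VObj X // viso_rel V X)"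
  proof -
    have "VObj X // viso_rel V X = c ` VObj X" by (auto simp: quotient_def c_def)
    then show ?thesis by (simp add: image_image rep_def)
  qed
  then have "small U (rep ` VObj X)"
    using small_image assms(2) unfolding vsmall_def by metis
  then show thesis
    by (rule that[of "rep ` VObj X" rep i j]) (use ij in \<open>auto simp: representatives_def\<close>)
qed

text \<open>Composition in the opposite inserts a symmetry, which on
  \<open>\<I> \<otimes> \<I>\<close> is the identity; so the same two arrows, with their roles
  exchanged, witness the isomorphism.\<close>

lemma viso_rel_op:
  assumes "vcat A"
  shows "viso_rel V (op A) = viso_rel V A"
proof -
  have *: "(VComp A a b a \<cdot> \<sigma> (VHom A a b) (VHom A b a)) \<cdot> (f \<boxtimes> g) = VComp A a b a \<cdot> (g \<boxtimes> f)"
    if "a \<in> VObj A" "b \<in> VObj A" "f \<in> Hom V \<I> (VHom A a b)" "g \<in> Hom V \<I> (VHom A b a)" for a b f g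
    using that assms symm_nat'[of f g] by (simp add: Hom_iff symm_unit)
  have "(a, b) \<in> viso_rel V (op A) \<longleftrightarrow> (a, b) \<in> viso_rel V A" for a b
  proof (cases "a \<in> VObj A \<and> b \<in> VObj A")
    case True
    then have "(\<exists>f\<in>Hom V \<I> (VHom A b a). \<exists>g\<in>Hom V \<I> (VHom A a b).
        (VComp A a b a \<cdot> \<sigma> (VHom A a b) (VHom A b a)) \<cdot> (g \<boxtimes> f) = VId A a \<cdot> \<lambda>\<lambda> \<I> \<and>
        (VComp A b a b \<cdot> \<sigma> (VHom A b a) (VHom A a b)) \<cdot> (f \<boxtimes> g) = VId A b \<cdot> \<lambda>\<lambda> \<I>) \<longleftrightarrow>
      (\<exists>f\<in>Hom V \<I> (VHom A b a). \<exists>g\<in>Hom V \<I> (VHom A a b).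
        VComp A a b a \<cdot> (f \<boxtimes> g) = VId A a \<cdot> \<lambda>\<lambda> \<I> \<and> VComp A b a b \<cdot> (g \<boxtimes> f) = VId A b \<cdot> \<lambda>\<lambda> \<I>)"
      by (intro bex_cong refl) (simp only: *)
    then show ?thesis using True unfolding viso_rel_def vop_simps by blast
  next
    case False
    then show ?thesis by (auto simp: viso_rel_def)
  qed
  then show ?thesis by auto
qed

lemma vsmall_op: "vcat A \<Longrightarrow> vsmall V U A \<Longrightarrow> vsmall V U (op A)"
  by (simp add: vsmall_def viso_rel_op)

section \<open>Natural families, hom ends and functor categories\<close>

lemma natural_family_simps [simp]:
  assumes "natural_family V X Y F G z q"
  shows "z \<in> Obj V" "x \<in> VObj X \<Longrightarrow> q x \<in> Arr V" "x \<in> VObj X \<Longrightarrow> Dom V (q x) = z"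
    "x \<in> VObj X \<Longrightarrow> Cod V (q x) = VHom Y (FO F x) (FO G x)"
  using assms by (auto simp: natural_family_def Hom_iff)

end

lemma (in environment) natural_family_el:
  assumes "natural_family V X Y F G z q" "vcat X" "vcat Y" "F \<in> vfun X Y" "G \<in> vfun X Y" "x \<in> VObj X" "y \<in> VObj X"
    and "el s" "el t" "ctx s \<inter> ctx t = {}" "ty s = z" "ty t = VHom X x y"
  shows "VComp Y (FO F x) (FO F y) (FO G y) \<bullet> ((q y \<bullet> s) \<diamondop> (FA F x y \<bullet> t))
    = VComp Y (FO F x) (FO G x) (FO G y) \<bullet> ((FA G x y \<bullet> t) \<diamondop> (q x \<bullet> s))"
proof -
  have "VComp Y (FO F x) (FO F y) (FO G y) \<cdot> (q y \<boxtimes> FA F x y)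
          = VComp Y (FO F x) (FO G x) (FO G y) \<cdot> (FA G x y \<boxtimes> q x) \<cdot> \<sigma> z (VHom X x y)"
    using assms(1,6,7) unfolding natural_family_def by blast
  from arg_cong[OF this, of "\<lambda>f. f \<bullet> (s \<diamondop> t)"] show ?thesis using assms by (simp add: Int_commute)
qed

context symmetric_monoidal_closed
begin

lemma natural_familyI:
  assumes "vcat X" "vcat Y" "F \<in> vfun X Y" "G \<in> vfun X Y" "z \<in> Obj V"
    and q: "\<And>x. x \<in> VObj X \<Longrightarrow> q x \<in> Arr V \<and> Dom V (q x) = z \<and> Cod V (q x) = VHom Y (FO F x) (FO G x)"
    and eq: "\<And>x y \<Gamma> s t. x \<in> VObj X \<Longrightarrow> y \<in> VObj X \<Longrightarrow> environment V \<Gamma> \<Longrightarrow>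
       El \<Gamma> s \<Longrightarrow> El \<Gamma> t \<Longrightarrow> Ty s = z \<Longrightarrow> Ty t = VHom X x y \<Longrightarrow>
       Ctx s = {0} \<Longrightarrow> Ctx t = {Suc 0} \<Longrightarrow>
       App (VComp Y (FO F x) (FO F y) (FO G y)) (Pr \<Gamma> (App (q y) s) (App (FA F x y) t))
       = App (VComp Y (FO F x) (FO G x) (FO G y)) (Pr \<Gamma> (App (FA G x y) t) (App (q x) s))"
  shows "natural_family V X Y F G z q"
  unfolding natural_family_def
proof (intro conjI ballI)
  fix x y assume xy: "x \<in> VObj X" "y \<in> VObj X"
  show "VComp Y (FO F x) (FO F y) (FO G y) \<cdot> (q y \<boxtimes> FA F x y)
          = VComp Y (FO F x) (FO G x) (FO G y) \<cdot> (FA G x y \<boxtimes> q x) \<cdot> \<sigma> z (VHom X x y)"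
  proof (rule ext2[of _ _ z "VHom X x y"], goal_cases)
    case p: (7 \<Gamma> s t)
    interpret environment V \<Gamma> by (rule p)
    have "ctx t = {Suc 0}" using p by simp
    from eq[OF xy p(1,2,3,4,5,6) this] q xy assms(1-5) p(2-) show ?case by simp
  qed (use assms(1-5) q xy in simp_all)
qed (use assms in \<open>auto simp: Hom_iff\<close>)

text \<open>Isolates what makes the descriptions in \<open>functor_cat\<close> meaningful. The lemma
  \<open>ends\<close> derives it from smallness; until then nothing refers to size.\<close>

definition has_ends :: "('a, 'v, 'm) vcat \<Rightarrow> ('b, 'v, 'm) vcat \<Rightarrow> bool" where
  "has_ends X Y \<longleftrightarrow> (\<forall>F\<in>vfun X Y. \<forall>G\<in>vfun X Y. \<exists>e p. is_hom_end V X Y F G e p)"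

lemma nat_end:
  assumes "has_ends X Y" "F \<in> vfun X Y" "G \<in> vfun X Y"
  shows "is_hom_end V X Y F G (nat_obj V X Y F G) (nat_proj V X Y F G)"
proof -
  have "\<exists>ep. is_hom_end V X Y F G (fst ep) (snd ep)"
    using assms unfolding has_ends_def by auto
  from someI_ex[OF this] show ?thesis
    unfolding nat_obj_def nat_proj_def hom_end_def by (simp add: case_prod_unfold)
qed

lemma nat_proj_natural:
  assumes "has_ends X Y" "F \<in> vfun X Y" "G \<in> vfun X Y"
  shows "natural_family V X Y F G (nat_obj V X Y F G) (nat_proj V X Y F G)"
  using nat_end[OF assms] by (simp add: is_hom_end_def)

lemma nat_simps [simp]:
  assumes "has_ends X Y" "F \<in> vfun X Y" "G \<in> vfun X Y"
  shows "nat_obj V X Y F G \<in> Obj V" "x \<in> VObj X \<Longrightarrow> nat_proj V X Y F G x \<in> Arr V"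
    "x \<in> VObj X \<Longrightarrow> Dom V (nat_proj V X Y F G x) = nat_obj V X Y F G"
    "x \<in> VObj X \<Longrightarrow> Cod V (nat_proj V X Y F G x) = VHom Y (FO F x) (FO G x)"
  using natural_family_simps[OF nat_proj_natural[OF assms]] by auto

text \<open>The projections of an end are jointly monic, since both arrows factor one natural
  family. Equations in functor categories are thereby reduced to one object at a time.\<close>

lemma nat_ext:
  assumes "has_ends X Y" "F \<in> vfun X Y" "G \<in> vfun X Y"
    and "f \<in> Arr V" "g \<in> Arr V" "Dom V f = z" "Dom V g = z" "Cod V f = nat_obj V X Y F G" "Cod V g
        = nat_obj V X Y F G"
    and eq: "\<And>x. x \<in> VObj X \<Longrightarrow> nat_proj V X Y F G x \<cdot> f = nat_proj V X Y F G x \<cdot> g"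
    and XY: "vcat X" "vcat Y"
  shows "f = g"
proof -
  have z: "z \<in> Obj V" using assms(4,6) Dom_Obj' by blast
  have "natural_family V X Y F G z (\<lambda>x. nat_proj V X Y F G x \<cdot> g)"
  proof (rule natural_familyI, goal_cases)
    case p: (7 x y \<Gamma> s t)
    interpret environment V \<Gamma> by (rule p)
    from p assms(1-9) XY show ?case
      using natural_family_el[OF nat_proj_natural[OF assms(1-3)], of x y "emap g s" t] by simp
  qed (use assms z in simp_all)
  then have "\<exists>!h. h \<in> Hom V z (nat_obj V X Y F G) \<and> (\<forall>x\<in>VObj X. nat_proj V X Y F G x \<cdot> h = nat_proj V X Y F G x \<cdot> g)"
    using nat_end[OF assms(1-3)] unfolding is_hom_end_def by blast
  then show ?thesis using assms(4-9) eq by (metis Hom_iff)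
qed

lemma nat_lift:
  assumes "has_ends X Y" "F \<in> vfun X Y" "G \<in> vfun X Y" "natural_family V X Y F G z q"
  shows "\<exists>!h. h \<in> Hom V z (nat_obj V X Y F G) \<and> (\<forall>x\<in>VObj X. nat_proj V X Y F G x \<cdot> h = q x)"
  using nat_end[OF assms(1-3)] assms(4) unfolding is_hom_end_def by blast

lemma functor_cat_simps [simp]:
  "VObj (functor_cat V X Y) = vfun X Y" "VHom (functor_cat V X Y) = nat_obj V X Y"
  by (simp_all add: functor_cat_def)

text \<open>Justifies the definite description in \<open>functor_cat\<close>: the pointwise
  composites form a natural family, by naturality of the first factor and then of the
  second.\<close>

lemma functor_cat_Comp:
  assumes "has_ends X Y" "vcat X" "vcat Y" "F \<in> vfun X Y" "G \<in> vfun X Y" "H \<in> vfun X Y"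
  shows "VComp (functor_cat V X Y) F G H \<in> Hom V (nat_obj V X Y G H \<otimes> nat_obj V X Y F G) (nat_obj V X Y F H) \<and>
        (\<forall>x\<in>VObj X. nat_proj V X Y F H x \<cdot> VComp (functor_cat V X Y) F G H
           = VComp Y (FO F x) (FO G x) (FO H x) \<cdot> (nat_proj V X Y G H x \<boxtimes> nat_proj V X Y F G x))"
proof -
  have "natural_family V X Y F H (nat_obj V X Y G H \<otimes> nat_obj V X Y F G)
    (\<lambda>x. VComp Y (FO F x) (FO G x) (FO H x) \<cdot> (nat_proj V X Y G H x \<boxtimes> nat_proj V X Y F G x))"
    unfolding natural_family_def
  proof (intro conjI ballI)
    fix x y assume xy: "x \<in> VObj X" "y \<in> VObj X"
    let ?c = "\<lambda>x. VComp Y (FO F x) (FO G x) (FO H x) \<cdot> (nat_proj V X Y G H x \<boxtimes> nat_proj V X Y F G x)"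
    show "VComp Y (FO F x) (FO F y) (FO H y) \<cdot> (?c y \<boxtimes> FA F x y)
       = VComp Y (FO F x) (FO H x) (FO H y) \<cdot> (FA H x y \<boxtimes> ?c x)
           \<cdot> \<sigma> (nat_obj V X Y G H \<otimes> nat_obj V X Y F G) (VHom X x y)"
    proof (rule ext3[of _ _ "nat_obj V X Y G H" "nat_obj V X Y F G" "VHom X x y"], goal_cases)
      case p: (8 \<Gamma> r s t)
      interpret environment V \<Gamma> by (rule p)
      have 1: "emap (VComp Y (FO F x) (FO F y) (FO G y)) (pr (emap (nat_proj V X Y F G y) s) (emap (FA F x y) t))
        = emap (VComp Y (FO F x) (FO G x) (FO G y)) (pr (emap (FA G x y) t) (emap (nat_proj V X Y F G x) s))"
        by (rule natural_family_el[OF nat_proj_natural]) (use p assms xy in simp_all)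
      have 2: "emap (VComp Y (FO G x) (FO G y) (FO H y)) (pr (emap (nat_proj V X Y G H y) r) (emap (FA G x y) t))
        = emap (VComp Y (FO G x) (FO H x) (FO H y)) (pr (emap (FA H x y) t) (emap (nat_proj V X Y G H x) r))"
        by (rule natural_family_el[OF nat_proj_natural]) (use p assms xy in simp_all)
      have "emap (VComp Y (FO F x) (FO G y) (FO H y)) (pr (emap (nat_proj V X Y G H y) r)
          (emap (VComp Y (FO F x) (FO G x) (FO G y)) (pr (emap (FA G x y) t) (emap (nat_proj V X Y F G x) s))))
        = emap (VComp Y (FO F x) (FO G x) (FO H y)) (pr (emap (VComp Y (FO G x) (FO G y) (FO H y)) (pr (emap
            (nat_proj V X Y G H y) r) (emap (FA G x y) t))) (emap (nat_proj V X Y F G x) s))"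
        using p(2-) assms xy by simp
      with 1 2 p(2-) assms xy show ?case by simp
    qed (use assms xy in simp_all)
  qed (use assms in \<open>auto simp: Hom_iff\<close>)
  from theI'[OF nat_lift[OF assms(1,4,6) this]] show ?thesis
    unfolding functor_cat_def by simp
qed

lemma functor_cat_Id:
  assumes "has_ends X Y" "vcat X" "vcat Y" "F \<in> vfun X Y"
  shows "VId (functor_cat V X Y) F \<in> Hom V \<I> (nat_obj V X Y F F) \<and>
        (\<forall>x\<in>VObj X. nat_proj V X Y F F x \<cdot> VId (functor_cat V X Y) F = VId Y (FO F x))"
proof -
  have "natural_family V X Y F F \<I> (\<lambda>x. VId Y (FO F x))"
    unfolding natural_family_def
  proof (intro conjI ballI)
    fix x y assume xy: "x \<in> VObj X" "y \<in> VObj X"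
    have "VComp Y (FO F x) (FO F y) (FO F y) \<cdot> (VId Y (FO F y) \<boxtimes> FA F x y) \<cdot> invr (\<lambda>\<lambda> (VHom X x y))
       = VComp Y (FO F x) (FO F x) (FO F y) \<cdot> (FA F x y \<boxtimes> VId Y (FO F x)) \<cdot> \<sigma> \<I> (VHom X x y) \<cdot> invr (\<lambda>\<lambda> (VHom X x y))"
    proof (rule ext1[of _ _ "VHom X x y"], goal_cases)
      case p: (5 \<Gamma> t)
      interpret environment V \<Gamma> by (rule p)
      from p(2-) assms xy show ?case by simp
    qed (use assms xy in simp_all)
    then have "(VComp Y (FO F x) (FO F y) (FO F y) \<cdot> (VId Y (FO F y) \<boxtimes> FA F x y)) \<cdot> invr (\<lambda>\<lambda> (VHom X x y))
       = (VComp Y (FO F x) (FO F x) (FO F y) \<cdot> (FA F x y \<boxtimes> VId Y (FO F x)) \<cdot> \<sigma> \<I> (VHom X x y))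
           \<cdot> invr (\<lambda>\<lambda> (VHom X x y))"
      using assms xy by simp
    then show "VComp Y (FO F x) (FO F y) (FO F y) \<cdot> (VId Y (FO F y) \<boxtimes> FA F x y)
       = VComp Y (FO F x) (FO F x) (FO F y) \<cdot> (FA F x y \<boxtimes> VId Y (FO F x)) \<cdot> \<sigma> \<I> (VHom X x y)"
      by (rule iso_cancel_r[rotated -1]) (use assms xy in simp_all)
  qed (use assms in \<open>auto simp: Hom_iff\<close>)
  from theI'[OF nat_lift[OF assms(1,4,4) this]] show ?thesis
    unfolding functor_cat_def by simp
qed

lemma functor_cat_Arr [simp]:
  assumes "has_ends X Y" "vcat X" "vcat Y" "F \<in> vfun X Y" 
  shows "G \<in> vfun X Y \<Longrightarrow> H \<in> vfun X Y \<Longrightarrow> VComp (functor_cat V X Y) F G H \<in> Arr V"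
   "G \<in> vfun X Y \<Longrightarrow> H \<in> vfun X Y \<Longrightarrow> Dom V (VComp (functor_cat V X Y) F G H) = nat_obj V X Y G H \<otimes> nat_obj V X Y F G"
   "G \<in> vfun X Y \<Longrightarrow> H \<in> vfun X Y \<Longrightarrow> Cod V (VComp (functor_cat V X Y) F G H) = nat_obj V X Y F H"
   "VId (functor_cat V X Y) F \<in> Arr V" "Dom V (VId (functor_cat V X Y) F) = \<I>" "Cod V (VId (functor_cat V X Y) F)
       = nat_obj V X Y F F"
  using functor_cat_Comp[OF assms] functor_cat_Id[OF assms] by (auto simp: Hom_iff)

end

context environment
begin

lemma nat_proj_Comp [simp]:
  assumes "has_ends X Y" "vcat X" "vcat Y" "F \<in> vfun X Y" "G \<in> vfun X Y" "H \<in> vfun X Y" "x \<in> VObj X"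
    and "el s" "el t" "ctx s \<inter> ctx t = {}" "ty s = nat_obj V X Y G H" "ty t = nat_obj V X Y F G"
  shows "nat_proj V X Y F H x \<bullet> VComp (functor_cat V X Y) F G H \<bullet> (s \<diamondop> t)
           = VComp Y (FO F x) (FO G x) (FO H x) \<bullet> ((nat_proj V X Y G H x \<bullet> s) \<diamondop> (nat_proj V X Y F G x \<bullet> t))"
proof -
  have "(nat_proj V X Y F H x \<cdot> VComp (functor_cat V X Y) F G H) \<bullet> (s \<diamondop> t)
     = (VComp Y (FO F x) (FO G x) (FO H x) \<cdot> (nat_proj V X Y G H x \<boxtimes> nat_proj V X Y F G x)) \<bullet> (s \<diamondop> t)"
    using functor_cat_Comp[OF assms(1-6)] assms(7) by simp
  then show ?thesis using assms by simp
qed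

end

context symmetric_monoidal_closed
begin

text \<open>Each law is tested by the projections of the end, where it becomes the corresponding law
  of \<open>Y\<close>.\<close>

lemma vcat_functor_cat:
  assumes "has_ends X Y" "vcat X" "vcat Y"
  shows "vcat (functor_cat V X Y)"
  unfolding vcategory_def functor_cat_simps
proof (intro conjI ballI)
  fix F G H K assume F: "F \<in> vfun X Y" and G: "G \<in> vfun X Y" and H: "H \<in> vfun X Y" and K: "K \<in> vfun X Y"
  let ?C = "functor_cat V X Y" and ?N = "nat_obj V X Y"
  note asm = assms F G H K
  show "VComp ?C F G K \<cdot> (VComp ?C G H K \<boxtimes> \<one> (?N F G))
          = VComp ?C F H K \<cdot> (\<one> (?N H K) \<boxtimes> VComp ?C F G H) \<cdot> \<alpha> (?N H K) (?N G H) (?N F G)"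
  proof (rule nat_ext[of X Y F K], goal_cases)
    case (10 x)
    note asm = asm this
    show ?case
    proof (rule ext3[of _ _ "?N H K" "?N G H" "?N F G"], goal_cases)
      case p: (8 \<Gamma> r s t)
      interpret environment V \<Gamma> by (rule p)
      from p(2-) asm show ?case by simp
    qed (use asm in simp_all)
  qed (use asm in simp_all)
  show "VComp ?C F G G \<cdot> (VId ?C G \<boxtimes> \<one> (?N F G)) = \<lambda>\<lambda> (?N F G)"
  proof (rule nat_ext[of X Y F G], goal_cases)
    case (10 x)
    note asm = asm this
    have "nat_proj V X Y F G x \<cdot> VComp ?C F G G \<cdot> (VId ?C G \<boxtimes> \<one> (?N F G)) =
      (VComp Y (FO F x) (FO G x) (FO G x) \<cdot> (nat_proj V X Y G G x \<boxtimes> nat_proj V X Y F G x)) \<cdot> (VId ?C G \<boxtimes> \<one> (?N F G))"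
      using tail[of "nat_proj V X Y F G x" "VComp ?C F G G"] functor_cat_Comp[of X Y F G G] asm by simp
    also have "\<dots> = VComp Y (FO F x) (FO G x) (FO G x) \<cdot> (VId Y (FO G x) \<boxtimes> \<one> (VHom Y (FO F x) (FO G x)))
        \<cdot> (\<one> \<I> \<boxtimes> nat_proj V X Y F G x)"
      using functor_cat_Id[of X Y G] asm by (simp add: tens_cmp)
    also have "\<dots> = (VComp Y (FO F x) (FO G x) (FO G x) \<cdot> (VId Y (FO G x) \<boxtimes> \<one> (VHom Y (FO F x) (FO G x))))
        \<cdot> (\<one> \<I> \<boxtimes> nat_proj V X Y F G x)"
      using asm by simp
    also have "VComp Y (FO F x) (FO G x) (FO G x) \<cdot> (VId Y (FO G x) \<boxtimes> \<one> (VHom Y (FO F x) (FO G x)))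
        = \<lambda>\<lambda> (VHom Y (FO F x) (FO G x))"
      using asm(3) vfun_simps(1)[OF F] vfun_simps(1)[OF G] 10 by (simp add: vcategory_def)
    finally show ?case using lunit_nat'[of "nat_proj V X Y F G x"] asm by simp
  qed (use asm in simp_all)
  show "VComp ?C F F G \<cdot> (\<one> (?N F G) \<boxtimes> VId ?C F) = \<rho> (?N F G)"
  proof (rule nat_ext[of X Y F G], goal_cases)
    case (10 x)
    note asm = asm this
    have "nat_proj V X Y F G x \<cdot> VComp ?C F F G \<cdot> (\<one> (?N F G) \<boxtimes> VId ?C F) =
      (VComp Y (FO F x) (FO F x) (FO G x) \<cdot> (nat_proj V X Y F G x \<boxtimes> nat_proj V X Y F F x)) \<cdot> (\<one> (?N F G) \<boxtimes> VId ?C F)"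
      using tail[of "nat_proj V X Y F G x" "VComp ?C F F G"] functor_cat_Comp[of X Y F F G] asm by simp
    also have "\<dots> = VComp Y (FO F x) (FO F x) (FO G x) \<cdot> (\<one> (VHom Y (FO F x) (FO G x)) \<boxtimes> VId Y (FO F x))
        \<cdot> (nat_proj V X Y F G x \<boxtimes> \<one> \<I>)"
      using functor_cat_Id[of X Y F] asm by (simp add: tens_cmp)
    also have "\<dots> = (VComp Y (FO F x) (FO F x) (FO G x) \<cdot> (\<one> (VHom Y (FO F x) (FO G x)) \<boxtimes> VId Y (FO F x)))
        \<cdot> (nat_proj V X Y F G x \<boxtimes> \<one> \<I>)"
      using asm by simp
    also have "VComp Y (FO F x) (FO F x) (FO G x) \<cdot> (\<one> (VHom Y (FO F x) (FO G x)) \<boxtimes> VId Y (FO F x))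
        = \<rho> (VHom Y (FO F x) (FO G x))"
      using asm(3) vfun_simps(1)[OF F] vfun_simps(1)[OF G] 10 by (simp add: vcategory_def)
    finally show ?case using runit_nat'[of "nat_proj V X Y F G x"] asm by simp
  qed (use asm in simp_all)
qed (use assms in \<open>simp_all add: Hom_iff\<close>)

lemma curry_Cmp:
  assumes "f \<in> Arr V" "a \<in> Obj V" "b \<in> Obj V" "Dom V f = a \<otimes> b" "Cod V f = c" "q \<in> Arr V" "Dom V q = z" "Cod V q = a"
  shows "curry a b c f \<cdot> q = curry z b c (f \<cdot> (q \<boxtimes> \<one> b))"
proof -
  have [simp]: "c \<in> Obj V" "z \<in> Obj V" using Cod_Obj'[OF assms(1)] Dom_Obj'[OF assms(6)] assms by simp_all
  show ?thesis
  proof (rule ihom_ext1[of _ _ z b c], goal_cases)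
    case p: (10 \<Gamma> s t)
    interpret environment V \<Gamma> by (rule p)
    from p(2-) assms show ?case by simp
  qed (use assms in simp_all)
qed

lemma curry_inj:
  assumes "f \<in> Arr V" "g \<in> Arr V" "a \<in> Obj V" "b \<in> Obj V" "Dom V f = a \<otimes> b" "Dom V g = a \<otimes> b" "Cod V f
      = c" "Cod V g = c"
  shows "curry a b c f = curry a b c g \<longleftrightarrow> f = g"
  using curry_spec(2)[of f a b c] curry_spec(2)[of g a b c] assms by metis

section \<open>Extension of families and cocones from representatives\<close>

definition natural_at :: "('a, 'v, 'm) vcat \<Rightarrow> ('b, 'v, 'm) vcat \<Rightarrow> ('a, 'b, 'm) vfun \<Rightarrow> ('a, 'b, 'm) vfun \<Rightarrow>
     'v \<Rightarrow> ('a \<Rightarrow> 'm) \<Rightarrow> 'a \<Rightarrow> 'a \<Rightarrow> bool" where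
  "natural_at X Y F G z q x y \<longleftrightarrow> VComp Y (FO F x) (FO F y) (FO G y) \<cdot> (q y \<boxtimes> FA F x y)
          = VComp Y (FO F x) (FO G x) (FO G y) \<cdot> (FA G x y \<boxtimes> q x) \<cdot> \<sigma> z (VHom X x y)"

text \<open>Transposing the hom-object out of the domain turns naturality at \<open>x\<close>,
  \<open>y\<close> into an equation between composites of fixed arrows with \<open>q y\<close> and
  with \<open>q x\<close>. This is the form that \<open>graph_limit_exists\<close> can
  impose.\<close>

lemma natural_at_iff:
  assumes "vcat X" "vcat Y" "F \<in> vfun X Y" "G \<in> vfun X Y" "x \<in> VObj X" "y \<in> VObj X" "z \<in> Obj V"
    "q x \<in> Arr V" "Dom V (q x) = z" "Cod V (q x) = VHom Y (FO F x) (FO G x)"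
    "q y \<in> Arr V" "Dom V (q y) = z" "Cod V (q y) = VHom Y (FO F y) (FO G y)"
  shows "natural_at X Y F G z q x y \<longleftrightarrow>
    curry (VHom Y (FO F y) (FO G y)) (VHom X x y) (VHom Y (FO F x) (FO G y)) (VComp Y (FO F x) (FO F y) (FO G y)
        \<cdot> (\<one> (VHom Y (FO F y) (FO G y)) \<boxtimes> FA F x y)) \<cdot> q y
    = curry (VHom Y (FO F x) (FO G x)) (VHom X x y) (VHom Y (FO F x) (FO G y))
       (VComp Y (FO F x) (FO G x) (FO G y) \<cdot> (FA G x y \<boxtimes> \<one> (VHom Y (FO F x) (FO G x)))
           \<cdot> \<sigma> (VHom Y (FO F x) (FO G x)) (VHom X x y)) \<cdot> q x"
proof -
  have "\<sigma> (VHom Y (FO F x) (FO G x)) (VHom X x y) \<cdot> (q x \<boxtimes> \<one> (VHom X x y))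
      = (\<one> (VHom X x y) \<boxtimes> q x) \<cdot> \<sigma> z (VHom X x y)"
    using symm_nat'[of "q x" "\<one> (VHom X x y)"] assms by simp
  then show ?thesis
    unfolding natural_at_def using assms by (simp add: curry_Cmp curry_inj tens_cmp tens_cmp_tail)
qed

end

context environment
begin

lemma natural_at_el:
  assumes "natural_at X Y F G z q x y" "vcat X" "vcat Y" "F \<in> vfun X Y" "G \<in> vfun X Y" "x \<in> VObj X" "y \<in> VObj X"
    "q x \<in> Arr V" "Dom V (q x) = z" "Cod V (q x) = VHom Y (FO F x) (FO G x)"
    "q y \<in> Arr V" "Dom V (q y) = z" "Cod V (q y) = VHom Y (FO F y) (FO G y)"
    and "el s" "el t" "ctx s \<inter> ctx t = {}" "ty s = z" "ty t = VHom X x y"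
  shows "VComp Y (FO F x) (FO F y) (FO G y) \<bullet> ((q y \<bullet> s) \<diamondop> (FA F x y \<bullet> t))
    = VComp Y (FO F x) (FO G x) (FO G y) \<bullet> ((FA G x y \<bullet> t) \<diamondop> (q x \<bullet> s))"
proof -
  have "z \<in> Obj V" using ty_Obj[OF assms(14)] assms(17) by simp
  moreover have "ctx t \<inter> ctx s = {}" using assms(16) by blast
  moreover have "(VComp Y (FO F x) (FO F y) (FO G y) \<cdot> (q y \<boxtimes> FA F x y)) \<bullet> (s \<diamondop> t)
    = (VComp Y (FO F x) (FO G x) (FO G y) \<cdot> (FA G x y \<boxtimes> q x) \<cdot> \<sigma> z (VHom X x y)) \<bullet> (s \<diamondop> t)"
    using assms(1) by (simp only: natural_at_def)
  ultimately show ?thesis using assms(2-) by simp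
qed

end

context symmetric_monoidal_closed
begin

text \<open>On elements, this is \<open>G (j x)\<close> after \<open>q (rep x)\<close> after
  \<open>F (i x)\<close>; the inverse unitors supply the two constant factors.\<close>

definition extend_family where
  "extend_family X Y F G rep i j z q x = VComp Y (FO F x) (FO G (rep x)) (FO G x) \<cdot>
      ((FA G (rep x) x \<cdot> j x) \<boxtimes> (VComp Y (FO F x) (FO F (rep x)) (FO G (rep x)) \<cdot> (q (rep x) \<boxtimes> (FA F x (rep x)
          \<cdot> i x)) \<cdot> invr (\<rho> z))) \<cdot> invr (\<lambda>\<lambda> z)"

text \<open>
  A natural family on a set of representatives of the objects extends to all objects by conjugation
  with the chosen isomorphisms; only \<open>j x \<cdot> i x = 1\<close> is used.
\<close>

lemma natural_family_extend:
  assumes X: "vcat X" "vcat Y" and FG: "F \<in> vfun X Y" "G \<in> vfun X Y"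
    and reps: "representatives X R rep i j"
  defines "ex \<equiv> extend_family X Y F G rep i j"
  shows "z \<in> Obj V \<Longrightarrow> (\<And>x. x \<in> R \<Longrightarrow> q x \<in> Arr V \<and> Dom V (q x) = z \<and> Cod V (q x) = VHom Y (FO F x) (FO G x)) \<Longrightarrow>
      (\<And>x y. x \<in> R \<Longrightarrow> y \<in> R \<Longrightarrow> natural_at X Y F G z q x y) \<Longrightarrow> natural_family V X Y F G z (ex z q)"
    and "natural_at X Y F G z q' x (rep x) \<Longrightarrow> x \<in> VObj X \<Longrightarrow>
      (\<And>y. y \<in> {x, rep x} \<Longrightarrow> q' y \<in> Arr V \<and> Dom V (q' y) = z \<and> Cod V (q' y) = VHom Y (FO F y) (FO G y)) \<Longrightarrow>
          ex z q' x = q' x"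
    and "z \<in> Obj V \<Longrightarrow> (\<And>x. x \<in> R \<Longrightarrow> q x \<in> Arr V \<and> Dom V (q x) = z \<and> Cod V (q x) = VHom Y (FO F x) (FO G x)) \<Longrightarrow>
      h \<in> Arr V \<Longrightarrow> Dom V h = w \<Longrightarrow> Cod V h = z \<Longrightarrow> x \<in> VObj X \<Longrightarrow> ex z q x \<cdot> h = ex w (\<lambda>x. q x \<cdot> h) x"
proof -
  have R: "R \<subseteq> VObj X" "\<And>x. x \<in> VObj X \<Longrightarrow> rep x \<in> R"
    and i: "\<And>x. x \<in> VObj X \<Longrightarrow> i x \<in> Arr V \<and> Dom V (i x) = \<I> \<and> Cod V (i x) = VHom X x (rep x)"
    and j: "\<And>x. x \<in> VObj X \<Longrightarrow> j x \<in> Arr V \<and> Dom V (j x) = \<I> \<and> Cod V (j x) = VHom X (rep x) x"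
    and ji: "\<And>x. x \<in> VObj X \<Longrightarrow> VComp X x (rep x) x \<cdot> (j x \<boxtimes> i x) = VId X x \<cdot> \<lambda>\<lambda> \<I>"
    using reps unfolding representatives_def by blast+
  have rep: "\<And>x. x \<in> VObj X \<Longrightarrow> rep x \<in> VObj X" using R by blast
  note asm = X FG i j rep
  have exT: "ex z q x \<in> Arr V \<and> Dom V (ex z q x) = z \<and> Cod V (ex z q x) = VHom Y (FO F x) (FO G x)"
    if "x \<in> VObj X" "z \<in> Obj V" "q (rep x) \<in> Arr V \<and> Dom V (q (rep x)) = z \<and> Cod V (q (rep x))
        = VHom Y (FO F (rep x)) (FO G (rep x))" for z q x
    using asm that by (simp add: ex_def extend_family_def)
  have exE: "App (ex z q x) s = App (VComp Y (FO F x) (FO G (rep x)) (FO G x))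
      (Pr \<Gamma> (App (FA G (rep x) x) (App (j x) (Star)))
        (App (VComp Y (FO F x) (FO F (rep x)) (FO G (rep x)))
          (Pr \<Gamma> (App (q (rep x)) s) (App (FA F x (rep x)) (App (i x) (Star))))))"
    if "environment V \<Gamma>" "El \<Gamma> s" "Ty s = z" 
     "x \<in> VObj X" "z \<in> Obj V" "q (rep x) \<in> Arr V \<and> Dom V (q (rep x)) = z \<and> Cod V (q (rep x))
         = VHom Y (FO F (rep x)) (FO G (rep x))" for \<Gamma> s z q x
  proof -
    interpret environment V \<Gamma> by (rule that)
    show ?thesis using that(2-) asm by (simp add: ex_def extend_family_def)
  qed
  show "natural_family V X Y F G z (ex z q)"
    if z: "z \<in> Obj V" and q: "\<And>x. x \<in> R \<Longrightarrow> q x \<in> Arr V \<and> Dom V (q x) = z \<and> Cod V (q x) = VHom Y (FO F x) (FO G x)"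
     and nat: "\<And>x y. x \<in> R \<Longrightarrow> y \<in> R \<Longrightarrow> natural_at X Y F G z q x y"
  proof (rule natural_familyI[OF X FG z])
    have qr: "q (rep x) \<in> Arr V \<and> Dom V (q (rep x)) = z \<and> Cod V (q (rep x))
        = VHom Y (FO F (rep x)) (FO G (rep x))" if "x \<in> VObj X" for x
      using q R(2) that by blast
    show "ex z q x \<in> Arr V \<and> Dom V (ex z q x) = z \<and> Cod V (ex z q x) = VHom Y (FO F x) (FO G x)" if "x \<in> VObj X" for x
      using exT[OF that z, of q] qr that by blast
    fix x y \<Gamma> s t
    assume xy: "x \<in> VObj X" "y \<in> VObj X" and G: "environment V \<Gamma>" and
      st: "El \<Gamma> s" "El \<Gamma> t" "Ty s = z" "Ty t = VHom X x y"
       "Ctx s = {0}" "Ctx t = {Suc 0}"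
    interpret environment V \<Gamma> by (rule G)
    note asm = asm xy qr st z
    define I where "I x = emap (i x) star" for x
    define J where "J x = emap (j x) star" for x
    have I: "el (I x)" "ty (I x) = VHom X x (rep x)" "ctx (I x) = {}" "el (J x)" "ty (J x)
        = VHom X (rep x) x" "ctx (J x) = {}"
      if "x \<in> VObj X" for x using asm that by (simp_all add: I_def J_def)
    have JI: "emap (VComp X x (rep x) x) (pr (J x) (I x)) = emap (VId X x) star" if "x \<in> VObj X" for x
    proof -
      have "emap (VComp X x (rep x) x \<cdot> (j x \<boxtimes> i x)) (pr star star) = emap (VId X x \<cdot> \<lambda>\<lambda> \<I>) (pr star star)"
        using ji[OF that] by simp
      then show ?thesis using asm that by (simp add: I_def J_def)
    qed
    \<comment> \<open>The conjugate of \<open>t\<close>, from \<open>rep x\<close> to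
      \<open>rep y\<close>. Since \<open>j\<close> cancels \<open>i\<close>, it satisfies
      \<open>kI\<close> and \<open>Jk\<close>, through which naturality of \<open>q\<close> at
      \<open>k\<close> yields naturality of the extension at \<open>t\<close>.\<close>
    define k where "k = emap (VComp X (rep x) y (rep y)) (pr (I y) (emap (VComp X (rep x) x y) (pr t (J x))))"
    have k: "el k" "ty k = VHom X (rep x) (rep y)" "ctx k = {Suc 0}"
      using asm I by (simp_all add: k_def)
    note asm = asm I k
    have kI: "emap (VComp X x (rep x) (rep y)) (pr k (I x)) = emap (VComp X x y (rep y)) (pr (I y) t)"
      using asm by (simp add: k_def JI)
    have Jk: "emap (VComp X (rep x) (rep y) y) (pr (J y) k) = emap (VComp X (rep x) x y) (pr t (J x))"
    proof -
      have "emap (VComp X (rep x) (rep y) y) (pr (J y) k)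
          = emap (VComp X (rep x) y y) (pr (emap (VComp X y (rep y) y) (pr (J y) (I y))) (emap (VComp X (rep x) x
          y) (pr t (J x))))"
        using asm by (simp add: k_def)
      also have "\<dots> = emap (VComp X (rep x) x y) (pr t (J x))"
        using asm by (simp only: JI) simp
      finally show ?thesis .
    qed
    have 1: "emap (VComp Y (FO F x) (FO F y) (FO F (rep y))) (pr (emap (FA F y (rep y)) (I y)) (emap (FA F x y) t))
      = emap (VComp Y (FO F x) (FO F (rep x)) (FO F (rep y))) (pr (emap (FA F (rep x) (rep y)) k) (emap (FA F x
          (rep x)) (I x)))"
      using arg_cong[OF kI, of "emap (FA F x (rep y))"] asm by simp
    have 2: "emap (VComp Y (FO G (rep x)) (FO G (rep y)) (FO G y)) (pr (emap (FA G (rep y) y) (J y)) (emap (FA G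
        (rep x) (rep y)) k))
      = emap (VComp Y (FO G (rep x)) (FO G x) (FO G y)) (pr (emap (FA G x y) t) (emap (FA G (rep x) x) (J x)))"
      using arg_cong[OF Jk, of "emap (FA G (rep x) y)"] asm by simp
    have 3: "emap (VComp Y (FO F (rep x)) (FO F (rep y)) (FO G (rep y))) (pr (emap (q (rep y)) s) (emap (FA F (rep
        x) (rep y)) k))
      = emap (VComp Y (FO F (rep x)) (FO G (rep x)) (FO G (rep y))) (pr (emap (FA G (rep x) (rep y)) k) (emap (q
          (rep x)) s))"
      by (rule natural_at_el[OF nat]) (use asm R in auto)
    let ?c = "\<lambda>a b c s t. emap (VComp Y a b c) (pr s t)"
    let ?q = "\<lambda>x. emap (q (rep x)) s" and ?FI = "\<lambda>x. emap (FA F x (rep x)) (I x)" and ?GJ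
        = "\<lambda>x. emap (FA G (rep x) x) (J x)"
    have "?c (FO F x) (FO F y) (FO G y) (emap (ex z q y) s) (emap (FA F x y) t)
      = ?c (FO F x) (FO F y) (FO G y) (?c (FO F y) (FO G (rep y)) (FO G y) (?GJ y) (?c (FO F y) (FO F (rep y)) (FO
          G (rep y)) (?q y) (?FI y))) (emap (FA F x y) t)"
      using exE[OF G st(1,3) xy(2) z, of q] qr xy by (simp add: I_def J_def)
    also have "\<dots> = ?c (FO F x) (FO G (rep y)) (FO G y) (?GJ y) (?c (FO F x) (FO F (rep y)) (FO G (rep y)) (?q y)
        (?c (FO F x) (FO F y) (FO F (rep y)) (?FI y) (emap (FA F x y) t)))"
      using asm by simp
    also have "\<dots> = ?c (FO F x) (FO G (rep y)) (FO G y) (?GJ y) (?c (FO F x) (FO F (rep x)) (FO G (rep y)) (?c (FO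
        F (rep x)) (FO F (rep y)) (FO G (rep y)) (?q y) (emap (FA F (rep x) (rep y)) k)) (?FI x))"
      unfolding 1 using asm by simp
    also have "\<dots> = ?c (FO F x) (FO G (rep x)) (FO G y) (?c (FO G (rep x)) (FO G (rep y)) (FO G y) (?GJ y) (emap
        (FA G (rep x) (rep y)) k)) (?c (FO F x) (FO F (rep x)) (FO G (rep x)) (?q x) (?FI x))"
      unfolding 3 using asm by simp
    also have "\<dots> = ?c (FO F x) (FO G x) (FO G y) (emap (FA G x y) t) (?c (FO F x) (FO G (rep x)) (FO G x) (?GJ x)
        (?c (FO F x) (FO F (rep x)) (FO G (rep x)) (?q x) (?FI x)))"
      unfolding 2 using asm by simp
    also have "\<dots> = ?c (FO F x) (FO G x) (FO G y) (emap (FA G x y) t) (emap (ex z q x) s)"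
      using exE[OF G st(1,3) xy(1) z, of q] qr xy by (simp add: I_def J_def)
    finally show "?c (FO F x) (FO F y) (FO G y) (emap (ex z q y) s) (emap (FA F x y) t)
      = ?c (FO F x) (FO G x) (FO G y) (emap (FA G x y) t) (emap (ex z q x) s)" .
  qed
  show "ex z q' x = q' x" if q: "natural_at X Y F G z q' x (rep x)" and x: "x \<in> VObj X"
    and qT: "\<And>y. y \<in> {x, rep x} \<Longrightarrow> q' y \<in> Arr V \<and> Dom V (q' y) = z \<and> Cod V (q' y) = VHom Y (FO F y) (FO G y)"
  proof (rule ext1[of _ _ z], goal_cases)
    case p: (5 \<Gamma> s)
    interpret environment V \<Gamma> by (rule p)
    have z: "z \<in> Obj V" using ty_Obj[OF p(2)] p(3) by simp
    have q': "q' x \<in> Arr V \<and> Dom V (q' x) = z \<and> Cod V (q' x) = VHom Y (FO F x) (FO G x)"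
      "q' (rep x) \<in> Arr V \<and> Dom V (q' (rep x)) = z \<and> Cod V (q' (rep x)) = VHom Y (FO F (rep x)) (FO G (rep x))"
      using qT by blast+
    note asm = asm q' x p(2-) z
    define I where "I = emap (i x) star"
    define J where "J = emap (j x) star"
    have I: "el I" "ty I = VHom X x (rep x)" "ctx I = {}" "el J" "ty J = VHom X (rep x) x" "ctx J = {}"
      using asm by (simp_all add: I_def J_def)
    have "emap (VComp X x (rep x) x \<cdot> (j x \<boxtimes> i x)) (pr star star) = emap (VId X x \<cdot> \<lambda>\<lambda> \<I>) (pr star star)"
      using ji[OF x] by simp
    then have JI: "emap (VComp X x (rep x) x) (pr J I) = emap (VId X x) star"
      using asm by (simp add: I_def J_def)
    let ?c = "\<lambda>a b c s t. emap (VComp Y a b c) (pr s t)"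
    \<comment> \<open>Naturality of \<open>q'\<close> at \<open>i x\<close> moves \<open>i x\<close>
      to the other side of \<open>q'\<close>, where \<open>j x\<close> cancels it.\<close>
    have 1: "?c (FO F x) (FO F (rep x)) (FO G (rep x)) (emap (q' (rep x)) s) (emap (FA F x (rep x)) I)
        = ?c (FO F x) (FO G x) (FO G (rep x)) (emap (FA G x (rep x)) I) (emap (q' x) s)"
      by (rule natural_at_el[OF q]) (use asm I in auto)
    have 2: "?c (FO G x) (FO G (rep x)) (FO G x) (emap (FA G (rep x) x) J) (emap (FA G x (rep x)) I)
        = emap (VId Y (FO G x)) star"
      using arg_cong[OF JI, of "emap (FA G x x)"] asm I by simp
    have "emap (ex z q' x) s = ?c (FO F x) (FO G (rep x)) (FO G x) (emap (FA G (rep x) x) J)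
      (?c (FO F x) (FO F (rep x)) (FO G (rep x)) (emap (q' (rep x)) s) (emap (FA F x (rep x)) I))"
      using exE[OF p(1,2,3) x, of q'] asm by (simp add: I_def J_def)
    also have "\<dots> = ?c (FO F x) (FO G x) (FO G x) (?c (FO G x) (FO G (rep x)) (FO G x) (emap (FA G (rep x) x) J)
        (emap (FA G x (rep x)) I)) (emap (q' x) s)"
      unfolding 1 using asm I by simp
    also have "\<dots> = emap (q' x) s"
      unfolding 2 using asm by simp
    finally show ?case .
  qed (use exT[OF x, of z q'] qT[of x] qT[of "rep x"] Dom_Obj'[of "q' x"] in simp_all)
  show "ex z q x \<cdot> h = ex w (\<lambda>x. q x \<cdot> h) x"
    if z: "z \<in> Obj V" and q: "\<And>x. x \<in> R \<Longrightarrow> q x \<in> Arr V \<and> Dom V (q x) = z \<and> Cod V (q x) = VHom Y (FO F x) (FO G x)"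
      and h: "h \<in> Arr V" "Dom V h = w" "Cod V h = z" and x: "x \<in> VObj X"
  proof -
    have w: "w \<in> Obj V" using h Dom_Obj' by blast
    have qr: "q (rep x) \<in> Arr V \<and> Dom V (q (rep x)) = z \<and> Cod V (q (rep x)) = VHom Y (FO F (rep x)) (FO G (rep x))"
      using q R(2) x by blast
    show ?thesis
    proof (rule ext1[of _ _ w], goal_cases)
      case p: (5 \<Gamma> s)
      interpret environment V \<Gamma> by (rule p)
      show ?case
        using p(2-) h w x qr exT[OF x z, of q] exE[OF p(1) _ _ x z, of "emap h s" q] exE[OF p(1) p(2,3) x w, of
            "\<lambda>x. q x \<cdot> h"]
        by simp
    qed (use exT[OF x z, of q] exT[OF x w, of "\<lambda>x. q x \<cdot> h"] qr h in simp_all)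
  qed
qed

text \<open>Cocones under the diagram that computes the coend of
  \<open>\<phi> l \<otimes> S l\<close>: the action of \<open>L(l, l')\<close> on \<open>S\<close>
  and its action on \<open>\<phi>\<close> have to agree under \<open>q\<close>. The universal one is
  \<open>\<phi> * S\<close>. The set \<open>R\<close> allows restriction to representatives.\<close>

definition cocone :: "('l, 'v, 'm) vcat \<Rightarrow> ('l, 'v, 'm) vfun \<Rightarrow> ('l, 'v, 'm) vfun \<Rightarrow> 'v \<Rightarrow> ('l \<Rightarrow> 'm) \<Rightarrow> 'l set \<Rightarrow>
    bool" where
  "cocone L \<phi> S d q R \<longleftrightarrow> d \<in> Obj V \<and>
     (\<forall>l\<in>R. q l \<in> Arr V \<and> Dom V (q l) = FO \<phi> l \<otimes> FO S l \<and> Cod V (q l) = d) \<and>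
     (\<forall>l\<in>R. \<forall>l'\<in>R. q l' \<cdot> (\<one> (FO \<phi> l') \<boxtimes> (ev V (FO S l) (FO S l') \<cdot> (FA S l l' \<boxtimes> \<one> (FO S l))))
        = q l \<cdot> ((ev V (FO \<phi> l') (FO \<phi> l) \<cdot> (FA \<phi> l' l \<boxtimes> \<one> (FO \<phi> l')) \<cdot> \<sigma> (FO \<phi> l') (VHom L l l')) \<boxtimes> \<one> (FO S l))
            \<cdot> invr (\<alpha> (FO \<phi> l') (VHom L l l') (FO S l)))"

definition is_colim :: "('l, 'v, 'm) vcat \<Rightarrow> ('l, 'v, 'm) vfun \<Rightarrow> ('l, 'v, 'm) vfun \<Rightarrow> 'v \<Rightarrow> ('l \<Rightarrow> 'm) \<Rightarrow> bool" where
  "is_colim L \<phi> S C \<kappa> \<longleftrightarrow> cocone L \<phi> S C \<kappa> (VObj L) \<and>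
     (\<forall>d q. cocone L \<phi> S d q (VObj L) \<longrightarrow> (\<exists>!h. h \<in> Hom V C d \<and> (\<forall>l\<in>VObj L. h \<cdot> \<kappa> l = q l)))"

lemma cocone_simps [simp]:
  assumes "cocone L \<phi> S d q R"
  shows "d \<in> Obj V" "l \<in> R \<Longrightarrow> q l \<in> Arr V" "l \<in> R \<Longrightarrow> Dom V (q l) = FO \<phi> l \<otimes> FO S l" "l \<in> R \<Longrightarrow> Cod V (q l) = d"
  using assms by (auto simp: cocone_def)

end

lemma (in environment) cocone_el:
  assumes "cocone L \<phi> S d q R" "vcat L" "\<phi> \<in> vfun (op L) \<V>" "S \<in> vfun L \<V>" "R \<subseteq> VObj L" "l \<in> R" "l' \<in> R"
    and "el t" "el f" "el u" "ctx t \<inter> ctx f = {}" "ctx f \<inter> ctx t = {}" "ctx t \<inter> ctx u = {}" "ctx f \<inter> ctx u = {}"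
    and "ty t = FO \<phi> l'" "ty f = VHom L l l'" "ty u = FO S l"
  shows "q l' \<bullet> (t \<diamondop> (ev V (FO S l) (FO S l') \<bullet> ((FA S l l' \<bullet> f) \<diamondop> u)))
    = q l \<bullet> ((ev V (FO \<phi> l') (FO \<phi> l) \<bullet> ((FA \<phi> l' l \<bullet> f) \<diamondop> t)) \<diamondop> u)"
proof -
  have l: "l \<in> VObj L" "l' \<in> VObj L" using assms(5-7) by auto
  have o: "FO \<phi> l \<in> Obj V" "FO \<phi> l' \<in> Obj V" "FO S l \<in> Obj V" "FO S l' \<in> Obj V"
    using vfun_simps(1)[OF assms(3)] vfun_simps(1)[OF assms(4)] l by auto
  have "(q l' \<cdot> (\<one> (FO \<phi> l') \<boxtimes> (ev V (FO S l) (FO S l') \<cdot> (FA S l l' \<boxtimes> \<one> (FO S l))))) \<bullet> (t \<diamondop> (f \<diamondop> u))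
        = (q l \<cdot> ((ev V (FO \<phi> l') (FO \<phi> l) \<cdot> (FA \<phi> l' l \<boxtimes> \<one> (FO \<phi> l')) \<cdot> \<sigma> (FO \<phi> l') (VHom L l l')) \<boxtimes> \<one> (FO S l))
            \<cdot> invr (\<alpha> (FO \<phi> l') (VHom L l l') (FO S l))) \<bullet> (t \<diamondop> (f \<diamondop> u))"
    using assms(1,6,7) by (simp only: cocone_def)
  then show ?thesis using assms(1-4) assms(6-) l o by simp
qed

context symmetric_monoidal_closed
begin

text \<open>\<open>\<phi>\<close> is contravariant, so \<open>j l\<close> acts on
  \<open>\<phi>\<close> and \<open>i l\<close> on \<open>S\<close>; both lead from \<open>l\<close>
  to its representative.\<close>

definition extend_cocone where
  "extend_cocone \<phi> S rep i j q l = q (rep l) \<cdot> ((ev V (FO \<phi> l) (FO \<phi> (rep l)) \<cdot> ((FA \<phi> l (rep l)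
      \<cdot> j l) \<boxtimes> \<one> (FO \<phi> l)) \<cdot> invr (\<lambda>\<lambda> (FO \<phi> l)))
      \<boxtimes> (ev V (FO S l) (FO S (rep l)) \<cdot> ((FA S l (rep l) \<cdot> i l) \<boxtimes> \<one> (FO S l)) \<cdot> invr (\<lambda>\<lambda> (FO S l))))"

text \<open>The counterpart of \<open>natural_family_extend\<close>. The set \<open>R'\<close> of
  the second claim is later taken both as \<open>R\<close> and as the set of all objects.\<close>

lemma cocone_extend:
  assumes L: "vcat L" and F: "\<phi> \<in> vfun (op L) \<V>" "S \<in> vfun L \<V>" and reps: "representatives L R rep i j"
  defines "ex \<equiv> extend_cocone \<phi> S rep i j"
  shows "cocone L \<phi> S d q R \<Longrightarrow> cocone L \<phi> S d (ex q) (VObj L)"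
    and "cocone L \<phi> S d q' R' \<Longrightarrow> R' \<subseteq> VObj L \<Longrightarrow> l \<in> R' \<Longrightarrow> rep l \<in> R' \<Longrightarrow> ex q' l = q' l"
    and "cocone L \<phi> S d q R \<Longrightarrow> h \<in> Arr V \<Longrightarrow> Dom V h = d \<Longrightarrow> l \<in> VObj L \<Longrightarrow> h \<cdot> ex q l = ex (\<lambda>l. h \<cdot> q l) l"
proof -
  have R: "R \<subseteq> VObj L" "\<And>x. x \<in> VObj L \<Longrightarrow> rep x \<in> R"
    and i: "\<And>x. x \<in> VObj L \<Longrightarrow> i x \<in> Arr V \<and> Dom V (i x) = \<I> \<and> Cod V (i x) = VHom L x (rep x)"
    and j: "\<And>x. x \<in> VObj L \<Longrightarrow> j x \<in> Arr V \<and> Dom V (j x) = \<I> \<and> Cod V (j x) = VHom L (rep x) x"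
    and ji: "\<And>x. x \<in> VObj L \<Longrightarrow> VComp L x (rep x) x \<cdot> (j x \<boxtimes> i x) = VId L x \<cdot> \<lambda>\<lambda> \<I>"
    using reps unfolding representatives_def by blast+
  have rep: "\<And>x. x \<in> VObj L \<Longrightarrow> rep x \<in> VObj L" using R by blast
  have o: "x \<in> VObj L \<Longrightarrow> FO \<phi> x \<in> Obj V" "x \<in> VObj L \<Longrightarrow> FO S x \<in> Obj V" for x
    using vfun_simps(1)[OF F(1)] vfun_simps(1)[OF F(2)] by auto
  note asm = L F i j rep o
  have exT: "ex q l \<in> Arr V \<and> Dom V (ex q l) = FO \<phi> l \<otimes> FO S l \<and> Cod V (ex q l) = d"
    if "l \<in> VObj L" "q (rep l) \<in> Arr V \<and> Dom V (q (rep l)) = FO \<phi> (rep l) \<otimes> FO S (rep l) \<and> Cod V (q (rep l))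
        = d" for d q l
    using asm that by (simp add: ex_def extend_cocone_def)
  have exE: "App (ex q l) (Pr \<Gamma> t u) = App (q (rep l))
      (Pr \<Gamma> (App (ev V (FO \<phi> l) (FO \<phi> (rep l))) (Pr \<Gamma> (App (FA \<phi> l (rep l)) (App (j l) (Star))) t))
         (App (ev V (FO S l) (FO S (rep l))) (Pr \<Gamma> (App (FA S l (rep l)) (App (i l) (Star))) u)))"
    if "environment V \<Gamma>" "l \<in> VObj L" "q (rep l) \<in> Arr V \<and> Dom V (q (rep l))
        = FO \<phi> (rep l) \<otimes> FO S (rep l) \<and> Cod V (q (rep l)) = d"
     "El \<Gamma> t" "El \<Gamma> u" "Ty t = FO \<phi> l" "Ty u = FO S l"
     "Ctx t \<inter> Ctx u = {}" for \<Gamma> t u q l d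
  proof -
    interpret environment V \<Gamma> by (rule that)
    show ?thesis using that(2-) asm by (simp add: ex_def extend_cocone_def)
  qed
  show "cocone L \<phi> S d (ex q) (VObj L)" if q: "cocone L \<phi> S d q R"
    unfolding cocone_def
  proof (intro conjI ballI)
    have qr: "q (rep x) \<in> Arr V \<and> Dom V (q (rep x)) = FO \<phi> (rep x) \<otimes> FO S (rep x) \<and> Cod V (q (rep x))
        = d" if "x \<in> VObj L" for x
      using cocone_simps(2-)[OF q] R(2) that by blast
    show "d \<in> Obj V" using q by simp
    have exT': "ex q l \<in> Arr V \<and> Dom V (ex q l) = FO \<phi> l \<otimes> FO S l \<and> Cod V (ex q l) = d" if "l \<in> VObj L" for l
      using exT[OF that, of q d] qr[OF that] by blast
    then show "ex q l \<in> Arr V" "Dom V (ex q l) = FO \<phi> l \<otimes> FO S l" "Cod V (ex q l) = d" if "l \<in> VObj L" for l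
      using that by blast+
    fix l l' assume l: "l \<in> VObj L" "l' \<in> VObj L"
    show "ex q l' \<cdot> (\<one> (FO \<phi> l') \<boxtimes> (ev V (FO S l) (FO S l') \<cdot> (FA S l l' \<boxtimes> \<one> (FO S l))))
        = ex q l \<cdot> ((ev V (FO \<phi> l') (FO \<phi> l) \<cdot> (FA \<phi> l' l \<boxtimes> \<one> (FO \<phi> l')) \<cdot> \<sigma> (FO \<phi> l') (VHom L l l')) \<boxtimes> \<one> (FO S l))
            \<cdot> invr (\<alpha> (FO \<phi> l') (VHom L l l') (FO S l))"
    proof (rule ext3'[of _ _ "FO \<phi> l'" "VHom L l l'" "FO S l"], goal_cases)
      case p: (8 \<Gamma> t f u)
      interpret environment V \<Gamma> by (rule p)
      note asm = asm l p(2-) qr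
      define I where "I x = emap (i x) star" for x
      define J where "J x = emap (j x) star" for x
      have I: "el (I x)" "ty (I x) = VHom L x (rep x)" "ctx (I x) = {}" "el (J x)" "ty (J x)
          = VHom L (rep x) x" "ctx (J x) = {}"
        if "x \<in> VObj L" for x using asm that by (simp_all add: I_def J_def)
      have JI: "emap (VComp L x (rep x) x) (pr (J x) (I x)) = emap (VId L x) star" if "x \<in> VObj L" for x
      proof -
        have "emap (VComp L x (rep x) x \<cdot> (j x \<boxtimes> i x)) (pr star star) = emap (VId L x \<cdot> \<lambda>\<lambda> \<I>) (pr star star)"
          using ji[OF that] by simp
        then show ?thesis using asm that by (simp add: I_def J_def)
      qed
      \<comment> \<open>The conjugate of \<open>f\<close> between the representatives, as for
        natural families.\<close>
      define k where "k = emap (VComp L (rep l) l' (rep l')) (pr (I l') (emap (VComp L (rep l) l l') (pr f (J l))))"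
      have k: "el k" "ty k = VHom L (rep l) (rep l')" "ctx k = {Suc 0}"
        using asm I by (simp_all add: k_def)
      note asm = asm I k
      have kI: "emap (VComp L l (rep l) (rep l')) (pr k (I l)) = emap (VComp L l l' (rep l')) (pr (I l') f)"
        using asm by (simp add: k_def JI)
      have Jk: "emap (VComp L (rep l) (rep l') l') (pr (J l') k) = emap (VComp L (rep l) l l') (pr f (J l))"
      proof -
        have "emap (VComp L (rep l) (rep l') l') (pr (J l') k)
            = emap (VComp L (rep l) l' l') (pr (emap (VComp L l' (rep l') l') (pr (J l') (I l'))) (emap (VComp L
            (rep l) l l') (pr f (J l))))"
          using asm by (simp add: k_def)
        also have "\<dots> = emap (VComp L (rep l) l l') (pr f (J l))"
          using asm by (simp only: JI) simp
        finally show ?thesis .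
      qed
      let ?S = "\<lambda>x y g u. emap (ev V (FO S x) (FO S y)) (pr (emap (FA S x y) g) u)"
      let ?\<phi> = "\<lambda>x y g t. emap (ev V (FO \<phi> x) (FO \<phi> y)) (pr (emap (FA \<phi> x y) g) t)"
      have 1: "?S l' (rep l') (I l') (?S l l' f u) = ?S (rep l) (rep l') k (?S l (rep l) (I l) u)"
        using arg_cong[OF kI, of "\<lambda>e. ?S l (rep l') e u"] asm by simp
      \<comment> \<open>\<open>Jk\<close> is read in the opposite category, on which
        \<open>\<phi>\<close> is a functor, so that its action on the two composites can be
        split.\<close>
      have "?\<phi> l' (rep l) (emap (VComp (op L) l' (rep l') (rep l)) (pr k (J l'))) t
          = ?\<phi> l' (rep l) (emap (VComp (op L) l' l (rep l)) (pr (J l) f)) t"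
        using asm Jk by simp
      then have 2: "?\<phi> (rep l') (rep l) k (?\<phi> l' (rep l') (J l') t) = ?\<phi> l (rep l) (J l) (?\<phi> l' l f t)"
        using asm by (simp del: vop_simps(3) add: vop_simps(2))
      have "emap (ex q l') (pr t (?S l l' f u)) = emap (q (rep l')) (pr (?\<phi> l' (rep l') (J l') t) (?S l' (rep l')
          (I l') (?S l l' f u)))"
        by (subst exE[OF p(1) l(2), of q d]) (use asm in \<open>simp_all add: I_def J_def\<close>)
      also have "\<dots> = emap (q (rep l)) (pr (?\<phi> (rep l') (rep l) k (?\<phi> l' (rep l') (J l') t)) (?S l (rep l) (I l) u))"
        unfolding 1 by (rule cocone_el[OF q L F R(1)]) (use asm R in auto)
      also have "\<dots> = emap (ex q l) (pr (?\<phi> l' l f t) u)"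
        unfolding 2 by (subst exE[OF p(1) l(1), of q d]) (use asm in \<open>simp_all add: I_def J_def\<close>)
      finally show ?case using asm exT' by simp
    qed (use asm l exT' in simp_all)
  qed
  show "ex q' l = q' l" if q: "cocone L \<phi> S d q' R'" "R' \<subseteq> VObj L" "l \<in> R'" "rep l \<in> R'"
  proof -
   have l: "l \<in> VObj L" using q by blast
   show ?thesis
   proof (rule ext2[of _ _ "FO \<phi> l" "FO S l"], goal_cases)
    case p: (7 \<Gamma> t u)
    interpret environment V \<Gamma> by (rule p)
    note asm = asm l p(2-)
    define I where "I = emap (i l) star"
    define J where "J = emap (j l) star"
    have I: "el I" "ty I = VHom L l (rep l)" "ctx I = {}" "el J" "ty J = VHom L (rep l) l" "ctx J = {}"
      using asm by (simp_all add: I_def J_def)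
    have "emap (VComp L l (rep l) l \<cdot> (j l \<boxtimes> i l)) (pr star star) = emap (VId L l \<cdot> \<lambda>\<lambda> \<I>) (pr star star)"
      using ji[OF l] by simp
    then have JI: "emap (VComp L l (rep l) l) (pr J I) = emap (VId L l) star"
      using asm by (simp add: I_def J_def)
    let ?S = "\<lambda>x y g u. emap (ev V (FO S x) (FO S y)) (pr (emap (FA S x y) g) u)"
    let ?\<phi> = "\<lambda>x y g t. emap (ev V (FO \<phi> x) (FO \<phi> y)) (pr (emap (FA \<phi> x y) g) t)"
    have "emap (VComp (op L) l (rep l) l) (pr I J) = emap (VId (op L) l) star"
      using asm I JI by simp
    from arg_cong[OF this, of "\<lambda>e. ?\<phi> l l e t"]
    have 2: "?\<phi> (rep l) l I (?\<phi> l (rep l) J t) = t"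
      using asm I by (simp del: vop_simps(3,4) add: vop_simps(2))
    have "emap (ex q' l) (pr t u) = emap (q' (rep l)) (pr (?\<phi> l (rep l) J t) (?S l (rep l) I u))"
      by (subst exE[OF p(1) l, of q' d]) (use q asm rep in \<open>simp_all add: I_def J_def\<close>)
    also have "\<dots> = emap (q' l) (pr (?\<phi> (rep l) l I (?\<phi> l (rep l) J t)) u)"
      by (rule cocone_el[OF q(1) L F q(2)]) (use asm I q in auto)
    also have "\<dots> = emap (q' l) (pr t u)" unfolding 2 ..
    finally show ?case .
   qed (use exT[OF l, of q' d] q l rep o in simp_all)
  qed
  show "h \<cdot> ex q l = ex (\<lambda>l. h \<cdot> q l) l" if q: "cocone L \<phi> S d q R" and h: "h \<in> Arr V" "Dom V h
      = d" and l: "l \<in> VObj L"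
  proof -
    have "q (rep l) \<in> Arr V \<and> Dom V (q (rep l)) = FO \<phi> (rep l) \<otimes> FO S (rep l) \<and> Cod V (q (rep l)) = d"
      using cocone_simps(2-)[OF q] R(2) l by blast
    then show ?thesis using h asm l by (simp add: ex_def extend_cocone_def)
  qed
qed

end

section \<open>Existence of ends and of colimits in the base\<close>

locale enrichment = symmetric_monoidal_closed V
  for V :: "('v, 'm) smcc" (structure) +
  fixes U :: "'u itself"
  assumes univ: "universe U" and base: "enrichment_base U V"
begin

lemma inf: "infinite (UNIV :: 'u set)"
  using univ by (simp add: universe_def)

text \<open>A natural family on \<open>R\<close> solves a small system with one equation for each
  pair of representatives; a universal solution exists by completeness, and its extension to all
  objects is the end.\<close>

lemma ends:
  assumes "vcat X" "vcat Y" "vsmall V U X"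
  shows "has_ends X Y"
  unfolding has_ends_def
proof (intro ballI)
  fix F G assume FG: "F \<in> vfun X Y" "G \<in> vfun X Y"
  obtain R rep i j where small: "small U R" and reps: "representatives X R rep i j"
    by (rule vsmall_representatives[OF assms(1,3)]) (rule that)
  have R: "R \<subseteq> VObj X" "\<And>x. x \<in> VObj X \<Longrightarrow> rep x \<in> R"
    using reps unfolding representatives_def by blast+
  define H where "H x = VHom Y (FO F x) (FO G x)" for x
  define f where "f x y = curry (H y) (VHom X x y) (VHom Y (FO F x) (FO G y)) (VComp Y (FO F x) (FO F y) (FO G y)
      \<cdot> (\<one> (H y) \<boxtimes> FA F x y))" for x y
  define g where "g x y = curry (H x) (VHom X x y) (VHom Y (FO F x) (FO G y))
       (VComp Y (FO F x) (FO G x) (FO G y) \<cdot> (FA G x y \<boxtimes> \<one> (H x)) \<cdot> \<sigma> (H x) (VHom X x y))" for x y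
  note asm = assms(1,2) FG
  have Rx: "x \<in> R \<Longrightarrow> x \<in> VObj X" for x using R by blast
  have nat: "natural_at X Y F G z q x y \<longleftrightarrow> f x y \<cdot> q y = g x y \<cdot> q x"
    if "x \<in> R" "y \<in> R" "z \<in> Obj V" "q x \<in> Hom V z (H x)" "q y \<in> Hom V z (H y)" for x y z q
    unfolding f_def g_def H_def by (rule natural_at_iff[OF asm Rx[OF that(1)] Rx[OF that(2)] that(3)])
      (use that in \<open>simp_all add: H_def Hom_iff\<close>)
  have "complete U V" using base by (simp add: enrichment_base_def)
  then obtain e p where e: "e \<in> Obj V" and p: "\<And>x. x \<in> R \<Longrightarrow> p x \<in> Hom V e (H x)"
    and pn: "\<And>k. k \<in> R \<times> R \<Longrightarrow> f (fst k) (snd k) \<cdot> p (snd k) = g (fst k) (snd k) \<cdot> p (fst k)"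
    and pu: "\<And>z q. z \<in> Obj V \<Longrightarrow> (\<And>x. x \<in> R \<Longrightarrow> q x \<in> Hom V z (H x)) \<Longrightarrow>
       (\<And>k. k \<in> R \<times> R \<Longrightarrow> f (fst k) (snd k) \<cdot> q (snd k) = g (fst k) (snd k) \<cdot> q (fst k)) \<Longrightarrow>
           \<exists>!h. h \<in> Hom V z e \<and> (\<forall>x\<in>R. p x \<cdot> h = q x)"
  proof (rule graph_limit_exists[of U R "R \<times> R" H snd fst "\<lambda>k. f (fst k) (snd k)"
      "\<lambda>k. \<lbrakk>VHom X (fst k) (snd k), VHom Y (FO F (fst k)) (FO G (snd k))\<rbrakk>" "\<lambda>k. g (fst k) (snd k)"], goal_cases)
    case 1 show ?case by (rule inf)
  next
    case 2 show ?case by (rule small)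
  next
    case 3 show ?case by (rule small_square[OF inf small])
  next
    case (4 x) then show ?case using asm Rx by (simp add: H_def)
  next
    case (7 k) then show ?case using asm Rx by (auto simp: f_def H_def Hom_iff)
  next
    case (8 k) then show ?case using asm Rx by (auto simp: g_def H_def Hom_iff)
  next
    case (9 E p) show ?case by (rule 9(1)) (rule 9(2-); assumption)+
  qed auto
  define ex where "ex = extend_family X Y F G rep i j"
  note ext = natural_family_extend[OF asm reps, folded ex_def]
  have pT: "p x \<in> Arr V \<and> Dom V (p x) = e \<and> Cod V (p x) = VHom Y (FO F x) (FO G x)" if "x \<in> R" for x
    using p[OF that] by (simp add: Hom_iff H_def)
  have "is_hom_end V X Y F G e (ex e p)"
    unfolding is_hom_end_def
  proof (intro conjI allI impI)
    show nf: "natural_family V X Y F G e (ex e p)"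
      by (rule ext(1)[OF e pT]) (use pn p nat e in \<open>auto\<close>)
    fix z q assume q: "natural_family V X Y F G z q"
    then have z: "z \<in> Obj V" by simp
    have qT: "q x \<in> Hom V z (H x)" if "x \<in> R" for x using q Rx[OF that] by (simp add: Hom_iff H_def)
    have "f (fst k) (snd k) \<cdot> q (snd k) = g (fst k) (snd k) \<cdot> q (fst k)" if "k \<in> R \<times> R" for k
    proof -
      have "natural_at X Y F G z q (fst k) (snd k)"
        using q Rx that unfolding natural_family_def natural_at_def by (metis mem_Times_iff)
      then show ?thesis using nat[of "fst k" "snd k" z q] qT z that by auto
    qed
    from pu[OF z qT this] have ex1: "\<exists>!h. h \<in> Hom V z e \<and> (\<forall>x\<in>R. p x \<cdot> h = q x)" .
    \<comment> \<open>Extension commutes with composition and recovers a family that is already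
      natural. So an arrow \<open>h\<close> factors \<open>q\<close> over \<open>R\<close> exactly
      when it does so over all objects, and unique existence carries over.\<close>
    have "(\<forall>x\<in>R. p x \<cdot> h = q x) \<longleftrightarrow> (\<forall>x\<in>VObj X. ex e p x \<cdot> h = q x)" if h: "h \<in> Hom V z e" for h
    proof
      assume *: "\<forall>x\<in>R. p x \<cdot> h = q x"
      show "\<forall>x\<in>VObj X. ex e p x \<cdot> h = q x"
      proof
        fix x assume x: "x \<in> VObj X"
        have "ex e p x \<cdot> h = ex z (\<lambda>x. p x \<cdot> h) x"
          by (rule ext(3)[OF e pT]) (use h x in \<open>auto simp: Hom_iff\<close>)
        also have "\<dots> = ex z q x" using * R(2)[OF x] by (simp add: ex_def extend_family_def)
        also have "\<dots> = q x"
        proof (rule ext(2)[OF _ x])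
          show "natural_at X Y F G z q x (rep x)"
            using q x Rx[OF R(2)[OF x]] unfolding natural_family_def natural_at_def by blast
        qed (use natural_family_simps(2-)[OF q] x Rx[OF R(2)[OF x]] in blast)
        finally show "ex e p x \<cdot> h = q x" .
      qed
    next
      assume *: "\<forall>x\<in>VObj X. ex e p x \<cdot> h = q x"
      have "ex e p x = p x" if x: "x \<in> R" for x
      proof (rule ext(2)[OF _ Rx[OF x]])
        show "natural_at X Y F G e p x (rep x)"
          using nat[of x "rep x" e p] pn[of "(x, rep x)"] p e R(2) x Rx[OF x] by auto
      qed (use pT x R(2) Rx[OF x] in blast)
      then show "\<forall>x\<in>R. p x \<cdot> h = q x" using * Rx by metis
    qed
    with ex1 show "\<exists>!h. h \<in> Hom V z e \<and> (\<forall>x\<in>VObj X. ex e p x \<cdot> h = q x)" by metis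
  qed
  then show "\<exists>e p. is_hom_end V X Y F G e p" by blast
qed

lemma colims:
  assumes L: "vcat L" "vsmall V U L" and F: "\<phi> \<in> vfun (op L) \<V>" "S \<in> vfun L \<V>"
  shows "\<exists>C \<kappa>. is_colim L \<phi> S C \<kappa>"
proof -
  obtain R rep i j where small: "small U R" and reps: "representatives L R rep i j"
    by (rule vsmall_representatives[OF L]) (rule that)
  have R: "R \<subseteq> VObj L" "\<And>x. x \<in> VObj L \<Longrightarrow> rep x \<in> R"
    using reps unfolding representatives_def by blast+
  have Rx: "x \<in> R \<Longrightarrow> x \<in> VObj L" for x using R by blast
  have o: "x \<in> VObj L \<Longrightarrow> FO \<phi> x \<in> Obj V" "x \<in> VObj L \<Longrightarrow> FO S x \<in> Obj V" for x
    using vfun_simps(1)[OF F(1)] vfun_simps(1)[OF F(2)] by auto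
  define D where "D x = FO \<phi> x \<otimes> FO S x" for x
  define B where "B l l' = FO \<phi> l' \<otimes> (VHom L l l' \<otimes> FO S l)" for l l'
  define f where "f l l' = \<one> (FO \<phi> l') \<boxtimes> (ev V (FO S l) (FO S l') \<cdot> (FA S l l' \<boxtimes> \<one> (FO S l)))" for l l'
  define g where "g l l' = ((ev V (FO \<phi> l') (FO \<phi> l) \<cdot> (FA \<phi> l' l \<boxtimes> \<one> (FO \<phi> l'))
      \<cdot> \<sigma> (FO \<phi> l') (VHom L l l')) \<boxtimes> \<one> (FO S l))
            \<cdot> invr (\<alpha> (FO \<phi> l') (VHom L l l') (FO S l))" for l l'
  have cocone: "cocone L \<phi> S d q R \<longleftrightarrow> d \<in> Obj V \<and> (\<forall>x\<in>R. q x \<in> Hom V (D x) d) \<and>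
      (\<forall>k\<in>R \<times> R. q (snd k) \<cdot> f (fst k) (snd k) = q (fst k) \<cdot> g (fst k) (snd k))"
    for d q unfolding cocone_def f_def g_def D_def Hom_iff by auto
  have cc: "complete U (op_cat V)" using base by (simp add: enrichment_base_def cocomplete_def)
  \<comment> \<open>Cocones are cones in the opposite category, so the lemma on systems of equations
    also yields colimits; now each equation compares two arrows out of
    \<open>B l l'\<close>.\<close>
  interpret op: category "op_cat V" by (rule category_op)
  obtain e p where e: "e \<in> Obj V" and p: "\<And>x. x \<in> R \<Longrightarrow> p x \<in> Hom V (D x) e"
    and pn: "\<And>k. k \<in> R \<times> R \<Longrightarrow> p (snd k) \<cdot> f (fst k) (snd k) = p (fst k) \<cdot> g (fst k) (snd k)"
    and pu: "\<And>z q. z \<in> Obj V \<Longrightarrow> (\<And>x. x \<in> R \<Longrightarrow> q x \<in> Hom V (D x) z) \<Longrightarrow>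
       (\<And>k. k \<in> R \<times> R \<Longrightarrow> q (snd k) \<cdot> f (fst k) (snd k) = q (fst k) \<cdot> g (fst k) (snd k)) \<Longrightarrow>
           \<exists>!h. h \<in> Hom V e z \<and> (\<forall>x\<in>R. h \<cdot> p x = q x)"
  proof (rule op.graph_limit_exists[of U R "R \<times> R" D snd fst "\<lambda>k. f (fst k) (snd k)" "\<lambda>k. B (fst k) (snd k)"
      "\<lambda>k. g (fst k) (snd k)", unfolded Hom_op_cat], goal_cases)
    case 1 show ?case by (rule cc)
  next
    case 2 show ?case by (rule inf)
  next
    case 3 show ?case by (rule small)
  next
    case 4 show ?case by (rule small_square[OF inf small])
  next
    case (5 x) then show ?case using o Rx by (simp add: D_def)
  next
    case (8 k) then show ?case using L F o Rx by (auto simp: f_def D_def B_def Hom_iff)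
  next
    case (9 k) then show ?case using L F o Rx by (auto simp: g_def D_def B_def Hom_iff)
  next
    case (10 E p) show ?case by (rule 10(1)) (rule 10(2-); assumption)+
  qed auto
  define ex where "ex = extend_cocone \<phi> S rep i j"
  note ext = cocone_extend[OF L(1) F reps, folded ex_def]
  have pR: "cocone L \<phi> S e p R" unfolding cocone using e p pn by blast
  have "is_colim L \<phi> S e (ex p)"
    unfolding is_colim_def
  proof (intro conjI allI impI)
    show "cocone L \<phi> S e (ex p) (VObj L)" by (rule ext(1)[OF pR])
    fix d q assume q: "cocone L \<phi> S d q (VObj L)"
    then have qR: "cocone L \<phi> S d q R" unfolding cocone_def using Rx by blast
    then have ex1: "\<exists>!h. h \<in> Hom V e d \<and> (\<forall>x\<in>R. h \<cdot> p x = q x)" unfolding cocone by (intro pu) auto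
    have "(\<forall>x\<in>R. h \<cdot> p x = q x) \<longleftrightarrow> (\<forall>x\<in>VObj L. h \<cdot> ex p x = q x)" if h: "h \<in> Hom V e d" for h
    proof
      assume *: "\<forall>x\<in>R. h \<cdot> p x = q x"
      show "\<forall>x\<in>VObj L. h \<cdot> ex p x = q x"
      proof
        fix x assume x: "x \<in> VObj L"
        have "h \<cdot> ex p x = ex (\<lambda>x. h \<cdot> p x) x"
          by (rule ext(3)[OF pR _ _ x]) (use h in \<open>auto simp: Hom_iff\<close>)
        also have "\<dots> = ex q x" using * R(2)[OF x] by (simp add: ex_def extend_cocone_def)
        also have "\<dots> = q x" by (rule ext(2)[OF q order.refl x Rx[OF R(2)[OF x]]])
        finally show "h \<cdot> ex p x = q x" .
      qed
    next
      assume *: "\<forall>x\<in>VObj L. h \<cdot> ex p x = q x"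
      have "ex p x = p x" if x: "x \<in> R" for x
        by (rule ext(2)[OF pR R(1) x R(2)[OF Rx[OF x]]])
      then show "\<forall>x\<in>R. h \<cdot> p x = q x" using * Rx by metis
    qed
    with ex1 show "\<exists>!h. h \<in> Hom V e d \<and> (\<forall>x\<in>VObj L. h \<cdot> ex p x = q x)" by metis
  qed
  then show ?thesis by blast
qed

end

section \<open>Weighted limits as universal cones\<close>

context symmetric_monoidal_closed
begin

lemma ext_unit:
  assumes [simp]: "f \<in> Arr V" "g \<in> Arr V" "a \<in> Obj V" and d: "Dom V f = \<I> \<otimes> a" "Dom V g = \<I> \<otimes> a"
    and eq: "\<And>\<Gamma> s. environment V \<Gamma> \<Longrightarrow> El \<Gamma> s \<Longrightarrow> Ty s = a \<Longrightarrow> Ctx s = {0} \<Longrightarrow>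
       App f (Pr \<Gamma> (Star) s) = App g (Pr \<Gamma> (Star) s)"
  shows "f = g"
proof -
  interpret environment V "[(0, a)]" by unfold_locales simp
  obtain s where s: "gen s" "ty s = a" "ctx s = {0}" using gen_var[of a 0] by auto
  note [simp] = s s(1)[THEN gen_el]
  show ?thesis
  proof (rule gen_ext[of "pr star s"])
    show "emap f (pr star s) = emap g (pr star s)" by (rule eq[OF environment_axioms]) simp_all
  qed (simp_all add: d)
qed

text \<open>A variable of type \<open>\<I>\<close> is replaced by \<open>\<star>\<close>, on which
  the unit rules and \<open>ev_name\<close> can act.\<close>

lemma ihom_ext_unit:
  assumes [simp]: "f \<in> Arr V" "g \<in> Arr V" "a \<in> Obj V" "b \<in> Obj V" "c \<in> Obj V"
    and d: "Dom V f = \<I> \<otimes> a" "Dom V g = \<I> \<otimes> a" "Cod V f = \<lbrakk>b, c\<rbrakk>" "Cod V g = \<lbrakk>b, c\<rbrakk>"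
    and eq: "\<And>\<Gamma> s t. environment V \<Gamma> \<Longrightarrow> El \<Gamma> s \<Longrightarrow> El \<Gamma> t \<Longrightarrow>
       Ty s = a \<Longrightarrow> Ty t = b \<Longrightarrow> Ctx s = {0} \<Longrightarrow> Ctx t = {Suc 0} \<Longrightarrow>
       App (ev V b c) (Pr \<Gamma> (App f (Pr \<Gamma> (Star) s)) t) =
       App (ev V b c) (Pr \<Gamma> (App g (Pr \<Gamma> (Star) s)) t)"
  shows "f = g"
proof -
  have "f \<cdot> invr (\<lambda>\<lambda> a) = g \<cdot> invr (\<lambda>\<lambda> a)"
  proof (rule ihom_ext1[of _ _ a b c], goal_cases)
    case p: (10 \<Gamma> s t)
    interpret environment V \<Gamma> by (rule p)
    show ?case using eq[OF p(1-5)] p d by simp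
  qed (use d in simp_all)
  then show ?thesis by (rule iso_cancel_r[rotated -1]) (use d in simp_all)
qed

lemma name_simps [simp]:
  assumes "f \<in> Arr V" "Dom V f = a" "Cod V f = b"
  shows "name V a b f \<in> Arr V" "Dom V (name V a b f) = \<I>" "Cod V (name V a b f) = \<lbrakk>a, b\<rbrakk>"
proof -
  have "a \<in> Obj V" "b \<in> Obj V" using Dom_Obj'[OF assms(1)] Cod_Obj'[OF assms(1)] assms by simp_all
  then show "name V a b f \<in> Arr V" "Dom V (name V a b f) = \<I>" "Cod V (name V a b f) = \<lbrakk>a, b\<rbrakk>"
    using assms by (simp_all add: name_def)
qed

lemma (in environment) ev_name [simp]:
  assumes "f \<in> Arr V" "Dom V f = a" "Cod V f = b" "el t" "ty t = a"
  shows "ev V a b \<bullet> ((name V a b f \<bullet> \<star>) \<diamondop> t) = f \<bullet> t"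
proof -
  have "a \<in> Obj V" using Dom_Obj'[OF assms(1)] assms by simp
  then show ?thesis using assms by (simp add: name_def)
qed

text \<open>Resolves the description in \<open>unname\<close>: an arrow is recovered from its name
  by evaluation.\<close>

lemma unname_eq:
  assumes "u \<in> Arr V" "Dom V u = \<I>" "Cod V u = \<lbrakk>a, b\<rbrakk>" and [simp]: "a \<in> Obj V" "b \<in> Obj V"
  shows "unname V a b u = ev V a b \<cdot> (u \<boxtimes> \<one> a) \<cdot> invr (\<lambda>\<lambda> a)"
  unfolding unname_def
proof (rule the_equality)
  have "name V a b (ev V a b \<cdot> (u \<boxtimes> \<one> a) \<cdot> invr (\<lambda>\<lambda> a)) = u"
  proof (rule ihom_ext0[of _ _ a b], goal_cases)
    case p: (9 \<Gamma> t)
    interpret environment V \<Gamma> by (rule p)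
    show ?case using p assms by simp
  qed (use assms in simp_all)
  then show "ev V a b \<cdot> (u \<boxtimes> \<one> a) \<cdot> invr (\<lambda>\<lambda> a) \<in> Hom V a b \<and> name V a b (ev V a b \<cdot> (u \<boxtimes> \<one> a) \<cdot> invr (\<lambda>\<lambda> a)) = u"
    using assms by (simp add: Hom_iff)
  fix f assume f: "f \<in> Hom V a b \<and> name V a b f = u"
  show "f = ev V a b \<cdot> (u \<boxtimes> \<one> a) \<cdot> invr (\<lambda>\<lambda> a)"
  proof (rule ext1[of _ _ a], goal_cases)
    case p: (5 \<Gamma> t)
    interpret environment V \<Gamma> by (rule p)
    have "emap (ev V a b) (pr (emap (name V a b f) star) t) = emap f t"
      by (rule ev_name) (use f p in \<open>simp_all add: Hom_iff\<close>)
    then show ?case using p assms f by simp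
  qed (use assms f in \<open>simp_all add: Hom_iff\<close>)
qed

text \<open>
  Weighted limits without internal homs: the arrows \<open>z \<rightarrow> [X, V](\<phi>, A(a, T -))\<close> are
  the natural families \<open>\<phi> x \<otimes> z \<rightarrow> A(a, T x)\<close>.
\<close>

definition wcone :: "('x, 'v, 'm) vcat \<Rightarrow> ('x, 'v, 'm) vfun \<Rightarrow> ('a, 'v, 'm) vcat \<Rightarrow> ('x, 'a, 'm) vfun \<Rightarrow>
    'a \<Rightarrow> 'v \<Rightarrow> ('x \<Rightarrow> 'm) \<Rightarrow> bool" where
  "wcone X \<phi> A T a z r \<longleftrightarrow> a \<in> VObj A \<and> z \<in> Obj V \<and>
     (\<forall>x\<in>VObj X. r x \<in> Arr V \<and> Dom V (r x) = FO \<phi> x \<otimes> z \<and> Cod V (r x) = VHom A a (FO T x)) \<and>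
     (\<forall>x\<in>VObj X. \<forall>y\<in>VObj X. VComp A a (FO T x) (FO T y) \<cdot> (FA T x y \<boxtimes> r x) \<cdot> \<alpha> (VHom X x y) (FO \<phi> x) z
        = r y \<cdot> ((ev V (FO \<phi> x) (FO \<phi> y) \<cdot> (FA \<phi> x y \<boxtimes> \<one> (FO \<phi> x))) \<boxtimes> \<one> z))"

text \<open>A natural transformation from \<open>\<phi>\<close> to \<open>A(L, T -)\<close>,
  uncurried: a cone with \<open>z = \<I>\<close>, without the unit factor.\<close>

definition wcounit :: "('x, 'v, 'm) vcat \<Rightarrow> ('x, 'v, 'm) vfun \<Rightarrow> ('a, 'v, 'm) vcat \<Rightarrow> ('x, 'a, 'm) vfun \<Rightarrow>
    'a \<Rightarrow> ('x \<Rightarrow> 'm) \<Rightarrow> bool" where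
  "wcounit X \<phi> A T L \<gamma> \<longleftrightarrow> L \<in> VObj A \<and>
     (\<forall>x\<in>VObj X. \<gamma> x \<in> Arr V \<and> Dom V (\<gamma> x) = FO \<phi> x \<and> Cod V (\<gamma> x) = VHom A L (FO T x)) \<and>
     (\<forall>x\<in>VObj X. \<forall>y\<in>VObj X. VComp A L (FO T x) (FO T y) \<cdot> (FA T x y \<boxtimes> \<gamma> x)
        = \<gamma> y \<cdot> ev V (FO \<phi> x) (FO \<phi> y) \<cdot> (FA \<phi> x y \<boxtimes> \<one> (FO \<phi> x)))"

text \<open>The Yoneda form of representability: \<open>h\<close> ranges over generalised elements
  of \<open>A(a, L)\<close>, and it is the arbitrary domain \<open>z\<close> that makes the property
  enriched.\<close>

definition is_lim :: "('x, 'v, 'm) vcat \<Rightarrow> ('x, 'v, 'm) vfun \<Rightarrow> ('a, 'v, 'm) vcat \<Rightarrow> ('x, 'a, 'm) vfun \<Rightarrow>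
    'a \<Rightarrow> ('x \<Rightarrow> 'm) \<Rightarrow> bool" where
  "is_lim X \<phi> A T L \<gamma> \<longleftrightarrow> wcounit X \<phi> A T L \<gamma> \<and>
     (\<forall>a z r. wcone X \<phi> A T a z r \<longrightarrow>
       (\<exists>!h. h \<in> Hom V z (VHom A a L) \<and> (\<forall>x\<in>VObj X. VComp A a L (FO T x) \<cdot> (\<gamma> x \<boxtimes> h) = r x)))"

lemma wcone_simps [simp]:
  assumes "wcone X \<phi> A T a z r"
  shows "a \<in> VObj A" "z \<in> Obj V" "x \<in> VObj X \<Longrightarrow> r x \<in> Arr V" "x \<in> VObj X \<Longrightarrow> Dom V (r x) = FO \<phi> x \<otimes> z"
    "x \<in> VObj X \<Longrightarrow> Cod V (r x) = VHom A a (FO T x)"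
  using assms by (auto simp: wcone_def)

lemma wcounit_simps [simp]:
  assumes "wcounit X \<phi> A T L \<gamma>"
  shows "L \<in> VObj A" "x \<in> VObj X \<Longrightarrow> \<gamma> x \<in> Arr V" "x \<in> VObj X \<Longrightarrow> Dom V (\<gamma> x) = FO \<phi> x"
    "x \<in> VObj X \<Longrightarrow> Cod V (\<gamma> x) = VHom A L (FO T x)"
  using assms by (auto simp: wcounit_def)

lemma is_lim_wcounit: "is_lim X \<phi> A T L \<gamma> \<Longrightarrow> wcounit X \<phi> A T L \<gamma>"
  by (simp add: is_lim_def)

end

context environment
begin

lemma wcone_el:
  assumes "wcone X \<phi> A T a z r" and asm: "vcat X" "vcat A" "\<phi> \<in> vfun X \<V>" "T \<in> vfun X A" "x \<in> VObj X" "y \<in> VObj X"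
    and "el s" "el t" "el u" "ctx s \<inter> ctx t = {}" "ctx s \<inter> ctx u = {}" "ctx t \<inter> ctx u = {}"
    and "ty s = VHom X x y" "ty t = FO \<phi> x" "ty u = z"
  shows "VComp A a (FO T x) (FO T y) \<bullet> ((FA T x y \<bullet> s) \<diamondop> (r x \<bullet> (t \<diamondop> u)))
    = r y \<bullet> ((ev V (FO \<phi> x) (FO \<phi> y) \<bullet> ((FA \<phi> x y \<bullet> s) \<diamondop> t)) \<diamondop> u)"
proof -
  have o: "FO \<phi> x \<in> Obj V" "FO \<phi> y \<in> Obj V" using vfun_simps(1)[OF asm(3)] asm by auto
  have "(VComp A a (FO T x) (FO T y) \<cdot> (FA T x y \<boxtimes> r x) \<cdot> \<alpha> (VHom X x y) (FO \<phi> x) z) \<bullet> ((s \<diamondop> t) \<diamondop> u)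
        = (r y \<cdot> ((ev V (FO \<phi> x) (FO \<phi> y) \<cdot> (FA \<phi> x y \<boxtimes> \<one> (FO \<phi> x))) \<boxtimes> \<one> z)) \<bullet> ((s \<diamondop> t) \<diamondop> u)"
    using assms(1) asm(5,6) by (simp only: wcone_def)
  then show ?thesis using assms o by simp
qed

lemma wcounit_el:
  assumes "wcounit X \<phi> A T L \<gamma>" and asm: "vcat X" "vcat A" "\<phi> \<in> vfun X \<V>" "T \<in> vfun X A" "x \<in> VObj X" "y \<in> VObj X"
    and "el s" "el t" "ctx s \<inter> ctx t = {}" "ty s = VHom X x y" "ty t = FO \<phi> x"
  shows "VComp A L (FO T x) (FO T y) \<bullet> ((FA T x y \<bullet> s) \<diamondop> (\<gamma> x \<bullet> t))
    = \<gamma> y \<bullet> ev V (FO \<phi> x) (FO \<phi> y) \<bullet> ((FA \<phi> x y \<bullet> s) \<diamondop> t)"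
proof -
  have o: "FO \<phi> x \<in> Obj V" "FO \<phi> y \<in> Obj V" using vfun_simps(1)[OF asm(3)] asm by auto
  have "(VComp A L (FO T x) (FO T y) \<cdot> (FA T x y \<boxtimes> \<gamma> x)) \<bullet> (s \<diamondop> t)
        = (\<gamma> y \<cdot> ev V (FO \<phi> x) (FO \<phi> y) \<cdot> (FA \<phi> x y \<boxtimes> \<one> (FO \<phi> x))) \<bullet> (s \<diamondop> t)"
    using assms(1) asm(5,6) by (simp only: wcounit_def)
  then show ?thesis using assms o by simp
qed

end

context symmetric_monoidal_closed
begin

lemma wconeI:
  assumes asm: "vcat X" "vcat A" "\<phi> \<in> vfun X \<V>" "T \<in> vfun X A" "a \<in> VObj A" "z \<in> Obj V"
    and r: "\<And>x. x \<in> VObj X \<Longrightarrow> r x \<in> Arr V \<and> Dom V (r x) = FO \<phi> x \<otimes> z \<and> Cod V (r x) = VHom A a (FO T x)"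
    and eq: "\<And>x y \<Gamma> s t u. x \<in> VObj X \<Longrightarrow> y \<in> VObj X \<Longrightarrow> environment V \<Gamma> \<Longrightarrow>
       El \<Gamma> s \<Longrightarrow> El \<Gamma> t \<Longrightarrow> El \<Gamma> u \<Longrightarrow>
       Ty s = VHom X x y \<Longrightarrow> Ty t = FO \<phi> x \<Longrightarrow> Ty u = z \<Longrightarrow>
       Ctx s = {0} \<Longrightarrow> Ctx t = {Suc 0} \<Longrightarrow> Ctx u = {2} \<Longrightarrow>
       App (VComp A a (FO T x) (FO T y)) (Pr \<Gamma> (App (FA T x y) s) (App (r x) (Pr \<Gamma> t u)))
       = App (r y) (Pr \<Gamma> (App (ev V (FO \<phi> x) (FO \<phi> y)) (Pr \<Gamma> (App (FA \<phi> x y) s) t)) u)"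
  shows "wcone X \<phi> A T a z r"
  unfolding wcone_def
proof (intro conjI ballI)
  fix x y assume xy: "x \<in> VObj X" "y \<in> VObj X"
  have o: "FO \<phi> x \<in> Obj V" "FO \<phi> y \<in> Obj V" using vfun_simps(1)[OF asm(3)] xy by auto
  show "VComp A a (FO T x) (FO T y) \<cdot> (FA T x y \<boxtimes> r x) \<cdot> \<alpha> (VHom X x y) (FO \<phi> x) z
        = r y \<cdot> ((ev V (FO \<phi> x) (FO \<phi> y) \<cdot> (FA \<phi> x y \<boxtimes> \<one> (FO \<phi> x))) \<boxtimes> \<one> z)"
  proof (rule ext3[of _ _ "VHom X x y" "FO \<phi> x" z], goal_cases)
    case p: (8 \<Gamma> s t u)
    interpret environment V \<Gamma> by (rule p)
    from eq[OF xy p(1-7)] p o r[OF xy(1)] r[OF xy(2)] xy asm show ?case by simp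
  qed (use asm xy o r[OF xy(1)] r[OF xy(2)] in simp_all)
qed (use asm r in auto)

lemma wcounitI:
  assumes asm: "vcat X" "vcat A" "\<phi> \<in> vfun X \<V>" "T \<in> vfun X A" "L \<in> VObj A"
    and r: "\<And>x. x \<in> VObj X \<Longrightarrow> \<gamma> x \<in> Arr V \<and> Dom V (\<gamma> x) = FO \<phi> x \<and> Cod V (\<gamma> x) = VHom A L (FO T x)"
    and eq: "\<And>x y \<Gamma> s t. x \<in> VObj X \<Longrightarrow> y \<in> VObj X \<Longrightarrow> environment V \<Gamma> \<Longrightarrow>
       El \<Gamma> s \<Longrightarrow> El \<Gamma> t \<Longrightarrow>
       Ty s = VHom X x y \<Longrightarrow> Ty t = FO \<phi> x \<Longrightarrow>
       Ctx s = {0} \<Longrightarrow> Ctx t = {Suc 0} \<Longrightarrow>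
       App (VComp A L (FO T x) (FO T y)) (Pr \<Gamma> (App (FA T x y) s) (App (\<gamma> x) t))
       = App (\<gamma> y) (App (ev V (FO \<phi> x) (FO \<phi> y)) (Pr \<Gamma> (App (FA \<phi> x y) s) t))"
  shows "wcounit X \<phi> A T L \<gamma>"
  unfolding wcounit_def
proof (intro conjI ballI)
  fix x y assume xy: "x \<in> VObj X" "y \<in> VObj X"
  have o: "FO \<phi> x \<in> Obj V" "FO \<phi> y \<in> Obj V" using vfun_simps(1)[OF asm(3)] xy by auto
  show "VComp A L (FO T x) (FO T y) \<cdot> (FA T x y \<boxtimes> \<gamma> x)
        = \<gamma> y \<cdot> ev V (FO \<phi> x) (FO \<phi> y) \<cdot> (FA \<phi> x y \<boxtimes> \<one> (FO \<phi> x))"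
  proof (rule ext2[of _ _ "VHom X x y" "FO \<phi> x"], goal_cases)
    case p: (7 \<Gamma> s t)
    interpret environment V \<Gamma> by (rule p)
    have "ctx t = {Suc 0}" using p by simp
    from eq[OF xy p(1-6) this] p o r[OF xy(1)] r[OF xy(2)] xy asm show ?case by simp
  qed (use asm xy o r[OF xy(1)] r[OF xy(2)] in simp_all)
qed (use asm r in auto)

lemma wcone_of_arrow:
  assumes "wcounit X \<phi> A T L \<gamma>" and asm: "vcat X" "vcat A" "\<phi> \<in> vfun X \<V>" "T \<in> vfun X A" "a \<in> VObj A"
    and h: "h \<in> Arr V" "Dom V h = z" "Cod V h = VHom A a L"
  shows "wcone X \<phi> A T a z (\<lambda>x. VComp A a L (FO T x) \<cdot> (\<gamma> x \<boxtimes> h))"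
proof -
  have z: "z \<in> Obj V" using h Dom_Obj' by blast
  have o: "x \<in> VObj X \<Longrightarrow> FO \<phi> x \<in> Obj V" for x using vfun_simps(1)[OF asm(3)] by auto
  show ?thesis
  proof (rule wconeI[OF asm z], goal_cases)
    case (1 x) then show ?case using assms by simp
  next
    case p: (2 x y \<Gamma> s t u)
    interpret environment V \<Gamma> by (rule p)
    have "emap (VComp A a (FO T x) (FO T y)) (pr (emap (FA T x y) s) (emap (VComp A a L (FO T x)) (pr (emap (\<gamma> x)
        t) (emap h u))))
      = emap (VComp A a L (FO T y)) (pr (emap (VComp A L (FO T x) (FO T y)) (pr (emap (FA T x y) s) (emap (\<gamma> x)
          t))) (emap h u))"
      using assms p(1,2) p(4-) by simp
    with wcounit_el[OF assms(1) asm(1-4) p(1,2), of s t] show ?case using assms p(1,2) p(4-) o by simp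
  qed
qed

text \<open>The cone obtained from \<open>g\<close> has one factorisation only, and \<open>f\<close>
  and \<open>g\<close> are both factorisations of it.\<close>

lemma lim_unique:
  assumes "is_lim X \<phi> A T L \<gamma>" and asm: "vcat X" "vcat A" "\<phi> \<in> vfun X \<V>" "T \<in> vfun X A" "a \<in> VObj A"
    and f: "f \<in> Arr V" "Dom V f = z" "Cod V f = VHom A a L"
    and g: "g \<in> Arr V" "Dom V g = z" "Cod V g = VHom A a L"
    and eq: "\<And>x. x \<in> VObj X \<Longrightarrow> VComp A a L (FO T x) \<cdot> (\<gamma> x \<boxtimes> f) = VComp A a L (FO T x) \<cdot> (\<gamma> x \<boxtimes> g)"
  shows "f = g"
proof -
  have "wcone X \<phi> A T a z (\<lambda>x. VComp A a L (FO T x) \<cdot> (\<gamma> x \<boxtimes> g))"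
    by (rule wcone_of_arrow[OF is_lim_wcounit[OF assms(1)] asm g])
  then have "\<exists>!h. h \<in> Hom V z (VHom A a L) \<and> (\<forall>x\<in>VObj X. VComp A a L (FO T x) \<cdot> (\<gamma> x \<boxtimes> h)
      = VComp A a L (FO T x) \<cdot> (\<gamma> x \<boxtimes> g))"
    using assms(1) unfolding is_lim_def by blast
  then show ?thesis by (rule ex1_unique) (use f g eq in \<open>auto simp: Hom_iff\<close>)
qed

lemma lim_lift:
  assumes "is_lim X \<phi> A T L \<gamma>" "wcone X \<phi> A T a z r"
  obtains h where "h \<in> Arr V" "Dom V h = z" "Cod V h = VHom A a L" "\<And>x. x \<in> VObj X \<Longrightarrow>
      VComp A a L (FO T x) \<cdot> (\<gamma> x \<boxtimes> h) = r x"
proof -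
  have "\<exists>!h. h \<in> Hom V z (VHom A a L) \<and> (\<forall>x\<in>VObj X. VComp A a L (FO T x) \<cdot> (\<gamma> x \<boxtimes> h) = r x)"
    using assms unfolding is_lim_def by blast
  then show thesis using that by (auto simp: Hom_iff)
qed

lemma is_limI:
  assumes asm: "vcat X" "vcat A" "\<phi> \<in> vfun X \<V>" "T \<in> vfun X A" and \<gamma>: "wcounit X \<phi> A T L \<gamma>"
    and ex: "\<And>a z r. wcone X \<phi> A T a z r \<Longrightarrow> \<exists>h. h \<in> Arr V \<and> Dom V h = z \<and> Cod V h
        = VHom A a L \<and> (\<forall>x\<in>VObj X. VComp A a L (FO T x) \<cdot> (\<gamma> x \<boxtimes> h) = r x)"
    and un: "\<And>a z f g. a \<in> VObj A \<Longrightarrow> z \<in> Obj V \<Longrightarrow> f \<in> Arr V \<Longrightarrow> Dom V f = z \<Longrightarrow> Cod V f = VHom A a L \<Longrightarrow>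
       g \<in> Arr V \<Longrightarrow> Dom V g = z \<Longrightarrow> Cod V g = VHom A a L \<Longrightarrow>
       (\<And>x. x \<in> VObj X \<Longrightarrow> VComp A a L (FO T x) \<cdot> (\<gamma> x \<boxtimes> f) = VComp A a L (FO T x) \<cdot> (\<gamma> x \<boxtimes> g)) \<Longrightarrow> f = g"
  shows "is_lim X \<phi> A T L \<gamma>"
  unfolding is_lim_def
proof (intro conjI allI impI)
  fix a z r assume r: "wcone X \<phi> A T a z r"
  from ex[OF r] obtain h where h: "h \<in> Arr V \<and> Dom V h = z \<and> Cod V h
      = VHom A a L \<and> (\<forall>x\<in>VObj X. VComp A a L (FO T x) \<cdot> (\<gamma> x \<boxtimes> h) = r x)" ..
  show "\<exists>!h. h \<in> Hom V z (VHom A a L) \<and> (\<forall>x\<in>VObj X. VComp A a L (FO T x) \<cdot> (\<gamma> x \<boxtimes> h) = r x)"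
  proof (rule ex1I[of _ h])
    show "h \<in> Hom V z (VHom A a L) \<and> (\<forall>x\<in>VObj X. VComp A a L (FO T x) \<cdot> (\<gamma> x \<boxtimes> h) = r x)" using h
        by (simp add: Hom_iff)
    fix k assume k: "k \<in> Hom V z (VHom A a L) \<and> (\<forall>x\<in>VObj X. VComp A a L (FO T x) \<cdot> (\<gamma> x \<boxtimes> k) = r x)"
    show "k = h" by (rule un[of a z]) (use h k wcone_simps(1,2)[OF r] in \<open>simp_all add: Hom_iff\<close>)
  qed
qed (rule \<gamma>)

end

section \<open>Representability of \<open>cylinders\<close> against universal cones\<close>

locale diagram = enrichment V U
  for V :: "('v, 'm) smcc" (structure) and U :: "'u itself" +
  fixes K :: "('k, 'v, 'm) vcat" and \<phi> :: "('k, 'v, 'm) vfun" and A :: "('a, 'v, 'm) vcat" and T :: "('k, 'a, 'm)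
      vfun"
  assumes K [simp]: "vcat K" and small_K: "vsmall V U K" and \<phi>: "\<phi> \<in> vfun (op K) \<V>"
    and A [simp]: "vcat A" and T: "T \<in> vfun (op K) A"
begin

definition N :: "'a \<Rightarrow> ('k, 'v, 'm) vfun" where
  "N a = vcompose V (op K) (hom_functor V A a) T"

abbreviation E :: "'a \<Rightarrow> 'v" where "E a \<equiv> nat_obj V (op K) \<V> \<phi> (N a)"
abbreviation P :: "'a \<Rightarrow> 'k \<Rightarrow> 'm" where "P a \<equiv> nat_proj V (op K) \<V> \<phi> (N a)"
abbreviation H :: "'a \<Rightarrow> 'a \<Rightarrow> 'm" where "H \<equiv> FA (hom_along V (op K) A T)"
abbreviation cyl :: "('a, 'v, 'm) vfun" where "cyl \<equiv> cylinders V (K, \<phi>) A T"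

lemma he [simp]: "has_ends (op K) \<V>"
  using ends[of "op K" \<V>] vsmall_op[OF K small_K] by simp

lemmas T_simps [simp] = vfun_simps(1-4)[OF T, simplified vop_simps]

lemma \<phi>_simps [simp]:
  "x \<in> VObj K \<Longrightarrow> FO \<phi> x \<in> Obj V"
  "x \<in> VObj K \<Longrightarrow> y \<in> VObj K \<Longrightarrow> FA \<phi> x y \<in> Arr V"
  "x \<in> VObj K \<Longrightarrow> y \<in> VObj K \<Longrightarrow> Dom V (FA \<phi> x y) = VHom K y x"
  "x \<in> VObj K \<Longrightarrow> y \<in> VObj K \<Longrightarrow> Cod V (FA \<phi> x y) = \<lbrakk>FO \<phi> x, FO \<phi> y\<rbrakk>"
  using vfun_simps(1-4)[OF \<phi>] by simp_all

lemma \<phi>_FC [simp]: "\<phi> \<in> vfun (op K) \<V>"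
  by (rule \<phi>)

lemma N_vfun [simp]: "a \<in> VObj A \<Longrightarrow> N a \<in> vfun (op K) \<V>"
  unfolding N_def by (rule vcompose_vfun[OF vcat_op[OF K] A vcat_self T hom_functor_vfun[OF A]])

lemma N_simps [simp]:
  assumes "a \<in> VObj A"
  shows "x \<in> VObj K \<Longrightarrow> FO (N a) x = VHom A a (FO T x)"
    "x \<in> VObj K \<Longrightarrow> y \<in> VObj K \<Longrightarrow> FA (N a) x y =
       curry (VHom A (FO T x) (FO T y)) (VHom A a (FO T x)) (VHom A a (FO T y)) (VComp A a (FO T x) (FO T y))
           \<cdot> FA T x y"
  using assms by (simp_all add: N_def)

text \<open>With \<open>family_of_cone\<close> this is transposition between
  \<open>z \<rightarrow> [\<phi> x, A(a, T x)]\<close> and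
  \<open>\<phi> x \<otimes> z \<rightarrow> A(a, T x)\<close>; the symmetry puts the weight
  first.\<close>

lemma cone_of_family:
  assumes q: "natural_family V (op K) \<V> \<phi> (N a) z q" and a [simp]: "a \<in> VObj A"
  shows "wcone (op K) \<phi> A T a z (\<lambda>x. ev V (FO \<phi> x) (VHom A a (FO T x)) \<cdot> (q x \<boxtimes> \<one> (FO \<phi> x)) \<cdot> \<sigma> (FO \<phi> x) z)"
proof (rule wconeI[OF vcat_op[OF K] A \<phi> T a], goal_cases)
  case 1 show ?case using q by simp
next
  case (2 x) then show ?case using natural_family_simps[OF q] by simp
next
  case p: (3 x y \<Gamma> s t u)
  interpret environment V \<Gamma> by (rule p)
  have [simp]: "x \<in> VObj K" "y \<in> VObj K" using p by simp_all
  note qT = natural_family_simps[OF q, simplified vop_simps]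
  have "emap (VComp \<V> (FO \<phi> x) (FO \<phi> y) (FO (N a) y)) (pr (emap (q y) u) (emap (FA \<phi> x y) s))
    = emap (VComp \<V> (FO \<phi> x) (FO (N a) x) (FO (N a) y)) (pr (emap (FA (N a) x y) s) (emap (q x) u))"
    by (rule natural_family_el[OF q]) (use p in simp_all)
  from arg_cong[OF this, of "\<lambda>e. emap (ev V (FO \<phi> x) (VHom A a (FO T y))) (pr e t)"]
  show ?case using p qT by simp
qed

lemma family_of_cone:
  assumes r: "wcone (op K) \<phi> A T a z r"
  shows "natural_family V (op K) \<V> \<phi> (N a) z (\<lambda>x. curry z (FO \<phi> x) (VHom A a (FO T x)) (r x \<cdot> \<sigma> z (FO \<phi> x)))"
  unfolding natural_family_def
proof (intro conjI ballI)
  note rT [simp] = wcone_simps[OF r, simplified vop_simps]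
  show "z \<in> Obj V" by simp
  fix x assume "x \<in> VObj (op K)"
  then have [simp]: "x \<in> VObj K" by simp
  show "curry z (FO \<phi> x) (VHom A a (FO T x)) (r x \<cdot> \<sigma> z (FO \<phi> x)) \<in> Hom V z (VHom \<V> (FO \<phi> x) (FO (N a) x))"
    by (simp add: Hom_iff)
  fix y assume "y \<in> VObj (op K)"
  then have [simp]: "y \<in> VObj K" by simp
  show "VComp \<V> (FO \<phi> x) (FO \<phi> y) (FO (N a) y) \<cdot> (curry z (FO \<phi> y) (VHom A a (FO T y)) (r y
      \<cdot> \<sigma> z (FO \<phi> y)) \<boxtimes> FA \<phi> x y) =
      VComp \<V> (FO \<phi> x) (FO (N a) x) (FO (N a) y) \<cdot> (FA (N a) x y \<boxtimes> curry z (FO \<phi> x) (VHom A a (FO T x)) (r x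
          \<cdot> \<sigma> z (FO \<phi> x))) \<cdot> \<sigma> z (VHom (op K) x y)"
  proof (rule ihom_ext2[of _ _ z "VHom K y x" "FO \<phi> x" "VHom A a (FO T y)"], goal_cases)
    case p: (11 \<Gamma> u s t)
    interpret environment V \<Gamma> by (rule p)
    have "emap (VComp A a (FO T x) (FO T y)) (pr (emap (FA T x y) s) (emap (r x) (pr t u)))
       = emap (r y) (pr (emap (ev V (FO \<phi> x) (FO \<phi> y)) (pr (emap (FA \<phi> x y) s) t)) u)"
      by (rule wcone_el[OF r vcat_op[OF K] A \<phi> T]) (use p in simp_all)
    then show ?case using p by simp
  qed simp_all
qed

lemma cone_family_inverse:
  assumes r: "wcone (op K) \<phi> A T a z r" and [simp]: "x \<in> VObj K"
  shows "ev V (FO \<phi> x) (VHom A a (FO T x)) \<cdot> (curry z (FO \<phi> x) (VHom A a (FO T x)) (r x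
      \<cdot> \<sigma> z (FO \<phi> x)) \<boxtimes> \<one> (FO \<phi> x)) \<cdot> \<sigma> (FO \<phi> x) z = r x"
proof -
  note rT [simp] = wcone_simps[OF r, simplified vop_simps]
  show ?thesis
    using tail[OF curry_spec(2)[of "r x \<cdot> \<sigma> z (FO \<phi> x)" z "FO \<phi> x" "VHom A a (FO T x)"], of "\<sigma> (FO \<phi> x) z"] by simp
qed

lemma cone_family_inj:
  assumes [simp]: "a \<in> VObj A" "x \<in> VObj K" "f \<in> Arr V" "g \<in> Arr V" and d: "Dom V f = z" "Dom V g = z"
    "Cod V f = \<lbrakk>FO \<phi> x, VHom A a (FO T x)\<rbrakk>" "Cod V g = \<lbrakk>FO \<phi> x, VHom A a (FO T x)\<rbrakk>"
    and eq: "ev V (FO \<phi> x) (VHom A a (FO T x)) \<cdot> (f \<boxtimes> \<one> (FO \<phi> x)) \<cdot> \<sigma> (FO \<phi> x) z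
      = ev V (FO \<phi> x) (VHom A a (FO T x)) \<cdot> (g \<boxtimes> \<one> (FO \<phi> x)) \<cdot> \<sigma> (FO \<phi> x) z"
  shows "f = g"
proof -
  have [simp]: "z \<in> Obj V" using d(1) Dom_Obj'[of f] by simp
  have "(ev V (FO \<phi> x) (VHom A a (FO T x)) \<cdot> (f \<boxtimes> \<one> (FO \<phi> x))) \<cdot> \<sigma> (FO \<phi> x) z
      = (ev V (FO \<phi> x) (VHom A a (FO T x)) \<cdot> (g \<boxtimes> \<one> (FO \<phi> x))) \<cdot> \<sigma> (FO \<phi> x) z"
    using eq d by simp
  then have "ev V (FO \<phi> x) (VHom A a (FO T x)) \<cdot> (f \<boxtimes> \<one> (FO \<phi> x))
      = ev V (FO \<phi> x) (VHom A a (FO T x)) \<cdot> (g \<boxtimes> \<one> (FO \<phi> x))"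
    by (rule iso_cancel_r[rotated -1]) (use d in simp_all)
  then show ?thesis by (rule uncurry_inj[rotated -1]) (use d in simp_all)
qed

text \<open>Justifies the definite description in \<open>hom_along\<close>: precomposition in
  \<open>A(-, T x)\<close> is natural in \<open>x\<close> by associativity.\<close>

lemma H_spec:
  assumes [simp]: "a \<in> VObj A" "b \<in> VObj A"
  shows "H a b \<in> Hom V (VHom A b a) (nat_obj V (op K) \<V> (N a) (N b)) \<and>
    (\<forall>x\<in>VObj (op K). nat_proj V (op K) \<V> (N a) (N b) x \<cdot> H a b = FA (hom_functor V (op A) (FO T x)) a b)"
proof -
  have "natural_family V (op K) \<V> (N a) (N b) (VHom A b a) (\<lambda>x. FA (hom_functor V (op A) (FO T x)) a b)"
    unfolding natural_family_def
  proof (intro conjI ballI)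
    fix x assume "x \<in> VObj (op K)"
    then have [simp]: "x \<in> VObj K" by simp
    show "FA (hom_functor V (op A) (FO T x)) a b \<in> Hom V (VHom A b a) (VHom \<V> (FO (N a) x) (FO (N b) x))"
      by (simp add: Hom_iff)
    fix y assume "y \<in> VObj (op K)"
    then have [simp]: "y \<in> VObj K" by simp
    show "VComp \<V> (FO (N a) x) (FO (N a) y) (FO (N b) y) \<cdot> (FA (hom_functor V (op A) (FO T y)) a b \<boxtimes> FA (N a) x y) =
       VComp \<V> (FO (N a) x) (FO (N b) x) (FO (N b) y) \<cdot> (FA (N b) x y \<boxtimes> FA (hom_functor V (op A) (FO T x)) a b)
           \<cdot> \<sigma> (VHom A b a) (VHom (op K) x y)"
    proof (rule ihom_ext2[of _ _ "VHom A b a" "VHom K y x" "VHom A a (FO T x)" "VHom A b (FO T y)"], goal_cases)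
      case p: (11 \<Gamma> u s t)
      interpret environment V \<Gamma> by (rule p)
      show ?case using p by simp
    qed simp_all
  qed simp_all
  from theI'[OF nat_lift[OF he N_vfun[OF assms(1)] N_vfun[OF assms(2)] this]]
  show ?thesis by (simp add: hom_along_def Let_def flip: N_def)
qed

lemma H_simps [simp]:
  assumes "a \<in> VObj A" "b \<in> VObj A"
  shows "H a b \<in> Arr V" "Dom V (H a b) = VHom A b a" "Cod V (H a b) = nat_obj V (op K) \<V> (N a) (N b)"
  using H_spec[OF assms] by (auto simp: Hom_iff)

lemma cyl_unfold:
  assumes "a \<in> VObj A"
  shows "FO cyl a = E a"
    "b \<in> VObj A \<Longrightarrow> FA cyl a b = curry (nat_obj V (op K) \<V> (N a) (N b)) (E a) (E b)
       (VComp (functor_cat V (op K) \<V>) \<phi> (N a) (N b)) \<cdot> H a b"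
proof -
  have FOh: "FO (hom_along V (op K) A T) a = N a" if "a \<in> VObj A" for a
    using that by (simp add: hom_along_def Let_def flip: N_def)
  show "FO cyl a = E a" using assms FOh by (simp add: cylinders_def)
  show "FA cyl a b = curry (nat_obj V (op K) \<V> (N a) (N b)) (E a) (E b)
       (VComp (functor_cat V (op K) \<V>) \<phi> (N a) (N b)) \<cdot> H a b" if "b \<in> VObj A"
    using assms FOh that by (simp add: cylinders_def)
qed

lemmas FO_cyl [simp] = cyl_unfold(1)

lemma FA_cyl [simp]:
  assumes "a \<in> VObj A" "b \<in> VObj A"
  shows "FA cyl a b \<in> Arr V" "Dom V (FA cyl a b) = VHom A b a" "Cod V (FA cyl a b) = \<lbrakk>E a, E b\<rbrakk>"
  using assms by (simp_all add: cyl_unfold)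

end

text \<open>An arrow \<open>f\<close> acts on a cylinder by precomposition in each component. Both
  directions of the comparison use the action of \<open>cylinders\<close> on homs through this
  equation.\<close>

lemma (in environment) cyl_el:
  assumes "diagram V U K \<phi> A T" and ab: "a \<in> VObj A" "b \<in> VObj A" "x \<in> VObj K"
    and el: "el f" "el e" "el t" "ctx f \<inter> ctx e = {}" "ctx f \<inter> ctx t = {}" "ctx e \<inter> ctx t = {}" "ctx t \<inter> ctx f
        = {}" "ctx e \<inter> ctx f = {}"
    "ty f = VHom A b a" "ty e = nat_obj V (op K) \<V> \<phi> (diagram.N V K A T a)" "ty t = FO \<phi> x"
  shows "ev V (FO \<phi> x) (VHom A b (FO T x)) \<bullet> ((nat_proj V (op K) \<V> \<phi> (diagram.N V K A T b) x \<bullet>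
      ev V (nat_obj V (op K) \<V> \<phi> (diagram.N V K A T a)) (nat_obj V (op K) \<V> \<phi> (diagram.N V K A T b)) \<bullet>
       ((FA (cylinders V (K, \<phi>) A T) a b \<bullet> f) \<diamondop> e)) \<diamondop> t)
    = VComp A b a (FO T x) \<bullet> ((ev V (FO \<phi> x) (VHom A a (FO T x)) \<bullet> ((nat_proj V (op K) \<V> \<phi> (diagram.N V K A T a) x
        \<bullet> e) \<diamondop> t)) \<diamondop> f)"
proof -
  interpret diagram V U K \<phi> A T by fact
  have "emap (nat_proj V (op K) \<V> (N a) (N b) x \<cdot> H a b) f = emap (FA (hom_functor V (op A) (FO T x)) a b) f"
    using H_spec[OF ab(1,2)] ab(3) by simp
  then have 1: "emap (nat_proj V (op K) \<V> (N a) (N b) x) (emap (H a b) f)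
      = emap (FA (hom_functor V (op A) (FO T x)) a b) f"
    using ab el by simp
  have 2: "emap (P b x) (emap (VComp (functor_cat V (op K) \<V>) \<phi> (N a) (N b)) (pr (emap (H a b) f) e))
    = emap (VComp \<V> (FO \<phi> x) (FO (N a) x) (FO (N b) x)) (pr (emap (nat_proj V (op K) \<V> (N a) (N b) x) (emap (H a
        b) f)) (emap (P a x) e))"
    by (rule nat_proj_Comp) (use ab el in simp_all)
  show ?thesis
    using ab el by (simp add: 2 1 cyl_unfold)
qed

context diagram
begin

lemma counit_eq:
  assumes [simp]: "L \<in> VObj A" "x \<in> VObj K" and \<theta>: "\<theta> L \<in> Arr V" "Dom V (\<theta> L) = VHom A L L" "Cod V (\<theta> L) = E L"
  shows "counit V (K, \<phi>) A T L \<theta> x = ev V (FO \<phi> x) (VHom A L (FO T x)) \<cdot> ((P L x \<cdot> \<theta> L \<cdot> VId A L) \<boxtimes> \<one> (FO \<phi> x))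
      \<cdot> invr (\<lambda>\<lambda> (FO \<phi> x))"
proof -
  have "counit V (K, \<phi>) A T L \<theta> x = unname V (FO \<phi> x) (VHom A L (FO T x)) (P L x \<cdot> \<theta> L \<cdot> VId A L)"
    by (simp add: counit_def flip: N_def)
  then show ?thesis using \<theta> by (simp add: unname_eq)
qed

theorem is_lim_if_is_wlimit:
  assumes "is_wlimit V (K, \<phi>) A T L \<theta>"
  shows "is_lim (op K) \<phi> A T L (counit V (K, \<phi>) A T L \<theta>)"
proof -
  have L [simp]: "L \<in> VObj A" and iso: "\<And>a. a \<in> VObj A \<Longrightarrow> is_iso V (VHom A a L) (E a) (\<theta> a)"
    and nat: "natural_family V (op A) \<V> (hom_functor V (op A) L) cyl \<I> (\<lambda>a. name V (VHom A a L) (FO cyl a) (\<theta> a))"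
    using assms by (auto simp: is_wlimit_def vnat_trans_def)
  have \<theta> [simp]: "\<And>a. a \<in> VObj A \<Longrightarrow> \<theta> a \<in> Arr V" "\<And>a. a \<in> VObj A \<Longrightarrow> Dom V (\<theta> a) = VHom A a L"
    "\<And>a. a \<in> VObj A \<Longrightarrow> Cod V (\<theta> a) = E a" and isoT: "\<And>a. a \<in> VObj A \<Longrightarrow> iso (\<theta> a)"
    using iso by (auto simp: is_iso_iff)
  define \<gamma> where "\<gamma> = counit V (K, \<phi>) A T L \<theta>"
  have \<gamma>: "\<gamma> x = ev V (FO \<phi> x) (VHom A L (FO T x)) \<cdot> ((P L x \<cdot> \<theta> L \<cdot> VId A L) \<boxtimes> \<one> (FO \<phi> x)) \<cdot> invr (\<lambda>\<lambda> (FO \<phi> x))"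
    if "x \<in> VObj K" for x unfolding \<gamma>_def by (rule counit_eq) (use that in simp_all)
  have \<gamma>T [simp]: "\<gamma> x \<in> Arr V" "Dom V (\<gamma> x) = FO \<phi> x" "Cod V (\<gamma> x) = VHom A L (FO T x)" if "x \<in> VObj K" for x
    using that by (simp_all add: \<gamma>)
  have nat_el: "App (\<theta> b) (App (VComp A b a L) (Pr \<Gamma> g f))
     = App (ev V (E a) (E b)) (Pr \<Gamma> (App (FA cyl a b) f) (App (\<theta> a) g))"
    if [simp]: "a \<in> VObj A" "b \<in> VObj A" and G: "environment V \<Gamma>" "El \<Gamma> f" "El \<Gamma> g"
       "Ty f = VHom A b a" "Ty g = VHom A a L" "Ctx f \<inter> Ctx g = {}"
       "Ctx g \<inter> Ctx f = {}"
    for a b f g \<Gamma>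
  proof -
    interpret environment V \<Gamma> by (rule G)
    have eq: "VComp \<V> (VHom A a L) (VHom A b L) (E b) \<cdot> (name V (VHom A b L) (E b) (\<theta> b) \<boxtimes> FA (hom_functor V (op
        A) L) a b)
       = VComp \<V> (VHom A a L) (E a) (E b) \<cdot> (FA cyl a b \<boxtimes> name V (VHom A a L) (E a) (\<theta> a)) \<cdot> \<sigma> \<I> (VHom A b a)"
      using nat that(1,2) unfolding natural_family_def by (simp del: self_enriched_simps(3))
    from arg_cong[OF this, of "\<lambda>h. emap (ev V (VHom A a L) (E b)) (pr (emap h (pr star f)) g)"]
    show ?thesis using G by simp
  qed
  \<comment> \<open>The Yoneda argument: writing \<open>f\<close> as the identity of
    \<open>L\<close> composed with \<open>f\<close>, naturality computes \<open>\<theta> a\<close>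
    on \<open>f\<close> from the value of \<open>\<theta> L\<close> at the identity, which is the
    counit.\<close>
  have key: "App (ev V (FO \<phi> x) (VHom A a (FO T x))) (Pr \<Gamma> (App (P a x) (App (\<theta> a) f)) t)
     = App (VComp A a L (FO T x)) (Pr \<Gamma> (App (\<gamma> x) t) f)"
    if ax: "a \<in> VObj A" "x \<in> VObj K" and G: "environment V \<Gamma>" "El \<Gamma> f" "El \<Gamma> t"
       "Ty f = VHom A a L" "Ty t = FO \<phi> x" "Ctx f \<inter> Ctx t = {}"
       "Ctx t \<inter> Ctx f = {}"
    for a x f t \<Gamma>
  proof -
    interpret environment V \<Gamma> by (rule G)
    have "emap (\<theta> a) f = emap (\<theta> a) (emap (VComp A a L L) (pr (emap (VId A L) star) f))"
      using ax G by simp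
    also have "\<dots> = emap (ev V (E L) (E a)) (pr (emap (FA cyl L a) f) (emap (\<theta> L) (emap (VId A L) star)))"
      by (rule nat_el) (use ax G in simp_all)
    finally have 1: "emap (\<theta> a) f = \<dots>" .
    have 2: "emap (ev V (FO \<phi> x) (VHom A a (FO T x))) (pr (emap (P a x) (emap (ev V (E L) (E a)) (pr (emap (FA cyl
        L a) f) (emap (\<theta> L) (emap (VId A L) star))))) t)
      = emap (VComp A a L (FO T x)) (pr (emap (ev V (FO \<phi> x) (VHom A L (FO T x))) (pr (emap (P L x) (emap (\<theta> L)
          (emap (VId A L) star))) t)) f)"
      by (rule cyl_el[OF diagram_axioms]) (use ax G in simp_all)
    have "emap (\<gamma> x) t = emap (ev V (FO \<phi> x) (VHom A L (FO T x))) (pr (emap (P L x) (emap (\<theta> L) (emap (VId A L)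
        star))) t)"
      unfolding \<gamma>[OF ax(2)] using ax G by simp
    then show ?thesis unfolding 1 2 by simp
  qed
  have key': "ev V (FO \<phi> x) (VHom A a (FO T x)) \<cdot> ((P a x \<cdot> \<theta> a \<cdot> h) \<boxtimes> \<one> (FO \<phi> x)) \<cdot> \<sigma> (FO \<phi> x) z
     = VComp A a L (FO T x) \<cdot> (\<gamma> x \<boxtimes> h)"
    if [simp]: "a \<in> VObj A" "x \<in> VObj K" "h \<in> Arr V" "z \<in> Obj V" and h: "Dom V h = z" "Cod V h
        = VHom A a L" for a x h z
  proof (rule ext2[of _ _ "FO \<phi> x" z], goal_cases)
    case p: (7 \<Gamma> t u)
    interpret environment V \<Gamma> by (rule p)
    have "emap (ev V (FO \<phi> x) (VHom A a (FO T x))) (pr (emap (P a x) (emap (\<theta> a) (emap h u))) t)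
     = emap (VComp A a L (FO T x)) (pr (emap (\<gamma> x) t) (emap h u))"
      by (rule key) (use p h in simp_all)
    then show ?case using p h by simp
  qed (use h in simp_all)
  have "wcounit (op K) \<phi> A T L \<gamma>"
  proof (rule wcounitI[OF vcat_op[OF K] A \<phi> T L], goal_cases)
    case (1 x) then show ?case by simp
  next
    case p: (2 x y \<Gamma> s t)
    interpret environment V \<Gamma> by (rule p)
    have [simp]: "x \<in> VObj K" "y \<in> VObj K" using p by simp_all
    let ?u = "emap (\<theta> L) (emap (VId A L) star)"
    have "emap (VComp \<V> (FO \<phi> x) (FO \<phi> y) (FO (N L) y)) (pr (emap (P L y) ?u) (emap (FA \<phi> x y) s))
      = emap (VComp \<V> (FO \<phi> x) (FO (N L) x) (FO (N L) y)) (pr (emap (FA (N L) x y) s) (emap (P L x) ?u))"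
      by (rule natural_family_el[OF nat_proj_natural]) (use p in simp_all)
    from arg_cong[OF this, of "\<lambda>e. emap (ev V (FO \<phi> x) (VHom A L (FO T y))) (pr e t)"]
    show ?case using p by (simp add: \<gamma>)
  qed
  then show "is_lim (op K) \<phi> A T L \<gamma>"
  proof (rule is_limI[OF vcat_op[OF K] A \<phi> T])
    fix a z r assume r: "wcone (op K) \<phi> A T a z r"
    note rT [simp] = wcone_simps[OF r, simplified vop_simps]
    \<comment> \<open>The cone, read as a natural family, is an arrow into the end
      \<open>E a\<close>; the inverse of \<open>\<theta> a\<close> carries it to the required
      factorisation.\<close>
    obtain k where k: "k \<in> Arr V" "Dom V k = z" "Cod V k = E a" 
      "\<And>x. x \<in> VObj K \<Longrightarrow> P a x \<cdot> k = curry z (FO \<phi> x) (VHom A a (FO T x)) (r x \<cdot> \<sigma> z (FO \<phi> x))"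
      using nat_lift[OF he \<phi> N_vfun family_of_cone[OF r]] by (auto simp: Hom_iff)
    have "VComp A a L (FO T x) \<cdot> (\<gamma> x \<boxtimes> (invr (\<theta> a) \<cdot> k)) = r x" if x [simp]: "x \<in> VObj K" for x
    proof -
      have "VComp A a L (FO T x) \<cdot> (\<gamma> x \<boxtimes> (invr (\<theta> a) \<cdot> k))
        = ev V (FO \<phi> x) (VHom A a (FO T x)) \<cdot> ((P a x \<cdot> \<theta> a \<cdot> invr (\<theta> a) \<cdot> k) \<boxtimes> \<one> (FO \<phi> x)) \<cdot> \<sigma> (FO \<phi> x) z"
        by (rule key'[symmetric]) (use k isoT in simp_all)
      also have "\<dots> = ev V (FO \<phi> x) (VHom A a (FO T x)) \<cdot> (curry z (FO \<phi> x) (VHom A a (FO T x)) (r x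
          \<cdot> \<sigma> z (FO \<phi> x)) \<boxtimes> \<one> (FO \<phi> x)) \<cdot> \<sigma> (FO \<phi> x) z"
        using k(1-3) isoT by (simp flip: k(4))
      also have "\<dots> = r x" by (rule cone_family_inverse[OF r x])
      finally show ?thesis .
    qed
    then show "\<exists>h. h \<in> Arr V \<and> Dom V h = z \<and> Cod V h = VHom A a L \<and>
        (\<forall>x\<in>VObj (op K). VComp A a L (FO T x) \<cdot> (\<gamma> x \<boxtimes> h) = r x)"
      by (intro exI[of _ "invr (\<theta> a) \<cdot> k"]) (use k isoT in simp_all)
  next
    fix a z f g assume [simp]: "a \<in> VObj A" "z \<in> Obj V" and f: "f \<in> Arr V" "Dom V f = z" "Cod V f = VHom A a L"
       and g: "g \<in> Arr V" "Dom V g = z" "Cod V g = VHom A a L"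
       and eq: "\<And>x. x \<in> VObj (op K) \<Longrightarrow> VComp A a L (FO T x) \<cdot> (\<gamma> x \<boxtimes> f) = VComp A a L (FO T x) \<cdot> (\<gamma> x \<boxtimes> g)"
    have "\<theta> a \<cdot> f = \<theta> a \<cdot> g"
    proof (rule nat_ext[OF he \<phi> N_vfun[of a]], goal_cases)
      case (8 x)
      then have [simp]: "x \<in> VObj K" by simp
      show ?case
        by (rule cone_family_inj[of a x _ _ z]) (use f g key'[of a x f z] key'[of a x g z] eq[of x] in simp_all)
    qed (use f g in simp_all)
    then show "f = g" by (rule iso_cancel_l[OF isoT, rotated -1]) (use f g in simp_all)
  qed
qed

theorem is_wlimit_if_is_lim:
  assumes lim: "is_lim (op K) \<phi> A T L \<gamma>"
  shows "\<exists>\<theta>. is_wlimit V (K, \<phi>) A T L \<theta> \<and> (\<forall>x\<in>VObj K. counit V (K, \<phi>) A T L \<theta> x = \<gamma> x)"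
proof -
  note \<gamma> = is_lim_wcounit[OF lim]
  note \<gamma>T [simp] = wcounit_simps[OF \<gamma>, simplified vop_simps]
  \<comment> \<open>\<open>\<theta> a\<close> has to send an arrow \<open>a \<rightarrow> L\<close>
    to its composite with the counit; the cone of the identity of \<open>A(a, L)\<close> yields it
    at once for all generalised elements.\<close>
  have "\<exists>\<theta>. \<theta> \<in> Arr V \<and> Dom V \<theta> = VHom A a L \<and> Cod V \<theta> = E a \<and>
     (\<forall>x\<in>VObj K. ev V (FO \<phi> x) (VHom A a (FO T x)) \<cdot> ((P a x \<cdot> \<theta>) \<boxtimes> \<one> (FO \<phi> x)) \<cdot> \<sigma> (FO \<phi> x) (VHom A a L)
         = VComp A a L (FO T x) \<cdot> (\<gamma> x \<boxtimes> \<one> (VHom A a L)))"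
    if a [simp]: "a \<in> VObj A" for a
  proof -
    have r: "wcone (op K) \<phi> A T a (VHom A a L) (\<lambda>x. VComp A a L (FO T x) \<cdot> (\<gamma> x \<boxtimes> \<one> (VHom A a L)))"
      by (rule wcone_of_arrow[OF \<gamma> vcat_op[OF K] A \<phi> T a]) simp_all
    obtain k where k: "k \<in> Arr V" "Dom V k = VHom A a L" "Cod V k = E a" 
      "\<And>x. x \<in> VObj K \<Longrightarrow> P a x \<cdot> k = curry (VHom A a L) (FO \<phi> x) (VHom A a (FO T x)) ((VComp A a L (FO T x)
          \<cdot> (\<gamma> x \<boxtimes> \<one> (VHom A a L))) \<cdot> \<sigma> (VHom A a L) (FO \<phi> x))"
      using nat_lift[OF he \<phi> N_vfun[OF a] family_of_cone[OF r]] by (auto simp: Hom_iff simp del: assoc_r)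
    then show ?thesis using cone_family_inverse[OF r] by (intro exI[of _ k]) (simp del: assoc_r)
  qed
  then obtain \<theta> where \<theta> [simp]: "\<And>a. a \<in> VObj A \<Longrightarrow> \<theta> a \<in> Arr V" "\<And>a. a \<in> VObj A \<Longrightarrow> Dom V (\<theta> a) = VHom A a L"
    "\<And>a. a \<in> VObj A \<Longrightarrow> Cod V (\<theta> a) = E a"
    and \<theta>_eq: "\<And>a x. a \<in> VObj A \<Longrightarrow> x \<in> VObj K \<Longrightarrow> ev V (FO \<phi> x) (VHom A a (FO T x)) \<cdot> ((P a x \<cdot> \<theta> a) \<boxtimes> \<one> (FO \<phi> x))
        \<cdot> \<sigma> (FO \<phi> x) (VHom A a L) = VComp A a L (FO T x) \<cdot> (\<gamma> x \<boxtimes> \<one> (VHom A a L))"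
    by metis
  have \<theta>_el: "App (ev V (FO \<phi> x) (VHom A a (FO T x))) (Pr \<Gamma> (App (P a x) (App (\<theta> a) f)) t)
     = App (VComp A a L (FO T x)) (Pr \<Gamma> (App (\<gamma> x) t) f)"
    if ax: "a \<in> VObj A" "x \<in> VObj K" and G: "environment V \<Gamma>" "El \<Gamma> f" "El \<Gamma> t"
       "Ty f = VHom A a L" "Ty t = FO \<phi> x" "Ctx f \<inter> Ctx t = {}"
       "Ctx t \<inter> Ctx f = {}"
    for a x f t \<Gamma>
  proof -
    interpret environment V \<Gamma> by (rule G)
    from arg_cong[OF \<theta>_eq[OF ax], of "\<lambda>h. emap h (pr t f)"] show ?thesis using ax G by simp
  qed
  \<comment> \<open>Tested on the projections of the end and then transposed, both sides are the
    counit composed with \<open>g\<close> and then with \<open>f\<close>.\<close>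
  have \<theta>_nat: "\<theta> b \<cdot> VComp A b a L = ev V (E a) (E b) \<cdot> (FA cyl a b \<boxtimes> \<theta> a) \<cdot> \<sigma> (VHom A a L) (VHom A b a)"
    if a [simp]: "a \<in> VObj A" and b [simp]: "b \<in> VObj A" for a b
    proof (rule nat_ext[OF he \<phi> N_vfun[of b], of _ _ "VHom A a L \<otimes> VHom A b a"], goal_cases)
      case (8 x)
      then have x [simp]: "x \<in> VObj K" by simp
      show ?case
      proof (rule cone_family_inj[of b x _ _ "VHom A a L \<otimes> VHom A b a"], goal_cases)
        case 9
        show ?case
        proof (rule ext3'[of _ _ "FO \<phi> x" "VHom A a L" "VHom A b a"], goal_cases)
          case p: (8 \<Gamma> t g f)
          interpret environment V \<Gamma> by (rule p)
          have 1: "emap (ev V (FO \<phi> x) (VHom A b (FO T x))) (pr (emap (P b x) (emap (\<theta> b) (emap (VComp A b a L)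
              (pr g f)))) t)
            = emap (VComp A b L (FO T x)) (pr (emap (\<gamma> x) t) (emap (VComp A b a L) (pr g f)))"
            by (rule \<theta>_el) (use p in simp_all)
          have 2: "emap (ev V (FO \<phi> x) (VHom A b (FO T x))) (pr (emap (P b x) (emap (ev V (E a) (E b)) (pr (emap
              (FA cyl a b) f) (emap (\<theta> a) g)))) t)
            = emap (VComp A b a (FO T x)) (pr (emap (ev V (FO \<phi> x) (VHom A a (FO T x))) (pr (emap (P a x) (emap (\<theta>
                a) g)) t)) f)"
            by (rule cyl_el[OF diagram_axioms]) (use p in simp_all)
          have 3: "emap (ev V (FO \<phi> x) (VHom A a (FO T x))) (pr (emap (P a x) (emap (\<theta> a) g)) t)
              = emap (VComp A a L (FO T x)) (pr (emap (\<gamma> x) t) g)"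
            by (rule \<theta>_el) (use p in simp_all)
          show ?case using p 1 2 3 by simp
        qed simp_all
      qed simp_all
    qed simp_all
  have "is_iso V (VHom A a L) (E a) (\<theta> a)" if a [simp]: "a \<in> VObj A" for a
  proof -
    \<comment> \<open>The tautological cone, which corresponds to the identity of
      \<open>E a\<close>; its factorisation \<open>k\<close> is the inverse of
      \<open>\<theta> a\<close>.\<close>
    have r: "wcone (op K) \<phi> A T a (E a) (\<lambda>x. ev V (FO \<phi> x) (VHom A a (FO T x)) \<cdot> (P a x \<boxtimes> \<one> (FO \<phi> x))
        \<cdot> \<sigma> (FO \<phi> x) (E a))"
      by (rule cone_of_family[OF nat_proj_natural]) simp_all
    obtain k where k [simp]: "k \<in> Arr V" "Dom V k = E a" "Cod V k = VHom A a L" and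
      kx: "\<And>x. x \<in> VObj (op K) \<Longrightarrow> VComp A a L (FO T x) \<cdot> (\<gamma> x \<boxtimes> k)
          = ev V (FO \<phi> x) (VHom A a (FO T x)) \<cdot> (P a x \<boxtimes> \<one> (FO \<phi> x)) \<cdot> \<sigma> (FO \<phi> x) (E a)"
      using lim_lift[OF lim r] by metis
    have 1: "\<theta> a \<cdot> k = \<one> (E a)"
    proof (rule nat_ext[OF he \<phi> N_vfun[of a], of _ _ "E a"], goal_cases)
      case (8 x)
      then have [simp]: "x \<in> VObj K" by simp
      show ?case
      proof (rule cone_family_inj[of a x _ _ "E a"], goal_cases)
        case 9
        show ?case
        proof (rule ext2[of _ _ "FO \<phi> x" "E a"], goal_cases)
          case p: (7 \<Gamma> t e)
          interpret environment V \<Gamma> by (rule p)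
          have "emap (ev V (FO \<phi> x) (VHom A a (FO T x))) (pr (emap (P a x) (emap (\<theta> a) (emap k e))) t)
             = emap (VComp A a L (FO T x)) (pr (emap (\<gamma> x) t) (emap k e))"
            by (rule \<theta>_el) (use p in simp_all)
          also have "\<dots> = emap (ev V (FO \<phi> x) (VHom A a (FO T x))) (pr (emap (P a x) e) t)"
            using arg_cong[OF kx[of x], of "\<lambda>h. emap h (pr t e)"] p by simp
          finally show ?case using p by simp
        qed simp_all
      qed simp_all
    qed simp_all
    have 2: "k \<cdot> \<theta> a = \<one> (VHom A a L)"
    proof (rule lim_unique[OF lim vcat_op[OF K] A \<phi> T a], goal_cases)
      case (7 x)
      then have [simp]: "x \<in> VObj K" by simp
      show ?case
      proof (rule ext2[of _ _ "FO \<phi> x" "VHom A a L"], goal_cases)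
        case p: (7 \<Gamma> t f)
        interpret environment V \<Gamma> by (rule p)
        have "emap (VComp A a L (FO T x)) (pr (emap (\<gamma> x) t) (emap k (emap (\<theta> a) f)))
          = emap (ev V (FO \<phi> x) (VHom A a (FO T x))) (pr (emap (P a x) (emap (\<theta> a) f)) t)"
          using arg_cong[OF kx[of x], of "\<lambda>h. emap h (pr t (emap (\<theta> a) f))"] p by simp
        also have "\<dots> = emap (VComp A a L (FO T x)) (pr (emap (\<gamma> x) t) f)"
          by (rule \<theta>_el) (use p in simp_all)
        finally show ?case using p by simp
      qed simp_all
    qed simp_all
    show ?thesis unfolding is_iso_iff using isoI[of "\<theta> a" k] 1 2 by simp
  qed
  moreover have "natural_family V (op A) \<V> (hom_functor V (op A) L) cyl \<I> (\<lambda>a. name V (VHom A a L) (FO cyl a) (\<theta> a))"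
    unfolding natural_family_def
  proof (intro conjI ballI)
    fix a assume "a \<in> VObj (op A)"
    then have a [simp]: "a \<in> VObj A" by simp
    show "name V (VHom A a L) (FO cyl a) (\<theta> a) \<in> Hom V \<I> (VHom \<V> (FO (hom_functor V (op A) L) a) (FO cyl a))"
      by (simp add: Hom_iff)
    fix b assume "b \<in> VObj (op A)"
    then have b [simp]: "b \<in> VObj A" by simp
    show "VComp \<V> (FO (hom_functor V (op A) L) a) (FO (hom_functor V (op A) L) b) (FO cyl b)
        \<cdot> (name V (VHom A b L) (FO cyl b) (\<theta> b) \<boxtimes> FA (hom_functor V (op A) L) a b)
       = VComp \<V> (FO (hom_functor V (op A) L) a) (FO cyl a) (FO cyl b)
           \<cdot> (FA cyl a b \<boxtimes> name V (VHom A a L) (FO cyl a) (\<theta> a)) \<cdot> \<sigma> \<I> (VHom (op A) a b)"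
    proof (rule ihom_ext_unit[of _ _ "VHom A b a" "VHom A a L" "E b"], goal_cases)
      case p: (10 \<Gamma> f g)
      interpret environment V \<Gamma> by (rule p)
      from arg_cong[OF \<theta>_nat[OF a b], of "\<lambda>h. emap h (pr g f)"] show ?case using p by simp
    qed simp_all
  qed simp_all
  ultimately have "is_wlimit V (K, \<phi>) A T L \<theta>"
    unfolding is_wlimit_def vnat_trans_def by simp
  moreover have "counit V (K, \<phi>) A T L \<theta> x = \<gamma> x" if x [simp]: "x \<in> VObj K" for x
  proof (rule ext1[of _ _ "FO \<phi> x"], goal_cases)
    case p: (5 \<Gamma> t)
    interpret environment V \<Gamma> by (rule p)
    have "emap (ev V (FO \<phi> x) (VHom A L (FO T x))) (pr (emap (P L x) (emap (\<theta> L) (emap (VId A L) star))) t)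
       = emap (VComp A L L (FO T x)) (pr (emap (\<gamma> x) t) (emap (VId A L) star))"
      by (rule \<theta>_el) (use p in simp_all)
    then show ?case using p by (simp add: counit_eq)
  qed (simp_all add: counit_eq)
  ultimately show ?thesis by blast
qed

end

section \<open>Preservation of limits\<close>

context symmetric_monoidal_closed
begin

lemma is_lim_cong:
  assumes "\<And>x. x \<in> VObj X \<Longrightarrow> \<gamma> x = \<gamma>' x" "is_lim X \<phi> A T L \<gamma>"
  shows "is_lim X \<phi> A T L \<gamma>'"
proof -
  have 1: "wcounit X \<phi> A T L \<gamma>'"
    using assms unfolding is_lim_def wcounit_def by simp
  have "(\<forall>x\<in>VObj X. VComp A a L (FO T x) \<cdot> (\<gamma> x \<boxtimes> h) = r x) \<longleftrightarrow> (\<forall>x\<in>VObj X. VComp A a L (FO T x) \<cdot> (\<gamma>' x \<boxtimes> h)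
      = r x)" for a h r
    using assms(1) by simp
  with 1 assms(2) show ?thesis unfolding is_lim_def by simp
qed

lemma wcounit_compose:
  assumes "wcounit X \<phi> A T L \<gamma>" and asm: "vcat X" "vcat A" "vcat B" "\<phi> \<in> vfun X \<V>" "T \<in> vfun X A" "F \<in> vfun A B"
  shows "wcounit X \<phi> B (vcompose V X F T) (FO F L) (\<lambda>x. FA F L (FO T x) \<cdot> \<gamma> x)"
proof (rule wcounitI[OF asm(1,3,4) vcompose_vfun[OF asm(1,2,3,5,6)]], goal_cases)
  case 1 show ?case using assms by simp
next
  case (2 x) then show ?case using assms by simp
next
  case p: (3 x y \<Gamma> s t)
  interpret environment V \<Gamma> by (rule p)
  have "emap (FA F L (FO T y)) (emap (VComp A L (FO T x) (FO T y)) (pr (emap (FA T x y) s) (emap (\<gamma> x) t)))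
    = emap (FA F L (FO T y)) (emap (\<gamma> y) (emap (ev V (FO \<phi> x) (FO \<phi> y)) (pr (emap (FA \<phi> x y) s) t)))"
    by (subst wcounit_el[OF assms(1) asm(1,2,4,5)]) (use p in simp_all)
  then show ?case using p assms vfun_simps(1)[OF asm(4) p(1)] vfun_simps(1)[OF asm(4) p(2)] by simp
qed

text \<open>\<open>u\<close> and \<open>v\<close> are mutually inverse arrows between
  \<open>L\<close> and \<open>L'\<close>, and composing with them exchanges the factorisations
  through the two objects.\<close>

lemma is_lim_iso:
  assumes lim: "is_lim X \<phi> A T L \<gamma>" and asm: "vcat X" "vcat A" "\<phi> \<in> vfun X \<V>" "T \<in> vfun X A" and L: "L' \<in> VObj A"
    and u: "u \<in> Arr V" "Dom V u = \<I>" "Cod V u = VHom A L L'" and v: "v \<in> Arr V" "Dom V v = \<I>" "Cod V v = VHom A L' L"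
    and vu: "VComp A L L' L \<cdot> (v \<boxtimes> u) \<cdot> invr (\<lambda>\<lambda> \<I>) = VId A L" and uv: "VComp A L' L L' \<cdot> (u \<boxtimes> v) \<cdot> invr (\<lambda>\<lambda> \<I>)
        = VId A L'"
    and \<gamma>': "wcounit X \<phi> A T L' \<gamma>'" "\<And>x. x \<in> VObj X \<Longrightarrow> \<gamma>' x = VComp A L' L (FO T x) \<cdot> (\<gamma> x \<boxtimes> v) \<cdot> invr (\<rho> (FO \<phi> x))"
  shows "is_lim X \<phi> A T L' \<gamma>'"
proof (rule is_limI[OF asm \<gamma>'(1)])
  note \<gamma> = is_lim_wcounit[OF lim]
  note \<gamma>T = wcounit_simps[OF \<gamma>]
  have o: "x \<in> VObj X \<Longrightarrow> FO \<phi> x \<in> Obj V" for x using vfun_simps(1)[OF asm(3)] by auto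
  note all = asm L u v \<gamma>T o
  have vu': "App (VComp A L L' L) (Pr \<Gamma> (App v (Star)) (App u (Star)))
      = App (VId A L) (Star)" if "environment V \<Gamma>" for \<Gamma>
  proof -
    interpret environment V \<Gamma> by (rule that)
    show ?thesis using arg_cong[OF vu, of "\<lambda>f. emap f star"] all by simp
  qed
  have uv': "App (VComp A L' L L') (Pr \<Gamma> (App u (Star)) (App v (Star)))
      = App (VId A L') (Star)" if "environment V \<Gamma>" for \<Gamma>
  proof -
    interpret environment V \<Gamma> by (rule that)
    show ?thesis using arg_cong[OF uv, of "\<lambda>f. emap f star"] all by simp
  qed
  show "\<exists>h. h \<in> Arr V \<and> Dom V h = z \<and> Cod V h = VHom A a L' \<and> (\<forall>x\<in>VObj X. VComp A a L' (FO T x) \<cdot> (\<gamma>' x \<boxtimes> h) = r x)"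
    if r: "wcone X \<phi> A T a z r" for a z r
  proof -
    note rT = wcone_simps[OF r]
    from lim_lift[OF lim r] obtain h where h: "h \<in> Arr V" "Dom V h = z" "Cod V h = VHom A a L"
       "\<And>x. x \<in> VObj X \<Longrightarrow> VComp A a L (FO T x) \<cdot> (\<gamma> x \<boxtimes> h) = r x" by metis
    have "VComp A a L' (FO T x) \<cdot> (\<gamma>' x \<boxtimes> (VComp A a L L' \<cdot> (u \<boxtimes> h) \<cdot> invr (\<lambda>\<lambda> z))) = r x" if x: "x \<in> VObj X" for x
      unfolding h(4)[OF x, symmetric]
    proof (rule ext2[of _ _ "FO \<phi> x" z], goal_cases)
      case p: (7 \<Gamma> t k)
      interpret environment V \<Gamma> by (rule p)
      let ?t = "emap (\<gamma> x) t" and ?v = "emap v star" and ?u = "emap u star" and ?h = "emap h k"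
      have "emap (VComp A L' L (FO T x)) (pr ?t ?v) = emap (\<gamma>' x) t"
        unfolding \<gamma>'(2)[OF x] using p all x by simp
      then have "emap (VComp A a L' (FO T x)) (pr (emap (\<gamma>' x) t) (emap (VComp A a L L') (pr ?u ?h)))
        = emap (VComp A a L' (FO T x)) (pr (emap (VComp A L' L (FO T x)) (pr ?t ?v)) (emap (VComp A a L L') (pr ?u
            ?h)))" by simp
      also have "\<dots> = emap (VComp A a L (FO T x)) (pr ?t (emap (VComp A a L L) (pr (emap (VComp A L L' L) (pr ?v
          ?u)) ?h)))"
        using p all x h(1-3) rT(1,2) by simp
      also have "\<dots> = emap (VComp A a L (FO T x)) (pr ?t ?h)"
        unfolding vu'[OF p(1)] using p all x h(1-3) rT(1,2) by simp
      finally show ?case using p all x h(1-3) rT(1,2) \<gamma>'(1) by simp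
    qed (use all h(1-3) rT(1,2) x \<gamma>'(1) in simp_all)
    then show ?thesis by (intro exI[of _ "VComp A a L L' \<cdot> (u \<boxtimes> h) \<cdot> invr (\<lambda>\<lambda> z)"])
        (use all h(1-3) rT(1,2) in simp_all)
  qed
  fix a z f g
  assume a: "a \<in> VObj A" "z \<in> Obj V" and f: "f \<in> Arr V" "Dom V f = z" "Cod V f = VHom A a L'"
    and g: "g \<in> Arr V" "Dom V g = z" "Cod V g = VHom A a L'"
    and eq: "\<And>x. x \<in> VObj X \<Longrightarrow> VComp A a L' (FO T x) \<cdot> (\<gamma>' x \<boxtimes> f) = VComp A a L' (FO T x) \<cdot> (\<gamma>' x \<boxtimes> g)"
  have key: "VComp A a L (FO T x) \<cdot> (\<gamma> x \<boxtimes> (VComp A a L' L \<cdot> (v \<boxtimes> f) \<cdot> invr (\<lambda>\<lambda> z)))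
      = VComp A a L' (FO T x) \<cdot> (\<gamma>' x \<boxtimes> f)"
    if x: "x \<in> VObj X" and f: "f \<in> Arr V" "Dom V f = z" "Cod V f = VHom A a L'" for x f
  proof (rule ext2[of _ _ "FO \<phi> x" z], goal_cases)
    case p: (7 \<Gamma> t k)
    interpret environment V \<Gamma> by (rule p)
    show ?case using p all x f a by (simp add: \<gamma>'(2))
  qed (use all f a x \<gamma>'(1) in simp_all)
  have vfg: "VComp A a L' L \<cdot> (v \<boxtimes> f) \<cdot> invr (\<lambda>\<lambda> z) = VComp A a L' L \<cdot> (v \<boxtimes> g) \<cdot> invr (\<lambda>\<lambda> z)"
    by (rule lim_unique[OF lim asm a(1), of _ z]) (use all a f g key[OF _ f] key[OF _ g] eq in simp_all)
  have uvf: "VComp A a L L' \<cdot> (u \<boxtimes> (VComp A a L' L \<cdot> (v \<boxtimes> f) \<cdot> invr (\<lambda>\<lambda> z))) \<cdot> invr (\<lambda>\<lambda> z) = f"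
    if f: "f \<in> Arr V" "Dom V f = z" "Cod V f = VHom A a L'" for f
  proof (rule ext1[of _ _ z], goal_cases)
    case p: (5 \<Gamma> k)
    interpret environment V \<Gamma> by (rule p)
    let ?v = "emap v star" and ?u = "emap u star" and ?f = "emap f k"
    have "emap (VComp A a L L') (pr ?u (emap (VComp A a L' L) (pr ?v ?f)))
        = emap (VComp A a L' L') (pr (emap (VComp A L' L L') (pr ?u ?v)) ?f)"
      using p all f a by simp
    also have "\<dots> = ?f" unfolding uv'[OF p(1)] using p all f a by simp
    finally show ?case using p all f a by simp
  qed (use all f a in simp_all)
  show "f = g" using uvf[OF f] uvf[OF g] unfolding vfg by simp
qed

text \<open>A counit becomes a cone with \<open>z = \<I>\<close> by means of the right unitor. Its
  factorisation is the comparison arrow.\<close>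

lemma lim_compare:
  assumes lim: "is_lim X \<phi> A T L \<gamma>" and asm: "vcat X" "vcat A" "\<phi> \<in> vfun X \<V>"
      "T \<in> vfun X A" and \<gamma>': "wcounit X \<phi> A T L' \<gamma>'"
  obtains v where "v \<in> Arr V" "Dom V v = \<I>" "Cod V v = VHom A L' L"
    "\<And>x. x \<in> VObj X \<Longrightarrow> \<gamma>' x = VComp A L' L (FO T x) \<cdot> (\<gamma> x \<boxtimes> v) \<cdot> invr (\<rho> (FO \<phi> x))"
proof -
  note \<gamma>T = wcounit_simps[OF is_lim_wcounit[OF lim]] wcounit_simps[OF \<gamma>']
  have o: "x \<in> VObj X \<Longrightarrow> FO \<phi> x \<in> Obj V" for x using vfun_simps(1)[OF asm(3)] by auto
  have "wcone X \<phi> A T L' \<I> (\<lambda>x. \<gamma>' x \<cdot> \<rho> (FO \<phi> x))"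
  proof -
    have "wcone X \<phi> A T L' \<I> (\<lambda>x. VComp A L' L' (FO T x) \<cdot> (\<gamma>' x \<boxtimes> VId A L'))"
      by (rule wcone_of_arrow[OF \<gamma>' asm]) (use asm \<gamma>T in simp_all)
    moreover have "VComp A L' L' (FO T x) \<cdot> (\<gamma>' x \<boxtimes> VId A L') = \<gamma>' x \<cdot> \<rho> (FO \<phi> x)" if x: "x \<in> VObj X" for x
    proof -
      have "VComp A L' L' (FO T x) \<cdot> (\<gamma>' x \<boxtimes> VId A L') = (VComp A L' L' (FO T x)
          \<cdot> (\<one> (VHom A L' (FO T x)) \<boxtimes> VId A L')) \<cdot> (\<gamma>' x \<boxtimes> \<one> \<I>)"
        using asm \<gamma>T x by (simp add: tens_cmp)
      also have "VComp A L' L' (FO T x) \<cdot> (\<one> (VHom A L' (FO T x)) \<boxtimes> VId A L') = \<rho> (VHom A L' (FO T x))"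
        using asm(2) \<gamma>T(5) vfun_simps(1)[OF asm(4) x] by (simp add: vcategory_def)
      finally show ?thesis using runit_nat'[of "\<gamma>' x"] \<gamma>T x by simp
    qed
    ultimately show ?thesis unfolding wcone_def by simp
  qed
  from lim_lift[OF lim this] obtain v where v: "v \<in> Arr V" "Dom V v = \<I>" "Cod V v = VHom A L' L"
    "\<And>x. x \<in> VObj X \<Longrightarrow> VComp A L' L (FO T x) \<cdot> (\<gamma> x \<boxtimes> v) = \<gamma>' x \<cdot> \<rho> (FO \<phi> x)"
    by metis
  have "\<gamma>' x = VComp A L' L (FO T x) \<cdot> (\<gamma> x \<boxtimes> v) \<cdot> invr (\<rho> (FO \<phi> x))" if x: "x \<in> VObj X" for x
    using tail[OF v(4)[OF x], of "invr (\<rho> (FO \<phi> x))"] asm \<gamma>T x o v(1-3) by simp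
  with v show thesis using that by blast
qed

text \<open>The composite and the identity both factor the counit \<open>\<gamma>\<close> through
  itself.\<close>

lemma comparison_inverse:
  assumes lim: "is_lim X \<phi> A T L \<gamma>" and asm: "vcat X" "vcat A" "\<phi> \<in> vfun X \<V>"
      "T \<in> vfun X A" and \<gamma>': "wcounit X \<phi> A T L' \<gamma>'"
    and v: "v \<in> Arr V" "Dom V v = \<I>" "Cod V v = VHom A L' L"
    "\<And>x. x \<in> VObj X \<Longrightarrow> \<gamma>' x = VComp A L' L (FO T x) \<cdot> (\<gamma> x \<boxtimes> v) \<cdot> invr (\<rho> (FO \<phi> x))"
    and u: "u \<in> Arr V" "Dom V u = \<I>" "Cod V u = VHom A L L'"
    "\<And>x. x \<in> VObj X \<Longrightarrow> \<gamma> x = VComp A L L' (FO T x) \<cdot> (\<gamma>' x \<boxtimes> u) \<cdot> invr (\<rho> (FO \<phi> x))"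
  shows "VComp A L L' L \<cdot> (v \<boxtimes> u) \<cdot> invr (\<lambda>\<lambda> \<I>) = VId A L"
proof -
  note \<gamma>T = wcounit_simps[OF is_lim_wcounit[OF lim]] wcounit_simps[OF \<gamma>']
  have o: "x \<in> VObj X \<Longrightarrow> FO \<phi> x \<in> Obj V" for x using vfun_simps(1)[OF asm(3)] by auto
  show ?thesis
  proof (rule lim_unique[OF lim asm \<gamma>T(1), of _ \<I>], goal_cases)
    case x: (7 x)
    have "VComp A L L (FO T x) \<cdot> (\<gamma> x \<boxtimes> (VComp A L L' L \<cdot> (v \<boxtimes> u) \<cdot> invr (\<lambda>\<lambda> \<I>))) \<cdot> invr (\<rho> (FO \<phi> x))
      = VComp A L L (FO T x) \<cdot> (\<gamma> x \<boxtimes> VId A L) \<cdot> invr (\<rho> (FO \<phi> x))"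
    proof (rule ext1[of _ _ "FO \<phi> x"], goal_cases)
      case p: (5 \<Gamma> t)
      interpret environment V \<Gamma> by (rule p)
      have 1: "emap (\<gamma>' x) t = emap (VComp A L' L (FO T x)) (pr (emap (\<gamma> x) t) (emap v star))"
        using arg_cong[OF v(4)[OF x], of "\<lambda>f. emap f t"] p asm x \<gamma>T v(1-3) o by simp
      have 2: "emap (\<gamma> x) t = emap (VComp A L L' (FO T x)) (pr (emap (\<gamma>' x) t) (emap u star))"
        using arg_cong[OF u(4)[OF x], of "\<lambda>f. emap f t"] p asm x \<gamma>T u(1-3) o by simp
      have "emap (VComp A L L (FO T x)) (pr (emap (\<gamma> x) t) (emap (VComp A L L' L) (pr (emap v star) (emap u
          star)))) = emap (\<gamma> x) t"
        using 2[unfolded 1] p asm x \<gamma>T u(1-3) v(1-3) o by simp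
      then show ?case using p asm x \<gamma>T u(1-3) v(1-3) o by simp
    qed (use asm x \<gamma>T u(1-3) v(1-3) o in simp_all)
    then have "(VComp A L L (FO T x) \<cdot> (\<gamma> x \<boxtimes> (VComp A L L' L \<cdot> (v \<boxtimes> u) \<cdot> invr (\<lambda>\<lambda> \<I>)))) \<cdot> invr (\<rho> (FO \<phi> x))
      = (VComp A L L (FO T x) \<cdot> (\<gamma> x \<boxtimes> VId A L)) \<cdot> invr (\<rho> (FO \<phi> x))"
      using asm x \<gamma>T u(1-3) v(1-3) o by simp
    then show ?case by (rule iso_cancel_r[rotated -1]) (use asm x \<gamma>T u(1-3) v(1-3) o in simp_all)
  qed (use asm \<gamma>T u(1-3) v(1-3) in simp_all)
qed

text \<open>Two limits of one diagram are isomorphic over it, and \<open>F\<close> preserves the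
  isomorphism. This allows preservation to be checked on a conveniently constructed limit.\<close>

lemma preserves_lim_all:
  assumes asm: "vcat X" "vcat A" "vcat B" "\<phi> \<in> vfun X \<V>" "T \<in> vfun X A" "F \<in> vfun A B"
    and lim: "is_lim X \<phi> A T L \<gamma>" "is_lim X \<phi> B (vcompose V X F T) (FO F L) (\<lambda>x. FA F L (FO T x) \<cdot> \<gamma> x)"
    and lim': "is_lim X \<phi> A T L' \<gamma>'"
  shows "is_lim X \<phi> B (vcompose V X F T) (FO F L') (\<lambda>x. FA F L' (FO T x) \<cdot> \<gamma>' x)"
proof -
  note \<gamma> = is_lim_wcounit[OF lim(1)] and \<gamma>' = is_lim_wcounit[OF lim']
  note \<gamma>T = wcounit_simps[OF \<gamma>] wcounit_simps[OF \<gamma>']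
  have o: "x \<in> VObj X \<Longrightarrow> FO \<phi> x \<in> Obj V" for x using vfun_simps(1)[OF asm(4)] by auto
  obtain v where v: "v \<in> Arr V" "Dom V v = \<I>" "Cod V v = VHom A L' L"
    "\<And>x. x \<in> VObj X \<Longrightarrow> \<gamma>' x = VComp A L' L (FO T x) \<cdot> (\<gamma> x \<boxtimes> v) \<cdot> invr (\<rho> (FO \<phi> x))"
    by (rule lim_compare[OF lim(1) asm(1,2,4,5) \<gamma>']) (rule that)
  obtain u where u: "u \<in> Arr V" "Dom V u = \<I>" "Cod V u = VHom A L L'"
    "\<And>x. x \<in> VObj X \<Longrightarrow> \<gamma> x = VComp A L L' (FO T x) \<cdot> (\<gamma>' x \<boxtimes> u) \<cdot> invr (\<rho> (FO \<phi> x))"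
    by (rule lim_compare[OF lim' asm(1,2,4,5) \<gamma>]) (rule that)
  have vu: "VComp A L L' L \<cdot> (v \<boxtimes> u) \<cdot> invr (\<lambda>\<lambda> \<I>) = VId A L"
    by (rule comparison_inverse[OF lim(1) asm(1,2,4,5) \<gamma>' v u])
  have uv: "VComp A L' L L' \<cdot> (u \<boxtimes> v) \<cdot> invr (\<lambda>\<lambda> \<I>) = VId A L'"
    by (rule comparison_inverse[OF lim' asm(1,2,4,5) \<gamma> u v])
  have F_inv: "VComp B (FO F L) (FO F L') (FO F L) \<cdot> ((FA F L' L \<cdot> v) \<boxtimes> (FA F L L' \<cdot> u)) \<cdot> invr (\<lambda>\<lambda> \<I>)
      = VId B (FO F L)"
    if vu: "VComp A L L' L \<cdot> (v \<boxtimes> u) \<cdot> invr (\<lambda>\<lambda> \<I>) = VId A L" and L: "L \<in> VObj A" "L' \<in> VObj A"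
     and u: "u \<in> Arr V" "Dom V u = \<I>" "Cod V u = VHom A L L'" and v: "v \<in> Arr V" "Dom V v = \<I>" "Cod V v
         = VHom A L' L" for L L' u v
  proof (rule unit_ext, goal_cases)
    case p: (5 \<Gamma>)
    interpret environment V \<Gamma> by (rule p)
    have "emap (FA F L L) (emap (VComp A L L' L) (pr (emap v star) (emap u star))) = emap (VId B (FO F L)) star"
      using arg_cong[OF vu, of "\<lambda>f. emap (FA F L L) (emap f star)"] asm u v L by simp
    then show ?case using asm u v L by simp
  qed (use asm u v L in simp_all)
  have F\<gamma>: "FA F L' (FO T x) \<cdot> \<gamma>' x = VComp B (FO F L') (FO F L) (FO (vcompose V X F T) x) \<cdot> ((FA F L (FO T x)
      \<cdot> \<gamma> x) \<boxtimes> (FA F L' L \<cdot> v)) \<cdot> invr (\<rho> (FO \<phi> x))"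
    if x: "x \<in> VObj X" for x
    unfolding v(4)[OF x]
  proof (rule ext1[of _ _ "FO \<phi> x"], goal_cases)
    case p: (5 \<Gamma> t)
    interpret environment V \<Gamma> by (rule p)
    show ?case using p asm x \<gamma>T v(1-3) o by simp
  qed (use asm x \<gamma>T v(1-3) o in simp_all)
  show ?thesis
    by (rule is_lim_iso[OF lim(2) asm(1,3,4) vcompose_vfun[OF asm(1,2,3,5,6)] _ _ _ _ _ _ _ F_inv[OF vu \<gamma>T(1,5)
        u(1-3) v(1-3)] F_inv[OF uv \<gamma>T(5,1) v(1-3) u(1-3)]
        wcounit_compose[OF \<gamma>' asm] F\<gamma>])
      (use asm \<gamma>T u(1-3) v(1-3) in simp_all)
qed

end

text \<open>
  The saturation tests only categories with objects in one type. Categories with other objects are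
  transported to it along injections.
\<close>

definition relabel :: "('b \<Rightarrow> 'a) \<Rightarrow> ('b, 'v, 'm) vcat \<Rightarrow> ('a, 'v, 'm) vcat" where
  "relabel e A = \<lparr>VObj = e ` VObj A, VHom = \<lambda>a b. VHom A (inv e a) (inv e b),
     VComp = \<lambda>a b c. VComp A (inv e a) (inv e b) (inv e c), VId = \<lambda>a. VId A (inv e a)\<rparr>"

definition relabel_fun :: "('b \<Rightarrow> 'a) \<Rightarrow> ('x, 'v, 'm) vcat \<Rightarrow> ('x, 'b, 'm) vfun \<Rightarrow> ('x, 'a, 'm) vfun" where
  "relabel_fun e X T = mk_vfun X (\<lambda>x. e (FO T x)) (FA T)"

lemma relabel_simps [simp]:
  assumes "inj e"
  shows "VObj (relabel e A) = e ` VObj A" "VHom (relabel e A) (e a) (e b) = VHom A a b"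
    "VComp (relabel e A) (e a) (e b) (e c) = VComp A a b c" "VId (relabel e A) (e a) = VId A a"
  using assms by (simp_all add: relabel_def)

lemma relabel_fun_simps [simp]:
  "x \<in> VObj X \<Longrightarrow> FO (relabel_fun e X T) x = e (FO T x)"
  "x \<in> VObj X \<Longrightarrow> y \<in> VObj X \<Longrightarrow> FA (relabel_fun e X T) x y = FA T x y"
  by (simp_all add: relabel_fun_def)

context symmetric_monoidal_closed
begin

lemma vcat_relabel: "inj e \<Longrightarrow> vcat (relabel e A) \<longleftrightarrow> vcat A"
  unfolding vcategory_def by (simp only: relabel_simps ball_simps)

lemma relabel_fun_vfun:
  assumes "inj e" "T \<in> vfun X A"
  shows "relabel_fun e X T \<in> vfun X (relabel e A)"
  unfolding relabel_fun_def by (rule mk_vfun_vfun) (use assms vfun_Cmp[OF assms(2)] in simp_all)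

lemma relabel_fun_surj:
  assumes "inj e" "T' \<in> vfun X (relabel e A)"
  obtains T where "T \<in> vfun X A" "T' = relabel_fun e X T"
proof -
  define T where "T = mk_vfun X (\<lambda>x. inv e (FO T' x)) (FA T')"
  have e: "e (inv e (FO T' x)) = FO T' x" "inv e (FO T' x) \<in> VObj A" if "x \<in> VObj X" for x
    using vfun_simps(1)[OF assms(2) that] assms(1) by auto
  have T: "T \<in> vfun X A"
    unfolding T_def
  proof (rule mk_vfun_vfun, goal_cases)
    case (1 x) then show ?case by (rule e)
  next
    case (2 x y)
    then show ?case using vfun_simps(2-4)[OF assms(2) 2] by (simp add: relabel_def)
  next
    case (3 x y z)
    then show ?case using vfun_Cmp[OF assms(2) 3] by (simp add: relabel_def)
  next
    case (4 x)
    then show ?case using vfun_simps(5)[OF assms(2) 4] by (simp add: relabel_def)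
  qed
  have "T' = relabel_fun e X T"
    by (rule vfun_eqI[OF assms(2) relabel_fun_vfun[OF assms(1) T]]) (simp_all add: T_def e)
  with T show thesis by (rule that)
qed

text \<open>Hom-objects are unchanged and every object of the relabelled category is some
  \<open>e b\<close>, so the two universal properties quantify over the same cones.\<close>

lemma is_lim_relabel:
  assumes e: "inj e"
  shows "is_lim X \<phi> (relabel e A) (relabel_fun e X T) (e L) \<gamma> \<longleftrightarrow> is_lim X \<phi> A T L \<gamma>"
proof -
  have 1: "wcone X \<phi> (relabel e A) (relabel_fun e X T) (e a) z r \<longleftrightarrow> wcone X \<phi> A T a z r" for a z r
    unfolding wcone_def using e by (simp add: inj_image_mem_iff)
  have 2: "wcounit X \<phi> (relabel e A) (relabel_fun e X T) (e L) \<gamma> \<longleftrightarrow> wcounit X \<phi> A T L \<gamma>"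
    unfolding wcounit_def using e by (simp add: inj_image_mem_iff)
  have 3: "(\<forall>a z r. wcone X \<phi> (relabel e A) (relabel_fun e X T) a z r \<longrightarrow> Q a z r)
    \<longleftrightarrow> (\<forall>a z r. wcone X \<phi> A T a z r \<longrightarrow> Q (e a) z r)" for Q
  proof
    assume *: "\<forall>a z r. wcone X \<phi> A T a z r \<longrightarrow> Q (e a) z r"
    show "\<forall>a z r. wcone X \<phi> (relabel e A) (relabel_fun e X T) a z r \<longrightarrow> Q a z r"
    proof (intro allI impI)
      fix a z r assume r: "wcone X \<phi> (relabel e A) (relabel_fun e X T) a z r"
      then obtain b where "a = e b" using wcone_simps(1)[OF r] e by auto
      with r * 1 show "Q a z r" by blast
    qed
  qed (use 1 in blast)
  show ?thesis
    unfolding is_lim_def 2 3 using e by simp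
qed

end

section \<open>Completeness, preservation and saturation through universal cones\<close>

context enrichment
begin

lemma weights_iff: "(K, \<phi>) \<in> weights V U \<longleftrightarrow> vcat K \<and> vsmall V U K \<and> \<phi> \<in> vfun (op K) \<V>"
  by (simp add: weights_def)

lemma diagramI:
  assumes "(K, \<phi>) \<in> weights V U" "vcat A" "T \<in> vfun (op K) A"
  shows "diagram V U K \<phi> A T"
  using assms unfolding weights_iff by unfold_locales auto

lemma wcomplete_iff:
  assumes "\<Phi> \<subseteq> weights V U" "vcat A"
  shows "wcomplete V \<Phi> A \<longleftrightarrow> (\<forall>w\<in>\<Phi>. \<forall>T\<in>vfun (op (fst w)) A. \<exists>L \<gamma>. is_lim (op (fst w)) (snd w) A T L \<gamma>)"
  unfolding wcomplete_def
proof (intro ball_cong refl)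
  fix w T assume "w \<in> \<Phi>" "T \<in> vfun (op (fst w)) A"
  then interpret diagram V U "fst w" "snd w" A T
    using assms by (intro diagramI) auto
  show "(\<exists>L \<theta>. is_wlimit V w A T L \<theta>) \<longleftrightarrow> (\<exists>L \<gamma>. is_lim (op (fst w)) (snd w) A T L \<gamma>)"
    using is_lim_if_is_wlimit is_wlimit_if_is_lim unfolding prod.collapse by metis
qed

lemma preserves_iff:
  assumes w: "(K, \<phi>) \<in> weights V U" and AB: "vcat A" "vcat B" "F \<in> vfun A B"
  shows "preserves V (K, \<phi>) A B F \<longleftrightarrow> (\<forall>T\<in>vfun (op K) A. \<forall>L \<gamma>. is_lim (op K) \<phi> A T L \<gamma> \<longrightarrow>
    is_lim (op K) \<phi> B (vcompose V (op K) F T) (FO F L) (\<lambda>k. FA F L (FO T k) \<cdot> \<gamma> k))"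
  unfolding preserves_def fst_conv
proof (intro ball_cong refl)
  fix T assume T: "T \<in> vfun (op K) A"
  interpret A: diagram V U K \<phi> A T using diagramI[OF w AB(1) T] .
  interpret B: diagram V U K \<phi> B "vcompose V (op K) F T"
    using w AB T by (intro diagramI[OF w AB(2)] vcompose_vfun) (auto simp: weights_iff)
  show "(\<forall>L \<theta>. is_wlimit V (K, \<phi>) A T L \<theta> \<longrightarrow> (\<exists>\<theta>'. is_wlimit V (K, \<phi>) B (vcompose V (op K) F T) (FO F L) \<theta>' \<and>
      (\<forall>k\<in>VObj K. counit V (K, \<phi>) B (vcompose V (op K) F T) (FO F L) \<theta>' k
          = FA F L (FO T k) \<cdot> counit V (K, \<phi>) A T L \<theta> k)))
    \<longleftrightarrow> (\<forall>L \<gamma>. is_lim (op K) \<phi> A T L \<gamma> \<longrightarrow> is_lim (op K) \<phi> B (vcompose V (op K) F T) (FO F L) (\<lambda>k. FA F L (FO T k)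
        \<cdot> \<gamma> k))"
    (is "?l \<longleftrightarrow> ?r")
  proof (intro iffI allI impI)
    fix L \<gamma> assume l: ?l and "is_lim (op K) \<phi> A T L \<gamma>"
    with A.is_wlimit_if_is_lim obtain \<theta> where \<theta>: "is_wlimit V (K, \<phi>) A T L \<theta>" "\<And>x. x \<in> VObj K \<Longrightarrow>
        counit V (K, \<phi>) A T L \<theta> x = \<gamma> x"
      by blast
    from l \<theta>(1) obtain \<theta>' where \<theta>': "is_wlimit V (K, \<phi>) B (vcompose V (op K) F T) (FO F L) \<theta>'"
      "\<And>k. k\<in>VObj K \<Longrightarrow> counit V (K, \<phi>) B (vcompose V (op K) F T) (FO F L) \<theta>' k
          = FA F L (FO T k) \<cdot> counit V (K, \<phi>) A T L \<theta> k"
      by blast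
    show "is_lim (op K) \<phi> B (vcompose V (op K) F T) (FO F L) (\<lambda>k. FA F L (FO T k) \<cdot> \<gamma> k)"
      by (rule is_lim_cong[OF _ B.is_lim_if_is_wlimit[OF \<theta>'(1)]]) (simp add: \<theta>(2) \<theta>'(2))
  next
    fix L \<theta> assume r: ?r and \<theta>: "is_wlimit V (K, \<phi>) A T L \<theta>"
    from r A.is_lim_if_is_wlimit[OF \<theta>] B.is_wlimit_if_is_lim
    show "\<exists>\<theta>'. is_wlimit V (K, \<phi>) B (vcompose V (op K) F T) (FO F L) \<theta>' \<and>
      (\<forall>k\<in>VObj K. counit V (K, \<phi>) B (vcompose V (op K) F T) (FO F L) \<theta>' k
          = FA F L (FO T k) \<cdot> counit V (K, \<phi>) A T L \<theta> k)"
      by blast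
  qed
qed

lemma wcomplete_relabel:
  assumes \<Phi>: "\<Phi> \<subseteq> weights V U" and C: "vcat C" "wcomplete V \<Phi> C" and e: "inj e"
  shows "wcomplete V \<Phi> (relabel e C)"
proof -
  have "vcat (relabel e C)" using C e by (simp add: vcat_relabel)
  then show ?thesis
    unfolding wcomplete_iff[OF \<Phi> \<open>vcat (relabel e C)\<close>]
    using C(2)[unfolded wcomplete_iff[OF \<Phi> C(1)]] relabel_fun_surj[OF e] is_lim_relabel[OF e] by metis
qed

text \<open>\<open>A\<close> and \<open>B\<close> may have objects of different types. Both are
  relabelled into \<open>'a\<close> along separate injections, the definition of saturation is
  applied there, and the conclusion is carried back.\<close>

lemma saturation_preserves:
  fixes e1 :: "'b \<Rightarrow> 'a" and e2 :: "'c \<Rightarrow> 'a" and A :: "('b, 'v, 'm) vcat" and B :: "('c, 'v, 'm) vcat"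
  assumes w: "w \<in> saturation V U TYPE('a) \<Phi>" and \<Phi>: "\<Phi> \<subseteq> weights V U" and e: "inj e1" "inj e2"
    and AB: "vcat A" "vcat B" "F \<in> vfun A B" and c: "wcomplete V \<Phi> A" "wcomplete V \<Phi> B" "wcontinuous V \<Phi> A B F"
  shows "preserves V w A B F"
proof -
  define A' where "A' = relabel e1 A"
  define B' where "B' = relabel e2 B"
  define F' where "F' = mk_vfun A' (\<lambda>a. e2 (FO F (inv e1 a))) (\<lambda>a b. FA F (inv e1 a) (inv e1 b))"
  have A': "vcat A'" and B': "vcat B'" using e AB by (simp_all add: A'_def B'_def vcat_relabel)
  have F': "F' \<in> vfun A' B'"
    unfolding F'_def
    by (rule mk_vfun_vfun) (use e AB vfun_Cmp[OF AB(3)] in \<open>auto simp: A'_def B'_def\<close>)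
  have F'_simps: "FO F' (e1 a) = e2 (FO F a)" "b \<in> VObj A \<Longrightarrow> FA F' (e1 a) (e1 b) = FA F a b" if "a \<in> VObj A" for a b
    using that e by (simp_all add: F'_def A'_def)
  \<comment> \<open>Stated for every weight, since it is used in both directions: to carry
    continuity for \<open>\<Phi>\<close> over to \<open>F'\<close>, and preservation of
    \<open>w\<close>-limits back to \<open>F\<close>.\<close>
  have pres: "preserves V w A' B' F' \<longleftrightarrow> preserves V w A B F" if w: "w \<in> weights V U" for w
  proof -
    obtain K \<phi> where w_eq: "w = (K, \<phi>)" by (cases w)
    have w': "(K, \<phi>) \<in> weights V U" using w by (simp add: w_eq)
    then have K: "vcat (op K)" by (simp add: weights_iff)
    have lim: "is_lim (op K) \<phi> B' (vcompose V (op K) F' (relabel_fun e1 (op K) T)) (FO F' (e1 L)) (\<lambda>k. FA F' (e1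
        L) (FO (relabel_fun e1 (op K) T) k) \<cdot> \<gamma> k)
        \<longleftrightarrow> is_lim (op K) \<phi> B (vcompose V (op K) F T) (FO F L) (\<lambda>k. FA F L (FO T k) \<cdot> \<gamma> k)"
      if T: "T \<in> vfun (op K) A" and L: "L \<in> VObj A" for T L \<gamma>
    proof -
      have Tx: "x \<in> VObj K \<Longrightarrow> FO T x \<in> VObj A" for x using vfun_simps(1)[OF T] by simp
      have 1: "vcompose V (op K) F' (relabel_fun e1 (op K) T) = relabel_fun e2 (op K) (vcompose V (op K) F T)"
        by (rule vfun_eqI[OF vcompose_vfun[OF K A' B' _ F'] relabel_fun_vfun[OF e(2) vcompose_vfun[OF K AB(1,2) T
            AB(3)]]])
          (use relabel_fun_vfun[OF e(1) T] F'_simps Tx in \<open>simp_all add: A'_def\<close>)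
      have 2: "is_lim (op K) \<phi> B' T'' L'' (\<lambda>k. FA F' (e1 L) (FO (relabel_fun e1 (op K) T) k) \<cdot> \<gamma> k)
        \<longleftrightarrow> is_lim (op K) \<phi> B' T'' L'' (\<lambda>k. FA F L (FO T k) \<cdot> \<gamma> k)" for T'' L''
        by (rule iffI; rule is_lim_cong[rotated]; assumption?) (use F'_simps(2)[OF L] Tx in simp_all)
      show ?thesis
        unfolding 1 2 F'_simps(1)[OF L] unfolding B'_def by (rule is_lim_relabel[OF e(2)])
    qed
    have lim': "is_lim (op K) \<phi> A' (relabel_fun e1 (op K) T) (e1 L) \<gamma> \<longleftrightarrow> is_lim (op K) \<phi> A T L \<gamma>" for T L \<gamma>
      unfolding A'_def by (rule is_lim_relabel[OF e(1)])
    show ?thesis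
      unfolding w_eq preserves_iff[OF w' A' B' F'] preserves_iff[OF w' AB]
    proof (intro iffI ballI allI impI)
      fix T L \<gamma> assume *: "\<forall>T\<in>vfun (op K) A'. \<forall>L \<gamma>. is_lim (op K) \<phi> A' T L \<gamma> \<longrightarrow>
          is_lim (op K) \<phi> B' (vcompose V (op K) F' T) (FO F' L) (\<lambda>k. FA F' L (FO T k) \<cdot> \<gamma> k)"
        and T: "T \<in> vfun (op K) A" and l: "is_lim (op K) \<phi> A T L \<gamma>"
      have L: "L \<in> VObj A" using wcounit_simps(1)[OF is_lim_wcounit[OF l]] .
      have "relabel_fun e1 (op K) T \<in> vfun (op K) A'" unfolding A'_def by (rule relabel_fun_vfun[OF e(1) T])
      with * l lim' lim[OF T L] show "is_lim (op K) \<phi> B (vcompose V (op K) F T) (FO F L) (\<lambda>k. FA F L (FO T k)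
          \<cdot> \<gamma> k)" by blast
    next
      fix T' L' \<gamma> assume *: "\<forall>T\<in>vfun (op K) A. \<forall>L \<gamma>. is_lim (op K) \<phi> A T L \<gamma> \<longrightarrow>
          is_lim (op K) \<phi> B (vcompose V (op K) F T) (FO F L) (\<lambda>k. FA F L (FO T k) \<cdot> \<gamma> k)"
        and T': "T' \<in> vfun (op K) A'" and l: "is_lim (op K) \<phi> A' T' L' \<gamma>"
      obtain T where T: "T \<in> vfun (op K) A" "T' = relabel_fun e1 (op K) T"
        by (rule relabel_fun_surj[OF e(1) T'[unfolded A'_def]]) (rule that)
      obtain L where L: "L \<in> VObj A" "L' = e1 L"
        using wcounit_simps(1)[OF is_lim_wcounit[OF l]] e(1) by (auto simp: A'_def)
      from l have "is_lim (op K) \<phi> A T L \<gamma>" unfolding T(2) L(2) lim' .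
      with * T(1) have "is_lim (op K) \<phi> B (vcompose V (op K) F T) (FO F L) (\<lambda>k. FA F L (FO T k) \<cdot> \<gamma> k)" by blast
      then show "is_lim (op K) \<phi> B' (vcompose V (op K) F' T') (FO F' L') (\<lambda>k. FA F' L' (FO T' k) \<cdot> \<gamma> k)"
        unfolding T(2) L(2) lim[OF T(1) L(1)] .
    qed
  qed
  have "wcontinuous V \<Phi> A' B' F'" using c(3) pres \<Phi> unfolding wcontinuous_def by blast
  moreover have "wcomplete V \<Phi> A'" "wcomplete V \<Phi> B'"
    unfolding A'_def B'_def using wcomplete_relabel[OF \<Phi>] AB c e by blast+
  ultimately have "wcontinuous V {w} A' B' F'"
    using w A' B' F' unfolding saturation_def by blast
  then show ?thesis using pres[of w] w unfolding wcontinuous_def saturation_def by blast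
qed

end

section \<open>Limits in functor categories\<close>

lemma choice2:
  assumes "\<And>x y. P x \<Longrightarrow> Q y \<Longrightarrow> \<exists>f. R x y f"
  shows "\<exists>F. \<forall>x y. P x \<longrightarrow> Q y \<longrightarrow> R x y (F x y)"
  by (rule exI[of _ "\<lambda>x y. SOME f. R x y f"]) (use someI_ex[OF assms] in blast)

text \<open>
  A category \<open>FC\<close> of functors \<open>J \<rightarrow> Y\<close>, given by a bijection \<open>D\<close> on objects and hom ends \<open>\<pi>\<close>. The
  instances are \<open>[J, V]\<close> and the opposite of \<open>[X, V]\<close>, with \<open>J = X\<^sup>o\<^sup>p\<close> and \<open>Y = V\<^sup>o\<^sup>p\<close>.
\<close>

locale functor_category = symmetric_monoidal_closed V
  for V :: "('v, 'm) smcc" (structure) +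
  fixes FC :: "('f, 'v, 'm) vcat" and J :: "('i, 'v, 'm) vcat" and Y :: "('y, 'v, 'm) vcat"
    and D :: "'f \<Rightarrow> ('i, 'y, 'm) vfun" and \<pi> :: "'f \<Rightarrow> 'f \<Rightarrow> 'i \<Rightarrow> 'm"
  assumes FC [simp]: "vcat FC" and J [simp]: "vcat J" and Y [simp]: "vcat Y"
    and D: "F \<in> VObj FC \<Longrightarrow> D F \<in> vfun J Y" and D_surj: "F' \<in> vfun J Y \<Longrightarrow> \<exists>F\<in>VObj FC. D F = F'"
    and hom_end: "F \<in> VObj FC \<Longrightarrow> G \<in> VObj FC \<Longrightarrow> is_hom_end V J Y (D F) (D G) (VHom FC F G) (\<pi> F G)"
    and \<pi>_Comp: "F \<in> VObj FC \<Longrightarrow> G \<in> VObj FC \<Longrightarrow> H \<in> VObj FC \<Longrightarrow> i \<in> VObj J \<Longrightarrow>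
      \<pi> F H i \<cdot> VComp FC F G H = VComp Y (FO (D F) i) (FO (D G) i) (FO (D H) i) \<cdot> (\<pi> G H i \<boxtimes> \<pi> F G i)"
    and \<pi>_Id: "F \<in> VObj FC \<Longrightarrow> i \<in> VObj J \<Longrightarrow> \<pi> F F i \<cdot> VId FC F = VId Y (FO (D F) i)"
begin

lemma \<pi>_natural: "F \<in> VObj FC \<Longrightarrow> G \<in> VObj FC \<Longrightarrow> natural_family V J Y (D F) (D G) (VHom FC F G) (\<pi> F G)"
  using hom_end by (simp add: is_hom_end_def)

lemma D_simps [simp]:
  assumes "F \<in> VObj FC"
  shows "i \<in> VObj J \<Longrightarrow> FO (D F) i \<in> VObj Y" "i \<in> VObj J \<Longrightarrow> j \<in> VObj J \<Longrightarrow> FA (D F) i j \<in> Arr V"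
    "i \<in> VObj J \<Longrightarrow> j \<in> VObj J \<Longrightarrow> Dom V (FA (D F) i j) = VHom J i j"
    "i \<in> VObj J \<Longrightarrow> j \<in> VObj J \<Longrightarrow> Cod V (FA (D F) i j) = VHom Y (FO (D F) i) (FO (D F) j)"
  using vfun_simps(1-4)[OF D[OF assms]] by auto

lemma \<pi>_simps [simp]:
  assumes "F \<in> VObj FC" "G \<in> VObj FC" "i \<in> VObj J"
  shows "\<pi> F G i \<in> Arr V" "Dom V (\<pi> F G i) = VHom FC F G" "Cod V (\<pi> F G i) = VHom Y (FO (D F) i) (FO (D G) i)"
  using natural_family_simps[OF \<pi>_natural[OF assms(1,2)]] assms(3) by auto

lemma \<pi>_ext:
  assumes [simp]: "F \<in> VObj FC" "G \<in> VObj FC" and f: "f \<in> Arr V" "Dom V f = z" "Cod V f = VHom FC F G"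
    and g: "g \<in> Arr V" "Dom V g = z" "Cod V g = VHom FC F G"
    and eq: "\<And>i. i \<in> VObj J \<Longrightarrow> \<pi> F G i \<cdot> f = \<pi> F G i \<cdot> g"
  shows "f = g"
proof -
  have z: "z \<in> Obj V" using f Dom_Obj' by blast
  have "natural_family V J Y (D F) (D G) z (\<lambda>i. \<pi> F G i \<cdot> f)"
  proof (rule natural_familyI[OF J Y D D z], goal_cases)
    case p: (4 i j \<Gamma> s t)
    interpret environment V \<Gamma> by (rule p)
    have "emap (VComp Y (FO (D F) i) (FO (D F) j) (FO (D G) j)) (pr (emap (\<pi> F G j) (emap f s)) (emap (FA (D F) i
        j) t))
       = emap (VComp Y (FO (D F) i) (FO (D G) i) (FO (D G) j)) (pr (emap (FA (D G) i j) t) (emap (\<pi> F G i) (emap f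
           s)))"
      by (rule natural_family_el[OF \<pi>_natural]) (use p f D in simp_all)
    then show ?case using p f z by simp
  qed (use f in simp_all)
  then have "\<exists>!h. h \<in> Hom V z (VHom FC F G) \<and> (\<forall>i\<in>VObj J. \<pi> F G i \<cdot> h = \<pi> F G i \<cdot> f)"
    using hom_end[OF assms(1,2)] unfolding is_hom_end_def by blast
  then show ?thesis by (rule ex1_unique) (use f g eq in \<open>auto simp: Hom_iff\<close>)
qed

lemma \<pi>_lift:
  assumes "F \<in> VObj FC" "G \<in> VObj FC" "natural_family V J Y (D F) (D G) z q"
  obtains h where "h \<in> Arr V" "Dom V h = z" "Cod V h = VHom FC F G" "\<And>i. i \<in> VObj J \<Longrightarrow> \<pi> F G i \<cdot> h = q i"
proof -
  have "\<exists>!h. h \<in> Hom V z (VHom FC F G) \<and> (\<forall>i\<in>VObj J. \<pi> F G i \<cdot> h = q i)"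
    using hom_end[OF assms(1,2)] assms(3) unfolding is_hom_end_def by blast
  then show thesis using that by (auto simp: Hom_iff)
qed

definition evaluation :: "'i \<Rightarrow> ('f, 'y, 'm) vfun" where
  "evaluation i = mk_vfun FC (\<lambda>F. FO (D F) i) (\<lambda>F G. \<pi> F G i)"

lemma evaluation_simps [simp]:
  "F \<in> VObj FC \<Longrightarrow> FO (evaluation i) F = FO (D F) i"
  "F \<in> VObj FC \<Longrightarrow> G \<in> VObj FC \<Longrightarrow> FA (evaluation i) F G = \<pi> F G i"
  by (simp_all add: evaluation_def)

lemma evaluation_vfun [simp]: "i \<in> VObj J \<Longrightarrow> evaluation i \<in> vfun FC Y"
  unfolding evaluation_def by (rule mk_vfun_vfun) (simp_all add: \<pi>_Comp \<pi>_Id)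

end

lemma (in environment) \<pi>_el:
  assumes "functor_category V FC J Y D \<pi>" "F \<in> VObj FC" "G \<in> VObj FC" "H \<in> VObj FC" "i \<in> VObj J"
    and "el s" "el t" "ctx s \<inter> ctx t = {}" "ty s = VHom FC G H" "ty t = VHom FC F G"
  shows "\<pi> F H i \<bullet> VComp FC F G H \<bullet> (s \<diamondop> t) = VComp Y (FO (D F) i) (FO (D G) i) (FO (D H) i) \<bullet> ((\<pi> G H i \<bullet> s) \<diamondop> (\<pi>
      F G i \<bullet> t))"
proof -
  interpret functor_category V FC J Y D \<pi> by fact
  show ?thesis using arg_cong[OF \<pi>_Comp[OF assms(2-5)], of "\<lambda>f. emap f (pr s t)"] assms(2-) by simp
qed

context functor_category
begin

text \<open>The values are given limits; the hom action and the projections are forced by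
  universality. All of this is exported with the limit, since the interchange theorem has to
  recognise the resulting functor.\<close>

theorem pointwise_lim:
  assumes X [simp]: "vcat X" and \<phi>: "\<phi> \<in> vfun X \<V>" and T: "T \<in> vfun X FC"
    and lim: "\<And>i. i \<in> VObj J \<Longrightarrow> is_lim X \<phi> Y (vcompose V X (evaluation i) T) (Li i) (\<gamma> i)"
  obtains L \<delta> where "is_lim X \<phi> FC T L \<delta>" "\<And>i. i \<in> VObj J \<Longrightarrow> FO (D L) i = Li i"
    "\<And>i x. i \<in> VObj J \<Longrightarrow> x \<in> VObj X \<Longrightarrow> \<pi> L (FO T x) i \<cdot> \<delta> x = \<gamma> i x"
    "\<And>i j x. i \<in> VObj J \<Longrightarrow> j \<in> VObj J \<Longrightarrow> x \<in> VObj X \<Longrightarrow> VComp Y (Li i) (Li j) (FO (D (FO T x)) j) \<cdot> (\<gamma> j x \<boxtimes> FA (D L) i j)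
      = VComp Y (Li i) (FO (D (FO T x)) i) (FO (D (FO T x)) j) \<cdot> (FA (D (FO T x)) i j \<boxtimes> \<gamma> i x)
          \<cdot> \<sigma> (FO \<phi> x) (VHom J i j)"
proof -
  let ?T = "\<lambda>i. vcompose V X (evaluation i) T"
  have Ti: "?T i \<in> vfun X Y" if "i \<in> VObj J" for i
    by (rule vcompose_vfun[OF X FC Y T evaluation_vfun[OF that]])
  note \<gamma> = is_lim_wcounit[OF lim]
  have Tx [simp]: "x \<in> VObj X \<Longrightarrow> FO T x \<in> VObj FC" "x \<in> VObj X \<Longrightarrow> y \<in> VObj X \<Longrightarrow> FA T x y \<in> Arr V"
    "x \<in> VObj X \<Longrightarrow> y \<in> VObj X \<Longrightarrow> Dom V (FA T x y) = VHom X x y"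
    "x \<in> VObj X \<Longrightarrow> y \<in> VObj X \<Longrightarrow> Cod V (FA T x y) = VHom FC (FO T x) (FO T y)" for x y
    using vfun_simps(1-4)[OF T] by auto
  have [simp]: "x \<in> VObj X \<Longrightarrow> FO \<phi> x \<in> Obj V" "x \<in> VObj X \<Longrightarrow> y \<in> VObj X \<Longrightarrow> FA \<phi> x y \<in> Arr V"
    "x \<in> VObj X \<Longrightarrow> y \<in> VObj X \<Longrightarrow> Dom V (FA \<phi> x y) = VHom X x y"
    "x \<in> VObj X \<Longrightarrow> y \<in> VObj X \<Longrightarrow> Cod V (FA \<phi> x y) = \<lbrakk>FO \<phi> x, FO \<phi> y\<rbrakk>" for x y
    using vfun_simps(1-4)[OF \<phi>] by auto
  have Li [simp]: "Li i \<in> VObj Y" if "i \<in> VObj J" for i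
    using wcounit_simps(1)[OF \<gamma>[OF that]] .
  have \<gamma>T [simp]: "\<gamma> i x \<in> Arr V" "Dom V (\<gamma> i x) = FO \<phi> x" "Cod V (\<gamma> i x) = VHom Y (Li i) (FO (D (FO T x)) i)"
    if "i \<in> VObj J" "x \<in> VObj X" for i x
    using wcounit_simps(2-4)[OF \<gamma>[OF that(1)] that(2)] that by auto
  have \<gamma>_el: "App (VComp Y (Li i) (FO (D (FO T x)) i) (FO (D (FO T y)) i)) (Pr \<Gamma> (App (\<pi> (FO T x) (FO T y) i) (App
      (FA T x y) s)) (App (\<gamma> i x) t))
    = App (\<gamma> i y) (App (ev V (FO \<phi> x) (FO \<phi> y)) (Pr \<Gamma> (App (FA \<phi> x y) s) t))"
    if i: "i \<in> VObj J" and x: "x \<in> VObj X" "y \<in> VObj X" and G: "environment V \<Gamma>" "El \<Gamma> s" "El \<Gamma> t"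
      "Ty s = VHom X x y" "Ty t = FO \<phi> x" "Ctx s \<inter> Ctx t = {}" for i x y s t \<Gamma>
  proof -
    interpret environment V \<Gamma> by (rule G)
    have "emap (VComp Y (Li i) (FO (?T i) x) (FO (?T i) y)) (pr (emap (FA (?T i) x y) s) (emap (\<gamma> i x) t))
      = emap (\<gamma> i y) (emap (ev V (FO \<phi> x) (FO \<phi> y)) (pr (emap (FA \<phi> x y) s) t))"
      by (rule wcounit_el[OF \<gamma>[OF i] X Y \<phi> Ti[OF i] x]) (use G i x in simp_all)
    then show ?thesis using G i x by simp
  qed
  have T_nat: "App (VComp Y (FO (D (FO T x)) i) (FO (D (FO T x)) j) (FO (D (FO T y)) j)) (Pr \<Gamma> (App (\<pi> (FO T x)
      (FO T y) j) (App (FA T x y) s)) (App (FA (D (FO T x)) i j) f))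
    = App (VComp Y (FO (D (FO T x)) i) (FO (D (FO T y)) i) (FO (D (FO T y)) j)) (Pr \<Gamma> (App (FA (D (FO T y)) i j)
        f) (App (\<pi> (FO T x) (FO T y) i) (App (FA T x y) s)))"
    if i: "i \<in> VObj J" "j \<in> VObj J" and x: "x \<in> VObj X" "y \<in> VObj X" and G: "environment V \<Gamma>" "El \<Gamma> s" "El \<Gamma> f"
      "Ty s = VHom X x y" "Ty f = VHom J i j" "Ctx s \<inter> Ctx f = {}" for i j x y s f \<Gamma>
  proof -
    interpret environment V \<Gamma> by (rule G)
    show ?thesis
      by (rule natural_family_el[OF \<pi>_natural]) (use G i x D in simp_all)
  qed
  \<comment> \<open>\<open>Q i j f\<close> says that the counits are natural in the index when
    \<open>f\<close> is the action of \<open>L\<close> on \<open>J(i, j)\<close>. Universality of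
    the counit at \<open>j\<close> determines such an \<open>f\<close> uniquely.\<close>
  define Q where "Q i j f \<longleftrightarrow> f \<in> Arr V \<and> Dom V f = VHom J i j \<and> Cod V f
      = VHom Y (Li i) (Li j) \<and> (\<forall>x\<in>VObj X. VComp Y (Li i) (Li j) (FO (D (FO T x)) j) \<cdot> (\<gamma> j x \<boxtimes> f)
      = VComp Y (Li i) (FO (D (FO T x)) i) (FO (D (FO T x)) j) \<cdot> (FA (D (FO T x)) i j \<boxtimes> \<gamma> i x)
          \<cdot> \<sigma> (FO \<phi> x) (VHom J i j))" for i j f
  have ex: "\<exists>f. Q i j f"
    if i [simp]: "i \<in> VObj J" "j \<in> VObj J" for i j
  proof -
    have "wcone X \<phi> Y (?T j) (Li i) (VHom J i j) (\<lambda>x. VComp Y (Li i) (FO (D (FO T x)) i) (FO (D (FO T x)) j)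
        \<cdot> (FA (D (FO T x)) i j \<boxtimes> \<gamma> i x) \<cdot> \<sigma> (FO \<phi> x) (VHom J i j))"
    proof (rule wconeI[OF X Y \<phi> Ti[OF i(2)]], goal_cases)
      case p: (4 x y \<Gamma> s t f)
      interpret environment V \<Gamma> by (rule p)
      have [simp]: "x \<in> VObj X" "y \<in> VObj X" using p by simp_all
      let ?F = "emap (FA (D (FO T x)) i j) f" and ?g = "emap (\<gamma> i x) t"
      have "emap (VComp Y (Li i) (FO (D (FO T x)) j) (FO (D (FO T y)) j)) (pr (emap (\<pi> (FO T x) (FO T y) j) (emap
          (FA T x y) s)) (emap (VComp Y (Li i) (FO (D (FO T x)) i) (FO (D (FO T x)) j)) (pr ?F ?g)))
        = emap (VComp Y (Li i) (FO (D (FO T x)) i) (FO (D (FO T y)) j)) (pr (emap (VComp Y (FO (D (FO T x)) i) (FO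
            (D (FO T x)) j) (FO (D (FO T y)) j)) (pr (emap (\<pi> (FO T x) (FO T y) j) (emap (FA T x y) s)) ?F)) ?g)"
        using p by simp
      also have "\<dots> = emap (VComp Y (Li i) (FO (D (FO T y)) i) (FO (D (FO T y)) j)) (pr (emap (FA (D (FO T y)) i j)
          f) (emap (VComp Y (Li i) (FO (D (FO T x)) i) (FO (D (FO T y)) i)) (pr (emap (\<pi> (FO T x) (FO T y) i)
          (emap (FA T x y) s)) ?g)))"
        by (subst T_nat) (use p in simp_all)
      also have "\<dots> = emap (VComp Y (Li i) (FO (D (FO T y)) i) (FO (D (FO T y)) j)) (pr (emap (FA (D (FO T y)) i j)
          f) (emap (\<gamma> i y) (emap (ev V (FO \<phi> x) (FO \<phi> y)) (pr (emap (FA \<phi> x y) s) t))))"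
        by (subst \<gamma>_el) (use p in simp_all)
      finally show ?case using p by simp
    qed simp_all
    from lim_lift[OF lim[OF i(2)] this] show ?thesis unfolding Q_def by simp metis
  qed
  have "\<exists>LA. \<forall>i j. i \<in> VObj J \<longrightarrow> j \<in> VObj J \<longrightarrow> Q i j (LA i j)"
    by (rule choice2) (rule ex)
  then obtain LA where LA0: "\<forall>i j. i \<in> VObj J \<longrightarrow> j \<in> VObj J \<longrightarrow> Q i j (LA i j)" ..
  have LA [simp]: "\<And>i j. i \<in> VObj J \<Longrightarrow> j \<in> VObj J \<Longrightarrow> LA i j \<in> Arr V" 
    "\<And>i j. i \<in> VObj J \<Longrightarrow> j \<in> VObj J \<Longrightarrow> Dom V (LA i j) = VHom J i j" "\<And>i j. i \<in> VObj J \<Longrightarrow> j \<in> VObj J \<Longrightarrow>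
        Cod V (LA i j) = VHom Y (Li i) (Li j)"
    and LA_eq: "\<And>i j x. i \<in> VObj J \<Longrightarrow> j \<in> VObj J \<Longrightarrow> x \<in> VObj X \<Longrightarrow>
        VComp Y (Li i) (Li j) (FO (D (FO T x)) j) \<cdot> (\<gamma> j x \<boxtimes> LA i j)
      = VComp Y (Li i) (FO (D (FO T x)) i) (FO (D (FO T x)) j) \<cdot> (FA (D (FO T x)) i j \<boxtimes> \<gamma> i x)
          \<cdot> \<sigma> (FO \<phi> x) (VHom J i j)"
    using LA0 unfolding Q_def by blast+
  have LA_el: "App (VComp Y (Li i) (Li j) (FO (D (FO T x)) j)) (Pr \<Gamma> (App (\<gamma> j x) t) (App (LA i j) f))
    = App (VComp Y (Li i) (FO (D (FO T x)) i) (FO (D (FO T x)) j)) (Pr \<Gamma> (App (FA (D (FO T x)) i j) f) (App (\<gamma> i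
        x) t))"
    if i: "i \<in> VObj J" "j \<in> VObj J" and x: "x \<in> VObj X" and G: "environment V \<Gamma>" "El \<Gamma> t" "El \<Gamma> f"
      "Ty t = FO \<phi> x" "Ty f = VHom J i j" "Ctx t \<inter> Ctx f = {}" "Ctx f \<inter> Ctx t = {}" for i j x t f \<Gamma>
  proof -
    interpret environment V \<Gamma> by (rule G)
    show ?thesis using arg_cong[OF LA_eq[OF i x], of "\<lambda>h. emap h (pr t f)"] i x G by simp
  qed
  have un: "f = g" if i: "i \<in> VObj J" and a: "a \<in> VObj Y" and f: "f \<in> Arr V" "Dom V f = z" "Cod V f = VHom Y a (Li i)"
    and g: "g \<in> Arr V" "Dom V g = z" "Cod V g = VHom Y a (Li i)"
    and eq: "\<And>x. x \<in> VObj X \<Longrightarrow> VComp Y a (Li i) (FO (D (FO T x)) i) \<cdot> (\<gamma> i x \<boxtimes> f)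
        = VComp Y a (Li i) (FO (D (FO T x)) i) \<cdot> (\<gamma> i x \<boxtimes> g)"
    for i a z f g
    by (rule lim_unique[OF lim[OF i] X Y \<phi> Ti[OF i] a f g]) (use i eq in simp)
  \<comment> \<open>Both functor laws are tested against the counits and follow from those of the
    functors \<open>D (FO T x)\<close>.\<close>
  have "mk_vfun J Li LA \<in> vfun J Y"
  proof (rule mk_vfun_vfun, goal_cases)
    case [simp]: (3 i j k)
    show ?case
    proof (rule un[of k "Li i" _ "VHom J j k \<otimes> VHom J i j"], goal_cases)
      case (9 x)
      then have [simp]: "x \<in> VObj X" .
      show ?case
      proof (rule ext3'[of _ _ "FO \<phi> x" "VHom J j k" "VHom J i j"], goal_cases)
        case p: (8 \<Gamma> t g f)
        interpret environment V \<Gamma> by (rule p)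
        have Dx: "emap (FA (D (FO T x)) i k) (emap (VComp J i j k) (pr g f))
            = emap (VComp Y (FO (D (FO T x)) i) (FO (D (FO T x)) j) (FO (D (FO T x)) k)) (pr (emap (FA (D (FO T
            x)) j k) g) (emap (FA (D (FO T x)) i j) f))"
          by (rule vfun_el_Cmp[OF D]) (use p in simp_all)
        have 1: "emap (VComp Y (Li i) (Li k) (FO (D (FO T x)) k)) (pr (emap (\<gamma> k x) t) (emap (LA i k) (emap (VComp
            J i j k) (pr g f))))
          = emap (VComp Y (Li i) (FO (D (FO T x)) i) (FO (D (FO T x)) k)) (pr (emap (FA (D (FO T x)) i k) (emap
              (VComp J i j k) (pr g f))) (emap (\<gamma> i x) t))"
          by (rule LA_el) (use p in simp_all)
        have 2: "emap (VComp Y (Li i) (Li k) (FO (D (FO T x)) k)) (pr (emap (\<gamma> k x) t) (emap (VComp Y (Li i) (Li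
            j) (Li k)) (pr (emap (LA j k) g) (emap (LA i j) f))))
          = emap (VComp Y (Li i) (Li j) (FO (D (FO T x)) k)) (pr (emap (VComp Y (Li j) (Li k) (FO (D (FO T x)) k))
              (pr (emap (\<gamma> k x) t) (emap (LA j k) g))) (emap (LA i j) f))"
          using p by simp
        have 3: "emap (VComp Y (Li j) (Li k) (FO (D (FO T x)) k)) (pr (emap (\<gamma> k x) t) (emap (LA j k) g))
          = emap (VComp Y (Li j) (FO (D (FO T x)) j) (FO (D (FO T x)) k)) (pr (emap (FA (D (FO T x)) j k) g) (emap
              (\<gamma> j x) t))"
          by (rule LA_el) (use p in simp_all)
        have 4: "emap (VComp Y (Li i) (Li j) (FO (D (FO T x)) j)) (pr (emap (\<gamma> j x) t) (emap (LA i j) f))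
          = emap (VComp Y (Li i) (FO (D (FO T x)) i) (FO (D (FO T x)) j)) (pr (emap (FA (D (FO T x)) i j) f) (emap
              (\<gamma> i x) t))"
          by (rule LA_el) (use p in simp_all)
        show ?case using p 1 2[unfolded 3] 4 by (simp add: Dx)
      qed simp_all
    qed simp_all
  next
    case [simp]: (4 i)
    show ?case
    proof (rule un[of i "Li i" _ \<I>], goal_cases)
      case (9 x)
      then have [simp]: "x \<in> VObj X" .
      have "VComp Y (Li i) (Li i) (FO (D (FO T x)) i) \<cdot> (\<gamma> i x \<boxtimes> (LA i i \<cdot> VId J i)) \<cdot> invr (\<rho> (FO \<phi> x))
         = VComp Y (Li i) (Li i) (FO (D (FO T x)) i) \<cdot> (\<gamma> i x \<boxtimes> VId Y (Li i)) \<cdot> invr (\<rho> (FO \<phi> x))"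
      proof (rule ext1[of _ _ "FO \<phi> x"], goal_cases)
        case p: (5 \<Gamma> t)
        interpret environment V \<Gamma> by (rule p)
        have Dx: "emap (FA (D (FO T x)) i i) (emap (VId J i) star) = emap (VId Y (FO (D (FO T x)) i)) star"
          by (rule vfun_el_Id[OF D]) (use p in simp_all)
        have "emap (VComp Y (Li i) (Li i) (FO (D (FO T x)) i)) (pr (emap (\<gamma> i x) t) (emap (LA i i) (emap (VId J i)
            star)))
          = emap (VComp Y (Li i) (FO (D (FO T x)) i) (FO (D (FO T x)) i)) (pr (emap (FA (D (FO T x)) i i) (emap
              (VId J i) star)) (emap (\<gamma> i x) t))"
          by (rule LA_el) (use p in simp_all)
        then show ?case using p by (simp add: Dx)
      qed simp_all
      then have "(VComp Y (Li i) (Li i) (FO (D (FO T x)) i) \<cdot> (\<gamma> i x \<boxtimes> (LA i i \<cdot> VId J i))) \<cdot> invr (\<rho> (FO \<phi> x))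
         = (VComp Y (Li i) (Li i) (FO (D (FO T x)) i) \<cdot> (\<gamma> i x \<boxtimes> VId Y (Li i))) \<cdot> invr (\<rho> (FO \<phi> x))" by simp
      then show ?case by (rule iso_cancel_r[rotated -1]) simp_all
    qed simp_all
  qed simp_all
  then obtain L where L [simp]: "L \<in> VObj FC" and DL: "D L = mk_vfun J Li LA" using D_surj by blast
  have DL_simps [simp]: "i \<in> VObj J \<Longrightarrow> FO (D L) i = Li i" "i \<in> VObj J \<Longrightarrow> j \<in> VObj J \<Longrightarrow> FA (D L) i j = LA i j" for i j
    by (simp_all add: DL)
  \<comment> \<open>The choice of \<open>LA\<close> makes \<open>\<gamma> i x\<close> natural in
    \<open>i\<close>, so it lifts to an arrow into the hom of the functor category.\<close>
  have "\<exists>d. d \<in> Arr V \<and> Dom V d = FO \<phi> x \<and> Cod V d = VHom FC L (FO T x) \<and> (\<forall>i\<in>VObj J. \<pi> L (FO T x) i \<cdot> d = \<gamma> i x)"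
    if x [simp]: "x \<in> VObj X" for x
  proof -
    have "natural_family V J Y (D L) (D (FO T x)) (FO \<phi> x) (\<lambda>i. \<gamma> i x)"
      unfolding natural_family_def using LA_eq by (simp add: Hom_iff)
    from \<pi>_lift[OF L Tx(1)[OF x] this] show ?thesis by metis
  qed
  then obtain \<delta> where \<delta> [simp]: "\<And>x. x \<in> VObj X \<Longrightarrow> \<delta> x \<in> Arr V" "\<And>x. x \<in> VObj X \<Longrightarrow> Dom V (\<delta> x) = FO \<phi> x"
    "\<And>x. x \<in> VObj X \<Longrightarrow> Cod V (\<delta> x) = VHom FC L (FO T x)"
    and \<delta>_eq: "\<And>i x. x \<in> VObj X \<Longrightarrow> i \<in> VObj J \<Longrightarrow> \<pi> L (FO T x) i \<cdot> \<delta> x = \<gamma> i x"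
    by metis
  have \<delta>_el: "App (\<pi> L (FO T x) i) (App (\<delta> x) t) = App (\<gamma> i x) t"
    if "environment V \<Gamma>" "El \<Gamma> t" "Ty t = FO \<phi> x" "x \<in> VObj X" "i \<in> VObj J" for \<Gamma> t x i
  proof -
    interpret environment V \<Gamma> by (rule that)
    show ?thesis unfolding \<delta>_eq[OF that(4,5), symmetric] using that by simp
  qed
  have wc: "wcounit X \<phi> FC T L \<delta>"
    unfolding wcounit_def
  proof (intro conjI ballI)
    fix x y assume [simp]: "x \<in> VObj X" "y \<in> VObj X"
    show "VComp FC L (FO T x) (FO T y) \<cdot> (FA T x y \<boxtimes> \<delta> x) = \<delta> y \<cdot> ev V (FO \<phi> x) (FO \<phi> y) \<cdot> (FA \<phi> x y \<boxtimes> \<one> (FO \<phi> x))"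
    proof (rule \<pi>_ext[of L "FO T y" _ "VHom X x y \<otimes> FO \<phi> x"], goal_cases)
      case (9 i)
      then have i [simp]: "i \<in> VObj J" .
      show ?case
      proof (rule ext2[of _ _ "VHom X x y" "FO \<phi> x"], goal_cases)
        case p: (7 \<Gamma> s t)
        interpret environment V \<Gamma> by (rule p)
        have 1: "emap (\<pi> L (FO T y) i) (emap (VComp FC L (FO T x) (FO T y)) (pr (emap (FA T x y) s) (emap (\<delta> x) t)))
          = emap (VComp Y (FO (D L) i) (FO (D (FO T x)) i) (FO (D (FO T y)) i)) (pr (emap (\<pi> (FO T x) (FO T y) i)
              (emap (FA T x y) s)) (emap (\<pi> L (FO T x) i) (emap (\<delta> x) t)))"
          by (rule \<pi>_el[OF functor_category_axioms]) (use p in simp_all)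
        have 2: "emap (\<pi> L (FO T x) i) (emap (\<delta> x) t) = emap (\<gamma> i x) t"
          by (rule \<delta>_el[OF p(1)]) (use p in simp_all)
        have 3: "emap (\<pi> L (FO T y) i) (emap (\<delta> y) (emap (ev V (FO \<phi> x) (FO \<phi> y)) (pr (emap (FA \<phi> x y) s) t)))
            = emap (\<gamma> i y) (emap (ev V (FO \<phi> x) (FO \<phi> y)) (pr (emap (FA \<phi> x y) s) t))"
          by (rule \<delta>_el[OF p(1)]) (use p in simp_all)
        have 4: "emap (VComp Y (Li i) (FO (D (FO T x)) i) (FO (D (FO T y)) i)) (pr (emap (\<pi> (FO T x) (FO T y) i)
            (emap (FA T x y) s)) (emap (\<gamma> i x) t))
          = emap (\<gamma> i y) (emap (ev V (FO \<phi> x) (FO \<phi> y)) (pr (emap (FA \<phi> x y) s) t))"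
          by (rule \<gamma>_el) (use p in simp_all)
        show ?case using p by (simp add: 1 2 3 4)
      qed simp_all
    qed simp_all
  qed (simp_all)
  have comp_el: "App (\<pi> F (FO T x) i) (App (VComp FC F L (FO T x)) (Pr \<Gamma> (App (\<delta> x) t) h))
     = App (VComp Y (FO (D F) i) (Li i) (FO (D (FO T x)) i)) (Pr \<Gamma> (App (\<gamma> i x) t) (App (\<pi> F L i) h))"
    if F: "F \<in> VObj FC" and x: "x \<in> VObj X" "i \<in> VObj J" and G: "environment V \<Gamma>" "El \<Gamma> t" "El \<Gamma> h" "Ty t = FO \<phi> x"
     "Ty h = VHom FC F L" "Ctx t \<inter> Ctx h = {}" for F x i \<Gamma> t h
  proof -
    interpret environment V \<Gamma> by (rule G)
    have "emap (\<pi> F (FO T x) i) (emap (VComp FC F L (FO T x)) (pr (emap (\<delta> x) t) h))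
       = emap (VComp Y (FO (D F) i) (FO (D L) i) (FO (D (FO T x)) i)) (pr (emap (\<pi> L (FO T x) i) (emap (\<delta> x) t))
           (emap (\<pi> F L i) h))"
      by (rule \<pi>_el[OF functor_category_axioms]) (use F x G in simp_all)
    then show ?thesis using \<delta>_el[OF G(1,2,4) x] F x G by simp
  qed
  have "is_lim X \<phi> FC T L \<delta>"
  proof (rule is_limI[OF X FC \<phi> T wc])
    fix F z r assume r: "wcone X \<phi> FC T F z r"
    note rT [simp] = wcone_simps[OF r]
    \<comment> \<open>A cone in the functor category is factored at each index separately; the
      factors are assembled afterwards.\<close>
    have "\<exists>h. h \<in> Arr V \<and> Dom V h = z \<and> Cod V h = VHom Y (FO (D F) i) (Li i) \<and>
        (\<forall>x\<in>VObj X. VComp Y (FO (D F) i) (Li i) (FO (D (FO T x)) i) \<cdot> (\<gamma> i x \<boxtimes> h) = \<pi> F (FO T x) i \<cdot> r x)"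
      if i [simp]: "i \<in> VObj J" for i
    proof -
      have "wcone X \<phi> Y (?T i) (FO (D F) i) z (\<lambda>x. \<pi> F (FO T x) i \<cdot> r x)"
      proof (rule wconeI[OF X Y \<phi> Ti[OF i]], goal_cases)
        case p: (4 x y \<Gamma> s t u)
        interpret environment V \<Gamma> by (rule p)
        have [simp]: "x \<in> VObj X" "y \<in> VObj X" using p by simp_all
        have 1: "emap (VComp FC F (FO T x) (FO T y)) (pr (emap (FA T x y) s) (emap (r x) (pr t u)))
            = emap (r y) (pr (emap (ev V (FO \<phi> x) (FO \<phi> y)) (pr (emap (FA \<phi> x y) s) t)) u)"
          by (rule wcone_el[OF r X FC \<phi> T]) (use p in simp_all)
        have 2: "emap (\<pi> F (FO T y) i) (emap (VComp FC F (FO T x) (FO T y)) (pr (emap (FA T x y) s) (emap (r x)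
            (pr t u))))
          = emap (VComp Y (FO (D F) i) (FO (D (FO T x)) i) (FO (D (FO T y)) i)) (pr (emap (\<pi> (FO T x) (FO T y) i)
              (emap (FA T x y) s)) (emap (\<pi> F (FO T x) i) (emap (r x) (pr t u))))"
          by (rule \<pi>_el[OF functor_category_axioms]) (use p in simp_all)
        show ?case using p 2[unfolded 1] by simp
      qed simp_all
      from lim_lift[OF lim[OF i] this] show ?thesis by simp metis
    qed
    then obtain h where h [simp]: "\<And>i. i \<in> VObj J \<Longrightarrow> h i \<in> Arr V" "\<And>i. i \<in> VObj J \<Longrightarrow> Dom V (h i) = z"
      "\<And>i. i \<in> VObj J \<Longrightarrow> Cod V (h i) = VHom Y (FO (D F) i) (Li i)"
      and h_eq: "\<And>i x. i \<in> VObj J \<Longrightarrow> x \<in> VObj X \<Longrightarrow> VComp Y (FO (D F) i) (Li i) (FO (D (FO T x)) i) \<cdot> (\<gamma> i x \<boxtimes> h i)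
          = \<pi> F (FO T x) i \<cdot> r x"
      by metis
    have h_el: "App (VComp Y (FO (D F) i) (Li i) (FO (D (FO T x)) i)) (Pr \<Gamma> (App (\<gamma> i x) t) (App (h i) u))
       = App (\<pi> F (FO T x) i) (App (r x) (Pr \<Gamma> t u))"
      if i: "i \<in> VObj J" and x: "x \<in> VObj X" and G: "environment V \<Gamma>" "El \<Gamma> t" "El \<Gamma> u"
      "Ty t = FO \<phi> x" "Ty u = z" "Ctx t \<inter> Ctx u = {}" for i x t u \<Gamma>
    proof -
      interpret environment V \<Gamma> by (rule G)
      show ?thesis using arg_cong[OF h_eq[OF i x], of "\<lambda>k. emap k (pr t u)"] i x G by simp
    qed
    \<comment> \<open>Both sides of naturality have the same composites with the counit at
      \<open>j\<close>, and factorisations through it are unique.\<close>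
    have "natural_family V J Y (D F) (D L) z h"
      unfolding natural_family_def
    proof (intro conjI ballI)
      fix i j assume [simp]: "i \<in> VObj J" "j \<in> VObj J"
      show "VComp Y (FO (D F) i) (FO (D F) j) (FO (D L) j) \<cdot> (h j \<boxtimes> FA (D F) i j)
          = VComp Y (FO (D F) i) (FO (D L) i) (FO (D L) j) \<cdot> (FA (D L) i j \<boxtimes> h i) \<cdot> \<sigma> z (VHom J i j)"
      proof (rule un[of j "FO (D F) i" _ "z \<otimes> VHom J i j"], goal_cases)
        case (9 x)
        then have [simp]: "x \<in> VObj X" .
        show ?case
        proof (rule ext3'[of _ _ "FO \<phi> x" z "VHom J i j"], goal_cases)
          case p: (8 \<Gamma> t u f)
          interpret environment V \<Gamma> by (rule p)
          let ?r = "emap (r x) (pr t u)"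
          have 1: "emap (VComp Y (FO (D F) j) (Li j) (FO (D (FO T x)) j)) (pr (emap (\<gamma> j x) t) (emap (h j) u))
              = emap (\<pi> F (FO T x) j) ?r"
            by (rule h_el) (use p in simp_all)
          have 2: "emap (VComp Y (FO (D F) i) (FO (D F) j) (FO (D (FO T x)) j)) (pr (emap (\<pi> F (FO T x) j) ?r)
              (emap (FA (D F) i j) f))
            = emap (VComp Y (FO (D F) i) (FO (D (FO T x)) i) (FO (D (FO T x)) j)) (pr (emap (FA (D (FO T x)) i j)
                f) (emap (\<pi> F (FO T x) i) ?r))"
            by (rule natural_family_el[OF \<pi>_natural]) (use p D in simp_all)
          have 3: "emap (VComp Y (FO (D F) i) (Li i) (FO (D (FO T x)) i)) (pr (emap (\<gamma> i x) t) (emap (h i) u))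
              = emap (\<pi> F (FO T x) i) ?r"
            by (rule h_el) (use p in simp_all)
          have 4: "emap (VComp Y (Li i) (Li j) (FO (D (FO T x)) j)) (pr (emap (\<gamma> j x) t) (emap (LA i j) f))
            = emap (VComp Y (Li i) (FO (D (FO T x)) i) (FO (D (FO T x)) j)) (pr (emap (FA (D (FO T x)) i j) f)
                (emap (\<gamma> i x) t))"
            by (rule LA_el) (use p in simp_all)
          have "emap (VComp Y (FO (D F) i) (Li j) (FO (D (FO T x)) j)) (pr (emap (\<gamma> j x) t) (emap (VComp Y (FO (D
              F) i) (FO (D F) j) (Li j)) (pr (emap (h j) u) (emap (FA (D F) i j) f))))
            = emap (VComp Y (FO (D F) i) (FO (D F) j) (FO (D (FO T x)) j)) (pr (emap (VComp Y (FO (D F) j) (Li j)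
                (FO (D (FO T x)) j)) (pr (emap (\<gamma> j x) t) (emap (h j) u))) (emap (FA (D F) i j) f))"
            using p by simp
          also have "\<dots> = emap (VComp Y (FO (D F) i) (FO (D (FO T x)) i) (FO (D (FO T x)) j)) (pr (emap (FA (D (FO
              T x)) i j) f) (emap (VComp Y (FO (D F) i) (Li i) (FO (D (FO T x)) i)) (pr (emap (\<gamma> i x) t) (emap (h
              i) u))))"
            unfolding 1 2 3 ..
          also have "\<dots> = emap (VComp Y (FO (D F) i) (Li i) (FO (D (FO T x)) j)) (pr (emap (VComp Y (Li i) (Li j)
              (FO (D (FO T x)) j)) (pr (emap (\<gamma> j x) t) (emap (LA i j) f))) (emap (h i) u))"
            unfolding 4 using p by simp
          also have "\<dots> = emap (VComp Y (FO (D F) i) (Li j) (FO (D (FO T x)) j)) (pr (emap (\<gamma> j x) t) (emap (VComp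
              Y (FO (D F) i) (Li i) (Li j)) (pr (emap (LA i j) f) (emap (h i) u))))"
            using p by simp
          finally show ?case using p by simp
        qed simp_all
      qed simp_all
    qed (simp_all add: Hom_iff)
    from \<pi>_lift[OF rT(1) L this] obtain k where k [simp]: "k \<in> Arr V" "Dom V k = z" "Cod V k = VHom FC F L"
      and k_eq: "\<And>i. i \<in> VObj J \<Longrightarrow> \<pi> F L i \<cdot> k = h i" by metis
    have "VComp FC F L (FO T x) \<cdot> (\<delta> x \<boxtimes> k) = r x" if [simp]: "x \<in> VObj X" for x
    proof (rule \<pi>_ext[of F "FO T x" _ "FO \<phi> x \<otimes> z"], goal_cases)
      case (9 i)
      then have [simp]: "i \<in> VObj J" .
      show ?case
      proof (rule ext2[of _ _ "FO \<phi> x" z], goal_cases)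
        case p: (7 \<Gamma> t u)
        interpret environment V \<Gamma> by (rule p)
        have 1: "emap (\<pi> F (FO T x) i) (emap (VComp FC F L (FO T x)) (pr (emap (\<delta> x) t) (emap k u)))
          = emap (VComp Y (FO (D F) i) (Li i) (FO (D (FO T x)) i)) (pr (emap (\<gamma> i x) t) (emap (\<pi> F L i) (emap k u)))"
          by (rule comp_el) (use p in simp_all)
        have 2: "emap (\<pi> F L i) (emap k u) = emap (h i) u" using arg_cong[OF k_eq[of i], of "\<lambda>e. emap e u"] p by simp
        have 3: "emap (VComp Y (FO (D F) i) (Li i) (FO (D (FO T x)) i)) (pr (emap (\<gamma> i x) t) (emap (h i) u))
            = emap (\<pi> F (FO T x) i) (emap (r x) (pr t u))"
          by (rule h_el) (use p in simp_all)
        show ?case using p by (simp add: 1 2 3)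
      qed simp_all
    qed simp_all
    then show "\<exists>h. h \<in> Arr V \<and> Dom V h = z \<and> Cod V h = VHom FC F L \<and> (\<forall>x\<in>VObj X. VComp FC F L (FO T x) \<cdot> (\<delta> x \<boxtimes> h)
        = r x)"
      using k by blast
  next
    fix F z f g assume [simp]: "F \<in> VObj FC" "z \<in> Obj V" and f: "f \<in> Arr V" "Dom V f = z" "Cod V f = VHom FC F L"
       and g: "g \<in> Arr V" "Dom V g = z" "Cod V g = VHom FC F L"
       and eq: "\<And>x. x \<in> VObj X \<Longrightarrow> VComp FC F L (FO T x) \<cdot> (\<delta> x \<boxtimes> f) = VComp FC F L (FO T x) \<cdot> (\<delta> x \<boxtimes> g)"
    show "f = g"
    proof (rule \<pi>_ext[OF _ L f g], goal_cases)
      case (2 i)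
      then have i [simp]: "i \<in> VObj J" .
      show ?case
      proof (rule un[of i "FO (D F) i" _ z], goal_cases)
        case (9 x)
        then have [simp]: "x \<in> VObj X" .
        show ?case
        proof (rule ext2[of _ _ "FO \<phi> x" z], goal_cases)
          case p: (7 \<Gamma> t u)
          interpret environment V \<Gamma> by (rule p)
          have 1: "emap (\<pi> F (FO T x) i) (emap (VComp FC F L (FO T x)) (pr (emap (\<delta> x) t) (emap f u)))
            = emap (VComp Y (FO (D F) i) (Li i) (FO (D (FO T x)) i)) (pr (emap (\<gamma> i x) t) (emap (\<pi> F L i) (emap f
                u)))"
            by (rule comp_el) (use p f in simp_all)
          have 2: "emap (\<pi> F (FO T x) i) (emap (VComp FC F L (FO T x)) (pr (emap (\<delta> x) t) (emap g u)))
            = emap (VComp Y (FO (D F) i) (Li i) (FO (D (FO T x)) i)) (pr (emap (\<gamma> i x) t) (emap (\<pi> F L i) (emap g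
                u)))"
            by (rule comp_el) (use p g in simp_all)
          have 3: "emap (VComp FC F L (FO T x)) (pr (emap (\<delta> x) t) (emap f u))
              = emap (VComp FC F L (FO T x)) (pr (emap (\<delta> x) t) (emap g u))"
            using arg_cong[OF eq[of x], of "\<lambda>e. emap e (pr t u)"] p f g by simp
          show ?case using p f g 1[unfolded 3 2] by simp
        qed (use f g in simp_all)
      qed (use f g in simp_all)
    qed simp
  qed
  then show thesis by (rule that) (use \<delta>_eq LA_eq in simp_all)
qed

text \<open>\<open>R\<close> sends \<open>F\<close> to a limit of \<open>D F\<close>. The last
  equation, naturality of the counits in \<open>F\<close>, fixes the action of \<open>R\<close> on
  homs, as arrows into \<open>FO R G\<close> are determined by their composites with the
  counit.\<close>

definition lim_functor :: "('i, 'v, 'm) vfun \<Rightarrow> ('f, 'y, 'm) vfun \<Rightarrow> ('f \<Rightarrow> 'i \<Rightarrow> 'm) \<Rightarrow> bool" where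
  "lim_functor \<phi> R \<gamma> \<longleftrightarrow> R \<in> vfun FC Y \<and> (\<forall>F\<in>VObj FC. is_lim J \<phi> Y (D F) (FO R F) (\<gamma> F)) \<and>
     (\<forall>F\<in>VObj FC. \<forall>G\<in>VObj FC. \<forall>i\<in>VObj J. VComp Y (FO R F) (FO R G) (FO (D G) i) \<cdot> (\<gamma> G i \<boxtimes> FA R F G)
       = VComp Y (FO R F) (FO (D F) i) (FO (D G) i) \<cdot> (\<pi> F G i \<boxtimes> \<gamma> F i) \<cdot> \<sigma> (FO \<phi> i) (VHom FC F G))"

text \<open>Parallel to \<open>pointwise_lim\<close>: there the counits were to be natural in the
  index, here in the functor \<open>F\<close>, and again uniqueness of factorisations gives the
  functor laws.\<close>

theorem lim_functor_exists:
  assumes \<phi>: "\<phi> \<in> vfun J \<V>" and lim: "\<And>F. F \<in> vfun J Y \<Longrightarrow> \<exists>L \<gamma>. is_lim J \<phi> Y F L \<gamma>"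
  shows "\<exists>R \<gamma>. lim_functor \<phi> R \<gamma>"
proof -
  obtain Li \<gamma> where lim: "\<And>F. F \<in> VObj FC \<Longrightarrow> is_lim J \<phi> Y (D F) (Li F) (\<gamma> F)"
  proof -
    have "\<exists>L \<gamma>. is_lim J \<phi> Y (D F) L \<gamma>" if "F \<in> VObj FC" for F using lim[OF D[OF that]] .
    then show thesis using that by metis
  qed
  note \<gamma> = is_lim_wcounit[OF lim]
  have [simp]: "x \<in> VObj J \<Longrightarrow> FO \<phi> x \<in> Obj V" "x \<in> VObj J \<Longrightarrow> y \<in> VObj J \<Longrightarrow> FA \<phi> x y \<in> Arr V"
    "x \<in> VObj J \<Longrightarrow> y \<in> VObj J \<Longrightarrow> Dom V (FA \<phi> x y) = VHom J x y"
    "x \<in> VObj J \<Longrightarrow> y \<in> VObj J \<Longrightarrow> Cod V (FA \<phi> x y) = \<lbrakk>FO \<phi> x, FO \<phi> y\<rbrakk>" for x y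
    using vfun_simps(1-4)[OF \<phi>] by auto
  have Li [simp]: "Li F \<in> VObj Y" if "F \<in> VObj FC" for F
    using wcounit_simps(1)[OF \<gamma>[OF that]] .
  have \<gamma>T [simp]: "\<gamma> F i \<in> Arr V" "Dom V (\<gamma> F i) = FO \<phi> i" "Cod V (\<gamma> F i) = VHom Y (Li F) (FO (D F) i)"
    if "i \<in> VObj J" "F \<in> VObj FC" for F i
    using wcounit_simps(2-4)[OF \<gamma>[OF that(2)] that(1)] that by auto
  define Q where "Q F G f \<longleftrightarrow> f \<in> Arr V \<and> Dom V f = VHom FC F G \<and> Cod V f
      = VHom Y (Li F) (Li G) \<and> (\<forall>i\<in>VObj J. VComp Y (Li F) (Li G) (FO (D G) i) \<cdot> (\<gamma> G i \<boxtimes> f)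
       = VComp Y (Li F) (FO (D F) i) (FO (D G) i) \<cdot> (\<pi> F G i \<boxtimes> \<gamma> F i) \<cdot> \<sigma> (FO \<phi> i) (VHom FC F G))" for F G f
  have ex: "\<exists>f. Q F G f"
    if F [simp]: "F \<in> VObj FC" "G \<in> VObj FC" for F G
  proof -
    have "wcone J \<phi> Y (D G) (Li F) (VHom FC F G) (\<lambda>i. VComp Y (Li F) (FO (D F) i) (FO (D G) i) \<cdot> (\<pi> F G i \<boxtimes> \<gamma> F i)
        \<cdot> \<sigma> (FO \<phi> i) (VHom FC F G))"
    proof (rule wconeI[OF J Y \<phi> D[OF F(2)]], goal_cases)
      case p: (4 i j \<Gamma> f t s)
      interpret environment V \<Gamma> by (rule p)
      have [simp]: "i \<in> VObj J" "j \<in> VObj J" using p by simp_all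
      have 1: "emap (VComp Y (FO (D F) i) (FO (D F) j) (FO (D G) j)) (pr (emap (\<pi> F G j) s) (emap (FA (D F) i j) f))
         = emap (VComp Y (FO (D F) i) (FO (D G) i) (FO (D G) j)) (pr (emap (FA (D G) i j) f) (emap (\<pi> F G i) s))"
        by (rule natural_family_el[OF \<pi>_natural]) (use p D in simp_all)
      have 2: "emap (VComp Y (Li F) (FO (D F) i) (FO (D F) j)) (pr (emap (FA (D F) i j) f) (emap (\<gamma> F i) t))
          = emap (\<gamma> F j) (emap (ev V (FO \<phi> i) (FO \<phi> j)) (pr (emap (FA \<phi> i j) f) t))"
        by (rule wcounit_el[OF \<gamma>[OF F(1)] J Y \<phi> D[OF F(1)]]) (use p in simp_all)
      have "emap (VComp Y (Li F) (FO (D G) i) (FO (D G) j)) (pr (emap (FA (D G) i j) f) (emap (VComp Y (Li F) (FO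
          (D F) i) (FO (D G) i)) (pr (emap (\<pi> F G i) s) (emap (\<gamma> F i) t))))
        = emap (VComp Y (Li F) (FO (D F) i) (FO (D G) j)) (pr (emap (VComp Y (FO (D F) i) (FO (D G) i) (FO (D G)
            j)) (pr (emap (FA (D G) i j) f) (emap (\<pi> F G i) s))) (emap (\<gamma> F i) t))"
        using p by simp
      also have "\<dots> = emap (VComp Y (Li F) (FO (D F) j) (FO (D G) j)) (pr (emap (\<pi> F G j) s) (emap (VComp Y (Li F)
          (FO (D F) i) (FO (D F) j)) (pr (emap (FA (D F) i j) f) (emap (\<gamma> F i) t))))"
        unfolding 1[symmetric] using p by simp
      finally show ?case using p by (simp add: 2)
    qed simp_all
    from lim_lift[OF lim[OF F(2)] this] show ?thesis unfolding Q_def by metis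
  qed
  have "\<exists>RA. \<forall>F G. F \<in> VObj FC \<longrightarrow> G \<in> VObj FC \<longrightarrow> Q F G (RA F G)"
    by (rule choice2) (rule ex)
  then obtain RA where RA0: "\<forall>F G. F \<in> VObj FC \<longrightarrow> G \<in> VObj FC \<longrightarrow> Q F G (RA F G)" ..
  have RA [simp]: "\<And>F G. F \<in> VObj FC \<Longrightarrow> G \<in> VObj FC \<Longrightarrow> RA F G \<in> Arr V"
    "\<And>F G. F \<in> VObj FC \<Longrightarrow> G \<in> VObj FC \<Longrightarrow> Dom V (RA F G) = VHom FC F G" "\<And>F G. F \<in> VObj FC \<Longrightarrow> G \<in> VObj FC \<Longrightarrow>
        Cod V (RA F G) = VHom Y (Li F) (Li G)"
    and RA_eq: "\<And>F G i. F \<in> VObj FC \<Longrightarrow> G \<in> VObj FC \<Longrightarrow> i \<in> VObj J \<Longrightarrow> VComp Y (Li F) (Li G) (FO (D G) i) \<cdot> (\<gamma> G i \<boxtimes> RA F G)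
       = VComp Y (Li F) (FO (D F) i) (FO (D G) i) \<cdot> (\<pi> F G i \<boxtimes> \<gamma> F i) \<cdot> \<sigma> (FO \<phi> i) (VHom FC F G)"
    using RA0 unfolding Q_def by blast+
  have RA_el: "App (VComp Y (Li F) (Li G) (FO (D G) i)) (Pr \<Gamma> (App (\<gamma> G i) t) (App (RA F G) s))
     = App (VComp Y (Li F) (FO (D F) i) (FO (D G) i)) (Pr \<Gamma> (App (\<pi> F G i) s) (App (\<gamma> F i) t))"
    if F: "F \<in> VObj FC" "G \<in> VObj FC" "i \<in> VObj J" and G: "environment V \<Gamma>" "El \<Gamma> t" "El \<Gamma> s" "Ty t = FO \<phi> i"
     "Ty s = VHom FC F G" "Ctx t \<inter> Ctx s = {}" "Ctx s \<inter> Ctx t = {}" for F G i \<Gamma> t s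
  proof -
    interpret environment V \<Gamma> by (rule G)
    show ?thesis using arg_cong[OF RA_eq[OF F], of "\<lambda>h. emap h (pr t s)"] F G by simp
  qed
  have un: "f = g" if F: "F \<in> VObj FC" "a \<in> VObj Y" and f: "f \<in> Arr V" "Dom V f = z" "Cod V f = VHom Y a (Li F)"
    and g: "g \<in> Arr V" "Dom V g = z" "Cod V g = VHom Y a (Li F)"
    and eq: "\<And>i. i \<in> VObj J \<Longrightarrow> VComp Y a (Li F) (FO (D F) i) \<cdot> (\<gamma> F i \<boxtimes> f)
        = VComp Y a (Li F) (FO (D F) i) \<cdot> (\<gamma> F i \<boxtimes> g)"
    for F a z f g
    by (rule lim_unique[OF lim[OF F(1)] J Y \<phi> D[OF F(1)] F(2) f g eq])
  have "mk_vfun FC Li RA \<in> vfun FC Y"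
  proof (rule mk_vfun_vfun, goal_cases)
    case [simp]: (3 F G H)
    show ?case
    proof (rule un[of H "Li F" _ "VHom FC G H \<otimes> VHom FC F G"], goal_cases)
      case (9 i)
      then have [simp]: "i \<in> VObj J" .
      show ?case
      proof (rule ext3'[of _ _ "FO \<phi> i" "VHom FC G H" "VHom FC F G"], goal_cases)
        case p: (8 \<Gamma> t g f)
        interpret environment V \<Gamma> by (rule p)
        have 0: "emap (\<pi> F H i) (emap (VComp FC F G H) (pr g f))
            = emap (VComp Y (FO (D F) i) (FO (D G) i) (FO (D H) i)) (pr (emap (\<pi> G H i) g) (emap (\<pi> F G i) f))"
          by (rule \<pi>_el[OF functor_category_axioms]) (use p in simp_all)
        have 1: "emap (VComp Y (Li F) (Li H) (FO (D H) i)) (pr (emap (\<gamma> H i) t) (emap (RA F H) (emap (VComp FC F G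
            H) (pr g f))))
          = emap (VComp Y (Li F) (FO (D F) i) (FO (D H) i)) (pr (emap (\<pi> F H i) (emap (VComp FC F G H) (pr g f)))
              (emap (\<gamma> F i) t))"
          by (rule RA_el) (use p in simp_all)
        have 2: "emap (VComp Y (Li F) (Li H) (FO (D H) i)) (pr (emap (\<gamma> H i) t) (emap (VComp Y (Li F) (Li G) (Li
            H)) (pr (emap (RA G H) g) (emap (RA F G) f))))
          = emap (VComp Y (Li F) (Li G) (FO (D H) i)) (pr (emap (VComp Y (Li G) (Li H) (FO (D H) i)) (pr (emap (\<gamma>
              H i) t) (emap (RA G H) g))) (emap (RA F G) f))"
          using p by simp
        have 3: "emap (VComp Y (Li G) (Li H) (FO (D H) i)) (pr (emap (\<gamma> H i) t) (emap (RA G H) g))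
          = emap (VComp Y (Li G) (FO (D G) i) (FO (D H) i)) (pr (emap (\<pi> G H i) g) (emap (\<gamma> G i) t))"
          by (rule RA_el) (use p in simp_all)
        have 4: "emap (VComp Y (Li F) (Li G) (FO (D G) i)) (pr (emap (\<gamma> G i) t) (emap (RA F G) f))
          = emap (VComp Y (Li F) (FO (D F) i) (FO (D G) i)) (pr (emap (\<pi> F G i) f) (emap (\<gamma> F i) t))"
          by (rule RA_el) (use p in simp_all)
        show ?case using p 1 2[unfolded 3] 4 by (simp add: 0)
      qed simp_all
    qed simp_all
  next
    case [simp]: (4 F)
    show ?case
    proof (rule un[of F "Li F" _ \<I>], goal_cases)
      case (9 i)
      then have [simp]: "i \<in> VObj J" .
      have "VComp Y (Li F) (Li F) (FO (D F) i) \<cdot> (\<gamma> F i \<boxtimes> (RA F F \<cdot> VId FC F)) \<cdot> invr (\<rho> (FO \<phi> i))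
         = VComp Y (Li F) (Li F) (FO (D F) i) \<cdot> (\<gamma> F i \<boxtimes> VId Y (Li F)) \<cdot> invr (\<rho> (FO \<phi> i))"
      proof (rule ext1[of _ _ "FO \<phi> i"], goal_cases)
        case p: (5 \<Gamma> t)
        interpret environment V \<Gamma> by (rule p)
        have 0: "emap (\<pi> F F i) (emap (VId FC F) star) = emap (VId Y (FO (D F) i)) star"
          using arg_cong[OF \<pi>_Id[of F i], of "\<lambda>e. emap e star"] by simp
        have "emap (VComp Y (Li F) (Li F) (FO (D F) i)) (pr (emap (\<gamma> F i) t) (emap (RA F F) (emap (VId FC F) star)))
          = emap (VComp Y (Li F) (FO (D F) i) (FO (D F) i)) (pr (emap (\<pi> F F i) (emap (VId FC F) star)) (emap (\<gamma> F
              i) t))"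
          by (rule RA_el) (use p in simp_all)
        then show ?case using p by (simp add: 0)
      qed simp_all
      then have "(VComp Y (Li F) (Li F) (FO (D F) i) \<cdot> (\<gamma> F i \<boxtimes> (RA F F \<cdot> VId FC F))) \<cdot> invr (\<rho> (FO \<phi> i))
         = (VComp Y (Li F) (Li F) (FO (D F) i) \<cdot> (\<gamma> F i \<boxtimes> VId Y (Li F))) \<cdot> invr (\<rho> (FO \<phi> i))" by simp
      then show ?case by (rule iso_cancel_r[rotated -1]) simp_all
    qed simp_all
  qed simp_all
  then have "lim_functor \<phi> (mk_vfun FC Li RA) \<gamma>"
    unfolding lim_functor_def using lim RA_eq by simp
  then show ?thesis by blast
qed

end

section \<open>Limits and colimits in \<open>\<V>\<close>, opposite functor categories, comparison
  arrows\<close>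

context symmetric_monoidal_closed
begin

lemma ihom_ext3':
  assumes [simp]: "f \<in> Arr V" "g \<in> Arr V" "a \<in> Obj V" "a' \<in> Obj V" "a'' \<in> Obj V" "b \<in> Obj V" "c \<in> Obj V"
    and d: "Dom V f = a \<otimes> (a' \<otimes> a'')" "Dom V g = a \<otimes> (a' \<otimes> a'')" "Cod V f = \<lbrakk>b, c\<rbrakk>" "Cod V g = \<lbrakk>b, c\<rbrakk>"
    and eq: "\<And>\<Gamma> s s' s'' t. environment V \<Gamma> \<Longrightarrow>
       El \<Gamma> s \<Longrightarrow> El \<Gamma> s' \<Longrightarrow> El \<Gamma> s'' \<Longrightarrow> El \<Gamma> t \<Longrightarrow>
       Ty s = a \<Longrightarrow> Ty s' = a' \<Longrightarrow> Ty s'' = a'' \<Longrightarrow> Ty t = b \<Longrightarrow>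
       Ctx s = {0} \<Longrightarrow> Ctx s' = {Suc 0} \<Longrightarrow> Ctx s'' = {2} \<Longrightarrow> Ctx t = {3} \<Longrightarrow>
       App (ev V b c) (Pr \<Gamma> (App f (Pr \<Gamma> s (Pr \<Gamma> s' s''))) t) =
       App (ev V b c) (Pr \<Gamma> (App g (Pr \<Gamma> s (Pr \<Gamma> s' s''))) t)"
  shows "f = g"
proof -
  have "f \<cdot> \<alpha> a a' a'' = g \<cdot> \<alpha> a a' a''"
  proof (rule ihom_ext3[of _ _ a a' a'' b c], goal_cases)
    case p: (12 \<Gamma> s s' s'' t)
    interpret environment V \<Gamma> by (rule p)
    show ?case using eq[OF p(1-13)] p d by simp
  qed (use d in simp_all)
  then show ?thesis by (rule iso_cancel_r[rotated -1]) (use d in simp_all)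
qed

lemma cocone_map:
  assumes q: "cocone L \<phi> S d q (VObj L)" and asm: "vcat L" "\<phi> \<in> vfun (op L) \<V>" "S \<in> vfun L \<V>" and h: "h \<in> Arr V"
      "Dom V h = d" "Cod V h = e"
  shows "cocone L \<phi> S e (\<lambda>l. h \<cdot> q l) (VObj L)"
  unfolding cocone_def
proof (intro conjI ballI)
  note qT = cocone_simps[OF q]
  have o: "x \<in> VObj L \<Longrightarrow> FO \<phi> x \<in> Obj V" "x \<in> VObj L \<Longrightarrow> FO S x \<in> Obj V" for x
    using vfun_simps(1)[OF asm(2)] vfun_simps(1)[OF asm(3)] by auto
  show "e \<in> Obj V" using h Cod_Obj' by blast
  show "h \<cdot> q l \<in> Arr V" "Dom V (h \<cdot> q l) = FO \<phi> l \<otimes> FO S l" "Cod V (h \<cdot> q l) = e" if "l \<in> VObj L" for l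
    using that qT h by simp_all
  fix l l' assume l: "l \<in> VObj L" "l' \<in> VObj L"
  have "q l' \<cdot> (\<one> (FO \<phi> l') \<boxtimes> (ev V (FO S l) (FO S l') \<cdot> (FA S l l' \<boxtimes> \<one> (FO S l))))
        = q l \<cdot> ((ev V (FO \<phi> l') (FO \<phi> l) \<cdot> (FA \<phi> l' l \<boxtimes> \<one> (FO \<phi> l')) \<cdot> \<sigma> (FO \<phi> l') (VHom L l l')) \<boxtimes> \<one> (FO S l))
            \<cdot> invr (\<alpha> (FO \<phi> l') (VHom L l l') (FO S l))"
    using q l unfolding cocone_def by blast
  from arg_cong[OF this, of "\<lambda>f. h \<cdot> f"]
  show "(h \<cdot> q l') \<cdot> (\<one> (FO \<phi> l') \<boxtimes> (ev V (FO S l) (FO S l') \<cdot> (FA S l l' \<boxtimes> \<one> (FO S l))))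
        = (h \<cdot> q l) \<cdot> ((ev V (FO \<phi> l') (FO \<phi> l) \<cdot> (FA \<phi> l' l \<boxtimes> \<one> (FO \<phi> l')) \<cdot> \<sigma> (FO \<phi> l') (VHom L l l')) \<boxtimes> \<one> (FO S l))
            \<cdot> invr (\<alpha> (FO \<phi> l') (VHom L l l') (FO S l))"
    using asm l qT h o by simp
qed

text \<open>The limit in \<open>\<V>\<close> is the end of \<open>[\<phi> x, T x]\<close>, and the
  counit transposes its projections.\<close>

lemma lim_self:
  assumes he: "has_ends X \<V>" and X [simp]: "vcat X" and \<phi>: "\<phi> \<in> vfun X \<V>" and T: "T \<in> vfun X \<V>"
  shows "\<exists>L \<gamma>. is_lim X \<phi> \<V> T L \<gamma>"
proof -
  define L where "L = nat_obj V X \<V> \<phi> T"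
  define p where "p = nat_proj V X \<V> \<phi> T"
  have o [simp]: "x \<in> VObj X \<Longrightarrow> FO \<phi> x \<in> Obj V" "x \<in> VObj X \<Longrightarrow> FO T x \<in> Obj V" for x
    using vfun_simps(1)[OF \<phi>] vfun_simps(1)[OF T] by auto
  have [simp]: "x \<in> VObj X \<Longrightarrow> y \<in> VObj X \<Longrightarrow> FA \<phi> x y \<in> Arr V" "x \<in> VObj X \<Longrightarrow> y \<in> VObj X \<Longrightarrow> FA T x y \<in> Arr V"
    "x \<in> VObj X \<Longrightarrow> y \<in> VObj X \<Longrightarrow> Dom V (FA \<phi> x y) = VHom X x y" "x \<in> VObj X \<Longrightarrow> y \<in> VObj X \<Longrightarrow>
        Dom V (FA T x y) = VHom X x y"
    "x \<in> VObj X \<Longrightarrow> y \<in> VObj X \<Longrightarrow> Cod V (FA \<phi> x y) = \<lbrakk>FO \<phi> x, FO \<phi> y\<rbrakk>" "x \<in> VObj X \<Longrightarrow> y \<in> VObj X \<Longrightarrow>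
        Cod V (FA T x y) = \<lbrakk>FO T x, FO T y\<rbrakk>" for x y
    using vfun_simps(2-4)[OF \<phi>] vfun_simps(2-4)[OF T] by auto
  have L [simp]: "L \<in> Obj V" and pT [simp]: "x \<in> VObj X \<Longrightarrow> p x \<in> Arr V" "x \<in> VObj X \<Longrightarrow> Dom V (p x) = L"
    "x \<in> VObj X \<Longrightarrow> Cod V (p x) = \<lbrakk>FO \<phi> x, FO T x\<rbrakk>" for x
    using nat_simps[OF he \<phi> T] by (auto simp: L_def p_def)
  define \<gamma> where "\<gamma> x = curry (FO \<phi> x) L (FO T x) (ev V (FO \<phi> x) (FO T x) \<cdot> (p x \<boxtimes> \<one> (FO \<phi> x)) \<cdot> \<sigma> (FO \<phi> x) L)" for x
  have \<gamma> [simp]: "x \<in> VObj X \<Longrightarrow> \<gamma> x \<in> Arr V" "x \<in> VObj X \<Longrightarrow> Dom V (\<gamma> x) = FO \<phi> x" "x \<in> VObj X \<Longrightarrow>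
      Cod V (\<gamma> x) = \<lbrakk>L, FO T x\<rbrakk>" for x
    by (simp_all add: \<gamma>_def)
  have \<gamma>_el: "App (ev V L (FO T x)) (Pr \<Gamma> (App (\<gamma> x) t) l)
     = App (ev V (FO \<phi> x) (FO T x)) (Pr \<Gamma> (App (p x) l) t)"
    if "environment V \<Gamma>" "El \<Gamma> t" "El \<Gamma> l" "Ty t = FO \<phi> x" "Ty l = L" 
      "Ctx t \<inter> Ctx l = {}" "Ctx l \<inter> Ctx t = {}" "x \<in> VObj X" for \<Gamma> t l x
  proof -
    interpret environment V \<Gamma> by (rule that)
    show ?thesis using that by (simp add: \<gamma>_def)
  qed
  have wc: "wcounit X \<phi> \<V> T L \<gamma>"
    unfolding wcounit_def
  proof (intro conjI ballI)
    fix x y assume [simp]: "x \<in> VObj X" "y \<in> VObj X"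
    show "VComp \<V> L (FO T x) (FO T y) \<cdot> (FA T x y \<boxtimes> \<gamma> x) = \<gamma> y \<cdot> ev V (FO \<phi> x) (FO \<phi> y) \<cdot> (FA \<phi> x y \<boxtimes> \<one> (FO \<phi> x))"
    proof (rule ihom_ext2[of _ _ "VHom X x y" "FO \<phi> x" L "FO T y"], goal_cases)
      case c: (11 \<Gamma> s t l)
      interpret environment V \<Gamma> by (rule c)
      have "emap (VComp \<V> (FO \<phi> x) (FO \<phi> y) (FO T y)) (pr (emap (p y) l) (emap (FA \<phi> x y) s))
        = emap (VComp \<V> (FO \<phi> x) (FO T x) (FO T y)) (pr (emap (FA T x y) s) (emap (p x) l))"
        unfolding p_def by (rule natural_family_el[OF nat_proj_natural[OF he \<phi> T]])
            (use c \<phi> T in \<open>simp_all add: L_def\<close>)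
      from arg_cong[OF this, of "\<lambda>e. emap (ev V (FO \<phi> x) (FO T y)) (pr e t)"]
      show ?case using c by (simp add: \<gamma>_el)
    qed simp_all
  qed simp_all
  have "is_lim X \<phi> \<V> T L \<gamma>"
  proof (rule is_limI[OF X vcat_self \<phi> T wc])
    fix a z r assume r: "wcone X \<phi> \<V> T a z r"
    note rT [simp] = wcone_simps[OF r, simplified self_enriched_simps(1,2)]
    \<comment> \<open>By closedness, a cone at \<open>a\<close> with domain \<open>z\<close> is a
      natural family from \<open>\<phi>\<close> to \<open>T\<close> with domain
      \<open>z \<otimes> a\<close>.\<close>
    define q where "q x = curry (z \<otimes> a) (FO \<phi> x) (FO T x) (ev V a (FO T x) \<cdot> (r x \<boxtimes> \<one> a) \<cdot> invr (\<alpha> (FO \<phi> x) z a)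
        \<cdot> \<sigma> (z \<otimes> a) (FO \<phi> x))" for x
    have q [simp]: "x \<in> VObj X \<Longrightarrow> q x \<in> Arr V" "x \<in> VObj X \<Longrightarrow> Dom V (q x) = z \<otimes> a" "x \<in> VObj X \<Longrightarrow>
        Cod V (q x) = \<lbrakk>FO \<phi> x, FO T x\<rbrakk>" for x
      by (simp_all add: q_def)
    have "natural_family V X \<V> \<phi> T (z \<otimes> a) q"
      unfolding natural_family_def
    proof (intro conjI ballI)
      fix x y assume [simp]: "x \<in> VObj X" "y \<in> VObj X"
      show "VComp \<V> (FO \<phi> x) (FO \<phi> y) (FO T y) \<cdot> (q y \<boxtimes> FA \<phi> x y)
          = VComp \<V> (FO \<phi> x) (FO T x) (FO T y) \<cdot> (FA T x y \<boxtimes> q x) \<cdot> \<sigma> (z \<otimes> a) (VHom X x y)"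
      proof (rule ihom_ext3[of _ _ z a "VHom X x y" "FO \<phi> x" "FO T y"], goal_cases)
        case c: (12 \<Gamma> u w s t)
        interpret environment V \<Gamma> by (rule c)
        have "emap (VComp \<V> a (FO T x) (FO T y)) (pr (emap (FA T x y) s) (emap (r x) (pr t u)))
            = emap (r y) (pr (emap (ev V (FO \<phi> x) (FO \<phi> y)) (pr (emap (FA \<phi> x y) s) t)) u)"
          by (rule wcone_el[OF r X vcat_self \<phi> T]) (use c in simp_all)
        from arg_cong[OF this, of "\<lambda>e. emap (ev V a (FO T y)) (pr e w)"]
        show ?case using c by (simp add: q_def)
      qed simp_all
    qed (simp_all add: Hom_iff)
    from nat_lift[OF he \<phi> T this] obtain k where k [simp]: "k \<in> Arr V" "Dom V k = z \<otimes> a" "Cod V k = L"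
      and k_eq: "\<And>x. x \<in> VObj X \<Longrightarrow> p x \<cdot> k = q x" by (auto simp: Hom_iff L_def p_def)
    have "VComp \<V> a L (FO T x) \<cdot> (\<gamma> x \<boxtimes> curry z a L k) = r x" if [simp]: "x \<in> VObj X" for x
    proof (rule ihom_ext2[of _ _ "FO \<phi> x" z a "FO T x"], goal_cases)
      case c: (11 \<Gamma> t u w)
      interpret environment V \<Gamma> by (rule c)
      have "emap (p x) (emap k (pr u w)) = emap (q x) (pr u w)"
          using arg_cong[OF k_eq[of x], of "\<lambda>e. emap e (pr u w)"] c by simp
      then show ?case using c by (simp add: \<gamma>_el q_def)
    qed simp_all
    then show "\<exists>h. h \<in> Arr V \<and> Dom V h = z \<and> Cod V h = VHom \<V> a L \<and> (\<forall>x\<in>VObj X. VComp \<V> a L (FO T x) \<cdot> (\<gamma> x \<boxtimes> h)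
        = r x)"
      by (intro exI[of _ "curry z a L k"]) simp
  next
    fix a z f g assume "a \<in> VObj \<V>" and [simp]: "z \<in> Obj V" and f: "f \<in> Arr V" "Dom V f = z" "Cod V f = VHom \<V> a L"
      and g: "g \<in> Arr V" "Dom V g = z" "Cod V g = VHom \<V> a L"
      and eq: "\<And>x. x \<in> VObj X \<Longrightarrow> VComp \<V> a L (FO T x) \<cdot> (\<gamma> x \<boxtimes> f) = VComp \<V> a L (FO T x) \<cdot> (\<gamma> x \<boxtimes> g)"
    then have a [simp]: "a \<in> Obj V" by simp
    have "ev V a L \<cdot> (f \<boxtimes> \<one> a) = ev V a L \<cdot> (g \<boxtimes> \<one> a)"
    proof (rule nat_ext[OF he \<phi> T, of _ _ "z \<otimes> a", folded L_def p_def], goal_cases)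
      case (7 x)
      then have [simp]: "x \<in> VObj X" .
      show ?case
      proof (rule ihom_ext2[of _ _ z a "FO \<phi> x" "FO T x"], goal_cases)
        case c: (11 \<Gamma> u w t)
        interpret environment V \<Gamma> by (rule c)
        from arg_cong[OF eq[of x], of "\<lambda>e. emap (ev V a (FO T x)) (pr (emap e (pr t u)) w)"]
        show ?case using c f g by (simp add: \<gamma>_el)
      qed (use f g in simp_all)
    qed (use f g in simp_all)
    then show "f = g" by (rule uncurry_inj[rotated -1]) (use f g in simp_all)
  qed
  then show ?thesis by blast
qed

text \<open>The hypothesis gives only an ordinary universal property. Closedness makes it enriched:
  a cone in the opposite at \<open>a\<close> with domain \<open>z\<close> is a cocone with vertex
  \<open>\<lbrakk>z, a\<rbrakk>\<close>.\<close>

lemma lim_op_self: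
  assumes L [simp]: "vcat L" and \<phi>: "\<phi> \<in> vfun (op L) \<V>" and S: "S \<in> vfun L \<V>" and col: "is_colim L \<phi> S C \<kappa>"
  shows "\<exists>C \<gamma>. is_lim (op L) \<phi> (op \<V>) (vop_fun S) C \<gamma>"
proof -
  have \<kappa>: "cocone L \<phi> S C \<kappa> (VObj L)" using col by (simp add: is_colim_def)
  note \<kappa>T [simp] = cocone_simps[OF \<kappa>]
  have T: "vop_fun S \<in> vfun (op L) (op \<V>)" by (rule vop_fun_vfun[OF L vcat_self S])
  have o [simp]: "x \<in> VObj L \<Longrightarrow> FO \<phi> x \<in> Obj V" "x \<in> VObj L \<Longrightarrow> FO S x \<in> Obj V" for x
    using vfun_simps(1)[OF \<phi>] vfun_simps(1)[OF S] by auto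
  have [simp]: "x \<in> VObj L \<Longrightarrow> y \<in> VObj L \<Longrightarrow> FA \<phi> x y \<in> Arr V" "x \<in> VObj L \<Longrightarrow> y \<in> VObj L \<Longrightarrow> FA S x y \<in> Arr V"
    "x \<in> VObj L \<Longrightarrow> y \<in> VObj L \<Longrightarrow> Dom V (FA \<phi> x y) = VHom L y x" "x \<in> VObj L \<Longrightarrow> y \<in> VObj L \<Longrightarrow>
        Dom V (FA S x y) = VHom L x y"
    "x \<in> VObj L \<Longrightarrow> y \<in> VObj L \<Longrightarrow> Cod V (FA \<phi> x y) = \<lbrakk>FO \<phi> x, FO \<phi> y\<rbrakk>" "x \<in> VObj L \<Longrightarrow> y \<in> VObj L \<Longrightarrow>
        Cod V (FA S x y) = \<lbrakk>FO S x, FO S y\<rbrakk>" for x y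
    using vfun_simps(2-4)[OF \<phi>] vfun_simps(2-4)[OF S] by auto
  define \<gamma> where "\<gamma> l = curry (FO \<phi> l) (FO S l) C (\<kappa> l)" for l
  have \<gamma> [simp]: "l \<in> VObj L \<Longrightarrow> \<gamma> l \<in> Arr V" "l \<in> VObj L \<Longrightarrow> Dom V (\<gamma> l) = FO \<phi> l" "l \<in> VObj L \<Longrightarrow>
      Cod V (\<gamma> l) = \<lbrakk>FO S l, C\<rbrakk>" for l
    by (simp_all add: \<gamma>_def)
  have \<gamma>_el: "App (ev V (FO S l) C) (Pr \<Gamma> (App (\<gamma> l) t) u) = App (\<kappa> l) (Pr \<Gamma> t u)"
    if "environment V \<Gamma>" "El \<Gamma> t" "El \<Gamma> u" "Ty t = FO \<phi> l" "Ty u = FO S l" 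
      "Ctx t \<inter> Ctx u = {}" "l \<in> VObj L" for \<Gamma> t u l
  proof -
    interpret environment V \<Gamma> by (rule that)
    show ?thesis using that by (simp add: \<gamma>_def)
  qed
  have wc: "wcounit (op L) \<phi> (op \<V>) (vop_fun S) C \<gamma>"
    unfolding wcounit_def
  proof (intro conjI ballI)
    fix x y assume "x \<in> VObj (op L)" "y \<in> VObj (op L)"
    then have [simp]: "x \<in> VObj L" "y \<in> VObj L" by simp_all
    show "VComp (op \<V>) C (FO (vop_fun S) x) (FO (vop_fun S) y) \<cdot> (FA (vop_fun S) x y \<boxtimes> \<gamma> x)
        = \<gamma> y \<cdot> ev V (FO \<phi> x) (FO \<phi> y) \<cdot> (FA \<phi> x y \<boxtimes> \<one> (FO \<phi> x))"
    proof (rule ihom_ext2[of _ _ "VHom L y x" "FO \<phi> x" "FO S y" C], goal_cases)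
      case c: (11 \<Gamma> s t u)
      interpret environment V \<Gamma> by (rule c)
      have "emap (\<kappa> x) (pr t (emap (ev V (FO S y) (FO S x)) (pr (emap (FA S y x) s) u)))
        = emap (\<kappa> y) (pr (emap (ev V (FO \<phi> x) (FO \<phi> y)) (pr (emap (FA \<phi> x y) s) t)) u)"
        by (rule cocone_el[OF \<kappa> L \<phi> S]) (use c in simp_all)
      then show ?case using c by (simp add: \<gamma>_el)
    qed simp_all
  qed simp_all
  have "is_lim (op L) \<phi> (op \<V>) (vop_fun S) C \<gamma>"
  proof (rule is_limI[OF vcat_op[OF L] vcat_op[OF vcat_self] \<phi> T wc])
    fix a z r assume r: "wcone (op L) \<phi> (op \<V>) (vop_fun S) a z r"
    note rT [simp] = wcone_simps[OF r, simplified vop_simps vop_fun_simps self_enriched_simps(1,2)]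
    define q where "q l = curry (FO \<phi> l \<otimes> FO S l) z a (ev V (FO S l) a \<cdot> (r l \<boxtimes> \<one> (FO S l))
        \<cdot> invr (\<alpha> (FO \<phi> l) z (FO S l)) \<cdot> (\<one> (FO \<phi> l) \<boxtimes> \<sigma> (FO S l) z) \<cdot> \<alpha> (FO \<phi> l) (FO S l) z)" for l
    have q [simp]: "x \<in> VObj L \<Longrightarrow> q x \<in> Arr V" "x \<in> VObj L \<Longrightarrow> Dom V (q x) = FO \<phi> x \<otimes> FO S x" "x \<in> VObj L \<Longrightarrow>
        Cod V (q x) = \<lbrakk>z, a\<rbrakk>" for x
      by (simp_all add: q_def)
    have "cocone L \<phi> S \<lbrakk>z, a\<rbrakk> q (VObj L)"
      unfolding cocone_def
    proof (intro conjI ballI)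
      fix l l' assume [simp]: "l \<in> VObj L" "l' \<in> VObj L"
      show "q l' \<cdot> (\<one> (FO \<phi> l') \<boxtimes> (ev V (FO S l) (FO S l') \<cdot> (FA S l l' \<boxtimes> \<one> (FO S l))))
        = q l \<cdot> ((ev V (FO \<phi> l') (FO \<phi> l) \<cdot> (FA \<phi> l' l \<boxtimes> \<one> (FO \<phi> l')) \<cdot> \<sigma> (FO \<phi> l') (VHom L l l')) \<boxtimes> \<one> (FO S l))
            \<cdot> invr (\<alpha> (FO \<phi> l') (VHom L l l') (FO S l))"
      proof (rule ihom_ext3'[of _ _ "FO \<phi> l'" "VHom L l l'" "FO S l" z a], goal_cases)
        case c: (12 \<Gamma> t f u v)
        interpret environment V \<Gamma> by (rule c)
        have "emap (VComp (op \<V>) a (FO (vop_fun S) l') (FO (vop_fun S) l)) (pr (emap (FA (vop_fun S) l' l) f)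
            (emap (r l') (pr t v)))
          = emap (r l) (pr (emap (ev V (FO \<phi> l') (FO \<phi> l)) (pr (emap (FA \<phi> l' l) f) t)) v)"
          by (rule wcone_el[OF r vcat_op[OF L] vcat_op[OF vcat_self] \<phi> T]) (use c in simp_all)
        from arg_cong[OF this, of "\<lambda>e. emap (ev V (FO S l) a) (pr e u)"]
        show ?case using c by (simp add: q_def)
      qed simp_all
    qed simp_all
    then obtain k where k [simp]: "k \<in> Arr V" "Dom V k = C" "Cod V k = \<lbrakk>z, a\<rbrakk>" and k_eq: "\<And>l. l \<in> VObj L \<Longrightarrow>
        k \<cdot> \<kappa> l = q l"
      using col unfolding is_colim_def Hom_iff by blast
    let ?h = "curry z C a (ev V z a \<cdot> (k \<boxtimes> \<one> z) \<cdot> \<sigma> z C)"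
    have "VComp (op \<V>) a C (FO (vop_fun S) l) \<cdot> (\<gamma> l \<boxtimes> ?h) = r l" if [simp]: "l \<in> VObj L" for l
    proof (rule ihom_ext2[of _ _ "FO \<phi> l" z "FO S l" a], goal_cases)
      case c: (11 \<Gamma> t v u)
      interpret environment V \<Gamma> by (rule c)
      have "emap k (emap (\<kappa> l) (pr t u)) = emap (q l) (pr t u)"
          using arg_cong[OF k_eq[of l], of "\<lambda>e. emap e (pr t u)"] c by simp
      then show ?case using c by (simp add: \<gamma>_el q_def)
    qed simp_all
    then show "\<exists>h. h \<in> Arr V \<and> Dom V h = z \<and> Cod V h = VHom (op \<V>) a C \<and>
        (\<forall>x\<in>VObj (op L). VComp (op \<V>) a C (FO (vop_fun S) x) \<cdot> (\<gamma> x \<boxtimes> h) = r x)"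
      by (intro exI[of _ ?h]) simp
  next
    fix a z f g assume "a \<in> VObj (op \<V>)" and [simp]: "z \<in> Obj V" and f: "f \<in> Arr V" "Dom V f = z" "Cod V f
        = VHom (op \<V>) a C"
      and g: "g \<in> Arr V" "Dom V g = z" "Cod V g = VHom (op \<V>) a C"
      and eq: "\<And>x. x \<in> VObj (op L) \<Longrightarrow> VComp (op \<V>) a C (FO (vop_fun S) x) \<cdot> (\<gamma> x \<boxtimes> f)
          = VComp (op \<V>) a C (FO (vop_fun S) x) \<cdot> (\<gamma> x \<boxtimes> g)"
    then have a [simp]: "a \<in> Obj V" by simp
    \<comment> \<open>Transposes \<open>z \<rightarrow> \<lbrakk>C, a\<rbrakk>\<close> into
      \<open>C \<rightarrow> \<lbrakk>z, a\<rbrakk>\<close>, to which the uniqueness of arrows out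
      of the colimit applies.\<close>
    let ?t = "\<lambda>f. curry C z a (ev V C a \<cdot> (f \<boxtimes> \<one> C) \<cdot> \<sigma> C z)"
    have t: "?t f \<in> Hom V C \<lbrakk>z, a\<rbrakk>" "?t g \<in> Hom V C \<lbrakk>z, a\<rbrakk>" using f g by (simp_all add: Hom_iff)
    have "?t f \<cdot> \<kappa> l = ?t g \<cdot> \<kappa> l" if [simp]: "l \<in> VObj L" for l
    proof (rule ihom_ext2[of _ _ "FO \<phi> l" "FO S l" z a], goal_cases)
      case c: (11 \<Gamma> t u v)
      interpret environment V \<Gamma> by (rule c)
      from arg_cong[OF eq[of l], of "\<lambda>e. emap (ev V (FO S l) a) (pr (emap e (pr t v)) u)"]
      show ?case using c f g by (simp add: \<gamma>_el)
    qed (use f g in simp_all)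
    moreover have "cocone L \<phi> S \<lbrakk>z, a\<rbrakk> (\<lambda>l. ?t g \<cdot> \<kappa> l) (VObj L)"
      by (rule cocone_map[OF \<kappa> L \<phi> S]) (use f g in simp_all)
    then have "\<exists>!h. h \<in> Hom V C \<lbrakk>z, a\<rbrakk> \<and> (\<forall>l\<in>VObj L. h \<cdot> \<kappa> l = ?t g \<cdot> \<kappa> l)"
      using col unfolding is_colim_def by blast
    ultimately have tfg: "?t f = ?t g" using t by (intro ex1_unique[of "\<lambda>h. h \<in> Hom V C \<lbrakk>z, a\<rbrakk> \<and>
        (\<forall>l\<in>VObj L. h \<cdot> \<kappa> l = ?t g \<cdot> \<kappa> l)"]) auto
    show "f = g"
    proof (rule ihom_ext1[of _ _ z C a], goal_cases)
      case c: (10 \<Gamma> v w)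
      interpret environment V \<Gamma> by (rule c)
      from arg_cong[OF tfg, of "\<lambda>e. emap (ev V z a) (pr (emap e w) v)"]
      show ?case using c f g by simp
    qed (use f g in simp_all)
  qed
  then show ?thesis by blast
qed

lemma vop_fun_vcompose: "vop_fun (vcompose V X G F) = vcompose V (op X) (vop_fun G) (vop_fun F)"
  by (auto simp: vcompose_def mk_vfun_def vop_fun_def fun_eq_iff restrict_def)

lemma vop_fun_inverse:
  assumes "vcat X" "vcat Y" "F \<in> vfun (op X) (op Y)"
  shows "vop_fun F \<in> vfun X Y"
  using vop_fun_vfun[OF vcat_op[OF assms(1)] vcat_op[OF assms(2)] assms(3)]
  by (simp only: vfun_op_op(1)[OF assms(1) vcat_op[OF vcat_op[OF assms(2)]]] vfun_op_op(2)[OF assms(1,2)])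

lemma functor_category_functor_cat:
  assumes "has_ends J Y" "vcat J" "vcat Y"
  shows "functor_category V (functor_cat V J Y) J Y (\<lambda>F. F) (nat_proj V J Y)"
proof unfold_locales
  show "vcat (functor_cat V J Y)" by (rule vcat_functor_cat[OF assms])
  fix F G H i assume F: "F \<in> VObj (functor_cat V J Y)"
  then show "F \<in> vfun J Y" by simp
  show "i \<in> VObj J \<Longrightarrow> nat_proj V J Y F F i \<cdot> VId (functor_cat V J Y) F = VId Y (FO F i)"
    using F functor_cat_Id[OF assms] by simp
  assume G: "G \<in> VObj (functor_cat V J Y)"
  show "is_hom_end V J Y F G (VHom (functor_cat V J Y) F G) (nat_proj V J Y F G)"
    using F G nat_end[OF assms(1)] by simp
  assume "H \<in> VObj (functor_cat V J Y)" "i \<in> VObj J"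
  then show "nat_proj V J Y F H i \<cdot> VComp (functor_cat V J Y) F G H =
       VComp Y (FO F i) (FO G i) (FO H i) \<cdot> (nat_proj V J Y G H i \<boxtimes> nat_proj V J Y F G i)"
    using F G functor_cat_Comp[OF assms] by simp
qed (use assms in simp_all)

text \<open>Passing to opposites reverses the direction of a transformation and keeps its
  components.\<close>

lemma natural_family_op:
  assumes XY: "vcat X" "vcat Y" and FG: "F \<in> vfun X Y" "G \<in> vfun X Y"
  shows "natural_family V (op X) (op Y) (vop_fun F) (vop_fun G) z q \<longleftrightarrow> natural_family V X Y G F z q"
proof
  assume q: "natural_family V (op X) (op Y) (vop_fun F) (vop_fun G) z q"
  note qT = natural_family_simps[OF q, simplified vop_simps vop_fun_simps]
  show "natural_family V X Y G F z q"
  proof (rule natural_familyI[OF XY FG(2,1)], goal_cases)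
    case p: (3 x y \<Gamma> s t)
    interpret environment V \<Gamma> by (rule p)
    have "emap (VComp (op Y) (FO (vop_fun F) y) (FO (vop_fun F) x) (FO (vop_fun G) x)) (pr (emap (q x) s) (emap
        (FA (vop_fun F) y x) t))
      = emap (VComp (op Y) (FO (vop_fun F) y) (FO (vop_fun G) y) (FO (vop_fun G) x)) (pr (emap (FA (vop_fun G) y
          x) t) (emap (q y) s))"
      by (rule natural_family_el[OF q vcat_op[OF XY(1)] vcat_op[OF XY(2)] vop_fun_vfun[OF XY FG(1)]
          vop_fun_vfun[OF XY FG(2)]]) (use p in simp_all)
    then show ?case using p XY FG qT by simp
  qed (use qT in auto)
next
  assume q: "natural_family V X Y G F z q"
  note qT = natural_family_simps[OF q]
  show "natural_family V (op X) (op Y) (vop_fun F) (vop_fun G) z q"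
  proof (rule natural_familyI[OF vcat_op[OF XY(1)] vcat_op[OF XY(2)] vop_fun_vfun[OF XY FG(1)] vop_fun_vfun[OF XY
      FG(2)]], goal_cases)
    case p: (3 x y \<Gamma> s t)
    interpret environment V \<Gamma> by (rule p)
    have "emap (VComp Y (FO G y) (FO G x) (FO F x)) (pr (emap (q x) s) (emap (FA G y x) t))
      = emap (VComp Y (FO G y) (FO F y) (FO F x)) (pr (emap (FA F y x) t) (emap (q y) s))"
      by (rule natural_family_el[OF q XY FG(2,1)]) (use p in simp_all)
    then show ?case using p XY FG qT by simp
  qed (use qT in auto)
qed

text \<open>Allows the results on limits of functors to be used for colimits in
  \<open>[X, Y]\<close>; the same ends serve, with the two functors exchanged.\<close>

lemma functor_category_op:
  assumes he: "has_ends X Y" and XY: "vcat X" "vcat Y"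
  shows "functor_category V (op (functor_cat V X Y)) (op X) (op Y) vop_fun (\<lambda>F G. nat_proj V X Y G F)"
proof unfold_locales
  show "vcat (op (functor_cat V X Y))" "vcat (op X)" "vcat (op Y)" using vcat_functor_cat[OF assms] XY by simp_all
  fix F' assume "F' \<in> vfun (op X) (op Y)"
  then show "\<exists>F\<in>VObj (op (functor_cat V X Y)). vop_fun F = F'"
    using vop_fun_inverse[OF XY] by (intro bexI[of _ "vop_fun F'"]) simp_all
next
  fix F G H i assume "F \<in> VObj (op (functor_cat V X Y))"
  then have F: "F \<in> vfun X Y" by simp
  show "vop_fun F \<in> vfun (op X) (op Y)" by (rule vop_fun_vfun[OF XY F])
  show "i \<in> VObj (op X) \<Longrightarrow> nat_proj V X Y F F i \<cdot> VId (op (functor_cat V X Y)) F = VId (op Y) (FO (vop_fun F) i)"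
    using F functor_cat_Id[OF assms] by simp
  assume "G \<in> VObj (op (functor_cat V X Y))"
  then have G: "G \<in> vfun X Y" by simp
  show "is_hom_end V (op X) (op Y) (vop_fun F) (vop_fun G) (VHom (op (functor_cat V X Y)) F G) (nat_proj V X Y G F)"
    using nat_end[OF he G F] unfolding is_hom_end_def natural_family_op[OF XY F G] by simp
  assume "H \<in> VObj (op (functor_cat V X Y))" "i \<in> VObj (op X)"
  then have H: "H \<in> vfun X Y" and i: "i \<in> VObj X" by simp_all
  have "nat_proj V X Y H F i \<cdot> VComp (op (functor_cat V X Y)) F G H
      = (nat_proj V X Y H F i \<cdot> VComp (functor_cat V X Y) H G F) \<cdot> \<sigma> (nat_obj V X Y H G) (nat_obj V X Y G F)"
    using he XY F G H i by simp
  also have "\<dots> = VComp Y (FO H i) (FO G i) (FO F i) \<cdot> (nat_proj V X Y G F i \<boxtimes> nat_proj V X Y H G i)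
      \<cdot> \<sigma> (nat_obj V X Y H G) (nat_obj V X Y G F)"
    using functor_cat_Comp[OF he XY H G F] he XY F G H i by simp
  also have "\<dots> = VComp (op Y) (FO F i) (FO G i) (FO H i) \<cdot> (nat_proj V X Y H G i \<boxtimes> nat_proj V X Y G F i)"
    using symm_nat'[of "nat_proj V X Y H G i" "nat_proj V X Y G F i"] he XY F G H i by simp
  finally show "nat_proj V X Y H F i \<cdot> VComp (op (functor_cat V X Y)) F G H =
       VComp (op Y) (FO (vop_fun F) i) (FO (vop_fun G) i) (FO (vop_fun H) i)
           \<cdot> (nat_proj V X Y H G i \<boxtimes> nat_proj V X Y G F i)" by simp
qed

definition invertible :: "('a, 'v, 'm) vcat \<Rightarrow> 'a \<Rightarrow> 'a \<Rightarrow> 'm \<Rightarrow> bool" where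
  "invertible A a b v \<longleftrightarrow> (\<exists>u. u \<in> Arr V \<and> Dom V u = \<I> \<and> Cod V u = VHom A b a \<and>
     VComp A b a b \<cdot> (v \<boxtimes> u) \<cdot> invr (\<lambda>\<lambda> \<I>) = VId A b \<and> VComp A a b a \<cdot> (u \<boxtimes> v) \<cdot> invr (\<lambda>\<lambda> \<I>) = VId A a)"

lemma invertible_op:
  assumes A: "vcat A" "a \<in> VObj A" "b \<in> VObj A" and v: "v \<in> Arr V" "Dom V v = \<I>" "Cod V v = VHom A a b"
  shows "invertible (op A) b a v \<longleftrightarrow> invertible A a b v"
proof -
  have 1: "VComp (op A) a b a \<cdot> (v \<boxtimes> u) \<cdot> invr (\<lambda>\<lambda> \<I>) = VComp A a b a \<cdot> (u \<boxtimes> v) \<cdot> invr (\<lambda>\<lambda> \<I>)"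
    "VComp (op A) b a b \<cdot> (u \<boxtimes> v) \<cdot> invr (\<lambda>\<lambda> \<I>) = VComp A b a b \<cdot> (v \<boxtimes> u) \<cdot> invr (\<lambda>\<lambda> \<I>)"
    if u: "u \<in> Arr V" "Dom V u = \<I>" "Cod V u = VHom A b a" for u
    using u v A tail[OF symm_nat'[of v u], of "invr (\<lambda>\<lambda> \<I>)"] tail[OF symm_nat'[of u v], of "invr (\<lambda>\<lambda> \<I>)"]
    by (simp_all add: symm_unit)
  show ?thesis
    unfolding invertible_def using 1 by (intro ex_cong1) (simp del: vop_simps(3), metis)
qed

text \<open>Replaces the statement that a cone is a limit by invertibility of one arrow, which
  unlike the cone can be shared by two diagrams.\<close>

lemma comparison_iff:
  assumes lim: "is_lim X \<phi> A T L \<gamma>" and asm: "vcat X" "vcat A" "\<phi> \<in> vfun X \<V>"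
      "T \<in> vfun X A" and \<gamma>': "wcounit X \<phi> A T L' \<gamma>'"
    and v: "v \<in> Arr V" "Dom V v = \<I>" "Cod V v = VHom A L' L"
    "\<And>x. x \<in> VObj X \<Longrightarrow> \<gamma>' x = VComp A L' L (FO T x) \<cdot> (\<gamma> x \<boxtimes> v) \<cdot> invr (\<rho> (FO \<phi> x))"
  shows "is_lim X \<phi> A T L' \<gamma>' \<longleftrightarrow> invertible A L' L v"
proof
  assume lim': "is_lim X \<phi> A T L' \<gamma>'"
  obtain u where u: "u \<in> Arr V" "Dom V u = \<I>" "Cod V u = VHom A L L'"
    "\<And>x. x \<in> VObj X \<Longrightarrow> \<gamma> x = VComp A L L' (FO T x) \<cdot> (\<gamma>' x \<boxtimes> u) \<cdot> invr (\<rho> (FO \<phi> x))"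
    by (rule lim_compare[OF lim' asm is_lim_wcounit[OF lim]]) (rule that)
  show "invertible A L' L v"
    unfolding invertible_def
    using comparison_inverse[OF lim asm \<gamma>' v u] comparison_inverse[OF lim' asm is_lim_wcounit[OF lim] u v] u(1-3)
        by blast
next
  assume "invertible A L' L v"
  then obtain u where u: "u \<in> Arr V" "Dom V u = \<I>" "Cod V u = VHom A L L'"
    "VComp A L L' L \<cdot> (v \<boxtimes> u) \<cdot> invr (\<lambda>\<lambda> \<I>) = VId A L" "VComp A L' L L' \<cdot> (u \<boxtimes> v) \<cdot> invr (\<lambda>\<lambda> \<I>) = VId A L'"
    unfolding invertible_def by blast
  show "is_lim X \<phi> A T L' \<gamma>'"
    by (rule is_lim_iso[OF lim asm wcounit_simps(1)[OF \<gamma>'] u(1-3) v(1-3) u(4,5) \<gamma>' v(4)])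
qed

end

context functor_category
begin

lemma lim_functor_simps:
  assumes "lim_functor \<phi> R \<gamma>"
  shows "R \<in> vfun FC Y" "F \<in> VObj FC \<Longrightarrow> is_lim J \<phi> Y (D F) (FO R F) (\<gamma> F)"
    "F \<in> VObj FC \<Longrightarrow> G \<in> VObj FC \<Longrightarrow> i \<in> VObj J \<Longrightarrow> VComp Y (FO R F) (FO R G) (FO (D G) i) \<cdot> (\<gamma> G i \<boxtimes> FA R F G)
       = VComp Y (FO R F) (FO (D F) i) (FO (D G) i) \<cdot> (\<pi> F G i \<boxtimes> \<gamma> F i) \<cdot> \<sigma> (FO \<phi> i) (VHom FC F G)"
  using assms unfolding lim_functor_def by blast+

text \<open>The hypothesis on homs is the equation characterising the action of \<open>R\<close>,
  restricted along \<open>W\<close>, and its solution is unique. The lemma recognises pointwise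
  limits as composites with a limit functor.\<close>

lemma lim_functor_vcompose:
  assumes R: "lim_functor \<phi> R \<gamma>" and Z: "vcat Z" and \<phi>: "\<phi> \<in> vfun J \<V>" and W: "W \<in> vfun Z FC" and P: "P \<in> vfun Z Y"
    and FO: "\<And>z. z \<in> VObj Z \<Longrightarrow> FO P z = FO R (FO W z)"
    and FA: "\<And>z z' i. z \<in> VObj Z \<Longrightarrow> z' \<in> VObj Z \<Longrightarrow> i \<in> VObj J \<Longrightarrow>
       VComp Y (FO P z) (FO P z') (FO (D (FO W z')) i) \<cdot> (\<gamma> (FO W z') i \<boxtimes> FA P z z')
       = VComp Y (FO P z) (FO (D (FO W z)) i) (FO (D (FO W z')) i) \<cdot> ((\<pi> (FO W z) (FO W z') i
           \<cdot> FA W z z') \<boxtimes> \<gamma> (FO W z) i) \<cdot> \<sigma> (FO \<phi> i) (VHom Z z z')"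
  shows "P = vcompose V Z R W"
proof (rule vfun_eqI[OF P vcompose_vfun[OF Z FC Y W lim_functor_simps(1)[OF R]]])
  show "FO P z = FO (vcompose V Z R W) z" if "z \<in> VObj Z" for z using that FO by simp
  fix z z' assume z [simp]: "z \<in> VObj Z" "z' \<in> VObj Z"
  note RT = vfun_simps(1-4)[OF lim_functor_simps(1)[OF R]] and WT [simp] = vfun_simps(1-4)[OF W] and PT
      = vfun_simps(1-4)[OF P]
  have \<phi>T: "i \<in> VObj J \<Longrightarrow> FO \<phi> i \<in> Obj V" for i using vfun_simps(1)[OF \<phi>] by simp
  have "FA P z z' = FA R (FO W z) (FO W z') \<cdot> FA W z z'"
  proof (rule lim_unique[OF lim_functor_simps(2)[OF R WT(1)[OF z(2)]] J Y \<phi> D[OF WT(1)[OF z(2)]], of "FO R (FO W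
      z)" _ "VHom Z z z'"], goal_cases)
    case (8 i)
    note i = 8
    note \<gamma>T = wcounit_simps(2-4)[OF is_lim_wcounit[OF lim_functor_simps(2)[OF R WT(1)[OF z(1)]]] i]
      wcounit_simps(2-4)[OF is_lim_wcounit[OF lim_functor_simps(2)[OF R WT(1)[OF z(2)]]] i]
    let ?c = "VComp Y (FO R (FO W z)) (FO R (FO W z')) (FO (D (FO W z')) i)"
    let ?d = "VComp Y (FO R (FO W z)) (FO (D (FO W z)) i) (FO (D (FO W z')) i)"
    have "?c \<cdot> (\<gamma> (FO W z') i \<boxtimes> (FA R (FO W z) (FO W z') \<cdot> FA W z z'))
        = (?c \<cdot> (\<gamma> (FO W z') i \<boxtimes> FA R (FO W z) (FO W z'))) \<cdot> (\<one> (FO \<phi> i) \<boxtimes> FA W z z')"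
      using Z \<gamma>T RT i \<phi>T by (simp add: tens_cmp)
    also have "\<dots> = (?d \<cdot> (\<pi> (FO W z) (FO W z') i \<boxtimes> \<gamma> (FO W z) i) \<cdot> \<sigma> (FO \<phi> i) (VHom FC (FO W z) (FO W z')))
        \<cdot> (\<one> (FO \<phi> i) \<boxtimes> FA W z z')"
      by (simp only: lim_functor_simps(3)[OF R WT(1)[OF z(1)] WT(1)[OF z(2)] i])
    also have "\<dots> = ?d \<cdot> ((\<pi> (FO W z) (FO W z') i \<cdot> FA W z z') \<boxtimes> \<gamma> (FO W z) i) \<cdot> \<sigma> (FO \<phi> i) (VHom Z z z')"
      using Z \<gamma>T RT i \<phi>T symm_nat'[of "\<one> (FO \<phi> i)" "FA W z z'"] by (simp add: tens_cmp_tail)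
    also have "\<dots> = ?c \<cdot> (\<gamma> (FO W z') i \<boxtimes> FA P z z')" using FA[OF z i] by (simp add: FO)
    finally show ?case by simp
  qed (use RT PT FO in simp_all)
  then show "FA P z z' = FA (vcompose V Z R W) z z'" by simp
qed

end

section \<open>Interchange of limits and colimits\<close>

context symmetric_monoidal_closed
begin

text \<open>The two curried forms \<open>X \<rightarrow> [L, V]\<close> and \<open>L \<rightarrow> [X, V]\<close> of a functor of two variables.\<close>

definition transposes :: "('x, 'v, 'm) vcat \<Rightarrow> ('l, 'v, 'm) vcat \<Rightarrow> ('x, ('l, 'v, 'm) vfun, 'm) vfun \<Rightarrow>
    ('l, ('x, 'v, 'm) vfun, 'm) vfun \<Rightarrow> bool" where
  "transposes X L T S \<longleftrightarrow> T \<in> vfun X (functor_cat V L \<V>) \<and> S \<in> vfun L (functor_cat V X \<V>) \<and>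
     (\<forall>l\<in>VObj L. \<forall>x\<in>VObj X. FO (FO S l) x = FO (FO T x) l) \<and>
     (\<forall>l\<in>VObj L. \<forall>x\<in>VObj X. \<forall>y\<in>VObj X. FA (FO S l) x y = nat_proj V L \<V> (FO T x) (FO T y) l \<cdot> FA T x y) \<and>
     (\<forall>x\<in>VObj X. \<forall>l\<in>VObj L. \<forall>l'\<in>VObj L. FA (FO T x) l l' = nat_proj V X \<V> (FO S l) (FO S l') x \<cdot> FA S l l')"

lemma transposes_sym: "transposes X L T S \<Longrightarrow> transposes L X S T"
  unfolding transposes_def by simp

text \<open>\<open>S\<close> sends \<open>l\<close> to \<open>T\<close> followed by evaluation at
  \<open>l\<close>, and its action on homs is the lift of the family \<open>FA (FO T x) l l'\<close>
  to the end over \<open>x\<close>.\<close>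

lemma transpose_exists:
  assumes he: "has_ends L \<V>" "has_ends X \<V>" and L [simp]: "vcat L" and X [simp]: "vcat X" and T: "T
      \<in> vfun X (functor_cat V L \<V>)"
  shows "\<exists>S. transposes X L T S"
proof -
  interpret A: functor_category V "functor_cat V L \<V>" L \<V> "\<lambda>F. F" "nat_proj V L \<V>"
    by (rule functor_category_functor_cat[OF he(1) L vcat_self])
  note heT = he
  have Tx: "FO T x \<in> vfun L \<V>" if "x \<in> VObj X" for x using vfun_simps(1)[OF T that] by simp
  have TA [simp]: "x \<in> VObj X \<Longrightarrow> y \<in> VObj X \<Longrightarrow> FA T x y \<in> Arr V" "x \<in> VObj X \<Longrightarrow> y \<in> VObj X \<Longrightarrow>
      Dom V (FA T x y) = VHom X x y"
    "x \<in> VObj X \<Longrightarrow> y \<in> VObj X \<Longrightarrow> Cod V (FA T x y) = nat_obj V L \<V> (FO T x) (FO T y)" for x y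
    using vfun_simps(2-4)[OF T] by auto
  have TxO [simp]: "FO (FO T x) l \<in> Obj V" if "x \<in> VObj X" "l \<in> VObj L" for x l
    using vfun_simps(1)[OF Tx[OF that(1)]] that by auto
  have TxT [simp]: "FA (FO T x) l l' \<in> Arr V" "Dom V (FA (FO T x) l l') = VHom L l l'"
    "Cod V (FA (FO T x) l l') = \<lbrakk>FO (FO T x) l, FO (FO T x) l'\<rbrakk>" if "x \<in> VObj X" "l \<in> VObj L" "l' \<in> VObj L" for x l l'
    using vfun_simps(1-4)[OF Tx[OF that(1)]] that by auto
  define S\<^sub>o where "S\<^sub>o l = vcompose V X (A.evaluation l) T" for l
  have So: "S\<^sub>o l \<in> vfun X \<V>" if "l \<in> VObj L" for l
    unfolding S\<^sub>o_def by (rule vcompose_vfun[OF X A.FC vcat_self T A.evaluation_vfun[OF that]])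
  have So_simps [simp]: "x \<in> VObj X \<Longrightarrow> FO (S\<^sub>o l) x = FO (FO T x) l"
    "x \<in> VObj X \<Longrightarrow> y \<in> VObj X \<Longrightarrow> FA (S\<^sub>o l) x y = nat_proj V L \<V> (FO T x) (FO T y) l \<cdot> FA T x y" for x y l
    using Tx by (simp_all add: S\<^sub>o_def)
  have "\<exists>h. h \<in> Hom V (VHom L l l') (nat_obj V X \<V> (S\<^sub>o l) (S\<^sub>o l')) \<and>
      (\<forall>x\<in>VObj X. nat_proj V X \<V> (S\<^sub>o l) (S\<^sub>o l') x \<cdot> h = FA (FO T x) l l')"
    if l [simp]: "l \<in> VObj L" "l' \<in> VObj L" for l l'
  proof -
    \<comment> \<open>Naturality in \<open>x\<close> holds because \<open>FA T x y\<close> takes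
      values in the hom of \<open>FO T x\<close> and \<open>FO T y\<close>, whose projections are
      natural in the index.\<close>
    have "natural_family V X \<V> (S\<^sub>o l) (S\<^sub>o l') (VHom L l l') (\<lambda>x. FA (FO T x) l l')"
    proof (rule natural_familyI[OF X vcat_self So[OF l(1)] So[OF l(2)]], goal_cases)
      case p: (3 x y \<Gamma> f s)
      interpret environment V \<Gamma> by (rule p)
      have "emap (VComp \<V> (FO (FO T x) l) (FO (FO T x) l') (FO (FO T y) l')) (pr (emap (nat_proj V L \<V> (FO T x)
          (FO T y) l') (emap (FA T x y) s)) (emap (FA (FO T x) l l') f))
        = emap (VComp \<V> (FO (FO T x) l) (FO (FO T y) l) (FO (FO T y) l')) (pr (emap (FA (FO T y) l l') f) (emap
            (nat_proj V L \<V> (FO T x) (FO T y) l) (emap (FA T x y) s)))"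
        by (rule natural_family_el[OF nat_proj_natural[OF he(1)]]) (use p Tx he in simp_all)
      then show ?case using p Tx he by (simp del: self_enriched_simps(3))
    qed simp_all
    from nat_lift[OF he(2) So[OF l(1)] So[OF l(2)] this] show ?thesis by blast
  qed
  then have "\<exists>SA. \<forall>l l'. l \<in> VObj L \<longrightarrow> l' \<in> VObj L \<longrightarrow> SA l l'
      \<in> Hom V (VHom L l l') (nat_obj V X \<V> (S\<^sub>o l) (S\<^sub>o l')) \<and>
      (\<forall>x\<in>VObj X. nat_proj V X \<V> (S\<^sub>o l) (S\<^sub>o l') x \<cdot> SA l l' = FA (FO T x) l l')"
    by (rule choice2)
  then obtain SA where SA0: "\<forall>l l'. l \<in> VObj L \<longrightarrow> l' \<in> VObj L \<longrightarrow> SA l l'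
      \<in> Hom V (VHom L l l') (nat_obj V X \<V> (S\<^sub>o l) (S\<^sub>o l')) \<and>
      (\<forall>x\<in>VObj X. nat_proj V X \<V> (S\<^sub>o l) (S\<^sub>o l') x \<cdot> SA l l' = FA (FO T x) l l')" ..
  have SA [simp]: "SA l l' \<in> Arr V" "Dom V (SA l l') = VHom L l l'" "Cod V (SA l l') = nat_obj V X \<V> (S\<^sub>o l) (S\<^sub>o l')"
    and SA_eq: "x \<in> VObj X \<Longrightarrow> nat_proj V X \<V> (S\<^sub>o l) (S\<^sub>o l') x \<cdot> SA l l'
        = FA (FO T x) l l'" if "l \<in> VObj L" "l' \<in> VObj L" for l l' x
    using SA0 that unfolding Hom_iff by blast+
  define S where "S = mk_vfun L S\<^sub>o SA"
  have S: "S \<in> vfun L (functor_cat V X \<V>)"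
    unfolding S_def
  proof (rule mk_vfun_vfun, goal_cases)
    case (1 l) then show ?case using So by simp
  next
    case (2 l l') then show ?case by simp
  next
    case l [simp]: (3 l l' l'')
    let ?C = "VComp (functor_cat V X \<V>) (S\<^sub>o l) (S\<^sub>o l') (S\<^sub>o l'')" and ?n = "nat_proj V X \<V>"
    note So' [simp] = So[OF l(1)] So[OF l(2)] So[OF l(3)]
    show ?case
    proof (rule nat_ext[OF he(2) So[OF l(1)] So[OF l(3)], of _ _ "VHom L l' l'' \<otimes> VHom L l l'"], goal_cases)
      case x [simp]: (7 x)
      have "?n (S\<^sub>o l) (S\<^sub>o l'') x \<cdot> SA l l'' \<cdot> VComp L l l' l'' = FA (FO T x) l l'' \<cdot> VComp L l l' l''"
        using tail[OF SA_eq[OF l(1,3) x], of "VComp L l l' l''"] he by simp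
      also have "\<dots> = VComp \<V> (FO (FO T x) l) (FO (FO T x) l') (FO (FO T x) l'')
          \<cdot> (FA (FO T x) l' l'' \<boxtimes> FA (FO T x) l l')"
        by (rule vfun_Cmp[OF Tx[OF x] l])
      also have "\<dots> = (VComp \<V> (FO (S\<^sub>o l) x) (FO (S\<^sub>o l') x) (FO (S\<^sub>o l'') x)
          \<cdot> (?n (S\<^sub>o l') (S\<^sub>o l'') x \<boxtimes> ?n (S\<^sub>o l) (S\<^sub>o l') x)) \<cdot> (SA l' l'' \<boxtimes> SA l l')"
        using he by (simp add: tens_cmp SA_eq del: self_enriched_simps(3))
      also have "\<dots> = (?n (S\<^sub>o l) (S\<^sub>o l'') x \<cdot> ?C) \<cdot> (SA l' l'' \<boxtimes> SA l l')"
        using functor_cat_Comp[OF he(2) X vcat_self So[OF l(1)] So[OF l(2)] So[OF l(3)]] x by simp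
      finally show ?case using he by simp
    qed (use he in simp_all)
  next
    case l [simp]: (4 l)
    note So' [simp] = So[OF l]
    show ?case
    proof (rule nat_ext[OF he(2) So[OF l] So[OF l], of _ _ \<I>], goal_cases)
      case x [simp]: (7 x)
      have "?case \<longleftrightarrow> FA (FO T x) l l \<cdot> VId L l = VId \<V> (FO (FO T x) l)"
        using tail[OF SA_eq[OF l l x], of "VId L l"] functor_cat_Id[OF he(2) X vcat_self So[OF l]] he by simp
      then show ?case using vfun_simps(5)[OF Tx[OF x] l] by simp
    qed (use he in simp_all)
  qed
  have "transposes X L T S"
    unfolding transposes_def using S T SA_eq by (simp add: S_def)
  then show ?thesis by blast
qed

end

section \<open>Limit and colimit functors, and the interchange\<close>

context enrichment
begin

abbreviation limit_functor where
  "limit_functor X \<equiv> functor_category.lim_functor V (functor_cat V X \<V>) X \<V> (\<lambda>F. F) (nat_proj V X \<V>)"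

abbreviation colimit_functor where
  "colimit_functor L \<equiv> functor_category.lim_functor V (op (functor_cat V L \<V>)) (op L) (op \<V>) vop_fun (\<lambda>F G.
      nat_proj V L \<V> G F)"

lemma lim_V_exists:
  assumes "vcat X" "vsmall V U X" "\<phi> \<in> vfun X \<V>" "T \<in> vfun X \<V>"
  shows "\<exists>L \<gamma>. is_lim X \<phi> \<V> T L \<gamma>"
  by (rule lim_self[OF ends[OF assms(1) vcat_self assms(2)] assms(1,3,4)])

lemma lim_Vop_exists:
  assumes L: "vcat L" "vsmall V U L" and \<phi>: "\<phi> \<in> vfun (op L) \<V>" and T: "T \<in> vfun (op L) (op \<V>)"
  shows "\<exists>C \<gamma>. is_lim (op L) \<phi> (op \<V>) T C \<gamma>"
proof -
  have S: "vop_fun T \<in> vfun L \<V>" by (rule vop_fun_inverse[OF L(1) vcat_self T])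
  obtain C \<kappa> where "is_colim L \<phi> (vop_fun T) C \<kappa>" using colims[OF L \<phi> S] by blast
  from lim_op_self[OF L(1) \<phi> S this] show ?thesis by simp
qed

lemma limit_functor_exists:
  assumes "vcat X" "vsmall V U X" "\<phi> \<in> vfun X \<V>"
  shows "\<exists>R \<gamma>. limit_functor X \<phi> R \<gamma>"
proof -
  interpret functor_category V "functor_cat V X \<V>" X \<V> "\<lambda>F. F" "nat_proj V X \<V>"
    by (rule functor_category_functor_cat[OF ends[OF assms(1) vcat_self assms(2)] assms(1) vcat_self])
  show ?thesis by (rule lim_functor_exists[OF assms(3) lim_V_exists[OF assms]])
qed

lemma colimit_functor_exists:
  assumes "vcat L" "vsmall V U L" "\<phi> \<in> vfun (op L) \<V>"
  shows "\<exists>R \<gamma>. colimit_functor L \<phi> R \<gamma>"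
proof -
  interpret functor_category V "op (functor_cat V L \<V>)" "op L" "op \<V>" vop_fun "\<lambda>F G. nat_proj V L \<V> G F"
    by (rule functor_category_op[OF ends[OF assms(1) vcat_self assms(2)] assms(1) vcat_self])
  show ?thesis by (rule lim_functor_exists[OF assms(3) lim_Vop_exists[OF assms]])
qed

text \<open>
  Both sides of the interchange compare two cones: \<open>G Lm\<close> and \<open>R Cm\<close> are the two iterated
  (co)limits, one cone over each is universal, and the comparison with the other is in both cases
  the same arrow \<open>G Lm \<rightarrow> R Cm\<close>.
\<close>

theorem interchange:
  assumes L: "vcat L" "vsmall V U L" and X: "vcat X" "vsmall V U X"
    and \<phi>: "\<phi> \<in> vfun (op L) \<V>" and \<psi>: "\<psi> \<in> vfun X \<V>"
    and G: "colimit_functor L \<phi> (vop_fun G) \<kappa>" and R: "limit_functor X \<psi> R lm"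
    and TS: "transposes X L T S"
  obtains Lm \<delta> Cm \<epsilon> where "is_lim X \<psi> (functor_cat V L \<V>) T Lm \<delta>"
      "is_lim (op L) \<phi> (op (functor_cat V X \<V>)) (vop_fun S) Cm \<epsilon>"
    "is_lim X \<psi> \<V> (vcompose V X G T) (FO G Lm) (\<lambda>x. FA G Lm (FO T x) \<cdot> \<delta> x) \<longleftrightarrow>
     is_lim (op L) \<phi> (op \<V>) (vcompose V (op L) (vop_fun R) (vop_fun S)) (FO (vop_fun R) Cm) (\<lambda>l. FA (vop_fun R) Cm
         (FO (vop_fun S) l) \<cdot> \<epsilon> l)"
proof -
  note [simp] = L(1) X(1)
  have he: "has_ends L \<V>" "has_ends X \<V>" by (rule ends[OF L(1) vcat_self L(2)], rule ends[OF X(1) vcat_self X(2)])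
  interpret A: functor_category V "functor_cat V L \<V>" L \<V> "\<lambda>F. F" "nat_proj V L \<V>"
    by (rule functor_category_functor_cat[OF he(1) L(1) vcat_self])
  interpret A': functor_category V "op (functor_cat V L \<V>)" "op L" "op \<V>" vop_fun "\<lambda>F G. nat_proj V L \<V> G F"
    by (rule functor_category_op[OF he(1) L(1) vcat_self])
  interpret B: functor_category V "functor_cat V X \<V>" X \<V> "\<lambda>F. F" "nat_proj V X \<V>"
    by (rule functor_category_functor_cat[OF he(2) X(1) vcat_self])
  interpret B': functor_category V "op (functor_cat V X \<V>)" "op X" "op \<V>" vop_fun "\<lambda>F G. nat_proj V X \<V> G F"
    by (rule functor_category_op[OF he(2) X(1) vcat_self])
  have T: "T \<in> vfun X (functor_cat V L \<V>)" and S: "S \<in> vfun L (functor_cat V X \<V>)"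
    and TSo: "\<And>l x. l \<in> VObj L \<Longrightarrow> x \<in> VObj X \<Longrightarrow> FO (FO S l) x = FO (FO T x) l"
    and Sx: "\<And>l x y. l \<in> VObj L \<Longrightarrow> x \<in> VObj X \<Longrightarrow> y \<in> VObj X \<Longrightarrow>
        FA (FO S l) x y = nat_proj V L \<V> (FO T x) (FO T y) l \<cdot> FA T x y"
    and Tl: "\<And>x l l'. x \<in> VObj X \<Longrightarrow> l \<in> VObj L \<Longrightarrow> l' \<in> VObj L \<Longrightarrow>
        FA (FO T x) l l' = nat_proj V X \<V> (FO S l) (FO S l') x \<cdot> FA S l l'"
    using TS unfolding transposes_def by blast+
  have S': "vop_fun S \<in> vfun (op L) (op (functor_cat V X \<V>))" by (rule vop_fun_vfun[OF L(1) B.FC S])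
  have T': "vop_fun T \<in> vfun (op X) (op (functor_cat V L \<V>))" by (rule vop_fun_vfun[OF X(1) A.FC T])
  have Tx: "FO T x \<in> vfun L \<V>" if "x \<in> VObj X" for x using vfun_simps(1)[OF T that] by simp
  have Sl: "FO S l \<in> vfun X \<V>" if "l \<in> VObj L" for l using vfun_simps(1)[OF S that] by simp
  have Gf: "G \<in> vfun (functor_cat V L \<V>) \<V>"
    using vop_fun_inverse[OF A.FC vcat_self A'.lim_functor_simps(1)[OF G]] by simp
  note Rf = B.lim_functor_simps(1)[OF R]
  note lm = B.lim_functor_simps(2)[OF R, simplified functor_cat_simps]
  note \<kappa> = A'.lim_functor_simps(2)[OF G, simplified functor_cat_simps vop_simps vop_fun_simps]
  \<comment> \<open>The diagrams whose limits are taken pointwise are the functors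
    \<open>FO S l\<close>, so the limits chosen by \<open>R\<close> can be used as values of
    \<open>Lm\<close>, and dually those of \<open>G\<close> for \<open>Cm\<close>.\<close>
  have evT: "vcompose V X (A.evaluation l) T = FO S l" if l: "l \<in> VObj L" for l
    by (rule vfun_eqI[OF vcompose_vfun[OF X(1) A.FC vcat_self T A.evaluation_vfun[OF l]] Sl[OF l]])
        (use l Tx in \<open>simp_all add: TSo Sx\<close>)
  have evS: "vcompose V (op L) (B'.evaluation x) (vop_fun S) = vop_fun (FO T x)" if x: "x \<in> VObj X" for x
    by (rule vfun_eqI[OF vcompose_vfun[OF vcat_op[OF L(1)] B'.FC vcat_op[OF vcat_self] S' B'.evaluation_vfun]
        vop_fun_vfun[OF L(1) vcat_self Tx[OF x]]])
      (use x Sl in \<open>simp_all add: TSo Tl\<close>)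
  obtain Lm \<delta> where Lm: "is_lim X \<psi> (functor_cat V L \<V>) T Lm \<delta>" and LmO: "\<And>l. l \<in> VObj L \<Longrightarrow> FO Lm l = FO R (FO S l)"
    and \<delta>: "\<And>l x. l \<in> VObj L \<Longrightarrow> x \<in> VObj X \<Longrightarrow> nat_proj V L \<V> Lm (FO T x) l \<cdot> \<delta> x = lm (FO S l) x"
    and LmA: "\<And>l l' x. l \<in> VObj L \<Longrightarrow> l' \<in> VObj L \<Longrightarrow> x \<in> VObj X \<Longrightarrow>
      VComp \<V> (FO R (FO S l)) (FO R (FO S l')) (FO (FO T x) l') \<cdot> (lm (FO S l') x \<boxtimes> FA Lm l l')
      = VComp \<V> (FO R (FO S l)) (FO (FO T x) l) (FO (FO T x) l') \<cdot> (FA (FO T x) l l' \<boxtimes> lm (FO S l) x)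
          \<cdot> \<sigma> (FO \<psi> x) (VHom L l l')"
  proof (rule A.pointwise_lim[OF X(1) \<psi> T, of "\<lambda>l. FO R (FO S l)" "\<lambda>l. lm (FO S l)"], goal_cases)
    case (1 l) then show ?case unfolding evT[OF 1(2)] by (intro lm Sl)
  next
    case (2 L \<delta>) show ?case by (rule 2(1)) (rule 2(2-); assumption)+
  qed
  have Lmf: "Lm \<in> vfun L \<V>" using wcounit_simps(1)[OF is_lim_wcounit[OF Lm]] by simp
  obtain Cm \<epsilon> where Cm: "is_lim (op L) \<phi> (op (functor_cat V X \<V>)) (vop_fun S) Cm \<epsilon>" and CmO: "\<And>x. x \<in> VObj X \<Longrightarrow>
      FO Cm x = FO G (FO T x)"
    and \<epsilon>: "\<And>l x. l \<in> VObj L \<Longrightarrow> x \<in> VObj X \<Longrightarrow> nat_proj V X \<V> (FO S l) Cm x \<cdot> \<epsilon> l = \<kappa> (FO T x) l"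
    and CmA: "\<And>x y l. x \<in> VObj X \<Longrightarrow> y \<in> VObj X \<Longrightarrow> l \<in> VObj L \<Longrightarrow>
      VComp (op \<V>) (FO G (FO T x)) (FO G (FO T y)) (FO (FO S l) y) \<cdot> (\<kappa> (FO T y) l \<boxtimes> FA Cm y x)
      = VComp (op \<V>) (FO G (FO T x)) (FO (FO S l) x) (FO (FO S l) y) \<cdot> (FA (FO S l) y x \<boxtimes> \<kappa> (FO T x) l)
          \<cdot> \<sigma> (FO \<phi> l) (VHom X y x)"
  proof (rule B'.pointwise_lim[OF vcat_op[OF L(1)] \<phi> S', of "\<lambda>x. FO G (FO T x)" "\<lambda>x. \<kappa> (FO T x)"], goal_cases)
    case (1 x) from 1(2) have x: "x \<in> VObj X" by simp
    show ?case unfolding evS[OF x] by (intro \<kappa> Tx x)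
  next
    case (2 C \<epsilon>) show ?case by (rule 2(1)) (rule 2(2-)[unfolded vop_simps(1,2) vop_fun_simps]; assumption)+
  qed
  have Cmf: "Cm \<in> vfun X \<V>" using wcounit_simps(1)[OF is_lim_wcounit[OF Cm]] by simp
  \<comment> \<open>The values agree by choice and the actions on homs satisfy the same equations,
    so the pointwise limit is literally the composite.\<close>
  have "Lm = vcompose V L R S"
    by (rule B.lim_functor_vcompose[OF R L(1) \<psi> S Lmf LmO])
        (use LmA LmO TSo Tl in \<open>simp_all del: self_enriched_simps(3)\<close>)
  then have Lm_eq: "vcompose V (op L) (vop_fun R) (vop_fun S) = vop_fun Lm" by (simp add: vop_fun_vcompose)
  have "vop_fun Cm = vcompose V (op X) (vop_fun G) (vop_fun T)"
    by (rule A'.lim_functor_vcompose[OF G vcat_op[OF X(1)] \<phi> T' vop_fun_vfun[OF X(1) vcat_self Cmf]])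
      (use CmA CmO TSo Sx in \<open>simp_all del: vop_simps(3)\<close>)
  then have "vop_fun (vop_fun Cm) = vop_fun (vop_fun (vcompose V X G T))" by (simp add: vop_fun_vcompose)
  then have Cm_eq: "vcompose V X G T = Cm" by simp
  have M1: "is_lim X \<psi> \<V> Cm (FO R Cm) (lm Cm)" by (rule lm[OF Cmf])
  have M2: "is_lim (op L) \<phi> (op \<V>) (vop_fun Lm) (FO G Lm) (\<kappa> Lm)" by (rule \<kappa>[OF Lmf])
  have w1: "wcounit X \<psi> \<V> Cm (FO G Lm) (\<lambda>x. FA G Lm (FO T x) \<cdot> \<delta> x)"
    using wcounit_compose[OF is_lim_wcounit[OF Lm] X(1) A.FC vcat_self \<psi> T Gf] unfolding Cm_eq .
  have w2: "wcounit (op L) \<phi> (op \<V>) (vop_fun Lm) (FO R Cm) (\<lambda>l. FA R (FO S l) Cm \<cdot> \<epsilon> l)"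
    using wcounit_compose[OF is_lim_wcounit[OF Cm] vcat_op[OF L(1)] B'.FC vcat_op[OF vcat_self] \<phi> S'
        vop_fun_vfun[OF B.FC vcat_self Rf]]
    unfolding Lm_eq vop_fun_simps .
  \<comment> \<open>Factoring the cone at \<open>R Cm\<close> through the colimit
    \<open>G Lm\<close> in the opposite category gives an arrow
    \<open>G Lm \<rightarrow> R Cm\<close> of \<open>\<V>\<close>.\<close>
  obtain v where v: "v \<in> Arr V" "Dom V v = \<I>" "Cod V v = VHom (op \<V>) (FO R Cm) (FO G Lm)"
    and v_eq: "\<And>l. l \<in> VObj (op L) \<Longrightarrow> FA R (FO S l) Cm \<cdot> \<epsilon> l
        = VComp (op \<V>) (FO R Cm) (FO G Lm) (FO (vop_fun Lm) l) \<cdot> (\<kappa> Lm l \<boxtimes> v) \<cdot> invr (\<rho> (FO \<phi> l))"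
    by (rule lim_compare[OF M2 vcat_op[OF L(1)] vcat_op[OF vcat_self] \<phi> vop_fun_vfun[OF L(1) vcat_self Lmf] w2])
        (rule that)
  note GA = vfun_simps(1-4)[OF Gf, simplified functor_cat_simps self_enriched_simps(1,2)]
  note RA = vfun_simps(1-4)[OF Rf, simplified functor_cat_simps self_enriched_simps(1,2)]
  have oL: "l \<in> VObj L \<Longrightarrow> FO \<phi> l \<in> Obj V" for l using vfun_simps(1)[OF \<phi>] by simp
  have oX: "x \<in> VObj X \<Longrightarrow> FO \<psi> x \<in> Obj V" for x using vfun_simps(1)[OF \<psi>] by simp
  have oT: "l \<in> VObj L \<Longrightarrow> x \<in> VObj X \<Longrightarrow> FO (FO T x) l \<in> Obj V" for l x using vfun_simps(1)[OF Tx] by simp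
  note \<delta>T = wcounit_simps(2-4)[OF is_lim_wcounit[OF Lm], simplified functor_cat_simps]
  note \<epsilon>T = wcounit_simps(2-4)[OF is_lim_wcounit[OF Cm], simplified vop_simps vop_fun_simps functor_cat_simps]
  have \<kappa>T: "\<kappa> F l \<in> Arr V" "Dom V (\<kappa> F l) = FO \<phi> l" "Cod V (\<kappa> F l)
      = \<lbrakk>FO F l, FO G F\<rbrakk>" if "F \<in> vfun L \<V>" "l \<in> VObj L" for F l
    using wcounit_simps(2-4)[OF is_lim_wcounit[OF \<kappa>[OF that(1)]], of l] that by auto
  have lmT: "lm F x \<in> Arr V" "Dom V (lm F x) = FO \<psi> x" "Cod V (lm F x)
      = \<lbrakk>FO R F, FO F x\<rbrakk>" if "F \<in> vfun X \<V>" "x \<in> VObj X" for F x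
    using wcounit_simps(2-4)[OF is_lim_wcounit[OF lm[OF that(1)]], of x] that by auto
  \<comment> \<open>The same \<open>v\<close> compares the cone at \<open>G Lm\<close> with the
    limit \<open>R Cm\<close>. Arrows out of the colimit \<open>G Lm\<close> are tested on its
    units, and both sides reduce to the unit \<open>\<kappa> (FO T x) l\<close> composed with the
    counit \<open>lm (FO S l) x\<close>.\<close>
  have key: "FA G Lm (FO T x) \<cdot> \<delta> x = VComp \<V> (FO G Lm) (FO R Cm) (FO Cm x) \<cdot> (lm Cm x \<boxtimes> v) \<cdot> invr (\<rho> (FO \<psi> x))"
    if x: "x \<in> VObj X" for x
  proof (rule lim_unique[OF M2 vcat_op[OF L(1)] vcat_op[OF vcat_self] \<phi> vop_fun_vfun[OF L(1) vcat_self Lmf], of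
      "FO G (FO T x)" _ "FO \<psi> x"], goal_cases)
    case (8 l)
    then have l: "l \<in> VObj L" by simp
    let ?D = "FO G Lm" and ?E = "FO R Cm" and ?B = "FO (FO T x) l" and ?c = "FO R (FO S l)" and ?Cx = "FO G (FO T x)"
    note all = x l GA[OF Lmf] GA[OF Tx[OF x]] RA[OF Cmf] RA[OF Sl[OF l]] Lmf Cmf Tx[OF x] Sl[OF l] oL[OF l] oX[OF
        x] oT[OF l x]
      \<delta>T[OF x] \<epsilon>T[OF l] \<kappa>T[OF Lmf l] \<kappa>T[OF Tx[OF x] l] lmT[OF Cmf x] lmT[OF Sl[OF l] x] LmO[OF l] CmO[OF x] TSo[OF
          l x] he
      v[simplified vop_simps self_enriched_simps(1,2)]
    show ?case
    proof (rule ext2[of _ _ "FO \<phi> l" "FO \<psi> x"], goal_cases)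
      case p: (7 \<Gamma> t s)
      interpret environment V \<Gamma> by (rule p)
      let ?d = "emap (\<delta> x) s" and ?e = "emap (\<epsilon> l) t" and ?v = "emap v star"
      have "emap (VComp (op \<V>) ?Cx ?D ?c \<cdot> (\<kappa> Lm l \<boxtimes> FA G Lm (FO T x))) (pr t ?d)
        = emap (VComp (op \<V>) ?Cx ?B ?c \<cdot> (nat_proj V L \<V> Lm (FO T x) l \<boxtimes> \<kappa> (FO T x) l)
            \<cdot> \<sigma> (FO \<phi> l) (nat_obj V L \<V> Lm (FO T x))) (pr t ?d)"
        using A'.lim_functor_simps(3)[OF G, of "FO T x" Lm l] Tx[OF x] Lmf l by (simp add: LmO del: vop_simps(3))
      then have 1: "emap (VComp \<V> ?c ?D ?Cx) (pr (emap (FA G Lm (FO T x)) ?d) (emap (\<kappa> Lm l) t))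
        = emap (VComp \<V> ?c ?B ?Cx) (pr (emap (\<kappa> (FO T x) l) t) (emap (nat_proj V L \<V> Lm (FO T x) l) ?d))"
        using p all by (simp del: self_enriched_simps(3))
      have 2: "emap (nat_proj V L \<V> Lm (FO T x) l) ?d = emap (lm (FO S l) x) s"
        using arg_cong[OF \<delta>[OF l x], of "\<lambda>h. emap h s"] p all by simp
      have "emap (VComp \<V> ?c ?E ?Cx \<cdot> (lm Cm x \<boxtimes> FA R (FO S l) Cm)) (pr s ?e)
        = emap (VComp \<V> ?c ?B ?Cx \<cdot> (nat_proj V X \<V> (FO S l) Cm x \<boxtimes> lm (FO S l) x)
            \<cdot> \<sigma> (FO \<psi> x) (nat_obj V X \<V> (FO S l) Cm)) (pr s ?e)"
        using B.lim_functor_simps(3)[OF R, of "FO S l" Cm x] Sl[OF l] Cmf x CmO[OF x] TSo[OF l x]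
            by (simp del: self_enriched_simps(3))
      then have 3: "emap (VComp \<V> ?c ?E ?Cx) (pr (emap (lm Cm x) s) (emap (FA R (FO S l) Cm) ?e))
        = emap (VComp \<V> ?c ?B ?Cx) (pr (emap (nat_proj V X \<V> (FO S l) Cm x) ?e) (emap (lm (FO S l) x) s))"
        using p all by (simp del: self_enriched_simps(3))
      have 4: "emap (nat_proj V X \<V> (FO S l) Cm x) ?e = emap (\<kappa> (FO T x) l) t"
        using arg_cong[OF \<epsilon>[OF l x], of "\<lambda>h. emap h t"] p all by simp
      have "emap (FA R (FO S l) Cm \<cdot> \<epsilon> l) t = emap (VComp (op \<V>) ?E ?D ?c \<cdot> (\<kappa> Lm l \<boxtimes> v) \<cdot> invr (\<rho> (FO \<phi> l))) t"
        using v_eq[of l] l LmO[OF l] by simp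
      then have 5: "emap (FA R (FO S l) Cm) ?e = emap (VComp \<V> ?c ?D ?E) (pr ?v (emap (\<kappa> Lm l) t))"
        using p all by (simp del: self_enriched_simps(3))
      have "emap (VComp \<V> ?c ?D ?Cx) (pr (emap (VComp \<V> ?D ?E ?Cx) (pr (emap (lm Cm x) s) ?v)) (emap (\<kappa> Lm l) t))
        = emap (VComp \<V> ?c ?E ?Cx) (pr (emap (lm Cm x) s) (emap (VComp \<V> ?c ?D ?E) (pr ?v (emap (\<kappa> Lm l) t))))"
        using p all by (simp del: self_enriched_simps(3))
      also have "\<dots> = emap (VComp \<V> ?c ?D ?Cx) (pr (emap (FA G Lm (FO T x)) ?d) (emap (\<kappa> Lm l) t))"
        unfolding 1 2 5[symmetric] 3 4 ..
      finally show ?case using p all by (simp del: self_enriched_simps(3))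
    qed (use all in \<open>simp_all del: self_enriched_simps(3)\<close>)
  qed (use x GA[OF Lmf] GA[OF Tx[OF x]] RA[OF Cmf] Lmf Cmf Tx[OF x] \<delta>T[OF x] lmT[OF Cmf x] oX[OF x] CmO[OF x] v in
      \<open>simp_all del: self_enriched_simps(3)\<close>)
  have DE: "FO G Lm \<in> VObj \<V>" "FO R Cm \<in> VObj \<V>" using GA(1)[OF Lmf] RA(1)[OF Cmf] by simp_all
  have vT: "Cod V v = VHom \<V> (FO G Lm) (FO R Cm)" using v(3) by simp
  \<comment> \<open>Each preservation statement says that \<open>v\<close> is invertible, once in
    \<open>\<V>\<close> and once in its opposite.\<close>
  have "is_lim X \<psi> \<V> Cm (FO G Lm) (\<lambda>x. FA G Lm (FO T x) \<cdot> \<delta> x) \<longleftrightarrow> invertible \<V> (FO G Lm) (FO R Cm) v"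
    by (rule comparison_iff[OF M1 X(1) vcat_self \<psi> Cmf w1 v(1,2) vT key])
  also have "\<dots> \<longleftrightarrow> invertible (op \<V>) (FO R Cm) (FO G Lm) v"
    by (rule invertible_op[OF vcat_self DE v(1,2) vT, symmetric])
  also have "\<dots> \<longleftrightarrow> is_lim (op L) \<phi> (op \<V>) (vop_fun Lm) (FO R Cm) (\<lambda>l. FA R (FO S l) Cm \<cdot> \<epsilon> l)"
    by (rule comparison_iff[OF M2 vcat_op[OF L(1)] vcat_op[OF vcat_self] \<phi> vop_fun_vfun[OF L(1) vcat_self Lmf] w2
        v v_eq, symmetric])
  finally show thesis
    by (intro that[OF Lm Cm]) (simp add: Cm_eq Lm_eq)
qed

end

lemma (in functor_category) pointwise_lim_exists:
  assumes X: "vcat X" and \<phi>: "\<phi> \<in> vfun X \<V>" and T: "T \<in> vfun X FC"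
    and lim: "\<And>T. T \<in> vfun X Y \<Longrightarrow> \<exists>L \<gamma>. is_lim X \<phi> Y T L \<gamma>"
  shows "\<exists>L \<gamma>. is_lim X \<phi> FC T L \<gamma>"
proof -
  have "\<forall>i\<in>VObj J. \<exists>L. \<exists>\<gamma>. is_lim X \<phi> Y (vcompose V X (evaluation i) T) L \<gamma>"
    using lim[OF vcompose_vfun[OF X FC Y T evaluation_vfun]] by blast
  then obtain Li where "\<forall>i\<in>VObj J. \<exists>\<gamma>. is_lim X \<phi> Y (vcompose V X (evaluation i) T) (Li i) \<gamma>"
    unfolding bchoice_iff ..
  then obtain \<gamma> where \<gamma>: "\<forall>i\<in>VObj J. is_lim X \<phi> Y (vcompose V X (evaluation i) T) (Li i) (\<gamma> i)"
    unfolding bchoice_iff ..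
  show ?thesis
    by (rule pointwise_lim[OF X \<phi> T, of Li \<gamma>]) (use \<gamma> in blast)+
qed

text \<open>Reconciles two forms of naturality of the units: the one in \<open>lim_functor\<close>
  for opposite categories and the one in \<open>is_wcolim_functor\<close>. They differ by
  composition with an invertible symmetry.\<close>

lemma (in symmetric_monoidal_closed) unit_naturality_op:
  assumes [simp]: "s \<in> Obj V" "s' \<in> Obj V" "g \<in> Obj V" "g' \<in> Obj V" "c \<in> Obj V" "n \<in> Obj V"
    and k: "k \<in> Arr V" "Dom V k = c" "Cod V k = \<lbrakk>s, g\<rbrakk>" and k': "k' \<in> Arr V" "Dom V k' = c" "Cod V k' = \<lbrakk>s', g'\<rbrakk>"
    and G: "G \<in> Arr V" "Dom V G = n" "Cod V G = \<lbrakk>g, g'\<rbrakk>" and p: "p \<in> Arr V" "Dom V p = n" "Cod V p = \<lbrakk>s, s'\<rbrakk>"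
  shows "VComp (op \<V>) g' g s \<cdot> (k \<boxtimes> G) = VComp (op \<V>) g' s' s \<cdot> (p \<boxtimes> k') \<cdot> \<sigma> c n \<longleftrightarrow>
    VComp \<V> s g g' \<cdot> (G \<boxtimes> k) = VComp \<V> s s' g' \<cdot> \<sigma> \<lbrakk>s, s'\<rbrakk> \<lbrakk>s', g'\<rbrakk> \<cdot> (p \<boxtimes> k')" (is "?l = ?r \<longleftrightarrow> ?l' = ?r'")
proof -
  note [simp] = k k' G p
  have l: "?l = ?l' \<cdot> \<sigma> c n"
    using symm_nat'[of k G] by (simp del: self_enriched_simps(3))
  have r: "?r = ?r' \<cdot> \<sigma> c n"
    by (simp del: self_enriched_simps(3))
  show ?thesis
    unfolding l r
  proof
    assume "?l' \<cdot> \<sigma> c n = ?r' \<cdot> \<sigma> c n"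
    then have "(?l' \<cdot> \<sigma> c n) \<cdot> \<sigma> n c = (?r' \<cdot> \<sigma> c n) \<cdot> \<sigma> n c" by simp
    then show "?l' = ?r'" by (simp del: self_enriched_simps(3))
  qed simp
qed

section \<open>Commutation as preservation, and closure under saturation\<close>

context enrichment
begin

text \<open>\<open>wcolim_functor\<close> is an arbitrary choice, so its property is available only
  once some functor has it; the opposite of a limit functor does. The property of the chosen functor
  is then put in the form that \<open>interchange\<close> takes.\<close>

lemma wcolim_functor_colimit_functor:
  assumes w: "(L, \<phi>) \<in> weights V U"
  obtains \<kappa> where "colimit_functor L \<phi> (vop_fun (wcolim_functor V (L, \<phi>))) \<kappa>"
proof -
  have L: "vcat L" "vsmall V U L" and \<phi>: "\<phi> \<in> vfun (op L) \<V>" using w by (simp_all add: weights_iff)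
  have he: "has_ends L \<V>" by (rule ends[OF L(1) vcat_self L(2)])
  interpret A: functor_category V "op (functor_cat V L \<V>)" "op L" "op \<V>" vop_fun "\<lambda>F G. nat_proj V L \<V> G F"
    by (rule functor_category_op[OF he L(1) vcat_self])
  have FC: "vcat (functor_cat V L \<V>)" by (rule vcat_functor_cat[OF he L(1) vcat_self])
  have diag: "diagram V U L \<phi> (op \<V>) (vop_fun S)" if "S \<in> vfun L \<V>" for S
    by (rule diagramI[OF w vcat_op[OF vcat_self] vop_fun_vfun[OF L(1) vcat_self that]])
  have unit_iff: "VComp (op \<V>) (FO G S') (FO G S) (FO S l) \<cdot> (\<kappa> S l \<boxtimes> FA G S S')
      = VComp (op \<V>) (FO G S') (FO S' l) (FO S l) \<cdot> (nat_proj V L \<V> S S' l \<boxtimes> \<kappa> S' l)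
          \<cdot> \<sigma> (FO \<phi> l) (nat_obj V L \<V> S S') \<longleftrightarrow>
    VComp \<V> (FO S l) (FO G S) (FO G S') \<cdot> (FA G S S' \<boxtimes> \<kappa> S l)
      = VComp \<V> (FO S l) (FO S' l) (FO G S') \<cdot> \<sigma> \<lbrakk>FO S l, FO S' l\<rbrakk> \<lbrakk>FO S' l, FO G S'\<rbrakk>
          \<cdot> (nat_proj V L \<V> S S' l \<boxtimes> \<kappa> S' l)"
    if G: "G \<in> vfun (functor_cat V L \<V>) \<V>" and \<kappa>: "\<And>S. S \<in> vfun L \<V> \<Longrightarrow>
        is_lim (op L) \<phi> (op \<V>) (vop_fun S) (FO G S) (\<kappa> S)"
      and S: "S \<in> vfun L \<V>" "S' \<in> vfun L \<V>" and l: "l \<in> VObj L" for G \<kappa> S S' l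
    by (rule unit_naturality_op)
      (use vfun_simps(1)[OF \<phi>, of l] vfun_simps(1)[OF S(1) l] vfun_simps(1)[OF S(2) l] vfun_simps(1-4)[OF G] S l he L
        wcounit_simps(2-4)[OF is_lim_wcounit[OF \<kappa>[OF S(1)]], of l] wcounit_simps(2-4)[OF is_lim_wcounit[OF \<kappa>[OF
            S(2)]], of l] in \<open>simp_all del: self_enriched_simps(3)\<close>)
  \<comment> \<open>The candidate for the choice: a limit functor into the opposite of
    \<open>\<V>\<close>, with its counits realised as units of weighted colimits.\<close>
  have "\<exists>G. is_wcolim_functor V (L, \<phi>) G"
  proof -
    obtain R \<kappa> where R: "colimit_functor L \<phi> R \<kappa>" using colimit_functor_exists[OF L \<phi>] by blast
    let ?G = "vop_fun R"
    have G: "?G \<in> vfun (functor_cat V L \<V>) \<V>" by (rule vop_fun_inverse[OF FC vcat_self A.lim_functor_simps(1)[OF R]])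
    have lim: "is_lim (op L) \<phi> (op \<V>) (vop_fun S) (FO ?G S) (\<kappa> S)" if "S \<in> vfun L \<V>" for S
      using A.lim_functor_simps(2)[OF R, of S] that by simp
    have "\<forall>S\<in>vfun L \<V>. \<exists>\<theta>. is_wcolimit V (L, \<phi>) \<V> S (FO ?G S) \<theta> \<and>
        (\<forall>l\<in>VObj L. wcolim_unit V (L, \<phi>) \<V> S (FO ?G S) \<theta> l = \<kappa> S l)"
      unfolding is_wcolimit_def wcolim_unit_def
      using diagram.is_wlimit_if_is_lim[OF diag lim] by blast
    then obtain \<theta> where \<theta>: "\<forall>S\<in>vfun L \<V>. is_wcolimit V (L, \<phi>) \<V> S (FO ?G S) (\<theta> S) \<and>
        (\<forall>l\<in>VObj L. wcolim_unit V (L, \<phi>) \<V> S (FO ?G S) (\<theta> S) l = \<kappa> S l)"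
      unfolding bchoice_iff ..
    have nat: "VComp \<V> (FO S l) (FO ?G S) (FO ?G S') \<cdot> (FA ?G S S' \<boxtimes> \<kappa> S l)
      = VComp \<V> (FO S l) (FO S' l) (FO ?G S') \<cdot> \<sigma> \<lbrakk>FO S l, FO S' l\<rbrakk> \<lbrakk>FO S' l, FO ?G S'\<rbrakk>
          \<cdot> (nat_proj V L \<V> S S' l \<boxtimes> \<kappa> S' l)"
      if S: "S \<in> vfun L \<V>" "S' \<in> vfun L \<V>" and l: "l \<in> VObj L" for S S' l
      by (rule iffD1[OF unit_iff[OF G lim S l]])
        (use A.lim_functor_simps(3)[OF R, of S' S l] S l in \<open>simp_all del: vop_simps(3) self_enriched_simps(3)\<close>)
    have "is_wcolim_functor V (L, \<phi>) ?G"
      unfolding is_wcolim_functor_def prod.case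
    proof (intro conjI exI[of _ \<theta>] ballI G)
      show "is_wcolimit V (L, \<phi>) \<V> S (FO ?G S) (\<theta> S)" if "S \<in> vfun L \<V>" for S using \<theta> that by blast
      fix S S' l assume S: "S \<in> vfun L \<V>" "S' \<in> vfun L \<V>" and l: "l \<in> VObj L"
      have 1: "wcolim_unit V (L, \<phi>) \<V> S (FO ?G S) (\<theta> S) l = \<kappa> S l" "wcolim_unit V (L, \<phi>) \<V> S' (FO ?G S') (\<theta> S') l
          = \<kappa> S' l"
        using \<theta> S l by blast+
      show "VComp \<V> (FO S l) (FO ?G S) (FO ?G S') \<cdot> (FA ?G S S' \<boxtimes> wcolim_unit V (L, \<phi>) \<V> S (FO ?G S) (\<theta> S) l)
        = VComp \<V> (FO S l) (FO S' l) (FO ?G S') \<cdot> \<sigma> \<lbrakk>FO S l, FO S' l\<rbrakk> \<lbrakk>FO S' l, FO ?G S'\<rbrakk> \<cdot>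
            (nat_proj V L \<V> S S' l \<boxtimes> wcolim_unit V (L, \<phi>) \<V> S' (FO ?G S') (\<theta> S') l)"
        unfolding 1 by (rule nat[OF S l])
    qed
    then show ?thesis by blast
  qed
  then have "is_wcolim_functor V (L, \<phi>) (wcolim_functor V (L, \<phi>))"
    unfolding wcolim_functor_def by (rule someI_ex)
  moreover define G where "G = wcolim_functor V (L, \<phi>)"
  ultimately have G: "G \<in> vfun (functor_cat V L \<V>) \<V>" and "\<exists>\<theta>. (\<forall>S\<in>vfun L \<V>. is_wcolimit V (L, \<phi>) \<V> S (FO G S) (\<theta>
      S)) \<and>
      (\<forall>S\<in>vfun L \<V>. \<forall>S'\<in>vfun L \<V>. \<forall>l\<in>VObj L.
         VComp \<V> (FO S l) (FO G S) (FO G S') \<cdot> (FA G S S' \<boxtimes> wcolim_unit V (L, \<phi>) \<V> S (FO G S) (\<theta> S) l)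
         = VComp \<V> (FO S l) (FO S' l) (FO G S') \<cdot> \<sigma> \<lbrakk>FO S l, FO S' l\<rbrakk> \<lbrakk>FO S' l, FO G S'\<rbrakk> \<cdot>
             (nat_proj V L \<V> S S' l \<boxtimes> wcolim_unit V (L, \<phi>) \<V> S' (FO G S') (\<theta> S') l))"
    unfolding is_wcolim_functor_def prod.case by blast+
  then obtain \<theta> where \<theta>: "\<And>S. S \<in> vfun L \<V> \<Longrightarrow> is_wcolimit V (L, \<phi>) \<V> S (FO G S) (\<theta> S)"
    and nat: "\<And>S S' l. S \<in> vfun L \<V> \<Longrightarrow> S' \<in> vfun L \<V> \<Longrightarrow> l \<in> VObj L \<Longrightarrow>
         VComp \<V> (FO S l) (FO G S) (FO G S') \<cdot> (FA G S S' \<boxtimes> wcolim_unit V (L, \<phi>) \<V> S (FO G S) (\<theta> S) l)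
         = VComp \<V> (FO S l) (FO S' l) (FO G S') \<cdot> \<sigma> \<lbrakk>FO S l, FO S' l\<rbrakk> \<lbrakk>FO S' l, FO G S'\<rbrakk> \<cdot>
             (nat_proj V L \<V> S S' l \<boxtimes> wcolim_unit V (L, \<phi>) \<V> S' (FO G S') (\<theta> S') l)"
    by blast
  define \<kappa> where "\<kappa> S = wcolim_unit V (L, \<phi>) \<V> S (FO G S) (\<theta> S)" for S
  have lim: "is_lim (op L) \<phi> (op \<V>) (vop_fun S) (FO G S) (\<kappa> S)" if "S \<in> vfun L \<V>" for S
    unfolding \<kappa>_def wcolim_unit_def
    by (rule diagram.is_lim_if_is_wlimit[OF diag[OF that]]) (use \<theta>[OF that] in \<open>simp only: is_wcolimit_def\<close>)
  have "colimit_functor L \<phi> (vop_fun G) \<kappa>"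
    unfolding A.lim_functor_def
  proof (intro conjI ballI)
    show "vop_fun G \<in> vfun (op (functor_cat V L \<V>)) (op \<V>)" by (rule vop_fun_vfun[OF FC vcat_self G])
  next
    fix S assume "S \<in> VObj (op (functor_cat V L \<V>))"
    then show "is_lim (op L) \<phi> (op \<V>) (vop_fun S) (FO (vop_fun G) S) (\<kappa> S)" using lim[of S] by simp
  next
    fix S' S l assume "S' \<in> VObj (op (functor_cat V L \<V>))" "S \<in> VObj (op (functor_cat V L \<V>))" "l \<in> VObj (op L)"
    then have S: "S \<in> vfun L \<V>" "S' \<in> vfun L \<V>" and l: "l \<in> VObj L" by simp_all
    show "VComp (op \<V>) (FO (vop_fun G) S') (FO (vop_fun G) S) (FO (vop_fun S) l) \<cdot> (\<kappa> S l \<boxtimes> FA (vop_fun G) S' S)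
      = VComp (op \<V>) (FO (vop_fun G) S') (FO (vop_fun S') l) (FO (vop_fun S) l) \<cdot> (nat_proj V L \<V> S S' l \<boxtimes> \<kappa> S' l) \<cdot>
          \<sigma> (FO \<phi> l) (VHom (op (functor_cat V L \<V>)) S' S)"
      using nat[OF S l] unit_iff[OF G lim S l] unfolding \<kappa>_def[symmetric]
          by (simp del: vop_simps(3) self_enriched_simps(3))
  qed
  then show thesis using that unfolding G_def by blast
qed

text \<open>Every diagram on one side has a transpose on the other, to which
  \<open>interchange\<close> applies. Since that theorem produces limits of its own,
  \<open>preserves_lim_all\<close> passes from them to the given ones.\<close>

theorem commutes_iff:
  assumes w: "(L, \<phi>) \<in> weights V U" and w': "(K, \<psi>) \<in> weights V U" and R: "limit_functor (op K) \<psi> R lm"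
  shows "commutes V (L, \<phi>) (K, \<psi>) \<longleftrightarrow> preserves V (L, \<phi>) (op (functor_cat V (op K) \<V>)) (op \<V>) (vop_fun R)"
proof -
  have L: "vcat L" "vsmall V U L" and \<phi>: "\<phi> \<in> vfun (op L) \<V>" using w by (simp_all add: weights_iff)
  have K: "vcat K" "vsmall V U K" and \<psi>: "\<psi> \<in> vfun (op K) \<V>" using w' by (simp_all add: weights_iff)
  note X = vcat_op[OF K(1)] vsmall_op[OF K]
  let ?G = "wcolim_functor V (L, \<phi>)" and ?FL = "functor_cat V L \<V>" and ?FX = "functor_cat V (op K) \<V>"
  obtain \<kappa> where G: "colimit_functor L \<phi> (vop_fun ?G) \<kappa>" by (rule wcolim_functor_colimit_functor[OF w])
  have he: "has_ends L \<V>" "has_ends (op K) \<V>" by (rule ends[OF L(1) vcat_self L(2)], rule ends[OF X(1) vcat_self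
      X(2)])
  have FL: "vcat ?FL" and FX: "vcat ?FX"
    by (rule vcat_functor_cat[OF he(1) L(1) vcat_self], rule vcat_functor_cat[OF he(2) X(1) vcat_self])
  have Gf: "?G \<in> vfun ?FL \<V>"
    by (rule vop_fun_inverse[OF FL vcat_self functor_category.lim_functor_simps(1)[OF functor_category_op[OF he(1)
        L(1) vcat_self] G], unfolded vop_fun_vop_fun])
  have Rf: "R \<in> vfun ?FX \<V>"
    by (rule functor_category.lim_functor_simps(1)[OF functor_category_functor_cat[OF he(2) X(1) vcat_self] R])
  note Rf' = vop_fun_vfun[OF FX vcat_self Rf]
  show ?thesis
    unfolding commutes_def fst_conv preserves_iff[OF w' FL vcat_self Gf] preserves_iff[OF w vcat_op[OF FX]
        vcat_op[OF vcat_self] Rf']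
  proof (intro iffI ballI allI impI)
    fix T' C \<epsilon>' assume *: "\<forall>T\<in>vfun (op K) ?FL. \<forall>L \<gamma>. is_lim (op K) \<psi> ?FL T L \<gamma> \<longrightarrow>
        is_lim (op K) \<psi> \<V> (vcompose V (op K) ?G T) (FO ?G L) (\<lambda>k. FA ?G L (FO T k) \<cdot> \<gamma> k)"
      and T': "T' \<in> vfun (op L) (op ?FX)" and C: "is_lim (op L) \<phi> (op ?FX) T' C \<epsilon>'"
    have S: "vop_fun T' \<in> vfun L ?FX" by (rule vop_fun_inverse[OF L(1) FX T'])
    obtain T where "transposes L (op K) (vop_fun T') T" using transpose_exists[OF he(2,1) X(1) L(1) S] by blast
    then have TS: "transposes (op K) L T (vop_fun T')" by (rule transposes_sym)
    then have T: "T \<in> vfun (op K) ?FL" unfolding transposes_def by blast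
    show "is_lim (op L) \<phi> (op \<V>) (vcompose V (op L) (vop_fun R) T') (FO (vop_fun R) C) (\<lambda>l. FA (vop_fun R) C (FO
        T' l) \<cdot> \<epsilon>' l)"
    proof (rule interchange[OF L X \<phi> \<psi> G R TS, unfolded vop_fun_vop_fun], goal_cases)
      case (1 Lm \<delta> Cm \<epsilon>)
      have "is_lim (op L) \<phi> (op \<V>) (vcompose V (op L) (vop_fun R) T') (FO (vop_fun R) Cm) (\<lambda>l. FA (vop_fun R) Cm
          (FO T' l) \<cdot> \<epsilon> l)"
        using * T 1(1,3) by blast
      \<comment> \<open>Preservation is known for the colimit \<open>Cm\<close> supplied by the
        interchange and is carried to the given \<open>C\<close>.\<close>
      from preserves_lim_all[OF vcat_op[OF L(1)] vcat_op[OF FX] vcat_op[OF vcat_self] \<phi> T' Rf' 1(2) this C]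
      show ?case .
    qed
  next
    fix T Lm' \<delta>' assume *: "\<forall>T\<in>vfun (op L) (op ?FX). \<forall>C \<gamma>. is_lim (op L) \<phi> (op ?FX) T C \<gamma> \<longrightarrow>
        is_lim (op L) \<phi> (op \<V>) (vcompose V (op L) (vop_fun R) T) (FO (vop_fun R) C) (\<lambda>l. FA (vop_fun R) C (FO T l)
            \<cdot> \<gamma> l)"
      and T: "T \<in> vfun (op K) ?FL" and Lm': "is_lim (op K) \<psi> ?FL T Lm' \<delta>'"
    obtain S where TS: "transposes (op K) L T S" using transpose_exists[OF he L(1) X(1) T] by blast
    then have "S \<in> vfun L ?FX" unfolding transposes_def by blast
    note S' = vop_fun_vfun[OF L(1) FX this]
    show "is_lim (op K) \<psi> \<V> (vcompose V (op K) ?G T) (FO ?G Lm') (\<lambda>k. FA ?G Lm' (FO T k) \<cdot> \<delta>' k)"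
    proof (rule interchange[OF L X \<phi> \<psi> G R TS], goal_cases)
      case (1 Lm \<delta> Cm \<epsilon>)
      have "is_lim (op K) \<psi> \<V> (vcompose V (op K) ?G T) (FO ?G Lm) (\<lambda>k. FA ?G Lm (FO T k) \<cdot> \<delta> k)"
        using * S' 1(2,3) by blast
      from preserves_lim_all[OF X(1) FL vcat_self \<psi> T Gf 1(1) this Lm'] show ?case .
    qed
  qed
qed

lemma weights_prodD:
  assumes "w \<in> weights V U"
  shows "vcat (fst w)" "vsmall V U (fst w)" "snd w \<in> vfun (op (fst w)) \<V>"
  using assms by (cases w; simp add: weights_iff)+

lemma wcomplete_V: "\<Phi> \<subseteq> weights V U \<Longrightarrow> wcomplete V \<Phi> \<V>"
  unfolding wcomplete_iff[OF _ vcat_self]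
  by (intro ballI lim_V_exists vcat_op vsmall_op) (use weights_prodD in blast)+

lemma wcomplete_Vop: "\<Phi> \<subseteq> weights V U \<Longrightarrow> wcomplete V \<Phi> (op \<V>)"
  unfolding wcomplete_iff[OF _ vcat_op[OF vcat_self]]
  by (intro ballI lim_Vop_exists) (use weights_prodD in blast)+

lemma wcomplete_functor_cat:
  assumes \<Phi>: "\<Phi> \<subseteq> weights V U" and L: "vcat L" "vsmall V U L"
  shows "wcomplete V \<Phi> (functor_cat V L \<V>)"
proof -
  interpret A: functor_category V "functor_cat V L \<V>" L \<V> "\<lambda>F. F" "nat_proj V L \<V>"
    by (rule functor_category_functor_cat[OF ends[OF L(1) vcat_self L(2)] L(1) vcat_self])
  show ?thesis
    unfolding wcomplete_iff[OF \<Phi> A.FC]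
  proof (intro ballI, rule A.pointwise_lim_exists)
    fix w T S assume w: "w \<in> \<Phi>" and S: "S \<in> vfun (op (fst w)) \<V>"
    then show "\<exists>L \<gamma>. is_lim (op (fst w)) (snd w) \<V> S L \<gamma>"
      using wcomplete_V[OF \<Phi>] unfolding wcomplete_iff[OF \<Phi> vcat_self] by blast
  qed (use \<Phi> weights_prodD vcat_op in blast)+
qed

lemma wcomplete_functor_cat_op:
  assumes \<Phi>: "\<Phi> \<subseteq> weights V U" and L: "vcat L" "vsmall V U L"
  shows "wcomplete V \<Phi> (op (functor_cat V L \<V>))"
proof -
  interpret A: functor_category V "op (functor_cat V L \<V>)" "op L" "op \<V>" vop_fun "\<lambda>F G. nat_proj V L \<V> G F"
    by (rule functor_category_op[OF ends[OF L(1) vcat_self L(2)] L(1) vcat_self])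
  show ?thesis
    unfolding wcomplete_iff[OF \<Phi> A.FC]
  proof (intro ballI, rule A.pointwise_lim_exists)
    fix w T S assume w: "w \<in> \<Phi>" and S: "S \<in> vfun (op (fst w)) (op \<V>)"
    then show "\<exists>L \<gamma>. is_lim (op (fst w)) (snd w) (op \<V>) S L \<gamma>"
      using wcomplete_Vop[OF \<Phi>] unfolding wcomplete_iff[OF \<Phi> vcat_op[OF vcat_self]] by blast
  qed (use \<Phi> weights_prodD vcat_op in blast)+
qed

text \<open>\<open>\<V>\<close> has to be relabelled too. Its objects embed among functors as
  constant object maps, so the injection assumed for functors is enough.\<close>

lemma inj_obj:
  fixes e :: "('k, 'v, 'm) vfun \<Rightarrow> 'a"
  assumes "inj e"
  shows "inj (\<lambda>v. e \<lparr>FO = \<lambda>_. v, FA = undefined\<rparr>)"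
proof (rule injI)
  fix v v' assume "e \<lparr>FO = \<lambda>_. v, FA = undefined\<rparr> = e \<lparr>FO = \<lambda>_. v', FA = undefined\<rparr>"
  from injD[OF assms this] have "(\<lambda>_ :: 'k. v) = (\<lambda>_. v')" by simp
  then show "v = v'" by (rule fun_cong)
qed

text \<open>The single functor to which saturation is applied is \<open>wcolim_functor V w\<close>;
  its source \<open>[L, V]\<close> is \<open>\<Psi>\<close>-complete because limits there are
  pointwise.\<close>

lemma commutes_saturation_limit:
  fixes e :: "('k, 'v, 'm) vfun \<Rightarrow> 'a" and w w' :: "('k, 'v, 'm) weight"
  assumes e: "inj e" and w: "w \<in> weights V U" and \<Psi>: "\<Psi> \<subseteq> weights V U" and c: "\<And>w'. w' \<in> \<Psi> \<Longrightarrow> commutes V w w'"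
    and w': "w' \<in> saturation V U TYPE('a) \<Psi>"
  shows "commutes V w w'"
proof -
  obtain L \<phi> where w_eq: "w = (L, \<phi>)" by (cases w)
  have L: "vcat L" "vsmall V U L" and \<phi>: "\<phi> \<in> vfun (op L) \<V>" using w by (simp_all add: w_eq weights_iff)
  have he: "has_ends L \<V>" by (rule ends[OF L(1) vcat_self L(2)])
  have FL: "vcat (functor_cat V L \<V>)" by (rule vcat_functor_cat[OF he L(1) vcat_self])
  obtain \<kappa> where G: "colimit_functor L \<phi> (vop_fun (wcolim_functor V w)) \<kappa>"
    unfolding w_eq by (rule wcolim_functor_colimit_functor[OF w[unfolded w_eq]])
  have Gf: "wcolim_functor V w \<in> vfun (functor_cat V L \<V>) \<V>"
    by (rule vop_fun_inverse[OF FL vcat_self functor_category.lim_functor_simps(1)[OF functor_category_op[OF he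
        L(1) vcat_self] G], unfolded vop_fun_vop_fun])
  have "wcontinuous V \<Psi> (functor_cat V L \<V>) \<V> (wcolim_functor V w)"
    using c unfolding wcontinuous_def commutes_def w_eq fst_conv by blast
  then have "preserves V w' (functor_cat V L \<V>) \<V> (wcolim_functor V w)"
    by (rule saturation_preserves[OF w' \<Psi> e inj_obj[OF e] FL vcat_self Gf wcomplete_functor_cat[OF \<Psi> L]
        wcomplete_V[OF \<Psi>]])
  then show ?thesis unfolding commutes_def w_eq by simp
qed

text \<open>Saturation concerns functors that preserve limits, whereas here the colimit weight
  varies. By \<open>commutes_iff\<close> it becomes the weight of limits preserved by a functor
  between opposite categories that does not depend on \<open>w\<close>.\<close>

lemma commutes_saturation_colimit:
  fixes e :: "('k, 'v, 'm) vfun \<Rightarrow> 'a" and w w' :: "('k, 'v, 'm) weight"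
  assumes e: "inj e" and w': "w' \<in> weights V U" and \<Phi>: "\<Phi> \<subseteq> weights V U" and c: "\<And>w. w \<in> \<Phi> \<Longrightarrow> commutes V w w'"
    and w: "w \<in> saturation V U TYPE('a) \<Phi>"
  shows "commutes V w w'"
proof -
  obtain K \<psi> where w'_eq: "w' = (K, \<psi>)" by (cases w')
  have K: "vcat K" "vsmall V U K" and \<psi>: "\<psi> \<in> vfun (op K) \<V>" using w' by (simp_all add: w'_eq weights_iff)
  note X = vcat_op[OF K(1)] vsmall_op[OF K]
  have he: "has_ends (op K) \<V>" by (rule ends[OF X(1) vcat_self X(2)])
  let ?FX = "functor_cat V (op K) \<V>"
  have FX: "vcat ?FX" by (rule vcat_functor_cat[OF he X(1) vcat_self])
  obtain R lm where R: "limit_functor (op K) \<psi> R lm" using limit_functor_exists[OF X \<psi>] by blast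
  have "R \<in> vfun ?FX \<V>"
    by (rule functor_category.lim_functor_simps(1)[OF functor_category_functor_cat[OF he X(1) vcat_self] R])
  note Rf' = vop_fun_vfun[OF FX vcat_self this]
  have iff: "commutes V w w' \<longleftrightarrow> preserves V w (op ?FX) (op \<V>) (vop_fun R)" if "w \<in> weights V U" for w
    using commutes_iff[OF _ w'[unfolded w'_eq] R, of "fst w" "snd w"] that by (simp add: w'_eq)
  have "wcontinuous V \<Phi> (op ?FX) (op \<V>) (vop_fun R)"
    using c iff \<Phi> unfolding wcontinuous_def by blast
  then have "preserves V w (op ?FX) (op \<V>) (vop_fun R)"
    by (rule saturation_preserves[OF w \<Phi> e inj_obj[OF e] vcat_op[OF FX] vcat_op[OF vcat_self] Rf'
        wcomplete_functor_cat_op[OF \<Phi> X] wcomplete_Vop[OF \<Phi>]])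
  moreover have "w \<in> weights V U" using w unfolding saturation_def by blast
  ultimately show ?thesis using iff by blast
qed

end

lemma (in symmetric_monoidal_closed) saturation_increasing:
  "\<Phi> \<subseteq> weights V U \<Longrightarrow> \<Phi> \<subseteq> saturation V U T \<Phi>"
  unfolding saturation_def wcomplete_def wcontinuous_def by blast

theorem proposition5p4:
  fixes V :: "('v, 'm) smcc" and \<Phi> \<Psi> :: "('k, 'v, 'm) weight set"
  assumes "universe TYPE('u)" and "enrichment_base TYPE('u) V"
    and "\<exists>e :: ('k, 'v, 'm) vfun \<Rightarrow> 'a. inj e"
    and "\<Phi> \<subseteq> weights V TYPE('u)" and "\<Psi> \<subseteq> weights V TYPE('u)"
  shows "saturated V TYPE('u) TYPE('a) (flat V TYPE('u) \<Psi>) \<and>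
         saturated V TYPE('u) TYPE('a) (atomic V TYPE('u) \<Phi>) \<and>
         flat V TYPE('u) \<Psi> = flat V TYPE('u) (saturation V TYPE('u) TYPE('a) \<Psi>) \<and>
         atomic V TYPE('u) \<Phi> = atomic V TYPE('u) (saturation V TYPE('u) TYPE('a) \<Phi>)"
proof -
  interpret enrichment V "TYPE('u)"
    using assms(1,2) unfolding enrichment_def enrichment_axioms_def enrichment_base_def by blast
  let ?sat = "saturation V TYPE('u) TYPE('a) :: ('k, 'v, 'm) weight set \<Rightarrow> _"
  obtain e :: "('k, 'v, 'm) vfun \<Rightarrow> 'a" where e: "inj e" using assms(3) by blast
  note \<Phi> = assms(4) and \<Psi> = assms(5)
  note lim = commutes_saturation_limit[OF e] and colim = commutes_saturation_colimit[OF e]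
  have w: "flat V TYPE('u) \<Psi> \<subseteq> weights V TYPE('u)" "atomic V TYPE('u) \<Phi> \<subseteq> weights V TYPE('u)"
    unfolding flat_def atomic_def by blast+
  have sat: "?sat \<Xi> \<subseteq> weights V TYPE('u)" for \<Xi> unfolding saturation_def by blast
  \<comment> \<open>For each fixed \<open>w' \<in> \<Psi>\<close>, the flat weights themselves form
    a class commuting with \<open>w'\<close>, so its saturation commutes with \<open>w'\<close> as
    well.\<close>
  have 1: "?sat (flat V TYPE('u) \<Psi>) \<subseteq> flat V TYPE('u) \<Psi>"
    using colim[OF _ w(1)] sat \<Psi> unfolding flat_def by blast
  have 2: "?sat (atomic V TYPE('u) \<Phi>) \<subseteq> atomic V TYPE('u) \<Phi>"
    using lim[OF _ w(2)] sat \<Phi> unfolding atomic_def by blast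
  \<comment> \<open>A larger class imposes more conditions, which gives one inclusion; the other is
    closure in the limit weight.\<close>
  have 3: "flat V TYPE('u) \<Psi> = flat V TYPE('u) (?sat \<Psi>)"
    using lim[OF _ \<Psi>] saturation_increasing[OF \<Psi>] unfolding flat_def by blast
  have 4: "atomic V TYPE('u) \<Phi> = atomic V TYPE('u) (?sat \<Phi>)"
    using colim[OF _ \<Phi>] saturation_increasing[OF \<Phi>] unfolding atomic_def by blast
  show ?thesis
    unfolding saturated_def using 1 2 3 4 saturation_increasing[OF w(1)] saturation_increasing[OF w(2)] by blast
qed

end
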